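(* Let $S_g$ be the orientable surface of fixed genus $g$, and let $\mathcal{X}_{n,6,g}$ be the set of all simple connected $6$-regular graphs with $n$ vertices embeddable on $S_g$. Then $$\lim_{n\to\infty}\left(\sup_{G\in\mathcal{X}_{n,6,g}}\tau(G)^{1/n}\right)\ \le\ \sigma_3^2\ <\ \sigma_6 .$$
   Context: $\tau(G)$ is the number of spanning trees of the graph $G$. For $k\ge3$, $\sigma_k=\dfrac{(k-1)^{k-1}}{(k(k-2))^{k/2-1}}$. *)

theory Defs
  imports "HOL-Analysis.Analysis"
begin

text \<open>Graphs are given by a vertex set \<open>V\<close> and a set \<open>E\<close> of two-element subsets of \<open>V\<close>.\<close>

definition simple_graph :: "'a set \<Rightarrow> 'a set set \<Rightarrow> bool" where
  "simple_graph V E \<longleftrightarrow> finite V \<and> (\<forall>e\<in>E. e \<subseteq> V \<and> card e = 2)"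

definition regular_graph :: "nat \<Rightarrow> 'a set \<Rightarrow> 'a set set \<Rightarrow> bool" where
  "regular_graph k V E \<longleftrightarrow> (\<forall>v\<in>V. card {e \<in> E. v \<in> e} = k)"

definition connected_graph :: "'a set \<Rightarrow> 'a set set \<Rightarrow> bool" where
  "connected_graph V E \<longleftrightarrow> V \<noteq> {} \<and> (\<forall>u\<in>V. \<forall>v\<in>V. (u, v) \<in> {(x, y). {x, y} \<in> E}\<^sup>*)"

definition is_cycle :: "'a set set \<Rightarrow> 'a list \<Rightarrow> bool" where
  "is_cycle E vs \<longleftrightarrow> length vs \<ge> 3 \<and> distinct vs \<and>
     (\<forall>i<length vs. {vs ! i, vs ! (Suc i mod length vs)} \<in> E)"

definition spanning_trees :: "'a set \<Rightarrow> 'a set set \<Rightarrow> 'a set set set" where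
  "spanning_trees V E = {T. T \<subseteq> E \<and> connected_graph V T \<and> (\<nexists>vs. is_cycle T vs)}"

definition num_spanning_trees :: "'a set \<Rightarrow> 'a set set \<Rightarrow> nat" where
  "num_spanning_trees V E = card (spanning_trees V E)"

text \<open>The closed orientable surface of genus \<open>g\<close> is determined up to homeomorphism, and
  whether a graph embeds in it depends only on the homeomorphism type. The model used is the
  boundary of a handlebody of genus \<open>g\<close>: the solid block \<open>[0, 2g+1] \<times> [0, 3] \<times> [0, 1]\<close> with \<open>g\<close>
  disjoint square tunnels drilled through it in the third coordinate direction. For \<open>g = 0\<close>
  this is the boundary of a block, hence a sphere.\<close>

definition handlebody :: "nat \<Rightarrow> (real \<times> real \<times> real) set" where
  "handlebody g =
     {(x, y, z). 0 \<le> x \<and> x \<le> 2 * real g + 1 \<and> 0 \<le> y \<and> y \<le> 3 \<and> 0 \<le> z \<and> z \<le> 1 \<and>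
        \<not> (\<exists>i<g. 2 * real i + 1 < x \<and> x < 2 * real i + 2 \<and> 1 < y \<and> y < 2)}"

definition genus_surface :: "nat \<Rightarrow> (real \<times> real \<times> real) set" where
  "genus_surface g = frontier (handlebody g)"

text \<open>An embedding sends vertices to distinct points and every edge to an arc (injective path)
  joining the images of its ends; an arc passes through no other vertex, and two arcs meet at
  most in the images of common ends. The faces need not be discs.\<close>

definition embeddable :: "'a set \<Rightarrow> 'a set set \<Rightarrow> 'b::topological_space set \<Rightarrow> bool" where
  "embeddable V E S \<longleftrightarrow>
     (\<exists>p \<gamma>. inj_on p V \<and> p ` V \<subseteq> S \<and>
        (\<forall>e\<in>E. arc (\<gamma> e) \<and> path_image (\<gamma> e) \<subseteq> S \<and>
           {pathstart (\<gamma> e), pathfinish (\<gamma> e)} = p ` e \<and>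
           path_image (\<gamma> e) \<inter> p ` V = p ` e) \<and>
        (\<forall>e\<in>E. \<forall>f\<in>E. e \<noteq> f \<longrightarrow> path_image (\<gamma> e) \<inter> path_image (\<gamma> f) \<subseteq> p ` (e \<inter> f)))"

text \<open>Every finite graph is isomorphic to one whose vertices are natural numbers, and all
  notions involved are invariant under isomorphism.\<close>

definition regular_graphs_on_surface :: "nat \<Rightarrow> nat \<Rightarrow> nat \<Rightarrow> (nat set \<times> nat set set) set" where
  "regular_graphs_on_surface n k g =
     {(V, E). simple_graph V E \<and> card V = n \<and> connected_graph V E \<and> regular_graph k V E \<and>
        embeddable V E (genus_surface g)}"

definition \<sigma> :: "nat \<Rightarrow> real" where
  "\<sigma> k = (real k - 1) ^ (k - 1) / (real k * (real k - 2)) powr (real k / 2 - 1)"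

end

theory Submission
  imports Defs "HOL-Combinatorics.Combinatorics" "Jordan_Normal_Form.Schur_Decomposition"
begin

text \<open>Fix \<open>\<epsilon> > 0\<close>, put \<open>x = 6 + \<epsilon>\<close> and let \<open>A\<close> be the adjacency matrix of \<open>G\<close>. The determinant of
  \<open>x I - A\<close> counts rooted spanning forests with weight \<open>\<epsilon>\<close> per root, so it lies between \<open>\<epsilon> \<tau>(G)\<close> and
  \<open>(1 + \<surd>\<epsilon>)\<^sup>2\<^sup>n \<tau>(G)\<close>, and its logarithm is \<open>n ln x\<close> minus the sum of the \<open>t k / (k x\<^sup>k)\<close>, where \<open>t k\<close> is the
  number of closed walks of length \<open>k\<close>. By Euler's formula a 6-regular graph on the surface
  triangulates it up to a number of darts bounded in terms of \<open>g\<close>; hence every walk that closes up in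
  the triangular lattice closes up from all but boundedly many starting points of \<open>G\<close>, and
  \<open>t k \<ge> n w k - O(1)\<close> for the number \<open>w k\<close> of closed lattice walks. For \<open>g \<ge> 1\<close> equality is attained, for
  each fixed range of \<open>k\<close>, by triangulations of a torus that embeds in the surface, so the limit exists
  and is the exponential of the tree entropy of the triangular lattice; four terms of its expansion
  put it below \<open>16 / 3\<close>. For \<open>g = 0\<close> Euler's formula leaves no 6-regular graph, and the supremum is
  \<open>-\<infinity>\<close>.

  Euler's formula is needed for an arbitrary topological embedding. It is obtained by rounding the
  surface to a cubical grid, whose combinatorial map has the right Euler characteristic by inspection:
  the graph is then a minor of this map, and contracting or deleting edges does not lower the Euler
  characteristic.\<close>

section \<open>Minors of combinatorial maps\<close>

text \<open>At \<epsilon> = 0 the determinant vanishes and the eigenvalue 6 makes the logarithmic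
  series diverge, so \<epsilon> stays positive until the last limit; n tends to infinity first,
  hence error terms may depend badly on \<epsilon> and on where the series is cut. The square root
  in the upper bound comes from splitting the weight of a forest evenly over two choices, its roots
  and the edges it omits from a tree; the loss factor per vertex then tends to 1.

  The arcs of an embedding can be wild, so only connectedness and compactness are used: cut into
  thirds, they give connected sets whose disjointness survives rounding to a fine grid. The vertices
  of the graph thus become mere connected sets of grid vertices, which is why the maps carry labels
  and a connectedness condition through every contraction.

  A triangulation with defects is not a quotient of the lattice. The lattice steps are modelled as
  permutations of darts, and relations are manipulated up to a number of exceptional darts that does
  not grow with n.\<close>

definition norb :: "('d \<Rightarrow> 'd) \<Rightarrow> 'd set \<Rightarrow> nat" where
  "norb \<pi> D = card (orbit \<pi> ` D)"

text \<open>The transposition reroutes the predecessor of \<open>d\<close> to \<open>\<pi> d\<close>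
  and leaves \<open>d\<close> fixed, which cuts \<open>d\<close> out of its cycle.\<close>

definition pdel :: "'d \<Rightarrow> ('d \<Rightarrow> 'd) \<Rightarrow> 'd \<Rightarrow> 'd" where
  "pdel d \<pi> = Transposition.transpose d (\<pi> d) \<circ> \<pi>"

lemma pdel_apply:
  assumes "\<pi> permutes D"
  shows "pdel d \<pi> x = (if x = d then d else if \<pi> x = d then \<pi> d else \<pi> x)"
proof -
  have "\<pi> x = \<pi> d \<longleftrightarrow> x = d" using permutes_inj[OF assms] by (auto dest: injD)
  then show ?thesis by (auto simp: pdel_def Transposition.transpose_def)
qed

lemma pdel_permutes:
  assumes "\<pi> permutes D"
  shows "pdel d \<pi> permutes (D - {d})"
proof (cases "d \<in> D")
  case True
  have "pdel d \<pi> permutes D"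
    unfolding pdel_def using assms True
    by (intro permutes_compose permutes_swap_id) (auto simp: permutes_in_image)
  then show ?thesis
    unfolding permutes_def by (auto simp: pdel_apply[OF assms])
next
  case False
  then have "\<pi> d = d" using assms by (simp add: permutes_not_in)
  then have "pdel d \<pi> = \<pi>" by (auto simp: pdel_def)
  then show ?thesis using assms False by simp
qed

text \<open>\<open>orbit \<pi> x\<close> is generated from \<open>\<pi> x\<close>, so
  \<open>x\<close> belongs to it only because its cycle is finite.\<close>

lemma orbit_self:
  assumes "\<pi> permutes D" "finite D" shows "x \<in> orbit \<pi> x"
  using assms by (intro permutation_self_in_orbit) (auto simp: permutation_permutes)

lemma orbit_eq:
  assumes "\<pi> permutes D" "finite D" "y \<in> orbit \<pi> x" shows "orbit \<pi> y = orbit \<pi> x"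
  using orbit_cyclic_eq3[OF cyclic_on_orbit[OF assms(1,2)] assms(3)] .

lemma orbit_sym:
  assumes "\<pi> permutes D" "finite D" "y \<in> orbit \<pi> x" shows "x \<in> orbit \<pi> y"
  using orbit_eq[OF assms] orbit_self[OF assms(1,2)] by simp

lemma orbit_least:
  assumes "x \<in> S" "\<And>y. y \<in> S \<Longrightarrow> f y \<in> S" shows "orbit f x \<subseteq> S"
proof
  fix y assume "y \<in> orbit f x" then show "y \<in> S" by induct (use assms in auto)
qed

text \<open>Following the shortened cycle from \<open>x\<close> skips \<open>d\<close> and nothing
  else.\<close>

lemma orbit_pdel:
  assumes p: "\<pi> permutes D" "finite D" and "x \<noteq> d"
  shows "orbit (pdel d \<pi>) x = orbit \<pi> x - {d}"
proof
  note ap = pdel_apply[OF p(1)]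
  show sub: "orbit (pdel d \<pi>) x \<subseteq> orbit \<pi> x - {d}"
  proof (rule orbit_least)
    show "x \<in> orbit \<pi> x - {d}" using orbit_self[OF p] \<open>x \<noteq> d\<close> by auto
    fix y assume y: "y \<in> orbit \<pi> x - {d}"
    have "\<pi> y \<in> orbit \<pi> x" using y by (auto intro: orbit.step)
    moreover have "\<pi> y = d \<Longrightarrow> \<pi> d \<in> orbit \<pi> x" using calculation by (auto intro: orbit.step)
    moreover have "\<pi> y = d \<Longrightarrow> \<pi> d \<noteq> d" using y permutes_inj[OF p(1)] by (metis DiffD2 injD singletonI)
    ultimately show "pdel d \<pi> y \<in> orbit \<pi> x - {d}" using y by (auto simp: ap)
  qed
  have selfx: "x \<in> orbit (pdel d \<pi>) x" by (rule orbit_self[OF pdel_permutes[OF p(1)]]) (use p in auto)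
  \<comment> \<open>When the old orbit passes through \<open>d\<close>, the induction remembers the
    predecessor of \<open>d\<close>, which is still in the new orbit.\<close>
  have "if y = d then \<exists>z\<in>orbit (pdel d \<pi>) x. \<pi> z = d else y \<in> orbit (pdel d \<pi>) x"
    if "y \<in> orbit \<pi> x" for y
    using that
  proof induct
    case base
    have "\<pi> x \<noteq> d \<Longrightarrow> pdel d \<pi> x = \<pi> x" using \<open>x \<noteq> d\<close> by (auto simp: ap)
    then show ?case using selfx by (auto) (metis orbit.base)
  next
    case (step y)
    show ?case
    proof (cases "y = d")
      case True
      with step obtain z where z: "z \<in> orbit (pdel d \<pi>) x" "\<pi> z = d" by auto
      then have "z \<noteq> d" using sub by auto
      then have "\<pi> d \<noteq> d" using z permutes_inj[OF p(1)] by (metis injD)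
      moreover have "pdel d \<pi> z = \<pi> d" using z \<open>z \<noteq> d\<close> by (simp add: ap)
      ultimately show ?thesis using True z by (auto) (metis orbit.step)
    next
      case False
      then have y: "y \<in> orbit (pdel d \<pi>) x" using step by auto
      show ?thesis
      proof (cases "\<pi> y = d")
        case True then show ?thesis using y by auto
      next
        case f: False
        then have "pdel d \<pi> y = \<pi> y" using False by (simp add: ap)
        then show ?thesis using f y by (auto) (metis orbit.step)
      qed
    qed
  qed
  then show "orbit \<pi> x - {d} \<subseteq> orbit (pdel d \<pi>) x" by (metis DiffE insertCI subsetI)
qed

definition pdel2 :: "'d \<Rightarrow> 'd \<Rightarrow> ('d \<Rightarrow> 'd) \<Rightarrow> 'd \<Rightarrow> 'd" where
  "pdel2 d e \<pi> = pdel e (pdel d \<pi>)"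

lemma pdel2_permutes:
  assumes "\<pi> permutes D" shows "pdel2 d e \<pi> permutes (D - {d, e})"
  using pdel_permutes[OF pdel_permutes[OF assms], of e d] unfolding pdel2_def
  by (simp add: Diff_insert[symmetric] insert_commute)

lemma orbit_pdel2:
  assumes "\<pi> permutes D" "finite D" "x \<noteq> d" "x \<noteq> e"
  shows "orbit (pdel2 d e \<pi>) x = orbit \<pi> x - {d, e}"
  using orbit_pdel[OF pdel_permutes[OF assms(1)], of d x e] orbit_pdel[OF assms(1-3)] assms
  unfolding pdel2_def by auto

lemma pdel2_apply:
  assumes "\<pi> permutes D" "x \<noteq> d" "x \<noteq> e" "\<pi> x \<noteq> d" "\<pi> x \<noteq> e"
  shows "pdel2 d e \<pi> x = \<pi> x"
  using assms unfolding pdel2_def by (simp add: pdel_apply[OF assms(1)] pdel_apply[OF pdel_permutes[OF assms(1)]])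

lemma pdel2_apply_left:
  assumes "\<pi> permutes D" "x \<noteq> d" "x \<noteq> e" "\<pi> x = d" "d \<noteq> e"
  shows "pdel2 d e \<pi> x = (if \<pi> d = e then \<pi> e else \<pi> d)"
proof -
  have "\<pi> x = \<pi> d \<longleftrightarrow> x = d" "\<pi> x = \<pi> e \<longleftrightarrow> x = e" using permutes_inj[OF assms(1)] by (auto dest: injD)
  then show ?thesis using assms unfolding pdel2_def
    by (auto simp add: pdel_apply[OF assms(1)] pdel_apply[OF pdel_permutes[OF assms(1)]])
qed

lemma pdel2_apply_right:
  assumes "\<pi> permutes D" "x \<noteq> d" "x \<noteq> e" "\<pi> x = e" "d \<noteq> e"
  shows "pdel2 d e \<pi> x = (if \<pi> e = d then \<pi> d else \<pi> e)"
proof -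
  have "\<pi> x = \<pi> d \<longleftrightarrow> x = d" "\<pi> x = \<pi> e \<longleftrightarrow> x = e" using permutes_inj[OF assms(1)] by (auto dest: injD)
  then show ?thesis using assms unfolding pdel2_def
    by (auto simp add: pdel_apply[OF assms(1)] pdel_apply[OF pdel_permutes[OF assms(1)]])
qed

text \<open>Each cycle leaves a nonempty remnant, and disjoint cycles leave distinct
  remnants.\<close>

lemma norb_pdel2:
  assumes p: "\<pi> permutes D" "finite D"
    and meet: "\<And>x. x \<in> D \<Longrightarrow> \<exists>y\<in>orbit \<pi> x. y \<in> D \<and> y \<noteq> d \<and> y \<noteq> e"
  shows "norb (pdel2 d e \<pi>) (D - {d, e}) = norb \<pi> D"
proof -
  let ?D = "D - {d, e}"
  have 1: "orbit (pdel2 d e \<pi>) ` ?D = (\<lambda>C. C - {d, e}) ` orbit \<pi> ` ?D"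
    using orbit_pdel2[OF p] by (auto simp: image_image intro!: image_cong)
  have 2: "orbit \<pi> ` ?D = orbit \<pi> ` D"
  proof
    show "orbit \<pi> ` D \<subseteq> orbit \<pi> ` ?D"
    proof
      fix C assume "C \<in> orbit \<pi> ` D"
      then obtain x where "x \<in> D" "C = orbit \<pi> x" by auto
      with meet[of x] obtain y where "y \<in> orbit \<pi> x" "y \<in> ?D" by auto
      then show "C \<in> orbit \<pi> ` ?D" using orbit_eq[OF p, of y x] \<open>C = _\<close> by auto
    qed
  qed auto
  have "inj_on (\<lambda>C. C - {d, e}) (orbit \<pi> ` ?D)"
  proof (rule inj_onI)
    fix A B assume "A \<in> orbit \<pi> ` ?D" "B \<in> orbit \<pi> ` ?D" and eq: "A - {d, e} = B - {d, e}"
    then obtain x y where x: "x \<in> ?D" "A = orbit \<pi> x" "B = orbit \<pi> y" by auto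
    then have "x \<in> orbit \<pi> y" using orbit_self[OF p, of x] eq by auto
    then show "A = B" using orbit_eq[OF p] x by simp
  qed
  then show ?thesis unfolding norb_def 1 2[symmetric] by (rule card_image)
qed

text \<open>Orbits avoiding \<open>d\<close> and \<open>e\<close> survive unchanged in
  \<open>\<rho>\<close>. If the two points share an orbit, only that one can be lost. If they lie on
  two orbits, one of these has a further point, whose \<open>\<rho>\<close>-orbit is not among the
  survivors and makes up for one loss. This bounds the vertices lost in a contraction and the faces
  lost in a deletion.\<close>

lemma norb_ge_pred:
  assumes p: "\<pi> permutes D" "finite D" and p': "\<rho> permutes (D - {d, e})"
    and agree: "\<And>x. x \<in> D - {d, e} \<Longrightarrow> \<pi> x \<notin> {d, e} \<Longrightarrow> \<rho> x = \<pi> x"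
    and nt: "d \<in> D" "e \<in> D" "\<not> (\<pi> d = d \<and> \<pi> e = e)" "d \<noteq> e"
  shows "norb \<pi> D \<le> norb \<rho> (D - {d, e}) + 1"
proof -
  let ?D = "D - {d, e}"
  define U where "U = {C \<in> orbit \<pi> ` D. d \<notin> C \<and> e \<notin> C}"
  have orbU: "orbit \<rho> x = orbit \<pi> x" if "x \<in> D" "d \<notin> orbit \<pi> x" "e \<notin> orbit \<pi> x" for x
  proof (rule orbit_cong[OF orbit_self[OF p]])
    fix s assume s: "s \<in> orbit \<pi> x"
    then have "\<pi> s \<in> orbit \<pi> x" by (rule orbit.step)
    moreover have "s \<in> D" using s permutes_orbit_subset[OF p(1) that(1)] by auto
    ultimately show "\<rho> s = \<pi> s" using s that by (intro agree) auto
  qed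
  have Usub: "U \<subseteq> orbit \<rho> ` ?D"
  proof
    fix C assume "C \<in> U"
    then obtain x where x: "x \<in> D" "C = orbit \<pi> x" "d \<notin> C" "e \<notin> C" unfolding U_def by auto
    then have "x \<noteq> d" "x \<noteq> e" using orbit_self[OF p, of x] by auto
    then show "C \<in> orbit \<rho> ` ?D" using x orbU[of x] by auto
  qed
  have fin: "finite (orbit \<rho> ` ?D)" using p by auto
  have all: "orbit \<pi> ` D \<subseteq> U \<union> {orbit \<pi> d, orbit \<pi> e}"
    unfolding U_def using orbit_eq[OF p] by fastforce
  have finU: "finite U" using Usub fin finite_subset by auto
  show ?thesis
  proof (cases "orbit \<pi> d = orbit \<pi> e")
    case True
    have "norb \<pi> D \<le> card (insert (orbit \<pi> d) U)"
      unfolding norb_def using all True finU by (intro card_mono) auto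
    also have "\<dots> \<le> card U + 1" using finU by (simp add: card_insert_if)
    also have "card U \<le> norb \<rho> ?D" unfolding norb_def by (intro card_mono Usub fin)
    finally show ?thesis by simp
  next
    case False
    have "\<exists>x\<in>?D. x \<in> orbit \<pi> d \<or> x \<in> orbit \<pi> e"
    proof -
      have "\<pi> d \<in> D" "\<pi> e \<in> D" using nt permutes_in_image[OF p(1)] by auto
      moreover have "\<pi> d \<noteq> e" using False orbit_eq[OF p, of "\<pi> d" d] by (auto intro: orbit.base)
      moreover have "\<pi> e \<noteq> d" using False orbit_eq[OF p, of "\<pi> e" e] by (auto intro: orbit.base)
      ultimately show ?thesis using nt by (metis Diff_iff insertE orbit.base singletonD)
    qed
    then obtain x where x: "x \<in> ?D" "x \<in> orbit \<pi> d \<or> x \<in> orbit \<pi> e" by auto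
    then have ox: "orbit \<pi> x = orbit \<pi> d \<or> orbit \<pi> x = orbit \<pi> e" using orbit_eq[OF p] by blast
    have "orbit \<rho> x \<notin> U"
    proof
      assume U: "orbit \<rho> x \<in> U"
      then obtain y where y: "y \<in> D" "orbit \<rho> x = orbit \<pi> y" "d \<notin> orbit \<pi> y" "e \<notin> orbit \<pi> y"
        unfolding U_def by auto
      have "x \<in> orbit \<rho> x" using orbit_self[OF p'] p by auto
      then have "orbit \<pi> x = orbit \<pi> y" using y orbit_eq[OF p] by metis
      then show False using ox y orbit_self[OF p] by metis
    qed
    then have "card (insert (orbit \<rho> x) U) = card U + 1" using finU by simp
    moreover have "card (insert (orbit \<rho> x) U) \<le> norb \<rho> ?D"
      unfolding norb_def using Usub x fin by (intro card_mono) auto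
    moreover have "norb \<pi> D \<le> card U + 2"
    proof -
      have "norb \<pi> D \<le> card (U \<union> {orbit \<pi> d, orbit \<pi> e})"
        unfolding norb_def using all finU by (intro card_mono) auto
      also have "\<dots> \<le> card U + card {orbit \<pi> d, orbit \<pi> e}" by (rule card_Un_le)
      also have "card {orbit \<pi> d, orbit \<pi> e} \<le> 2" by (simp add: card_insert_if)
      finally show ?thesis by simp
    qed
    ultimately show ?thesis by simp
  qed
qed

text \<open>Walking along the cycle from \<open>x\<close> eventually reaches \<open>d\<close>, and
  \<open>S\<close> can be left only by a step onto \<open>d\<close>.\<close>

lemma orbit_subset_exit:
  assumes p: "\<pi> permutes D" "finite D" and x: "x \<in> S" "x \<in> orbit \<pi> d" "d \<notin> S"
    and cl: "\<And>y. y \<in> S \<Longrightarrow> y \<in> orbit \<pi> d \<Longrightarrow> \<pi> y \<noteq> d \<Longrightarrow> \<pi> y \<in> S"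
  shows "\<exists>y\<in>S. \<pi> y = d"
proof (rule ccontr)
  assume *: "\<not> ?thesis"
  have "orbit \<pi> x \<subseteq> S \<inter> orbit \<pi> d"
    using x * cl by (intro orbit_least) (auto intro: orbit.step)
  moreover have "d \<in> orbit \<pi> x" using orbit_sym[OF p x(2)] .
  ultimately show False using x by auto
qed

text \<open>A combinatorial map has a set \<open>D\<close> of darts (oriented edges), a permutation \<open>\<tau>\<close> that rotates a dart
  about its tail and an involution \<open>\<alpha>\<close> that reverses it; the faces are the orbits of \<open>\<tau> \<circ> \<alpha>\<close>. Its vertices
  carry labels \<open>h\<close>, and each label must be connected: any two darts with that label are joined by
  rotations and by edges inside the label class.\<close>

definition fibre_connected :: "'d set \<Rightarrow> ('d \<Rightarrow> 'd) \<Rightarrow> ('d \<Rightarrow> 'd) \<Rightarrow> ('d \<Rightarrow> 'v) \<Rightarrow> bool" where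
  "fibre_connected D \<tau> \<alpha> h \<longleftrightarrow>
     (\<forall>P. (\<forall>x\<in>D. P x \<longrightarrow> P (\<tau> x)) \<longrightarrow> (\<forall>x\<in>D. h x = h (\<alpha> x) \<longrightarrow> P x \<longrightarrow> P (\<alpha> x)) \<longrightarrow>
        (\<forall>x\<in>D. \<forall>y\<in>D. h x = h y \<longrightarrow> P x \<longrightarrow> P y))"

lemma fibre_connectedD:
  assumes "fibre_connected D \<tau> \<alpha> h" "x \<in> D" "y \<in> D" "h x = h y" "P x"
    and "\<And>x. x \<in> D \<Longrightarrow> P x \<Longrightarrow> P (\<tau> x)"
    and "\<And>x. x \<in> D \<Longrightarrow> h x = h (\<alpha> x) \<Longrightarrow> P x \<Longrightarrow> P (\<alpha> x)"
  shows "P y"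
  using assms(1)[unfolded fibre_connected_def, rule_format, of P x y] assms(2-) by blast

definition labelled_map :: "'d set \<Rightarrow> ('d \<Rightarrow> 'd) \<Rightarrow> ('d \<Rightarrow> 'd) \<Rightarrow> ('d \<Rightarrow> 'v) \<Rightarrow> bool" where
  "labelled_map D \<tau> \<alpha> h \<longleftrightarrow> finite D \<and> \<tau> permutes D \<and> \<alpha> permutes D \<and>
     (\<forall>x\<in>D. \<alpha> x \<noteq> x \<and> \<alpha> (\<alpha> x) = x) \<and> (\<forall>x\<in>D. h (\<tau> x) = h x) \<and> fibre_connected D \<tau> \<alpha> h"

text \<open>Twice the Euler characteristic, as there are \<open>card D / 2\<close> edges.\<close>

definition euler2 :: "'d set \<Rightarrow> ('d \<Rightarrow> 'd) \<Rightarrow> ('d \<Rightarrow> 'd) \<Rightarrow> int" where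
  "euler2 D \<tau> \<alpha> = 2 * int (norb \<tau> D) + 2 * int (norb (\<tau> \<circ> \<alpha>) D) - int (card D)"

lemma norb_cong:
  assumes "\<And>x. x \<in> D \<Longrightarrow> f x = g x" "\<And>x. x \<in> D \<Longrightarrow> f x \<in> D"
  shows "norb f D = norb g D"
proof -
  have "orbit f x = orbit g x" if "x \<in> D" for x
    using that assms by (intro orbit_cong0[of x D]) auto
  then show ?thesis unfolding norb_def by (metis image_cong)
qed

lemma card_minus_pair:
  assumes "finite D" "d \<in> D" "e \<in> D" "d \<noteq> e" shows "card D = card (D - {d, e}) + 2"
proof -
  have "card D = card (insert d (insert e (D - {d, e})))" using assms by (intro arg_cong[where f = card]) auto
  then show ?thesis using assms by simp
qed

text \<open>Both \<open>\<alpha>\<close> and the face permutation lose the two darts, and the new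
  rotation is recomputed as their product. Every face retains a dart, so the number of faces is
  kept; one edge and at most one vertex go. \<open>K\<close> guarantees that the merged vertex still
  has a dart.\<close>

lemma contract_map:
  assumes m: "labelled_map D \<tau> \<alpha> h" and d: "d \<in> D" "h d = h (\<alpha> d)" "\<alpha> d \<notin> orbit \<tau> d"
    and K: "K \<subseteq> D - {d, \<alpha> d}" "h ` K = h ` D"
  defines "D' \<equiv> D - {d, \<alpha> d}"
  shows "\<exists>\<tau>' \<alpha>'. labelled_map D' \<tau>' \<alpha>' h \<and> (\<forall>x\<in>D'. \<alpha>' x = \<alpha> x) \<and> euler2 D \<tau> \<alpha> \<le> euler2 D' \<tau>' \<alpha>'"
proof -
  define e where "e = \<alpha> d"
  define \<phi> where "\<phi> = \<tau> \<circ> \<alpha>"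
  define \<alpha>' where "\<alpha>' = pdel2 d e \<alpha>"
  define \<phi>' where "\<phi>' = pdel2 d e \<phi>"
  define \<tau>' where "\<tau>' = \<phi>' \<circ> \<alpha>'"
  have fin: "finite D" and s: "\<tau> permutes D" and a: "\<alpha> permutes D"
    and inv: "\<And>x. x \<in> D \<Longrightarrow> \<alpha> x \<noteq> x" "\<And>x. x \<in> D \<Longrightarrow> \<alpha> (\<alpha> x) = x"
    and h: "\<And>x. x \<in> D \<Longrightarrow> h (\<tau> x) = h x" and fc: "fibre_connected D \<tau> \<alpha> h"
    using m unfolding labelled_map_def by auto
  have de: "e \<in> D" "d \<noteq> e" "\<alpha> d = e" "\<alpha> e = d" "h e = h d" "e \<notin> orbit \<tau> d" "d \<notin> orbit \<tau> e"
    using d inv[of d] permutes_in_image[OF a] orbit_sym[OF s fin] unfolding e_def by auto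
  have D': "D' = D - {d, e}" unfolding D'_def e_def ..
  have sD: "\<tau> x \<in> D \<longleftrightarrow> x \<in> D" and aD: "\<alpha> x \<in> D \<longleftrightarrow> x \<in> D" for x
    using permutes_in_image[OF s] permutes_in_image[OF a] by auto
  have p: "\<phi> permutes D" unfolding \<phi>_def using permutes_compose[OF a s] .
  have a'p: "\<alpha>' permutes D'" unfolding \<alpha>'_def D' by (rule pdel2_permutes[OF a])
  have p'p: "\<phi>' permutes D'" unfolding \<phi>'_def D' by (rule pdel2_permutes[OF p])
  have s'p: "\<tau>' permutes D'" unfolding \<tau>'_def by (rule permutes_compose[OF a'p p'p])
  have a': "\<alpha>' x = \<alpha> x" "\<alpha> x \<in> D'" if "x \<in> D'" for x
  proof -
    have "\<alpha> x \<noteq> d" "\<alpha> x \<noteq> e" using that inv(2)[of x] de D' by auto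
    then show "\<alpha>' x = \<alpha> x" "\<alpha> x \<in> D'" using that D' aD pdel2_apply[OF a] unfolding \<alpha>'_def by auto
  qed
  have s': "\<tau>' x = \<phi>' (\<alpha> x)" if "x \<in> D'" for x using a'[OF that] by (simp add: \<tau>'_def)
  have pa: "\<phi> (\<alpha> x) = \<tau> x" if "x \<in> D" for x using inv(2)[OF that] by (simp add: \<phi>_def)
  have s'1: "\<tau>' x = \<tau> x" if "x \<in> D'" "\<tau> x \<in> D'" for x
    using that a'[of x] pa[of x] unfolding s'[OF that(1)] \<phi>'_def
    by (subst pdel2_apply[OF p]) (auto simp: D')
  \<comment> \<open>At the merged vertex the rotation jumps from the dart before \<open>d\<close> to
    the one after \<open>e\<close>, and conversely; the conditional covers the case that the
    skipped-to dart was alone at its vertex.\<close>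
  have s'2: "\<tau>' x = (if \<tau> e = e then \<tau> d else \<tau> e)" if "x \<in> D'" "\<tau> x = d" for x
    using that a'[of x] pa[of x] unfolding s'[OF that(1)] \<phi>'_def
    by (subst pdel2_apply_left[OF p]) (auto simp: D' de \<phi>_def)
  have s'3: "\<tau>' x = (if \<tau> d = d then \<tau> e else \<tau> d)" if "x \<in> D'" "\<tau> x = e" for x
    using that a'[of x] pa[of x] unfolding s'[OF that(1)] \<phi>'_def
    by (subst pdel2_apply_right[OF p]) (auto simp: D' de \<phi>_def)
  have hs': "h (\<tau>' x) = h x" if x: "x \<in> D'" for x
  proof -
    have "x \<in> D" using x D' by auto
    consider "\<tau> x \<in> D'" | "\<tau> x = d" | "\<tau> x = e" using sD \<open>x \<in> D\<close> D' by auto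
    then show ?thesis
    proof cases
      case 1 then show ?thesis using s'1[OF x] h \<open>x \<in> D\<close> by simp
    next
      case 2 then have "h d = h x" using h[OF \<open>x \<in> D\<close>] by simp
      then show ?thesis using s'2[OF x 2] h[OF d(1)] h[OF de(1)] de by simp
    next
      case 3 then have "h e = h x" using h[OF \<open>x \<in> D\<close>] by simp
      then show ?thesis using s'3[OF x 3] h[OF d(1)] h[OF de(1)] de by simp
    qed
  qed
  have inj: "\<tau> x = \<tau> y \<longleftrightarrow> x = y" for x y using permutes_inj[OF s] by (auto dest: injD)
  \<comment> \<open>Otherwise \<open>{d, e}\<close> would be closed under rotation and reversal and
    thus be a whole label class, while \<open>K\<close> contains another dart with this
    label.\<close>
  have nofix: "\<not> (\<tau> d = d \<and> \<tau> e = e)"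
  proof
    assume *: "\<tau> d = d \<and> \<tau> e = e"
    have "h d \<in> h ` K" using K d(1) by simp
    then obtain k where k: "k \<in> K" "h k = h d" by auto
    have "k = d \<or> k = e"
    proof (rule fibre_connectedD[OF fc d(1), where P = "\<lambda>k. k = d \<or> k = e"])
      show "k \<in> D" "h d = h k" using k K by auto
    qed (use * de in auto)
    then show False using k K unfolding e_def by auto
  qed
  have fc': "fibre_connected D' \<tau>' \<alpha>' h"
    unfolding fibre_connected_def
  proof (intro allI impI ballI)
    fix P x y
    assume P1: "\<forall>x\<in>D'. P x \<longrightarrow> P (\<tau>' x)" and P2: "\<forall>x\<in>D'. h x = h (\<alpha>' x) \<longrightarrow> P x \<longrightarrow> P (\<alpha>' x)"
      and xy: "x \<in> D'" "y \<in> D'" "h x = h y" "P x"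
    define M where "M = D' \<inter> (orbit \<tau> d \<union> orbit \<tau> e)"
    \<comment> \<open>Closure under \<open>\<tau>'\<close> also works backwards, because its orbits
      are finite cycles.\<close>
    have bwd: "P x" if "x \<in> D'" "P (\<tau>' x)" for x
    proof -
      have fin': "finite D'" using fin D' by auto
      have "orbit \<tau>' (\<tau>' x) \<subseteq> {x \<in> D'. P x}"
        using that P1 permutes_in_image[OF s'p] by (intro orbit_least) auto
      moreover have "x \<in> orbit \<tau>' (\<tau>' x)" by (rule orbit_sym[OF s'p fin' orbit.base])
      ultimately show "P x" by auto
    qed
    have exit: "\<exists>y\<in>S. \<tau> y = c" if S: "S \<subseteq> D'" "\<And>y. y \<in> S \<Longrightarrow> \<tau>' y \<in> S" and c: "c = d \<or> c = e"
      and x: "x \<in> S" "x \<in> orbit \<tau> c" for S x c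
    proof (rule orbit_subset_exit[OF s fin x])
      show "c \<notin> S" using S(1) c D' by auto
      fix y assume y: "y \<in> S" "y \<in> orbit \<tau> c" "\<tau> y \<noteq> c"
      have "\<tau> y \<in> orbit \<tau> c" using y(2) by (rule orbit.step)
      then have "\<tau> y \<noteq> d" "\<tau> y \<noteq> e" using y c de by auto
      then have "\<tau> y \<in> D'" using S(1) y(1) D' sD by auto
      then show "\<tau> y \<in> S" using S y s'1[of y] by force
    qed
    \<comment> \<open>\<open>P\<close> is constant on the merged vertex: the sets where it is true
      and where it is false are both closed under \<open>\<tau>'\<close>. Two such sets meeting the
      same old orbit would share the dart before \<open>d\<close> or \<open>e\<close>, and a closed
      set meeting one old orbit passes on to the other if that one has darts left.\<close>
    have Mconst: False if z: "z \<in> M" "P z" and w: "w \<in> M" "\<not> P w" for z w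
    proof -
      define S where "S b = {x \<in> D'. P x = b}" for b
      have S: "S b \<subseteq> D'" "\<And>y. y \<in> S b \<Longrightarrow> \<tau>' y \<in> S b" for b
      proof -
        show "S b \<subseteq> D'" by (auto simp: S_def)
        fix y assume y: "y \<in> S b"
        then have yD: "y \<in> D'" "\<tau>' y \<in> D'" using permutes_in_image[OF s'p] by (auto simp: S_def)
        have "P y = P (\<tau>' y)" using P1 bwd[OF yD(1)] yD(1) by blast
        then show "\<tau>' y \<in> S b" using y yD by (simp add: S_def)
      qed
      have step: "\<exists>x\<in>S b. x \<in> orbit \<tau> c'" if st: "x \<in> S b" "x \<in> orbit \<tau> c" "{c, c'} = {d, e}" "\<tau> c' \<noteq> c'" for b c c' x
      proof -
        have c: "c = d \<or> c = e" using st by auto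
        obtain y where y: "y \<in> S b" "\<tau> y = c" using exit[OF S c st(1,2)] by auto
        then have "\<tau>' y = \<tau> c'" using st s'2[of y] s'3[of y] S(1)[of b] by (auto simp: doubleton_eq_iff)
        then have "\<tau> c' \<in> S b" using S(2)[OF y(1)] by simp
        then show ?thesis by (auto intro: orbit.base)
      qed
      have clash: False if "x \<in> S True" "x \<in> orbit \<tau> c" "y \<in> S False" "y \<in> orbit \<tau> c" "c = d \<or> c = e" for x y c
        using exit[OF S that(5,1,2)] exit[OF S that(5,3,4)] inj unfolding S_def by auto
      have triv: False if "x \<in> S b" "x \<in> orbit \<tau> c" "\<tau> c = c" "c = d \<or> c = e" for x c b
        using that orbit_eq_singleton_iff[of \<tau> c] S(1)[of b] D' by auto
      have zw: "z \<in> S True" "w \<in> S False" using z w unfolding S_def M_def by auto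
      consider "z \<in> orbit \<tau> d" "w \<in> orbit \<tau> d" | "z \<in> orbit \<tau> e" "w \<in> orbit \<tau> e"
        | "z \<in> orbit \<tau> d" "w \<in> orbit \<tau> e" | "z \<in> orbit \<tau> e" "w \<in> orbit \<tau> d"
        using z w unfolding M_def by auto
      then show False
      proof cases
        case 1 then show False using clash zw by blast
      next
        case 2 then show False using clash zw by blast
      next
        case 3
        then have "\<tau> e \<noteq> e" using triv zw by blast
        then show False using step[OF zw(1) 3(1), of e] clash zw(2) 3(2) by blast
      next
        case 4
        then have "\<tau> d \<noteq> d" using triv zw by blast
        then show False using step[OF zw(1) 4(1), of d] clash zw(2) 4(2) by blast
      qed
    qed
    \<comment> \<open>\<open>P\<close> is extended to the removed darts by its common value on the
      merged vertex, so that connectedness of the old label class applies.\<close>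
    define Q where "Q z \<longleftrightarrow> (z \<in> D' \<and> P z) \<or> ((z = d \<or> z = e) \<and> (\<exists>w\<in>M. P w))" for z
    have "Q y"
    proof (rule fibre_connectedD[OF fc, of x])
      show "x \<in> D" "y \<in> D" "h x = h y" using xy D' by auto
      show "Q x" using xy by (simp add: Q_def)
      fix z assume z: "z \<in> D" "Q z"
      show "Q (\<tau> z)"
      proof (cases "z \<in> D'")
        case True
        then have Pz: "P z" using z D' by (auto simp: Q_def)
        show ?thesis
        proof (cases "\<tau> z \<in> D'")
          case T: True then show ?thesis using P1 Pz True s'1 by (auto simp: Q_def)
        next
          case False
          then have c: "\<tau> z = d \<or> \<tau> z = e" using z sD D' by auto
          then have "z \<in> M" using True orbit_sym[OF s fin orbit.base[of \<tau> z]] unfolding M_def by auto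
          then show ?thesis using c Pz by (auto simp: Q_def)
        qed
      next
        case False
        then have c: "z = d \<or> z = e" and M: "\<exists>w\<in>M. P w" using z D' by (auto simp: Q_def)
        show ?thesis
        proof (cases "\<tau> z \<in> D'")
          case True
          then have "\<tau> z \<in> M" using c by (auto simp: M_def intro: orbit.base)
          then have "P (\<tau> z)" using M Mconst by blast
          then show ?thesis using True by (auto simp: Q_def)
        next
          case F: False
          then show ?thesis using M z sD D' by (auto simp: Q_def)
        qed
      qed
      assume hz: "h z = h (\<alpha> z)"
      show "Q (\<alpha> z)"
      proof (cases "z \<in> D'")
        case True
        then have "P z" using z D' by (auto simp: Q_def)
        then show ?thesis using a'[OF True] P2 True hz by (auto simp: Q_def)
      next
        case False
        then show ?thesis using z D' de by (auto simp: Q_def)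
      qed
    qed
    then show "P y" using xy D' by (auto simp: Q_def)
  qed
  have lm: "labelled_map D' \<tau>' \<alpha>' h"
    unfolding labelled_map_def
  proof (intro conjI ballI)
    show "finite D'" using fin D' by simp
    fix x assume x: "x \<in> D'"
    then have xD: "x \<in> D" using D' by simp
    show "\<alpha>' x \<noteq> x" using a'(1)[OF x] inv(1)[OF xD] by simp
    show "\<alpha>' (\<alpha>' x) = x" unfolding a'(1)[OF x] a'(1)[OF a'(2)[OF x]] by (rule inv(2)[OF xD])
  qed (use s'p a'p hs' fc' in auto)
  have sa: "norb (\<tau>' \<circ> \<alpha>') D' = norb \<phi>' D'"
    using a' inv(2) D' permutes_in_image[OF p'p] by (intro norb_cong) (auto simp: \<tau>'_def)
  have F: "norb \<phi>' D' = norb \<phi> D"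
    unfolding \<phi>'_def D'
  proof (rule norb_pdel2[OF p fin])
    fix x assume x: "x \<in> D"
    show "\<exists>y\<in>orbit \<phi> x. y \<in> D \<and> y \<noteq> d \<and> y \<noteq> e"
    proof (rule ccontr)
      assume "\<not> ?thesis"
      then have sub: "orbit \<phi> x \<subseteq> {d, e}" using permutes_orbit_subset[OF p x] by auto
      have pd: "\<phi> d = \<tau> e" "\<phi> e = \<tau> d" by (simp_all add: \<phi>_def de)
      have "d \<in> orbit \<phi> x \<or> e \<in> orbit \<phi> x" using sub orbit_self[OF p fin, of x] by auto
      moreover have "\<tau> e \<noteq> d" using de orbit.base[of \<tau> e] by auto
      moreover have "\<tau> d \<noteq> e" using de orbit.base[of \<tau> d] by auto
      ultimately have "\<tau> e = e \<and> \<tau> d = d"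
        using sub pd orbit.step[of d \<phi> x] orbit.step[of e \<phi> x] by (metis insertE singletonD subsetD)
      then show False using nofix by simp
    qed
  qed
  have V: "norb \<tau> D \<le> norb \<tau>' D' + 1"
    unfolding D'
  proof (rule norb_ge_pred[OF s fin _ _ d(1) de(1) nofix de(2)])
    show "\<tau>' permutes D - {d, e}" using s'p D' by simp
    fix x assume "x \<in> D - {d, e}" "\<tau> x \<notin> {d, e}"
    then show "\<tau>' x = \<tau> x" using s'1[of x] sD D' by auto
  qed
  have "card D = card D' + 2" unfolding D' by (rule card_minus_pair[OF fin d(1) de(1,2)])
  then have "euler2 D \<tau> \<alpha> \<le> euler2 D' \<tau>' \<alpha>'" using F V sa unfolding euler2_def \<phi>_def by simp
  then show ?thesis using lm a' by blast
qed

text \<open>With one vertex per label, the labels stay connected. \<open>K\<close> has a dart at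
  every vertex, so no vertex disappears, and at most one face is lost together with the
  edge.\<close>

lemma delete_map:
  assumes m: "labelled_map D \<tau> \<alpha> h" and d: "d \<in> D" "d \<notin> K" "\<alpha> d \<notin> K"
    and flat: "\<And>x y. x \<in> D \<Longrightarrow> y \<in> D \<Longrightarrow> h x = h y \<Longrightarrow> y \<in> orbit \<tau> x"
    and K: "K \<subseteq> D" "h ` K = h ` D"
  defines "D' \<equiv> D - {d, \<alpha> d}"
  shows "\<exists>\<tau>' \<alpha>'. labelled_map D' \<tau>' \<alpha>' h \<and> (\<forall>x\<in>D'. \<alpha>' x = \<alpha> x) \<and> euler2 D \<tau> \<alpha> \<le> euler2 D' \<tau>' \<alpha>'"
proof -
  define e where "e = \<alpha> d"
  define \<alpha>' where "\<alpha>' = pdel2 d e \<alpha>"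
  define \<tau>' where "\<tau>' = pdel2 d e \<tau>"
  have fin: "finite D" and s: "\<tau> permutes D" and a: "\<alpha> permutes D"
    and inv: "\<And>x. x \<in> D \<Longrightarrow> \<alpha> x \<noteq> x" "\<And>x. x \<in> D \<Longrightarrow> \<alpha> (\<alpha> x) = x"
    and h: "\<And>x. x \<in> D \<Longrightarrow> h (\<tau> x) = h x"
    using m unfolding labelled_map_def by auto
  have de: "e \<in> D" "d \<noteq> e" "\<alpha> d = e" "\<alpha> e = d"
    using d inv[of d] permutes_in_image[OF a] unfolding e_def by auto
  have D': "D' = D - {d, e}" unfolding D'_def e_def ..
  have sD: "\<tau> x \<in> D \<longleftrightarrow> x \<in> D" and aD: "\<alpha> x \<in> D \<longleftrightarrow> x \<in> D" for x
    using permutes_in_image[OF s] permutes_in_image[OF a] by auto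
  have a'p: "\<alpha>' permutes D'" unfolding \<alpha>'_def D' by (rule pdel2_permutes[OF a])
  have s'p: "\<tau>' permutes D'" unfolding \<tau>'_def D' by (rule pdel2_permutes[OF s])
  have a': "\<alpha>' x = \<alpha> x" "\<alpha> x \<in> D'" if "x \<in> D'" for x
  proof -
    have "\<alpha> x \<noteq> d" "\<alpha> x \<noteq> e" using that inv(2)[of x] de D' by auto
    then show "\<alpha>' x = \<alpha> x" "\<alpha> x \<in> D'" using that D' aD pdel2_apply[OF a] unfolding \<alpha>'_def by auto
  qed
  have orb': "orbit \<tau>' x = orbit \<tau> x - {d, e}" if "x \<in> D'" for x
    using that unfolding \<tau>'_def D' by (intro orbit_pdel2[OF s fin]) auto
  have horb: "h y = h x" if "x \<in> D" "y \<in> orbit \<tau> x" for x y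
  proof -
    have "orbit \<tau> x \<subseteq> {y \<in> D. h y = h x}" using that h sD by (intro orbit_least) auto
    then show ?thesis using that by auto
  qed
  have hs': "h (\<tau>' x) = h x" if x: "x \<in> D'" for x
    using orb'[OF x] orbit.base[of \<tau>' x] horb[of x] x D' by auto
  have fc': "fibre_connected D' \<tau>' \<alpha>' h"
    unfolding fibre_connected_def
  proof (intro allI impI ballI)
    fix P x y
    assume P1: "\<forall>x\<in>D'. P x \<longrightarrow> P (\<tau>' x)"
      and xy: "x \<in> D'" "y \<in> D'" "h x = h y" "P x"
    have "orbit \<tau>' x \<subseteq> {x \<in> D'. P x}"
      using xy P1 permutes_in_image[OF s'p] by (intro orbit_least) auto
    moreover have "y \<in> orbit \<tau>' x" using orb'[OF xy(1)] flat[of x y] xy D' by auto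
    ultimately show "P y" by auto
  qed
  have lm: "labelled_map D' \<tau>' \<alpha>' h"
    unfolding labelled_map_def
  proof (intro conjI ballI)
    show "finite D'" using fin D' by simp
    fix x assume x: "x \<in> D'"
    then have xD: "x \<in> D" using D' by simp
    show "\<alpha>' x \<noteq> x" using a'(1)[OF x] inv(1)[OF xD] by simp
    show "\<alpha>' (\<alpha>' x) = x" unfolding a'(1)[OF x] a'(1)[OF a'(2)[OF x]] by (rule inv(2)[OF xD])
  qed (use s'p a'p hs' fc' in auto)
  have meet: "\<exists>y\<in>orbit \<tau> x. y \<in> K" if x: "x \<in> D" for x
  proof -
    have "h x \<in> h ` K" using K x by simp
    then obtain k where "k \<in> K" "h k = h x" by auto
    then show ?thesis using flat[of x k] x K by auto
  qed
  have V: "norb \<tau>' D' = norb \<tau> D"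
    unfolding \<tau>'_def D'
  proof (rule norb_pdel2[OF s fin])
    fix x assume "x \<in> D"
    then show "\<exists>y\<in>orbit \<tau> x. y \<in> D \<and> y \<noteq> d \<and> y \<noteq> e" using meet[of x] d K unfolding e_def by blast
  qed
  have p: "\<tau> \<circ> \<alpha> permutes D" by (rule permutes_compose[OF a s])
  have p'p: "\<tau>' \<circ> \<alpha>' permutes D'" by (rule permutes_compose[OF a'p s'p])
  have F: "norb (\<tau> \<circ> \<alpha>) D \<le> norb (\<tau>' \<circ> \<alpha>') D' + 1"
    unfolding D'
  proof (rule norb_ge_pred[OF p fin _ _ d(1) de(1) _ de(2)])
    show "\<tau>' \<circ> \<alpha>' permutes D - {d, e}" using p'p D' by simp
    fix x assume x: "x \<in> D - {d, e}" "(\<tau> \<circ> \<alpha>) x \<notin> {d, e}"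
    then have "x \<in> D'" using D' by simp
    then show "(\<tau>' \<circ> \<alpha>') x = (\<tau> \<circ> \<alpha>) x"
      using a'[of x] x D' unfolding \<tau>'_def by (auto simp: pdel2_apply[OF s])
  next
    \<comment> \<open>Were both darts faces of length one, \<open>d\<close> and \<open>e\<close>
      would make up a whole vertex, without a dart of \<open>K\<close>.\<close>
    show "\<not> ((\<tau> \<circ> \<alpha>) d = d \<and> (\<tau> \<circ> \<alpha>) e = e)"
    proof
      assume "(\<tau> \<circ> \<alpha>) d = d \<and> (\<tau> \<circ> \<alpha>) e = e"
      then have "\<tau> e = d" "\<tau> d = e" using de by auto
      then have "orbit \<tau> d \<subseteq> {d, e}" by (intro orbit_least) auto
      then show False using meet[OF d(1)] d de by auto
    qed
  qed
  have "card D = card D' + 2" unfolding D' by (rule card_minus_pair[OF fin d(1) de(1,2)])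
  then have "euler2 D \<tau> \<alpha> \<le> euler2 D' \<tau>' \<alpha>'" using F V unfolding euler2_def by simp
  then show ?thesis using lm a' by blast
qed

text \<open>Edges inside a label class are contracted as long as they join different vertices. When
  none is left, connectedness forces one vertex per label. Only then are the edges outside
  \<open>K\<close> deleted, since an earlier deletion could disconnect a class.\<close>

theorem map_minor:
  assumes "labelled_map D \<tau> \<alpha> h" and "K \<subseteq> D" and "\<And>x. x \<in> K \<Longrightarrow> \<alpha> x \<in> K"
    and "\<And>x. x \<in> K \<Longrightarrow> h (\<alpha> x) \<noteq> h x" and "h ` K = h ` D"
  shows "\<exists>\<tau>' \<alpha>'. labelled_map K \<tau>' \<alpha>' h \<and> (\<forall>x\<in>K. \<alpha>' x = \<alpha> x) \<and>
     (\<forall>x\<in>K. \<forall>y\<in>K. h x = h y \<longrightarrow> y \<in> orbit \<tau>' x) \<and> euler2 D \<tau> \<alpha> \<le> euler2 K \<tau>' \<alpha>'"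
  using assms
proof (induction "card D" arbitrary: D \<tau> \<alpha> rule: less_induct)
  case less
  note m = less.prems(1)
  have fin: "finite D" and s: "\<tau> permutes D" and a: "\<alpha> permutes D" and fc: "fibre_connected D \<tau> \<alpha> h"
    using m unfolding labelled_map_def by auto
  have rec: ?case if d: "d \<in> D" "d \<notin> K" "\<alpha> d \<notin> K" and
    st: "\<exists>\<tau>' \<alpha>'. labelled_map (D - {d, \<alpha> d}) \<tau>' \<alpha>' h \<and> (\<forall>x\<in>D - {d, \<alpha> d}. \<alpha>' x = \<alpha> x) \<and>
       euler2 D \<tau> \<alpha> \<le> euler2 (D - {d, \<alpha> d}) \<tau>' \<alpha>'" for d
  proof -
    let ?D = "D - {d, \<alpha> d}"
    obtain \<tau>1 \<alpha>1 where 1: "labelled_map ?D \<tau>1 \<alpha>1 h" "\<And>x. x \<in> ?D \<Longrightarrow> \<alpha>1 x = \<alpha> x" "euler2 D \<tau> \<alpha> \<le> euler2 ?D \<tau>1 \<alpha>1"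
      using st by auto
    have KD: "K \<subseteq> ?D" using less.prems(2) d by auto
    have "card ?D < card D" using fin d(1) by (intro psubset_card_mono) auto
    moreover have "h ` K = h ` ?D" using less.prems(5) KD by auto
    moreover have a1: "\<alpha>1 x = \<alpha> x" if "x \<in> K" for x using 1(2) KD that by auto
    ultimately obtain \<tau>2 \<alpha>2 where "labelled_map K \<tau>2 \<alpha>2 h" "\<forall>x\<in>K. \<alpha>2 x = \<alpha>1 x"
      "\<forall>x\<in>K. \<forall>y\<in>K. h x = h y \<longrightarrow> y \<in> orbit \<tau>2 x" "euler2 ?D \<tau>1 \<alpha>1 \<le> euler2 K \<tau>2 \<alpha>2"
      using less.hyps[OF _ 1(1) KD] less.prems(3,4) by auto
    moreover from this have "\<forall>x\<in>K. \<alpha>2 x = \<alpha> x" "euler2 D \<tau> \<alpha> \<le> euler2 K \<tau>2 \<alpha>2"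
      using 1(3) a1 by auto
    ultimately show ?thesis by blast
  qed
  have nK: "\<alpha> d \<notin> K" if "d \<in> D" "d \<notin> K" for d
    using less.prems(3)[of "\<alpha> d"] that m unfolding labelled_map_def by auto
  consider (c) d where "d \<in> D" "h d = h (\<alpha> d)" "\<alpha> d \<notin> orbit \<tau> d"
    | (n) "\<And>d. d \<in> D \<Longrightarrow> h d = h (\<alpha> d) \<Longrightarrow> \<alpha> d \<in> orbit \<tau> d" by blast
  then show ?case
  proof cases
    case c
    have dK: "d \<notin> K" using less.prems(4)[of d] c by auto
    show ?thesis
    proof (rule rec[OF c(1) dK nK[OF c(1) dK]])
      show "\<exists>\<tau>' \<alpha>'. labelled_map (D - {d, \<alpha> d}) \<tau>' \<alpha>' h \<and> (\<forall>x\<in>D - {d, \<alpha> d}. \<alpha>' x = \<alpha> x) \<and>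
       euler2 D \<tau> \<alpha> \<le> euler2 (D - {d, \<alpha> d}) \<tau>' \<alpha>'"
        using less.prems(2,5) dK nK[OF c(1) dK] by (intro contract_map[OF m c, of K]) auto
    qed
  next
    case n
    have flat: "y \<in> orbit \<tau> x" if "x \<in> D" "y \<in> D" "h x = h y" for x y
    proof (rule fibre_connectedD[OF fc that, where P = "\<lambda>y. y \<in> orbit \<tau> x"])
      show "x \<in> orbit \<tau> x" by (rule orbit_self[OF s fin])
    next
      fix z assume "z \<in> orbit \<tau> x" then show "\<tau> z \<in> orbit \<tau> x" by (rule orbit.step)
    next
      fix z assume "z \<in> D" "h z = h (\<alpha> z)" "z \<in> orbit \<tau> x"
      then show "\<alpha> z \<in> orbit \<tau> x" using n[of z] orbit_eq[OF s fin, of z x] by auto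
    qed
    show ?thesis
    proof (cases "D = K")
      case True
      have "labelled_map K \<tau> \<alpha> h" "\<forall>x\<in>K. \<forall>y\<in>K. h x = h y \<longrightarrow> y \<in> orbit \<tau> x" "euler2 D \<tau> \<alpha> \<le> euler2 K \<tau> \<alpha>"
        using m flat True by simp_all
      then show ?thesis by blast
    next
      case False
      then obtain d where d: "d \<in> D" "d \<notin> K" using less.prems(2) by auto
      show ?thesis
        by (rule rec[OF d nK[OF d] delete_map[OF m d nK[OF d] flat less.prems(2,5)]])
    qed
  qed
qed

section \<open>The cubical map on the boundary of the handlebody\<close>

datatype dir = Xp | Xm | Yp | Ym | Zp | Zm

primrec neg :: "dir \<Rightarrow> dir" where
  "neg Xp = Xm" | "neg Xm = Xp" | "neg Yp = Ym" | "neg Ym = Yp" | "neg Zp = Zm" | "neg Zm = Zp"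

text \<open>The cross product of two perpendicular directions; on parallel ones the value is
  arbitrary.\<close>

definition crs :: "dir \<Rightarrow> dir \<Rightarrow> dir" where
  "crs a b = (case a of
      Xp \<Rightarrow> (case b of Yp \<Rightarrow> Zp | Ym \<Rightarrow> Zm | Zp \<Rightarrow> Ym | Zm \<Rightarrow> Yp | _ \<Rightarrow> b)
    | Xm \<Rightarrow> (case b of Yp \<Rightarrow> Zm | Ym \<Rightarrow> Zp | Zp \<Rightarrow> Yp | Zm \<Rightarrow> Ym | _ \<Rightarrow> b)
    | Yp \<Rightarrow> (case b of Zp \<Rightarrow> Xp | Zm \<Rightarrow> Xm | Xp \<Rightarrow> Zm | Xm \<Rightarrow> Zp | _ \<Rightarrow> b)
    | Ym \<Rightarrow> (case b of Zp \<Rightarrow> Xm | Zm \<Rightarrow> Xp | Xp \<Rightarrow> Zp | Xm \<Rightarrow> Zm | _ \<Rightarrow> b)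
    | Zp \<Rightarrow> (case b of Xp \<Rightarrow> Yp | Xm \<Rightarrow> Ym | Yp \<Rightarrow> Xm | Ym \<Rightarrow> Xp | _ \<Rightarrow> b)
    | Zm \<Rightarrow> (case b of Xp \<Rightarrow> Ym | Xm \<Rightarrow> Yp | Yp \<Rightarrow> Xp | Ym \<Rightarrow> Xm | _ \<Rightarrow> b))"

definition perp :: "dir \<Rightarrow> dir \<Rightarrow> bool" where "perp a b \<longleftrightarrow> a \<noteq> b \<and> a \<noteq> neg b"

definition dirs :: "dir list" where "dirs = [Xp, Xm, Yp, Ym, Zp, Zm]"

text \<open>The eight cubes around a grid vertex are filled in the pattern \<open>p \<and> z\<close>, where \<open>p\<close> depends on the first
  two coordinates and \<open>z\<close> on the third (\<open>True\<close> stands for the positive side). A frame \<open>(u, n)\<close> is an edge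
  with direction \<open>u\<close> together with the outward normal \<open>n\<close> of the boundary square to its left, which
  lies in direction \<open>crs n u\<close>; crossing the edge changes the normal by \<open>turn\<close>, according to whether the
  boundary is concave, flat or convex there.\<close>

definition cfg :: "(bool \<Rightarrow> bool \<Rightarrow> bool) \<Rightarrow> (bool \<Rightarrow> bool) \<Rightarrow> dir \<Rightarrow> dir \<Rightarrow> dir \<Rightarrow> bool" where
  "cfg p z a b c \<longleftrightarrow> p (a = Xp \<or> b = Xp \<or> c = Xp) (a = Yp \<or> b = Yp \<or> c = Yp) \<and> z (a = Zp \<or> b = Zp \<or> c = Zp)"

definition is_frame :: "(bool \<Rightarrow> bool \<Rightarrow> bool) \<Rightarrow> (bool \<Rightarrow> bool) \<Rightarrow> dir \<times> dir \<Rightarrow> bool" where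
  "is_frame p z = (\<lambda>(u, n). perp u n \<and> cfg p z u (crs n u) (neg n) \<and> \<not> cfg p z u (crs n u) n)"

definition turn :: "(bool \<Rightarrow> bool \<Rightarrow> bool) \<Rightarrow> (bool \<Rightarrow> bool) \<Rightarrow> dir \<Rightarrow> dir \<Rightarrow> dir" where
  "turn p z u n = (let l = crs n u in
     if cfg p z u (neg l) n then l else if cfg p z u (neg l) (neg n) then n else neg l)"

definition rot :: "(bool \<Rightarrow> bool \<Rightarrow> bool) \<Rightarrow> (bool \<Rightarrow> bool) \<Rightarrow> dir \<times> dir \<Rightarrow> dir \<times> dir" where
  "rot p z = (\<lambda>(u, n). (crs (turn p z u n) (neg u), turn p z u n))"

definition frames :: "(bool \<Rightarrow> bool \<Rightarrow> bool) \<Rightarrow> (bool \<Rightarrow> bool) \<Rightarrow> (dir \<times> dir) list" where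
  "frames p z = filter (is_frame p z) (List.product dirs dirs)"

definition tab2 :: "bool \<Rightarrow> bool \<Rightarrow> bool \<Rightarrow> bool \<Rightarrow> bool \<Rightarrow> bool \<Rightarrow> bool" where
  "tab2 a b c d x y = (if x then (if y then a else b) else (if y then c else d))"

definition tab1 :: "bool \<Rightarrow> bool \<Rightarrow> bool \<Rightarrow> bool" where
  "tab1 a b x = (if x then a else b)"

text \<open>For all patterns without a diagonal pair of columns: rotation permutes the frames at the vertex
  cyclically, and the number of frames deviates from 4 only at corners and at reflex corners.\<close>

definition local_check :: "bool \<Rightarrow> bool \<Rightarrow> bool \<Rightarrow> bool \<Rightarrow> bool \<Rightarrow> bool \<Rightarrow> bool" where
  "local_check a b c d e f = (let p = tab2 a b c d; z = tab1 e f; L = frames p z; r = rot p z in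
     list_all (\<lambda>x. list_ex (\<lambda>y. r x = y) L \<and> (let x1 = r x; x2 = r x1; x3 = r x2; x4 = r x3; x5 = r x4 in
        list_all (\<lambda>y. y = x1 \<or> y = x2 \<or> y = x3 \<or> y = x4 \<or> y = x5) L)) L \<and>
     length L \<le> (if e = f \<or> length (filter id [a, b, c, d]) \<noteq> 3 then 4 else 5) \<and>
     (e \<noteq> f \<and> length (filter id [a, b, c, d]) = 1 \<longrightarrow> length L = 3) \<and>
     (L = [] \<longrightarrow> a \<and> b \<and> c \<and> d \<and> e \<and> f \<or> \<not> a \<and> \<not> b \<and> \<not> c \<and> \<not> d \<or> \<not> e \<and> \<not> f))"

text \<open>Evaluated separately on each of the 64 patterns. The excluded diagonal pairs of columns
  would pinch the surface along a vertical edge.\<close>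

lemma local_check: "\<not> (a = d \<and> b = c \<and> a \<noteq> b) \<longrightarrow> local_check a b c d e f"
  by (induct a; induct b; induct c; induct d; induct e; induct f; code_simp)

lemma neg_neg [simp]: "neg (neg a) = a" by (cases a) auto

lemma neg_eq_iff: "neg a = b \<longleftrightarrow> a = neg b" by (cases a; cases b) auto

lemma crs_perp:
  assumes "perp u n"
  shows "crs (crs n u) u = neg n" "crs (neg (crs n u)) (neg u) = neg n" "crs (crs n u) (neg u) = n"
    "crs n (neg u) = neg (crs n u)" "perp u (crs n u)" "perp n (crs n u)"
  using assms by (cases u; cases n; simp add: perp_def crs_def)+

lemma perp_neg [simp]: "perp (neg a) b = perp a b" "perp a (neg b) = perp a b"
  by (auto simp: perp_def neg_eq_iff)

lemma perp_sym: "perp a b = perp b a" by (auto simp: perp_def neg_eq_iff)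

lemma cfg_swap: "cfg p z a b c = cfg p z a c b"
  by (simp add: cfg_def disj_commute)

section \<open>Cubes of side 1 / N in the handlebody and the darts on its boundary\<close>

definition in_block :: "nat \<Rightarrow> nat \<Rightarrow> int \<Rightarrow> int \<Rightarrow> bool" where
  "in_block g N i j \<longleftrightarrow> 0 \<le> i \<and> i < (2 * int g + 1) * int N \<and> 0 \<le> j \<and> j < 3 * int N"

definition hole_x :: "nat \<Rightarrow> nat \<Rightarrow> int \<Rightarrow> bool" where
  "hole_x g N i \<longleftrightarrow> (\<exists>m<g. (2 * int m + 1) * int N \<le> i \<and> i < (2 * int m + 2) * int N)"

definition hole_y :: "nat \<Rightarrow> int \<Rightarrow> bool" where
  "hole_y N j \<longleftrightarrow> int N \<le> j \<and> j < 2 * int N"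

definition plate :: "nat \<Rightarrow> nat \<Rightarrow> int \<Rightarrow> int \<Rightarrow> bool" where
  "plate g N i j \<longleftrightarrow> in_block g N i j \<and> \<not> (hole_x g N i \<and> hole_y N j)"

definition slab :: "nat \<Rightarrow> int \<Rightarrow> bool" where
  "slab N k \<longleftrightarrow> 0 \<le> k \<and> k < int N"

text \<open>The cube \<open>(i, j, k)\<close> is the one with least vertex \<open>(i, j, k)\<close>, hence the shift on negative sides.\<close>

definition shift :: "bool \<Rightarrow> int" where "shift b = (if b then 0 else 1)"

definition pc :: "nat \<Rightarrow> nat \<Rightarrow> int \<times> int \<times> int \<Rightarrow> bool \<Rightarrow> bool \<Rightarrow> bool" where
  "pc g N = (\<lambda>(i, j, k) a b. plate g N (i - shift a) (j - shift b))"

definition zc :: "nat \<Rightarrow> int \<times> int \<times> int \<Rightarrow> bool \<Rightarrow> bool" where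
  "zc N = (\<lambda>(i, j, k) a. slab N (k - shift a))"

definition move :: "dir \<Rightarrow> int \<times> int \<times> int \<Rightarrow> int \<times> int \<times> int" where
  "move d = (\<lambda>(i, j, k). case d of Xp \<Rightarrow> (i + 1, j, k) | Xm \<Rightarrow> (i - 1, j, k) | Yp \<Rightarrow> (i, j + 1, k)
     | Ym \<Rightarrow> (i, j - 1, k) | Zp \<Rightarrow> (i, j, k + 1) | Zm \<Rightarrow> (i, j, k - 1))"

type_synonym dart = "(int \<times> int \<times> int) \<times> dir \<times> dir"

definition darts :: "nat \<Rightarrow> nat \<Rightarrow> dart set" where
  "darts g N = {(v, x). is_frame (pc g N v) (zc N v) x}"

definition gsigma :: "nat \<Rightarrow> nat \<Rightarrow> dart \<Rightarrow> dart" where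
  "gsigma g N d = (if d \<in> darts g N then (fst d, rot (pc g N (fst d)) (zc N (fst d)) (snd d)) else d)"

text \<open>The square to the left of the reversed dart is the one to the right of the original,
  whose normal is given by \<open>turn\<close>.\<close>

definition galpha :: "nat \<Rightarrow> nat \<Rightarrow> dart \<Rightarrow> dart" where
  "galpha g N d = (if d \<in> darts g N then case d of (v, u, n) \<Rightarrow>
     (move u v, neg u, turn (pc g N v) (zc N v) u n) else d)"

text \<open>Both ends of an edge see the same four cubes around it.\<close>

lemma cfg_move:
  assumes "perp u a" "perp u b" "perp a b"
  shows "cfg (pc g N (move u v)) (zc N (move u v)) (neg u) a b = cfg (pc g N v) (zc N v) u a b"
proof -
  obtain i j k where v: "v = (i, j, k)" by (cases v)
  show ?thesis using assms unfolding v
    by (cases u; cases a; cases b; simp add: perp_def cfg_def pc_def zc_def shift_def move_def)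
qed

lemma move_neg [simp]: "move (neg u) (move u v) = v"
  by (cases v; cases u; simp add: move_def)

text \<open>Block and tunnels are products of conditions on single coordinates. Two filled cubes in
  diagonal position put all four cubes in the block; if the other two were in tunnels, both
  coordinates of all four would be, and none would be filled. The same argument empties a diagonal
  pair of tunnel cubes.\<close>

lemma nondiagonal:
  "\<not> (pc g N v True True = pc g N v False False \<and> pc g N v True False = pc g N v False True \<and>
      pc g N v True True \<noteq> pc g N v True False)"
  by (cases v) (auto simp: pc_def plate_def in_block_def shift_def)

lemma pc_tab: "pc g N v = tab2 (pc g N v True True) (pc g N v True False) (pc g N v False True) (pc g N v False False)"
  by (intro ext) (auto simp: tab2_def)

lemma zc_tab: "zc N v = tab1 (zc N v True) (zc N v False)"
  by (intro ext) (auto simp: tab1_def)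

lemma vertex_check:
  "local_check (pc g N v True True) (pc g N v True False) (pc g N v False True) (pc g N v False False)
     (zc N v True) (zc N v False)"
  by (rule mp[OF local_check nondiagonal])

lemma set_frames: "x \<in> set (frames p z) \<longleftrightarrow> is_frame p z x"
proof -
  have "a \<in> set dirs" for a by (cases a) (auto simp: dirs_def)
  then show ?thesis by (cases x) (auto simp: frames_def)
qed

lemma distinct_frames: "distinct (frames p z)"
  unfolding frames_def by (intro distinct_filter distinct_product) (auto simp: dirs_def)

definition solid :: "nat \<Rightarrow> nat \<Rightarrow> int \<times> int \<times> int \<Rightarrow> bool list" where
  "solid g N v = filter id [pc g N v True True, pc g N v True False, pc g N v False True, pc g N v False False]"

text \<open>Transfers the finite check to the patterns that occur at grid vertices. The third and
  fourth claims feed the degree count, the fifth the rounding of surface points.\<close>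

lemma frame_local:
  fixes g N v
  defines "p \<equiv> pc g N v" and "z \<equiv> zc N v"
  shows "is_frame p z x \<Longrightarrow> is_frame p z (rot p z x)"
    and "is_frame p z x \<Longrightarrow> is_frame p z y \<Longrightarrow> \<exists>k\<in>{1..5}. y = (rot p z ^^ k) x"
    and "length (frames p z) \<le> (if z True = z False \<or> length (solid g N v) \<noteq> 3 then 4 else 5)"
    and "z True \<noteq> z False \<Longrightarrow> length (solid g N v) = 1 \<Longrightarrow> length (frames p z) = 3"
    and "p a1 b1 \<and> z c1 \<Longrightarrow> \<not> (p a2 b2 \<and> z c2) \<Longrightarrow> frames p z \<noteq> []"
proof -
  note c = vertex_check[of g N v, unfolded local_check_def Let_def pc_tab[symmetric] zc_tab[symmetric],
      folded p_def z_def, folded set_frames]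
  have A: "rot p z x \<in> set (frames p z) \<and> (y = rot p z x \<or> y = rot p z (rot p z x) \<or> y = rot p z (rot p z (rot p z x)) \<or>
     y = rot p z (rot p z (rot p z (rot p z x))) \<or> y = rot p z (rot p z (rot p z (rot p z (rot p z x)))))"
    if xy: "x \<in> set (frames p z)" "y \<in> set (frames p z)" for x y
  proof -
    note B = bspec[OF conjunct1[OF c, unfolded list_all_iff list_ex_iff] xy(1)]
    show ?thesis by (rule conjI[OF bexE[OF conjunct1[OF B]] bspec[OF conjunct2[OF B] xy(2)]]) (erule ssubst)
  qed
  show "is_frame p z (rot p z x)" if "is_frame p z x"
    using conjunct1[OF A[of x x]] that unfolding set_frames by blast
  show "\<exists>k\<in>{1..5}. y = (rot p z ^^ k) x" if "is_frame p z x" "is_frame p z y"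
  proof -
    have "y \<in> (\<lambda>k. (rot p z ^^ k) x) ` {1, 2, 3, 4, 5}"
      using conjunct2[OF A[of x y]] that unfolding set_frames
      by (simp only: numeral_eq_Suc funpow.simps o_apply id_apply image_insert insert_iff image_empty pred_numeral_simps
          One_nat_def eval_nat_numeral BitM.simps empty_iff simp_thms)
    then obtain k where "y = (rot p z ^^ k) x" "k \<in> {1, 2, 3, 4, 5}" by (rule imageE)
    moreover from this(2) have "k \<in> {1..5}" by auto
    ultimately show ?thesis by (intro bexI)
  qed
  show "length (frames p z) \<le> (if z True = z False \<or> length (solid g N v) \<noteq> 3 then 4 else 5)"
    using conjunct1[OF conjunct2[OF c]] unfolding solid_def p_def .
  show "z True \<noteq> z False \<Longrightarrow> length (solid g N v) = 1 \<Longrightarrow> length (frames p z) = 3"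
    using conjunct1[OF conjunct2[OF conjunct2[OF c]]] unfolding solid_def p_def by (rule mp[OF _ conjI])
  have E: "frames p z = [] \<longrightarrow> p True True \<and> p True False \<and> p False True \<and> p False False \<and> z True \<and> z False
     \<or> \<not> p True True \<and> \<not> p True False \<and> \<not> p False True \<and> \<not> p False False \<or> \<not> z True \<and> \<not> z False"
    using conjunct2[OF conjunct2[OF conjunct2[OF c]]] .
  show "frames p z \<noteq> []" if pz: "p a1 b1 \<and> z c1" "\<not> (p a2 b2 \<and> z c2)"
  proof
    assume "frames p z = []"
    then consider (full) "p True True" "p True False" "p False True" "p False False" "z True" "z False"
      | (nop) "\<not> p True True" "\<not> p True False" "\<not> p False True" "\<not> p False False"
      | (noz) "\<not> z True" "\<not> z False" using E by blast
    then show False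
    proof cases
      case full
      then have "p a2 b2" by (cases a2; cases b2; simp)
      moreover have "z c2" using full by (cases c2; simp)
      ultimately show False using pz by simp
    next
      case nop
      then have "\<not> p a1 b1" by (cases a1; cases b1; simp)
      then show False using pz by simp
    next
      case noz
      then have "\<not> z c1" by (cases c1; simp)
      then show False using pz by simp
    qed
  qed
qed

text \<open>Seen from its other end, an edge has its two squares interchanged. Hence reversal is an
  involution, and reversal followed by rotation turns left around the original square.\<close>

lemma dart_facts:
  assumes "(v, u, n) \<in> darts g N"
  defines "l \<equiv> crs n u" and "n' \<equiv> turn (pc g N v) (zc N v) u n"
  shows "(move u v, neg u, n') \<in> darts g N"
    and "turn (pc g N (move u v)) (zc N (move u v)) (neg u) n' = n"
    and "rot (pc g N (move u v)) (zc N (move u v)) (neg u, n') = (l, n)"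
    and "n' = n \<or> n' = l \<or> n' = neg l"
proof -
  let ?c = "cfg (pc g N v) (zc N v) u" and ?c' = "cfg (pc g N (move u v)) (zc N (move u v)) (neg u)"
  have p: "perp u n" and f: "?c l (neg n)" "\<not> ?c l n"
    using assms(1) unfolding darts_def is_frame_def l_def by auto
  note cp = crs_perp[OF p, folded l_def]
  have mv: "?c' a b = ?c a b" if "perp u a" "perp u b" "perp a b" for a b using cfg_move[OF that] .
  have pp: "perp u n" "perp u l" "perp n l" "perp l n" using p cp perp_sym by auto
  note mvs = mv[of l n] mv[of l "neg n"] mv[of "neg l" n] mv[of "neg l" "neg n"] mv[of n l] mv[of n "neg l"] mv[of "neg n" l]
     mv[of "neg n" "neg l"]
  note sw = cfg_swap[of _ _ _ n] cfg_swap[of _ _ _ "neg n"]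
  have fl: "cfg (pc g N v) (zc N v) u n l = False" "cfg (pc g N v) (zc N v) u (neg n) l = True"
    using f by (simp_all add: cfg_swap[of _ _ _ _ l])
  have cps: "crs n (neg u) = neg l" "crs l (neg u) = n" "crs (neg l) (neg u) = neg n" using cp by auto
  consider (conc) "?c (neg l) n" | (flat) "\<not> ?c (neg l) n" "?c (neg l) (neg n)" | (conv) "\<not> ?c (neg l) n" "\<not> ?c (neg l) (neg n)"
    by blast
  then have "(move u v, neg u, n') \<in> darts g N \<and> turn (pc g N (move u v)) (zc N (move u v)) (neg u) n' = n \<and>
     rot (pc g N (move u v)) (zc N (move u v)) (neg u, n') = (l, n) \<and> (n' = n \<or> n' = l \<or> n' = neg l)"
  proof cases
    case conc
    \<comment> \<open>The fourth cube around a concave edge is filled too; otherwise the four would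
      show a diagonal pattern.\<close>
    have "?c (neg l) (neg n)"
      using p f conc nondiagonal[of g N v] unfolding l_def cfg_def
      by (cases u; cases n; simp add: perp_def crs_def; blast)
    moreover have "n' = l" using conc unfolding n'_def turn_def Let_def l_def[symmetric] by simp
    ultimately show ?thesis using conc f pp mvs cps
      by (simp add: darts_def is_frame_def rot_def turn_def l_def[symmetric] cfg_swap[of _ _ _ n] cfg_swap[of _ _ _ "neg n"])
  next
    case flat
    then have "n' = n" unfolding n'_def turn_def Let_def l_def[symmetric] by simp
    then show ?thesis using flat f pp mvs cps
      by (simp add: darts_def is_frame_def rot_def turn_def l_def[symmetric])
  next
    case conv
    then have "n' = neg l" unfolding n'_def turn_def Let_def l_def[symmetric] by simp
    then show ?thesis using conv f pp mvs cps
      by (simp add: darts_def is_frame_def rot_def turn_def l_def[symmetric] cfg_swap[of _ _ _ n] cfg_swap[of _ _ _ "neg n"])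
  qed
  then show "(move u v, neg u, n') \<in> darts g N"
    and "turn (pc g N (move u v)) (zc N (move u v)) (neg u) n' = n"
    and "rot (pc g N (move u v)) (zc N (move u v)) (neg u, n') = (l, n)"
    and "n' = n \<or> n' = l \<or> n' = neg l" by auto
qed

lemma UNIV_dir: "(UNIV :: dir set) = set dirs"
proof -
  have "a \<in> set dirs" for a by (cases a) (auto simp: dirs_def)
  then show ?thesis by auto
qed

lemma finite_darts: "finite (darts g N)"
proof -
  have "darts g N \<subseteq> ({0..(2 * int g + 1) * int N} \<times> {0..3 * int N} \<times> {0..int N}) \<times> (UNIV \<times> UNIV)"
  proof clarify
    fix i j k u n assume "((i, j, k), u, n) \<in> darts g N"
    then have "cfg (pc g N (i, j, k)) (zc N (i, j, k)) u (crs n u) (neg n)" by (simp add: darts_def is_frame_def)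
    then obtain a b c where "plate g N (i - shift a) (j - shift b)" "slab N (k - shift c)"
      unfolding cfg_def pc_def zc_def prod.case by blast
    moreover have "0 \<le> shift a" "shift a \<le> 1" for a by (auto simp: shift_def)
    ultimately show "(i, j, k) \<in> {0..(2 * int g + 1) * int N} \<times> {0..3 * int N} \<times> {0..int N} \<and> (u, n) \<in> UNIV \<times> UNIV"
      unfolding plate_def in_block_def slab_def by (smt (verit) UNIV_I atLeastAtMost_iff mem_Sigma_iff)
  qed
  moreover have "finite (UNIV :: dir set)" unfolding UNIV_dir by simp
  ultimately show ?thesis by (meson finite_SigmaI finite_atLeastAtMost_int finite_subset)
qed

lemma gsigma_dart:
  assumes "d \<in> darts g N" shows "gsigma g N d \<in> darts g N" "fst (gsigma g N d) = fst d"
proof -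
  obtain v x where d: "d = (v, x)" by (cases d)
  show "gsigma g N d \<in> darts g N" "fst (gsigma g N d) = fst d"
    using assms frame_local(1)[where g = g and N = N and v = v and x = x] unfolding d gsigma_def darts_def by auto
qed

text \<open>The exponent is positive even for \<open>x = y\<close>; the resulting return to
  \<open>x\<close> is what shows that rotation is onto.\<close>

lemma gsigma_transitive:
  assumes "x \<in> darts g N" "y \<in> darts g N" "fst x = fst y"
  shows "\<exists>k\<ge>1. y = (gsigma g N ^^ k) x"
proof -
  obtain v a where x: "x = (v, a)" by (cases x)
  then obtain b where y: "y = (v, b)" using assms(3) by (cases y) auto
  let ?r = "rot (pc g N v) (zc N v)"
  have f: "is_frame (pc g N v) (zc N v) a" "is_frame (pc g N v) (zc N v) b" using assms unfolding x y darts_def by auto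
  have "(gsigma g N ^^ k) (v, a) = (v, (?r ^^ k) a) \<and> is_frame (pc g N v) (zc N v) ((?r ^^ k) a)" for k
  proof (induction k)
    case (Suc k)
    then show ?case using frame_local(1)[of g N v "(?r ^^ k) a"] by (simp add: gsigma_def darts_def)
  qed (use f in simp)
  moreover obtain k where "k \<in> {1..5}" "b = (?r ^^ k) a" using frame_local(2)[OF f] by auto
  ultimately show ?thesis unfolding x y by (intro exI[of _ k]) auto
qed

lemma gsigma_permutes: "gsigma g N permutes darts g N"
proof (rule bij_imp_permutes)
  have sub: "gsigma g N ` darts g N \<subseteq> darts g N" using gsigma_dart by auto
  have "darts g N \<subseteq> gsigma g N ` darts g N"
  proof
    fix y assume y: "y \<in> darts g N"
    obtain k where k: "k \<ge> 1" "y = (gsigma g N ^^ k) y" using gsigma_transitive[OF y y] by auto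
    have "(gsigma g N ^^ j) y \<in> darts g N" for j by (induction j) (use y gsigma_dart in auto)
    moreover have "y = gsigma g N ((gsigma g N ^^ (k - 1)) y)" using k by (cases k) auto
    ultimately show "y \<in> gsigma g N ` darts g N" by blast
  qed
  with sub have eq: "gsigma g N ` darts g N = darts g N" by auto
  then show "bij_betw (gsigma g N) (darts g N) (darts g N)"
    unfolding bij_betw_def using eq_card_imp_inj_on[OF finite_darts] by metis
  show "gsigma g N x = x" if "x \<notin> darts g N" for x using that by (simp add: gsigma_def)
qed

lemma galpha_dart:
  assumes "d \<in> darts g N"
  shows "galpha g N d \<in> darts g N" "galpha g N (galpha g N d) = d" "galpha g N d \<noteq> d"
    "gsigma g N (galpha g N d) = (case d of (v, u, n) \<Rightarrow> (move u v, crs n u, n))"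
    "fst (galpha g N d) = move (fst (snd d)) (fst d)"
proof -
  obtain v u n where d: "d = (v, u, n)" by (metis prod_cases3)
  note f = dart_facts[OF assms[unfolded d]]
  have a: "galpha g N d = (move u v, neg u, turn (pc g N v) (zc N v) u n)" using assms unfolding d galpha_def by simp
  show "galpha g N d \<in> darts g N" using f(1) a by simp
  then show "galpha g N (galpha g N d) = d" unfolding a using f(2) by (simp add: galpha_def d)
  have "neg u \<noteq> u" by (cases u) auto
  then show "galpha g N d \<noteq> d" unfolding a by (simp add: d)
  show "gsigma g N (galpha g N d) = (case d of (v, u, n) \<Rightarrow> (move u v, crs n u, n))"
    using f(1,3) unfolding a by (simp add: gsigma_def d)
  show "fst (galpha g N d) = move (fst (snd d)) (fst d)" unfolding a by (simp add: d)
qed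

lemma galpha_permutes: "galpha g N permutes darts g N"
proof (rule bij_imp_permutes)
  show "bij_betw (galpha g N) (darts g N) (darts g N)"
    using galpha_dart(1,2) by (intro bij_betwI[of _ _ _ "galpha g N"]) auto
  show "galpha g N x = x" if "x \<notin> darts g N" for x using that by (simp add: galpha_def)
qed

lemma gsigma_orbit:
  assumes "x \<in> darts g N"
  shows "orbit (gsigma g N) x = {y \<in> darts g N. fst y = fst x}"
proof
  show "orbit (gsigma g N) x \<subseteq> {y \<in> darts g N. fst y = fst x}"
    using assms gsigma_dart by (intro orbit_least) auto
  show "{y \<in> darts g N. fst y = fst x} \<subseteq> orbit (gsigma g N) x"
  proof clarify
    fix v a assume y: "(v, a) \<in> darts g N" "fst (v, a) = fst x"
    then obtain k where "k \<ge> 1" "(v, a) = (gsigma g N ^^ k) x" using gsigma_transitive[OF assms y(1)] by auto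
    then show "(v, a) \<in> orbit (gsigma g N) x" unfolding orbit_altdef by auto
  qed
qed

text \<open>A face step moves along \<open>u\<close> and turns left with the normal unchanged, so
  four of them go once around a square.\<close>

lemma gphi_power:
  assumes "d \<in> darts g N"
  shows "((gsigma g N \<circ> galpha g N) ^^ 4) d = d"
proof -
  let ?f = "gsigma g N \<circ> galpha g N"
  have c: "?f x \<in> darts g N" if "x \<in> darts g N" for x
    using gsigma_dart(1)[OF galpha_dart(1)[OF that]] by simp
  obtain v u n where d: "d = (v, u, n)" by (metis prod_cases3)
  have p: "perp u n" using assms unfolding d darts_def is_frame_def by auto
  define l where "l = crs n u"
  have 1: "?f d = (move u v, l, n)" using galpha_dart(4)[OF assms] by (simp add: d l_def)
  have e: "crs n l = neg u" "crs n (neg u) = neg l" "crs n (neg l) = u" "perp u l"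
    using p unfolding l_def by (cases u; cases n; simp add: perp_def crs_def)+
  have step: "?f (w, a, n) = (move a w, crs n a, n)" if "(w, a, n) \<in> darts g N" for w a
    using galpha_dart(4)[OF that] by simp
  have D1: "(move u v, l, n) \<in> darts g N" using c[OF assms] unfolding 1 .
  have 2: "?f (move u v, l, n) = (move l (move u v), neg u, n)" unfolding step[OF D1] e ..
  have D2: "(move l (move u v), neg u, n) \<in> darts g N" using c[OF D1] unfolding 2 .
  have 3: "?f (move l (move u v), neg u, n) = (move (neg u) (move l (move u v)), neg l, n)" unfolding step[OF D2] e ..
  have D3: "(move (neg u) (move l (move u v)), neg l, n) \<in> darts g N" using c[OF D2] unfolding 3 .
  have 4: "?f (move (neg u) (move l (move u v)), neg l, n) = (move (neg l) (move (neg u) (move l (move u v))), u, n)"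
    unfolding step[OF D3] e ..
  have "move (neg l) (move (neg u) (move l (move u v))) = v"
    using e(4) by (cases v; cases u; cases l; simp add: move_def)
  then have "?f (?f (?f (?f d))) = d" unfolding 1 2 3 4 by (simp add: d)
  then show ?thesis by (simp add: numeral_eq_Suc)
qed

section \<open>Counting vertices, edges and faces of the grid map\<close>

lemma card_le_norb:
  assumes "f permutes D" "finite D" "\<And>x. x \<in> D \<Longrightarrow> (f ^^ c) x = x" "c > 0"
  shows "card D \<le> c * norb f D"
proof -
  have "D \<subseteq> \<Union> (orbit f ` D)" using orbit_self[OF assms(1,2)] by auto
  moreover have fin: "finite (orbit f x)" and c: "card (orbit f x) \<le> c" if "x \<in> D" for x
  proof -
    have o: "orbit f x = (\<lambda>m. (f ^^ m) x) ` {..<c}"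
      using orbit_altdef_bounded[OF assms(3)[OF that] assms(4)] by auto
    show "finite (orbit f x)" unfolding o by simp
    show "card (orbit f x) \<le> c" unfolding o using card_image_le[of "{..<c}"] by simp
  qed
  ultimately have "card D \<le> card (\<Union> (orbit f ` D))" using assms(2) by (intro card_mono) auto
  also have "\<dots> \<le> (\<Sum>C\<in>orbit f ` D. card C)"
    using card_Union_le_sum_card by blast
  also have "\<dots> \<le> (\<Sum>C\<in>orbit f ` D. c)" using c by (intro sum_mono) auto
  finally show ?thesis by (simp add: norb_def mult.commute)
qed

definition corners :: "nat \<Rightarrow> nat \<Rightarrow> (int \<times> int \<times> int) set" where
  "corners g N = {0, (2 * int g + 1) * int N} \<times> {0, 3 * int N} \<times> {0, int N}"

text \<open>The corners of the tunnel mouths on the top and bottom faces, the only places where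
  degree 5 can occur.\<close>

definition reflex :: "nat \<Rightarrow> nat \<Rightarrow> (int \<times> int \<times> int) set" where
  "reflex g N = ((\<lambda>m. (2 * int m + 1) * int N) ` {..<g} \<union> (\<lambda>m. (2 * int m + 2) * int N) ` {..<g}) \<times> {int N, 2 * int N} \<times> {0, int N}"

lemma degree_corner:
  assumes "N \<ge> 1" "v \<in> corners g N"
  shows "length (frames (pc g N v) (zc N v)) = 3"
proof (rule frame_local(4))
  obtain i j k where v: "v = (i, j, k)" by (cases v)
  let ?W = "(2 * int g + 1) * int N"
  have ij: "i = 0 \<or> i = ?W" "j = 0 \<or> j = 3 * int N" "k = 0 \<or> k = int N" using assms(2) unfolding v corners_def by auto
  have "1 * 1 \<le> ?W" using assms(1) by (intro mult_mono) auto
  then have W: "?W \<ge> 1" by simp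
  show "zc N v True \<noteq> zc N v False" using ij assms(1) by (auto simp: v zc_def slab_def shift_def)
  have h: "\<not> hole_y N 0" "\<not> hole_y N (3 * int N - 1)" using assms(1) by (auto simp: hole_y_def)
  show "length (solid g N v) = 1"
    using ij W h assms(1) by (auto simp: v solid_def pc_def plate_def in_block_def shift_def)
qed

text \<open>Degree above 4 requires a vertex on the top or bottom face with exactly three filled
  columns; both tunnel conditions then change across the vertex.\<close>

lemma degree_reflex:
  assumes "length (frames (pc g N v) (zc N v)) > 4"
  shows "v \<in> reflex g N"
proof -
  obtain i j k where v: "v = (i, j, k)" by (cases v)
  have z: "zc N v True \<noteq> zc N v False" and s: "length (solid g N v) = 3"
    using assms frame_local(3)[of g N v] by (auto split: if_splits)
  have k: "k = 0 \<or> k = int N" using z by (auto simp: v zc_def slab_def shift_def)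
  have h: "hole_x g N i \<noteq> hole_x g N (i - 1)" "hole_y N j \<noteq> hole_y N (j - 1)"
    using s by (auto simp: v solid_def pc_def plate_def in_block_def shift_def split: if_splits)
  have j: "j = int N \<or> j = 2 * int N" using h(2) by (auto simp: hole_y_def)
  have "\<exists>m<g. i = (2 * int m + 1) * int N \<or> i = (2 * int m + 2) * int N"
  proof (cases "hole_x g N i")
    case True
    then obtain m where m: "m < g" "(2 * int m + 1) * int N \<le> i" "i < (2 * int m + 2) * int N" by (auto simp: hole_x_def)
    moreover have "\<not> ((2 * int m + 1) * int N \<le> i - 1 \<and> i - 1 < (2 * int m + 2) * int N)"
      using h(1) True m(1) unfolding hole_x_def by blast
    ultimately show ?thesis by (intro exI[of _ m]) auto
  next
    case False
    then obtain m where m: "m < g" "(2 * int m + 1) * int N \<le> i - 1" "i - 1 < (2 * int m + 2) * int N"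
      using h(1) by (auto simp: hole_x_def)
    moreover have "\<not> ((2 * int m + 1) * int N \<le> i \<and> i < (2 * int m + 2) * int N)"
      using False m(1) unfolding hole_x_def by blast
    ultimately show ?thesis by (intro exI[of _ m]) auto
  qed
  then show ?thesis using j k by (auto simp: v reflex_def)
qed

lemma card_reflex: "card (reflex g N) \<le> 8 * g"
proof -
  let ?A = "(\<lambda>m. (2 * int m + 1) * int N) ` {..<g}" and ?B = "(\<lambda>m. (2 * int m + 2) * int N) ` {..<g}"
  have "card (?A \<union> ?B) \<le> card ?A + card ?B" by (rule card_Un_le)
  also have "\<dots> \<le> g + g"
    using card_image_le[of "{..<g}" "\<lambda>m. (2 * int m + 1) * int N"] card_image_le[of "{..<g}" "\<lambda>m. (2 * int m + 2) * int N"] by simp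
  finally have 1: "card (?A \<union> ?B) \<le> 2 * g" by simp
  have 2: "card ({int N, 2 * int N} \<times> {0, int N}) \<le> 2 * 2"
    unfolding card_cartesian_product by (intro mult_mono) (auto simp: card_insert_if)
  have "card (reflex g N) = card (?A \<union> ?B) * card ({int N, 2 * int N} \<times> {0, int N})"
    unfolding reflex_def by (rule card_cartesian_product)
  also have "\<dots> \<le> (2 * g) * (2 * 2)" using 1 2 by (intro mult_mono) auto
  finally show ?thesis by simp
qed

lemma card_corners: "N \<ge> 1 \<Longrightarrow> card (corners g N) = 8"
  unfolding corners_def card_cartesian_product by (auto simp: card_insert_if)

lemma norb_gsigma: "norb (gsigma g N) (darts g N) = card (fst ` darts g N)"
proof -
  have "orbit (gsigma g N) ` darts g N = (\<lambda>v. {y \<in> darts g N. fst y = v}) ` fst ` darts g N"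
    unfolding image_image by (intro image_cong refl gsigma_orbit)
  moreover have "inj_on (\<lambda>v. {y \<in> darts g N. fst y = v}) (fst ` darts g N)"
    by (rule inj_onI) blast
  ultimately show ?thesis unfolding norb_def by (simp add: card_image)
qed

text \<open>Faces have at most four darts, so with V vertices and E edges twice the characteristic
  is at least 2 V - E. The degree sum 2 E is at most 4 V - 8 + 8 g: each of the eight corners lacks
  one dart, and at most 8 g reflex vertices have one in excess.\<close>

lemma euler_grid:
  assumes "N \<ge> 1"
  shows "4 - 4 * int g \<le> euler2 (darts g N) (gsigma g N) (galpha g N)"
proof -
  let ?D = "darts g N" and ?f = "gsigma g N \<circ> galpha g N"
  define T where "T = fst ` darts g N"
  define deg where "deg v = length (frames (pc g N v) (zc N v))" for v
  have finT: "finite T" unfolding T_def using finite_darts by simp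
  have "card ?D \<le> 4 * norb ?f ?D"
    using gphi_power by (intro card_le_norb permutes_compose galpha_permutes gsigma_permutes finite_darts) auto
  then have F: "2 * int (norb ?f ?D) \<ge> int (card ?D) / 2" by linarith
  have D: "?D = (SIGMA v:T. set (frames (pc g N v) (zc N v)))"
    unfolding T_def darts_def by (force simp: set_frames)
  have "card ?D = (\<Sum>v\<in>T. deg v)"
    unfolding D deg_def using finT distinct_frames by (subst card_SigmaI) (auto simp: distinct_card)
  then have cD: "int (card ?D) = (\<Sum>v\<in>T. int (deg v))" by simp
  have cT: "corners g N \<subseteq> T"
  proof
    fix v assume "v \<in> corners g N"
    then have "frames (pc g N v) (zc N v) \<noteq> []" using degree_corner[OF assms] by fastforce
    then obtain x where "x \<in> set (frames (pc g N v) (zc N v))" by (cases "frames (pc g N v) (zc N v)") auto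
    then have "(v, x) \<in> darts g N" by (simp add: darts_def set_frames)
    then show "v \<in> T" unfolding T_def by (metis fst_conv image_eqI)
  qed
  have le: "int (deg v) \<le> 4 - (if v \<in> corners g N then 1 else 0) + (if v \<in> reflex g N then 1 else 0)" for v
  proof -
    have "deg v \<le> 5" using frame_local(3)[of g N v] unfolding deg_def by (auto split: if_splits)
    moreover have "v \<notin> reflex g N \<Longrightarrow> deg v \<le> 4" using degree_reflex[of g N v] unfolding deg_def by linarith
    moreover have "v \<in> corners g N \<Longrightarrow> deg v = 3" using degree_corner[OF assms, of v g] unfolding deg_def by simp
    ultimately show ?thesis by (cases "v \<in> reflex g N"; cases "v \<in> corners g N") auto
  qed
  have "(\<Sum>v\<in>T. int (deg v)) \<le> (\<Sum>v\<in>T. 4 - (if v \<in> corners g N then 1 else 0) + (if v \<in> reflex g N then 1 else 0))"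
    by (intro sum_mono le)
  also have "\<dots> = 4 * int (card T) - int (card (T \<inter> corners g N)) + int (card (T \<inter> reflex g N))"
    using finT by (simp add: sum.distrib sum_subtractf sum.If_cases)
  also have "T \<inter> corners g N = corners g N" using cT by auto
  also have "card (T \<inter> reflex g N) \<le> card (reflex g N)" by (intro card_mono) (auto simp: reflex_def)
  finally have "int (card ?D) \<le> 4 * int (card T) - 8 + 8 * int g"
    using card_reflex[of g N] card_corners[OF assms, of g] cD by linarith
  then show ?thesis using F unfolding euler2_def norb_gsigma T_def[symmetric] by linarith
qed

section \<open>Closed walks in nearly triangulated maps\<close>

lemma card_orbit_partition:
  assumes "f permutes D" "finite D"
  shows "card D = (\<Sum>C\<in>orbit f ` D. card C)"
proof -
  have "D = \<Union> (orbit f ` D)"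
    using orbit_self[OF assms] permutes_orbit_subset[OF assms(1)] by blast
  also have "card \<dots> = (\<Sum>C\<in>orbit f ` D. card C)"
  proof (rule card_Union_disjoint)
    show "pairwise disjnt (orbit f ` D)"
      unfolding pairwise_def disjnt_def using orbit_eq[OF assms] by blast
    show "\<And>A. A \<in> orbit f ` D \<Longrightarrow> finite A"
      using permutes_orbit_subset[OF assms(1)] assms(2) by (auto intro: finite_subset)
  qed
  finally show ?thesis .
qed

lemma funpow_card_orbit:
  assumes "f permutes D" "finite D"
  shows "(f ^^ card (orbit f x)) x = x"
proof -
  have x: "x \<in> orbit f x" by (rule orbit_self[OF assms])
  have "card (orbit f x) = funpow_dist1 f x x"
    unfolding orbit_conv_funpow_dist1[OF x] using inj_on_funpow_dist1[OF x] by (subst card_image) auto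
  then show ?thesis using funpow_dist1_prop[OF x] by simp
qed

text \<open>Without orbits of length 1 or 2, every orbit of length c \<ge> 4 contributes c - 3 \<ge>
  c / 4 to the excess of \<open>card D\<close> over three times the number of orbits.\<close>

lemma card_non_triangular:
  assumes p: "f permutes D" "finite D" and no12: "\<And>x. x \<in> D \<Longrightarrow> f x \<noteq> x \<and> f (f x) \<noteq> x"
  shows "int (card {x \<in> D. (f ^^ 3) x \<noteq> x}) \<le> 4 * (int (card D) - 3 * int (norb f D))"
proof -
  let ?O = "orbit f ` D"
  have fin: "finite C" if "C \<in> ?O" for C
    using that permutes_orbit_subset[OF p(1)] p(2) by (auto intro: finite_subset)
  have ge3: "3 \<le> card (orbit f x)" if "x \<in> D" for x
  proof -
    have "f x \<in> D" using that permutes_in_image[OF p(1)] by simp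
    then have "card {x, f x, f (f x)} = 3" using no12[OF that] no12[of "f x"] by auto
    moreover have "{x, f x, f (f x)} \<subseteq> orbit f x" by (simp add: orbit_self[OF p] orbit.base orbit.step)
    ultimately show ?thesis using card_mono[OF fin[of "orbit f x"], of "{x, f x, f (f x)}"] that by simp
  qed
  define B where "B = {C \<in> ?O. card C \<noteq> 3}"
  have "{x \<in> D. (f ^^ 3) x \<noteq> x} \<subseteq> \<Union> B"
  proof
    fix x assume x: "x \<in> {x \<in> D. (f ^^ 3) x \<noteq> x}"
    then have "card (orbit f x) \<noteq> 3" using funpow_card_orbit[OF p, of x] by auto
    then show "x \<in> \<Union> B" using x orbit_self[OF p, of x] unfolding B_def by auto
  qed
  then have "card {x \<in> D. (f ^^ 3) x \<noteq> x} \<le> card (\<Union> B)"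
    using fin p(2) by (intro card_mono) (auto simp: B_def)
  also have "\<dots> \<le> (\<Sum>C\<in>B. card C)" by (rule card_Union_le_sum_card)
  finally have "int (card {x \<in> D. (f ^^ 3) x \<noteq> x}) \<le> (\<Sum>C\<in>B. int (card C))"
    by (metis of_nat_le_iff of_nat_sum)
  also have "\<dots> \<le> (\<Sum>C\<in>B. 4 * (int (card C) - 3))"
  proof (rule sum_mono)
    fix C assume "C \<in> B"
    then have "3 \<le> card C" "card C \<noteq> 3" using ge3 by (auto simp: B_def)
    then have "4 \<le> int (card C)" by simp
    then show "int (card C) \<le> 4 * (int (card C) - 3)" by (simp add: right_diff_distrib)
  qed
  also have "\<dots> \<le> (\<Sum>C\<in>?O. 4 * (int (card C) - 3))"
  proof (rule sum_mono2)
    fix C assume "C \<in> ?O - B"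
    then have "3 \<le> card C" using ge3 by auto
    then show "0 \<le> 4 * (int (card C) - 3)" by simp
  qed (use p(2) in \<open>auto simp: B_def\<close>)
  also have "\<dots> = 4 * (int (card D) - 3 * int (norb f D))"
    using card_orbit_partition[OF p] by (simp add: sum_distrib_left[symmetric] sum_subtractf norb_def)
  finally show ?thesis .
qed

section \<open>Permutations that agree up to few points\<close>

definition near :: "'d set \<Rightarrow> nat \<Rightarrow> ('d \<Rightarrow> 'd) \<Rightarrow> ('d \<Rightarrow> 'd) \<Rightarrow> bool" where
  "near D c f g \<longleftrightarrow> card {x \<in> D. f x \<noteq> g x} \<le> c"

lemma near_refl: "near D c f f" by (simp add: near_def)

lemma near_sym: "near D c f g \<Longrightarrow> near D c g f" by (simp add: near_def eq_commute)

lemma near_mono: "near D c f g \<Longrightarrow> c \<le> d \<Longrightarrow> near D d f g" by (simp add: near_def)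

lemma near_trans:
  assumes "finite D" "near D c f g" "near D d g h" shows "near D (c + d) f h"
proof -
  have "card {x \<in> D. f x \<noteq> h x} \<le> card ({x \<in> D. f x \<noteq> g x} \<union> {x \<in> D. g x \<noteq> h x})"
    using assms(1) by (intro card_mono) auto
  also have "\<dots> \<le> c + d" using assms(2,3) unfolding near_def by (meson add_mono card_Un_le order_trans)
  finally show ?thesis by (simp add: near_def)
qed

text \<open>A permutation moves the exceptional points of the outer maps without changing their
  number, so errors add up.\<close>

lemma near_compose:
  assumes "finite D" "near D c f g" "near D d f' g'" "g' permutes D"
  shows "near D (c + d) (f \<circ> f') (g \<circ> g')"
proof -
  have "g' ` {x \<in> D. f (g' x) \<noteq> g (g' x)} \<subseteq> {x \<in> D. f x \<noteq> g x}"
    using permutes_in_image[OF assms(4)] by auto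
  then have "card {x \<in> D. f (g' x) \<noteq> g (g' x)} \<le> card {x \<in> D. f x \<noteq> g x}"
    using assms(1) permutes_inj_on[OF assms(4)] by (intro card_inj_on_le[of g']) auto
  moreover have "card {x \<in> D. (f \<circ> f') x \<noteq> (g \<circ> g') x} \<le> card ({x \<in> D. f (g' x) \<noteq> g (g' x)} \<union> {x \<in> D. f' x \<noteq> g' x})"
    using assms(1) by (intro card_mono) auto
  moreover note card_Un_le[of "{x \<in> D. f (g' x) \<noteq> g (g' x)}" "{x \<in> D. f' x \<noteq> g' x}"]
  ultimately show ?thesis using assms(2,3) unfolding near_def by linarith
qed

lemma near_inv:
  assumes "finite D" "near D c f g" "f permutes D" "g permutes D"
  shows "near D c (inv_into UNIV f) (inv_into UNIV g)"
proof -
  have "near D (0 + (c + 0)) (inv_into UNIV f \<circ> (g \<circ> inv_into UNIV g)) (inv_into UNIV f \<circ> (f \<circ> inv_into UNIV g))"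
    using assms by (intro near_compose near_refl near_sym[OF assms(2)] permutes_compose permutes_inv) auto
  moreover have "inv_into UNIV f \<circ> (f \<circ> inv_into UNIV g) = inv_into UNIV g" "g \<circ> inv_into UNIV g = id"
    using permutes_inv_o[OF assms(3)] permutes_inv_o[OF assms(4)] by (simp_all add: o_assoc)
  ultimately show ?thesis by simp
qed

definition ipow :: "('d \<Rightarrow> 'd) \<Rightarrow> int \<Rightarrow> 'd \<Rightarrow> 'd" where
  "ipow f i = (if i \<ge> 0 then f ^^ nat i else inv_into UNIV f ^^ nat (- i))"

lemma ipow_add1:
  assumes "f permutes D"
  shows "f \<circ> ipow f i = ipow f (i + 1)" "ipow f i \<circ> f = ipow f (i + 1)"
proof -
  have n: "nat (i + 1) = Suc (nat i)" if "i \<ge> 0" using that by simp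
  have m: "nat (- i) = Suc (nat (- (i + 1)))" if "i < 0" using that by simp
  have io: "f \<circ> (inv_into UNIV f \<circ> g) = g" "(g \<circ> inv_into UNIV f) \<circ> f = g" for g :: "'a \<Rightarrow> 'a"
    using permutes_inv_o[OF assms] by (simp_all add: o_assoc) (simp add: o_assoc[symmetric])
  show "f \<circ> ipow f i = ipow f (i + 1)"
    using n m by (cases "i \<ge> 0"; cases "i = -1") (auto simp: ipow_def io permutes_inv_o[OF assms])
  show "ipow f i \<circ> f = ipow f (i + 1)"
    using n m by (cases "i \<ge> 0"; cases "i = -1") (auto simp: ipow_def io permutes_inv_o[OF assms] funpow_Suc_right simp del: funpow.simps(2))
qed

lemma ipow_sub1:
  assumes "f permutes D"
  shows "inv_into UNIV f \<circ> ipow f i = ipow f (i - 1)" "ipow f i \<circ> inv_into UNIV f = ipow f (i - 1)"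
proof -
  have "inv_into UNIV f \<circ> (f \<circ> ipow f (i - 1)) = ipow f (i - 1)" "(ipow f (i - 1) \<circ> f) \<circ> inv_into UNIV f = ipow f (i - 1)"
    using permutes_inverses[OF assms] by (simp_all add: fun_eq_iff)
  then show "inv_into UNIV f \<circ> ipow f i = ipow f (i - 1)" "ipow f i \<circ> inv_into UNIV f = ipow f (i - 1)"
    using ipow_add1[OF assms, of "i - 1"] by simp_all
qed

lemma ipow_permutes: "f permutes D \<Longrightarrow> ipow f i permutes D"
  unfolding ipow_def by (simp add: permutes_funpow permutes_inv)

text \<open>Each factor of \<open>a\<close> or its inverse that is moved past \<open>b\<close> costs
  one error \<open>c\<close>.\<close>

lemma near_ipow_commute:
  assumes "finite D" "a permutes D" "b permutes D" "near D c (b \<circ> a) (a \<circ> b)"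
  shows "near D (nat \<bar>i\<bar> * c) (b \<circ> ipow a i) (ipow a i \<circ> b)"
proof (induction i rule: int_induct[of _ 0])
  case base then show ?case by (simp add: ipow_def near_refl)
next
  case (step1 i)
  have "near D (c + 0) ((b \<circ> a) \<circ> ipow a i) ((a \<circ> b) \<circ> ipow a i)"
    using assms by (intro near_compose near_refl ipow_permutes)
  moreover have "near D (0 + nat \<bar>i\<bar> * c) (a \<circ> (b \<circ> ipow a i)) (a \<circ> (ipow a i \<circ> b))"
    by (intro near_compose near_refl ipow_permutes permutes_compose permutes_inv assms(1-3) step1(2))
  ultimately have "near D (c + 0 + (0 + nat \<bar>i\<bar> * c)) (b \<circ> (a \<circ> ipow a i)) ((a \<circ> ipow a i) \<circ> b)"
    unfolding o_assoc by (rule near_trans[OF assms(1)])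
  then have "near D (c + nat \<bar>i\<bar> * c) (b \<circ> (a \<circ> ipow a i)) ((a \<circ> ipow a i) \<circ> b)" by simp
  moreover have "c + nat \<bar>i\<bar> * c = nat \<bar>i + 1\<bar> * c" using step1 by (simp add: nat_add_distrib)
  ultimately show ?case unfolding ipow_add1(1)[OF assms(2)] by (simp only:)
next
  case (step2 i)
  have "near D (0 + (c + 0)) (inv_into UNIV a \<circ> ((a \<circ> b) \<circ> inv_into UNIV a)) (inv_into UNIV a \<circ> ((b \<circ> a) \<circ> inv_into UNIV a))"
    using assms by (intro near_compose near_refl near_sym[OF assms(4)] permutes_compose permutes_inv)
  moreover have "inv_into UNIV a \<circ> ((a \<circ> b) \<circ> inv_into UNIV a) = b \<circ> inv_into UNIV a" "inv_into UNIV a \<circ> ((b \<circ> a) \<circ> inv_into UNIV a) = inv_into UNIV a \<circ> b"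
    using permutes_inv_o[OF assms(2)] by (simp_all add: fun_eq_iff)
  ultimately have ci: "near D c (b \<circ> inv_into UNIV a) (inv_into UNIV a \<circ> b)" by simp
  have "near D (c + 0) ((b \<circ> inv_into UNIV a) \<circ> ipow a i) ((inv_into UNIV a \<circ> b) \<circ> ipow a i)"
    using assms ci by (intro near_compose near_refl ipow_permutes)
  moreover have "near D (0 + nat \<bar>i\<bar> * c) (inv_into UNIV a \<circ> (b \<circ> ipow a i)) (inv_into UNIV a \<circ> (ipow a i \<circ> b))"
    by (intro near_compose near_refl ipow_permutes permutes_compose permutes_inv assms(1-3) step2(2))
  ultimately have "near D (c + 0 + (0 + nat \<bar>i\<bar> * c)) (b \<circ> (inv_into UNIV a \<circ> ipow a i)) ((inv_into UNIV a \<circ> ipow a i) \<circ> b)"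
    unfolding o_assoc by (rule near_trans[OF assms(1)])
  then have "near D (c + nat \<bar>i\<bar> * c) (b \<circ> (inv_into UNIV a \<circ> ipow a i)) ((inv_into UNIV a \<circ> ipow a i) \<circ> b)" by simp
  moreover have "nat \<bar>i - 1\<bar> = Suc (nat \<bar>i\<bar>)" using step2(1) by simp
  then have "c + nat \<bar>i\<bar> * c = nat \<bar>i - 1\<bar> * c" by (simp only: mult_Suc)
  ultimately show ?case unfolding ipow_sub1(1)[OF assms(2)] by (simp only:)
qed

text \<open>The six steps of the triangular lattice, in cyclic order.\<close>

definition hexstep :: "nat \<Rightarrow> int \<times> int" where
  "hexstep j = [(1, 0), (1, 1), (0, 1), (-1, 0), (-1, -1), (0, -1)] ! j"

definition hexwords :: "nat \<Rightarrow> nat list set" where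
  "hexwords k = {w. length w = k \<and> set w \<subseteq> {..<6}}"

definition endpoint :: "nat list \<Rightarrow> int \<times> int" where
  "endpoint w = ((\<Sum>j\<leftarrow>w. fst (hexstep j)), (\<Sum>j\<leftarrow>w. snd (hexstep j)))"

definition closed_words :: "nat \<Rightarrow> nat list set" where
  "closed_words k = {w \<in> hexwords k. endpoint w = (0, 0)}"

primrec apply_word :: "(nat \<Rightarrow> 'd \<Rightarrow> 'd) \<Rightarrow> nat list \<Rightarrow> 'd \<Rightarrow> 'd" where
  "apply_word T [] = id"
| "apply_word T (j # w) = apply_word T w \<circ> T j"

text \<open>If six permutations satisfy the relations of the triangular lattice up to a few exceptional
  points, then a word that closes up in the lattice fixes all but a few points.\<close>

lemma near_lattice_words:
  assumes fin: "finite D" and p: "\<And>j. j < 6 \<Longrightarrow> T j permutes D"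
    and c: "near D c (T 2 \<circ> T 0) (T 1)" "near D c (T 0 \<circ> T 2) (T 1)"
    and i: "T 3 = inv_into UNIV (T 0)" "T 5 = inv_into UNIV (T 2)" "T 4 = inv_into UNIV (T 1)"
    and w: "w \<in> hexwords k"
  shows "near D (k * (k + 3) * (2 * c)) (apply_word T w) (ipow (T 0) (fst (endpoint w)) \<circ> ipow (T 2) (snd (endpoint w)))
    \<and> \<bar>fst (endpoint w)\<bar> \<le> int k \<and> \<bar>snd (endpoint w)\<bar> \<le> int k"
  using w
proof (induction w arbitrary: k)
  case Nil
  then show ?case by (simp add: hexwords_def endpoint_def ipow_def near_refl)
next
  case (Cons j w)
  then obtain k' where k: "k = Suc k'" and w: "w \<in> hexwords k'" and j: "j < 6" by (auto simp: hexwords_def)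
  let ?a = "T 0" and ?b = "T 2"
  obtain x y where xy: "endpoint w = (x, y)" by (cases "endpoint w")
  obtain dx dy where d: "hexstep j = (dx, dy)" by (cases "hexstep j")
  have e: "endpoint (j # w) = (x + dx, y + dy)" using xy d by (auto simp: endpoint_def)
  note IH = Cons.IH[OF w, unfolded xy fst_conv snd_conv]
  have pa: "?a permutes D" and pb: "?b permutes D" and p1: "T 1 permutes D" by (rule p; simp)+
  have ab: "near D (2 * c) (?b \<circ> ?a) (?a \<circ> ?b)"
    using near_trans[OF fin c(1) near_sym[OF c(2)]] by (simp add: mult_2)
  have ba: "near D (2 * c) (?a \<circ> ?b) (?b \<circ> ?a)" by (rule near_sym[OF ab])
  have jin: "j \<in> {0, 1, 2, 3, 4, 5}" using j by auto
  have dcase: "(dx = 0 \<or> dx = 1 \<or> dx = -1) \<and> (dy = 0 \<or> dy = 1 \<or> dy = -1)"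
    using jin d by (auto simp: hexstep_def)
  have ipw: "ipow f 1 = f" "ipow f 0 = id" "ipow f (-1) = inv_into UNIV f" for f :: "'a \<Rightarrow> 'a" by (simp_all add: ipow_def)
  have Tj: "near D (2 * c) (T j) (ipow ?a dx \<circ> ipow ?b dy)"
  proof -
    have n1: "near D (2 * c) (T 1) (?a \<circ> ?b)" using near_mono[OF near_sym[OF c(2)]] by simp
    moreover have "near D (2 * c) (T 4) (inv_into UNIV ?a \<circ> inv_into UNIV ?b)"
    proof -
      have "near D c (inv_into UNIV (T 1)) (inv_into UNIV (?b \<circ> ?a))"
        using near_inv[OF fin near_sym[OF c(1)]] pa pb p1 by (simp add: permutes_compose)
      moreover have "inv_into UNIV (?b \<circ> ?a) = inv_into UNIV ?a \<circ> inv_into UNIV ?b"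
        using permutes_bij[OF pa] permutes_bij[OF pb] by (simp add: o_inv_distrib)
      ultimately show ?thesis using near_mono[of D c] i by simp
    qed
    ultimately show ?thesis using jin d i near_refl by (auto simp: hexstep_def ipw)
  qed
  have nb: "near D (k' * (2 * c)) (ipow ?a dx \<circ> ipow ?b y) (ipow ?b y \<circ> ipow ?a dx)"
  proof -
    have ny: "nat \<bar>y\<bar> * (2 * c) \<le> k' * (2 * c)" using IH by (intro mult_right_mono) auto
    have n: "near D (k' * (2 * c)) (?a \<circ> ipow ?b y) (ipow ?b y \<circ> ?a)"
      using near_mono[OF near_ipow_commute[OF fin pb pa ba] ny] .
    moreover have "near D (k' * (2 * c)) (inv_into UNIV ?a \<circ> ipow ?b y) (ipow ?b y \<circ> inv_into UNIV ?a)"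
    proof -
      have "near D (0 + (k' * (2 * c) + 0)) (inv_into UNIV ?a \<circ> ((ipow ?b y \<circ> ?a) \<circ> inv_into UNIV ?a)) (inv_into UNIV ?a \<circ> ((?a \<circ> ipow ?b y) \<circ> inv_into UNIV ?a))"
        using pa pb by (intro near_compose near_refl near_sym[OF n] fin permutes_compose permutes_inv ipow_permutes)
      moreover have "inv_into UNIV ?a \<circ> ((ipow ?b y \<circ> ?a) \<circ> inv_into UNIV ?a) = inv_into UNIV ?a \<circ> ipow ?b y"
        "inv_into UNIV ?a \<circ> ((?a \<circ> ipow ?b y) \<circ> inv_into UNIV ?a) = ipow ?b y \<circ> inv_into UNIV ?a"
        using permutes_inverses[OF pa] by (simp_all add: fun_eq_iff)
      ultimately show ?thesis by simp
    qed
    ultimately show ?thesis using dcase by (auto simp: ipw near_refl)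
  qed
  have comb: "ipow f u \<circ> ipow f v = ipow f (u + v)" if "f permutes D" "v = 0 \<or> v = 1 \<or> v = -1" for f :: "'a \<Rightarrow> 'a" and u v
    using that(2) ipow_add1[OF that(1)] ipow_sub1[OF that(1)] by (auto simp: ipw)
  have comb': "ipow f v \<circ> ipow f u = ipow f (u + v)" if "f permutes D" "v = 0 \<or> v = 1 \<or> v = -1" for f :: "'a \<Rightarrow> 'a" and u v
    using that(2) ipow_add1[OF that(1)] ipow_sub1[OF that(1)] by (auto simp: ipw)
  let ?A = "ipow ?a" and ?B = "ipow ?b"
  have s1: "near D (k' * (k' + 3) * (2 * c) + 2 * c) (apply_word T w \<circ> T j) ((?A x \<circ> ?B y) \<circ> (?A dx \<circ> ?B dy))"
    by (intro near_compose fin permutes_compose ipow_permutes conjunct1[OF IH] Tj pa pb)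
  have "near D (0 + (k' * (2 * c) + 0)) (?A x \<circ> ((?B y \<circ> ?A dx) \<circ> ?B dy)) (?A x \<circ> ((?A dx \<circ> ?B y) \<circ> ?B dy))"
    using pa pb by (intro near_compose near_refl near_sym[OF nb] fin permutes_compose ipow_permutes)
  moreover have "?A x \<circ> ((?A dx \<circ> ?B y) \<circ> ?B dy) = ?A (x + dx) \<circ> ?B (y + dy)"
    using comb[OF pa, of dx x] comb[OF pb, of dy y] dcase by (simp only: comp_assoc[symmetric]) (simp only: comp_assoc)
  ultimately have s2: "near D (k' * (2 * c)) ((?A x \<circ> ?B y) \<circ> (?A dx \<circ> ?B dy)) (?A (x + dx) \<circ> ?B (y + dy))"
    by (simp only: comp_assoc add_0_left add_0_right)
  \<comment> \<open>A new letter costs 2 c for replacing it by powers of the two generators, and 2 c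
    for each of the at most k' factors of \<open>T 2\<close> that its power of \<open>T 0\<close>
    must pass.\<close>
  have "k' * (k' + 3) * (2 * c) + 2 * c + k' * (2 * c) \<le> k * (k + 3) * (2 * c)"
    by (simp add: k algebra_simps)
  then have "near D (k * (k + 3) * (2 * c)) (apply_word T (j # w)) (?A (x + dx) \<circ> ?B (y + dy))"
    unfolding apply_word.simps by (rule near_mono[OF near_trans[OF fin s1 s2]])
  moreover have "\<bar>x + dx\<bar> \<le> int k" "\<bar>y + dy\<bar> \<le> int k" using IH dcase k by auto
  ultimately show ?case unfolding e by (simp only: fst_conv snd_conv)
qed

section \<open>Walks in a 6-regular map\<close>

definition nb :: "'v set set \<Rightarrow> 'v \<Rightarrow> 'v set" where "nb E u = {v. {u, v} \<in> E}"

primrec walks :: "'v set set \<Rightarrow> nat \<Rightarrow> 'v \<Rightarrow> 'v \<Rightarrow> nat" where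
  "walks E 0 u v = (if u = v then 1 else 0)"
| "walks E (Suc k) u v = (\<Sum>x\<in>nb E u. walks E k x v)"

lemma finite_hexwords: "finite (hexwords k)"
  using finite_lists_length_eq[of "{..<6::nat}" k] unfolding hexwords_def by (simp add: conj_commute)

lemma card_hexwords_Suc:
  "card {w \<in> hexwords (Suc k). P w} = (\<Sum>j<6. card {w \<in> hexwords k. P (j # w)})"
proof -
  have "{w \<in> hexwords (Suc k). P w} = (\<Union>j\<in>{..<6}. Cons j ` {w \<in> hexwords k. P (j # w)})"
    by (auto simp: hexwords_def length_Suc_conv)
  also have "card \<dots> = (\<Sum>j<6. card (Cons j ` {w \<in> hexwords k. P (j # w)}))"
    using finite_hexwords[of k] by (intro card_UN_disjoint) auto
  also have "\<dots> = (\<Sum>j<6. card {w \<in> hexwords k. P (j # w)})"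
    by (intro sum.cong refl card_image) simp
  finally show ?thesis .
qed

text \<open>What the topological part delivers, in abstract form: a 6-regular graph whose darts
  carry a rotation with one cycle per vertex.\<close>

locale hex_map =
  fixes K :: "'d set" and \<tau> \<alpha> :: "'d \<Rightarrow> 'd" and h :: "'d \<Rightarrow> 'v" and E :: "'v set set"
  assumes fin: "finite K" and perm: "\<tau> permutes K" "\<alpha> permutes K"
    and invol: "\<And>x. x \<in> K \<Longrightarrow> \<alpha> (\<alpha> x) = x"
    and tail: "\<And>x. x \<in> K \<Longrightarrow> h (\<tau> x) = h x"
    and fibre: "\<And>x y. x \<in> K \<Longrightarrow> y \<in> K \<Longrightarrow> h x = h y \<Longrightarrow> y \<in> orbit \<tau> x"
    and edges: "bij_betw (\<lambda>x. (h x, h (\<alpha> x))) K {(u, v). {u, v} \<in> E}"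
    and loopless: "\<And>x. x \<in> K \<Longrightarrow> h (\<alpha> x) \<noteq> h x"
    and degree: "\<And>u. u \<in> h ` K \<Longrightarrow> card (nb E u) = 6"
begin

text \<open>The transport of a dart along its \<open>j\<close>-th neighbour, \<open>\<tau>\<^sup>3\<^sup>-\<^sup>j \<alpha> \<tau>\<^sup>j\<close> with the exponents taken modulo 6. In
  a triangulated map these permutations satisfy the relations of the lattice steps.\<close>

definition T :: "nat \<Rightarrow> 'd \<Rightarrow> 'd" where "T j = \<tau> ^^ (9 - j) \<circ> \<alpha> \<circ> \<tau> ^^ j"

lemma tail_funpow: "x \<in> K \<Longrightarrow> (\<tau> ^^ j) x \<in> K \<and> h ((\<tau> ^^ j) x) = h x"
  by (induction j) (auto simp: tail permutes_in_image[OF perm(1)])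

lemma orbit_fibre: "x \<in> K \<Longrightarrow> orbit \<tau> x = {y \<in> K. h y = h x}"
proof
  assume x: "x \<in> K"
  show "orbit \<tau> x \<subseteq> {y \<in> K. h y = h x}"
    using x by (intro orbit_least) (auto simp: tail permutes_in_image[OF perm(1)])
  show "{y \<in> K. h y = h x} \<subseteq> orbit \<tau> x" using x fibre[of x] by auto
qed

lemma fibre_nb: "u \<in> h ` K \<Longrightarrow> bij_betw (\<lambda>y. h (\<alpha> y)) {y \<in> K. h y = u} (nb E u)"
  unfolding bij_betw_def
proof
  have inj: "inj_on (\<lambda>x. (h x, h (\<alpha> x))) K" and img: "(\<lambda>x. (h x, h (\<alpha> x))) ` K = {(u, v). {u, v} \<in> E}"
    using edges by (auto simp: bij_betw_def)
  show "inj_on (\<lambda>y. h (\<alpha> y)) {y \<in> K. h y = u}" using inj by (auto simp: inj_on_def)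
  show "(\<lambda>y. h (\<alpha> y)) ` {y \<in> K. h y = u} = nb E u"
  proof
    show "(\<lambda>y. h (\<alpha> y)) ` {y \<in> K. h y = u} \<subseteq> nb E u"
    proof clarify
      fix y assume "y \<in> K" "u = h y"
      then have "(h y, h (\<alpha> y)) \<in> {(u, v). {u, v} \<in> E}" unfolding img[symmetric] by blast
      then show "h (\<alpha> y) \<in> nb E (h y)" by (simp add: nb_def)
    qed
    show "nb E u \<subseteq> (\<lambda>y. h (\<alpha> y)) ` {y \<in> K. h y = u}"
    proof
      fix v assume "v \<in> nb E u"
      then have "(u, v) \<in> (\<lambda>x. (h x, h (\<alpha> x))) ` K" unfolding img nb_def by simp
      then show "v \<in> (\<lambda>y. h (\<alpha> y)) ` {y \<in> K. h y = u}" by auto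
    qed
  qed
qed

lemma card_orbit: "x \<in> K \<Longrightarrow> card (orbit \<tau> x) = 6"
  using bij_betw_same_card[OF fibre_nb[of "h x"]] degree[of "h x"] by (simp add: orbit_fibre)

lemma rot6: "(\<tau> ^^ 6) x = x"
proof (cases "x \<in> K")
  case True
  then show ?thesis using funpow_card_orbit[OF perm(1) fin, of x] card_orbit by simp
next
  case False
  then have "(\<tau> ^^ j) x = x" for j by (induction j) (auto simp: permutes_not_in[OF perm(1)])
  then show ?thesis .
qed

lemma inv2: "\<alpha> (\<alpha> x) = x"
  by (cases "x \<in> K") (auto simp: invol permutes_not_in[OF perm(2)])

lemma rot6': "\<tau> (\<tau> (\<tau> (\<tau> (\<tau> (\<tau> x))))) = x"
  using rot6[of x] by (simp add: numeral_eq_Suc)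

lemma T_simps:
  "T 0 x = \<tau> (\<tau> (\<tau> (\<alpha> x)))" "T (Suc 0) x = \<tau> (\<tau> (\<alpha> (\<tau> x)))" "T 2 x = \<tau> (\<alpha> (\<tau> (\<tau> x)))"
  "T 3 x = \<alpha> (\<tau> (\<tau> (\<tau> x)))" "T 4 x = \<tau> (\<tau> (\<tau> (\<tau> (\<tau> (\<alpha> (\<tau> (\<tau> (\<tau> (\<tau> x)))))))))"
  "T 5 x = \<tau> (\<tau> (\<tau> (\<tau> (\<alpha> (\<tau> (\<tau> (\<tau> (\<tau> (\<tau> x)))))))))"
  by (simp_all add: T_def numeral_eq_Suc rot6')

lemma T_2: "T (Suc (Suc 0)) x = \<tau> (\<alpha> (\<tau> (\<tau> x)))"
  using T_simps(3) by (simp only: numeral_2_eq_2)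

lemma T_permutes: "T j permutes K"
  unfolding T_def by (intro permutes_compose permutes_funpow perm)

lemma T_neighbours: "x \<in> K \<Longrightarrow> bij_betw (\<lambda>j. h (T j x)) {..<6} (nb E (h x))"
proof -
  assume x: "x \<in> K"
  have o: "orbit \<tau> x = (\<lambda>j. (\<tau> ^^ j) x) ` {..<6}"
    using orbit_altdef_bounded[OF rot6[of x]] by auto
  have "bij_betw (\<lambda>j. (\<tau> ^^ j) x) {..<6} (orbit \<tau> x)"
    unfolding bij_betw_def using o card_orbit[OF x] by (intro conjI eq_card_imp_inj_on) auto
  then have "bij_betw (\<lambda>j. (\<tau> ^^ j) x) {..<6} {y \<in> K. h y = h x}" using orbit_fibre[OF x] by simp
  from bij_betw_trans[OF this fibre_nb[of "h x"]]
  have "bij_betw ((\<lambda>y. h (\<alpha> y)) \<circ> (\<lambda>j. (\<tau> ^^ j) x)) {..<6} (nb E (h x))" using x by simp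
  moreover have "h (T j x) = ((\<lambda>y. h (\<alpha> y)) \<circ> (\<lambda>j. (\<tau> ^^ j) x)) j" for j
    using tail_funpow[of "\<alpha> ((\<tau> ^^ j) x)" "9 - j"] tail_funpow[OF x, of j] permutes_in_image[OF perm(2)] by (simp add: T_def)
  ultimately show ?thesis by (simp add: o_def)
qed

text \<open>\<open>T j\<close> carries a dart to a dart at the \<open>j\<close>-th neighbour of its
  tail, so the words of length \<open>k\<close> trace every walk from the tail exactly once.\<close>

lemma walks_words: "x \<in> K \<Longrightarrow> walks E k (h x) v = card {w \<in> hexwords k. h (apply_word T w x) = v}"
proof (induction k arbitrary: x)
  case 0
  have "{w \<in> hexwords 0. h (apply_word T w x) = v} = (if h x = v then {[]} else {})"
    by (auto simp: hexwords_def)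
  then show ?case by simp
next
  case (Suc k)
  have "walks E (Suc k) (h x) v = (\<Sum>j<6. walks E k (h (T j x)) v)"
    using sum.reindex_bij_betw[OF T_neighbours[OF Suc.prems], of "\<lambda>u. walks E k u v"] by simp
  also have "\<dots> = (\<Sum>j<6. card {w \<in> hexwords k. h (apply_word T w (T j x)) = v})"
    using Suc permutes_in_image[OF T_permutes] by (intro sum.cong) auto
  also have "\<dots> = card {w \<in> hexwords (Suc k). h (apply_word T w x) = v}"
    unfolding card_hexwords_Suc by simp
  finally show ?case .
qed

text \<open>Outside the bad darts \<tau> \<alpha> \<tau> \<alpha> \<tau> \<alpha> = 1, hence
  \<alpha> \<tau> \<alpha> = \<tau>^5 \<alpha> \<tau>^5 because \<tau>^6 = 1. This identity and its
  inverse reduce the two composites to \<open>T 1\<close>.\<close>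

lemma near_triangles:
  assumes "card {x \<in> K. ((\<tau> \<circ> \<alpha>) ^^ 3) x \<noteq> x} \<le> b"
  shows "near K b (T 2 \<circ> T 0) (T 1)" "near K b (T 0 \<circ> T 2) (T 1)"
proof -
  have p: "\<tau> ^^ j permutes K" for j by (intro permutes_funpow perm)
  have 0: "near K b ((\<tau> \<circ> \<alpha>) ^^ 3) id" using assms by (simp add: near_def)
  have "near K (0 + (b + 0)) (\<tau> ^^ 5 \<circ> (((\<tau> \<circ> \<alpha>) ^^ 3) \<circ> (\<alpha> \<circ> \<tau> ^^ 5))) (\<tau> ^^ 5 \<circ> (id \<circ> (\<alpha> \<circ> \<tau> ^^ 5)))"
    by (intro near_compose near_refl fin 0 permutes_compose p perm permutes_id)
  moreover have "\<tau> ^^ 5 \<circ> (((\<tau> \<circ> \<alpha>) ^^ 3) \<circ> (\<alpha> \<circ> \<tau> ^^ 5)) = \<alpha> \<circ> \<tau> \<circ> \<alpha>"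
    by (rule ext) (simp add: numeral_eq_Suc rot6' inv2)
  ultimately have 1: "near K b (\<alpha> \<circ> \<tau> \<circ> \<alpha>) (\<tau> ^^ 5 \<circ> (\<alpha> \<circ> \<tau> ^^ 5))" by (simp only: add_0_left add_0_right id_comp)
  have 2: "near K b (inv_into UNIV (\<alpha> \<circ> \<tau> \<circ> \<alpha>)) (inv_into UNIV (\<tau> ^^ 5 \<circ> (\<alpha> \<circ> \<tau> ^^ 5)))"
    by (intro near_inv fin 1 permutes_compose p perm)
  have i1: "inv_into UNIV (\<alpha> \<circ> \<tau> \<circ> \<alpha>) = \<alpha> \<circ> \<tau> ^^ 5 \<circ> \<alpha>"
    by (rule inv_unique_comp; rule ext; simp add: numeral_eq_Suc rot6' inv2)
  have i2: "inv_into UNIV (\<tau> ^^ 5 \<circ> (\<alpha> \<circ> \<tau> ^^ 5)) = \<tau> \<circ> \<alpha> \<circ> \<tau>"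
    by (rule inv_unique_comp; rule ext; simp add: numeral_eq_Suc rot6' inv2)
  have "near K (0 + b) (\<tau> \<circ> (\<alpha> \<circ> \<tau> ^^ 5 \<circ> \<alpha>)) (\<tau> \<circ> (\<tau> \<circ> \<alpha> \<circ> \<tau>))"
    by (intro near_compose near_refl fin 2[unfolded i1 i2] permutes_compose perm)
  moreover have "\<tau> \<circ> (\<alpha> \<circ> \<tau> ^^ 5 \<circ> \<alpha>) = T 2 \<circ> T 0" "\<tau> \<circ> (\<tau> \<circ> \<alpha> \<circ> \<tau>) = T 1"
    by (rule ext; simp add: T_2 T_simps numeral_eq_Suc rot6')+
  ultimately show "near K b (T 2 \<circ> T 0) (T 1)" by (simp only: add_0_left)
  have "near K (0 + (b + 0)) (\<tau> ^^ 3 \<circ> ((\<alpha> \<circ> \<tau> \<circ> \<alpha>) \<circ> \<tau> ^^ 2)) (\<tau> ^^ 3 \<circ> ((\<tau> ^^ 5 \<circ> (\<alpha> \<circ> \<tau> ^^ 5)) \<circ> \<tau> ^^ 2))"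
    by (intro near_compose near_refl fin 1 permutes_compose p perm)
  moreover have "\<tau> ^^ 3 \<circ> ((\<alpha> \<circ> \<tau> \<circ> \<alpha>) \<circ> \<tau> ^^ 2) = T 0 \<circ> T 2"
    "\<tau> ^^ 3 \<circ> ((\<tau> ^^ 5 \<circ> (\<alpha> \<circ> \<tau> ^^ 5)) \<circ> \<tau> ^^ 2) = T 1"
    by (rule ext; simp add: T_2 T_simps numeral_eq_Suc rot6')+
  ultimately show "near K b (T 0 \<circ> T 2) (T 1)" by (simp only: add_0_left add_0_right)
qed

lemma T_inverses: "T 3 = inv_into UNIV (T 0)" "T 5 = inv_into UNIV (T 2)" "T 4 = inv_into UNIV (T 1)"
  by (rule sym, rule inv_unique_comp; rule ext; simp add: T_simps rot6' inv2)+

lemma sum_over_tails: "(\<Sum>x\<in>K. f (h x)) = (6::nat) * (\<Sum>v\<in>h ` K. f v)"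
proof -
  have "(\<Sum>x\<in>K. f (h x)) = (\<Sum>v\<in>h ` K. \<Sum>x\<in>{x. x \<in> K \<and> h x = v}. f (h x))"
    by (rule sum.image_gen[OF fin])
  also have "\<dots> = (\<Sum>v\<in>h ` K. 6 * f v)"
  proof (intro sum.cong refl)
    fix v assume v: "v \<in> h ` K"
    then have "card {x \<in> K. h x = v} = 6" using bij_betw_same_card[OF fibre_nb[OF v]] degree by simp
    then show "(\<Sum>x\<in>{x. x \<in> K \<and> h x = v}. f (h x)) = 6 * f v" by simp
  qed
  finally show ?thesis by (simp add: sum_distrib_left)
qed

text \<open>Pairs of a closed lattice word and a dart fixed by it are counted in two ways. Each word
  fixes all but few darts; each word fixing a dart is a closed walk at its tail, and every vertex is
  the tail of six darts.\<close>

lemma closed_walks_ge: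
  assumes "card {x \<in> K. ((\<tau> \<circ> \<alpha>) ^^ 3) x \<noteq> x} \<le> b"
  shows "card (closed_words k) * (6 * card (h ` K)) \<le>
    6 * (\<Sum>v\<in>h ` K. walks E k v v) + card (closed_words k) * (k * (k + 3) * (2 * b))"
proof -
  let ?c = "k * (k + 3) * (2 * b)"
  have fc: "finite (closed_words k)" unfolding closed_words_def using finite_hexwords by simp
  have cK: "card K = 6 * card (h ` K)" using sum_over_tails[of "\<lambda>_. 1"] by simp
  have w: "card K \<le> card {x \<in> K. apply_word T w x = x} + ?c" if "w \<in> closed_words k" for w
  proof -
    have hw: "w \<in> hexwords k" and e: "endpoint w = (0, 0)" using that by (auto simp: closed_words_def)
    have "near K ?c (apply_word T w) id"
      using conjunct1[OF near_lattice_words[OF fin T_permutes near_triangles[OF assms] T_inverses hw]]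
      unfolding e by (simp add: ipow_def)
    then have "card {x \<in> K. apply_word T w x \<noteq> x} \<le> ?c" by (simp add: near_def)
    moreover have "{x \<in> K. apply_word T w x = x} \<union> {x \<in> K. apply_word T w x \<noteq> x} = K" by auto
    then have "card K \<le> card {x \<in> K. apply_word T w x = x} + card {x \<in> K. apply_word T w x \<noteq> x}"
      using card_Un_le[of "{x \<in> K. apply_word T w x = x}" "{x \<in> K. apply_word T w x \<noteq> x}"] by simp
    ultimately show ?thesis by simp
  qed
  have "card (closed_words k) * card K = (\<Sum>w\<in>closed_words k. card K)" by simp
  also have "\<dots> \<le> (\<Sum>w\<in>closed_words k. card {x \<in> K. apply_word T w x = x} + ?c)" by (intro sum_mono w)
  also have "\<dots> = (\<Sum>w\<in>closed_words k. card {x \<in> K. apply_word T w x = x}) + card (closed_words k) * ?c"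
    by (simp add: sum.distrib)
  also have "(\<Sum>w\<in>closed_words k. card {x \<in> K. apply_word T w x = x}) = (\<Sum>x\<in>K. card {w \<in> closed_words k. apply_word T w x = x})"
    using fin fc by (intro sum_multicount_gen) auto
  also have "\<dots> \<le> (\<Sum>x\<in>K. walks E k (h x) (h x))"
  proof (rule sum_mono)
    fix x assume x: "x \<in> K"
    show "card {w \<in> closed_words k. apply_word T w x = x} \<le> walks E k (h x) (h x)"
      unfolding walks_words[OF x] using finite_hexwords[of k] by (intro card_mono) (auto simp: closed_words_def)
  qed
  also have "\<dots> = 6 * (\<Sum>v\<in>h ` K. walks E k v v)" by (rule sum_over_tails)
  finally show ?thesis unfolding cK by simp
qed

text \<open>A face of length 1 would be a loop. In a face of length 2 the two edges would be
  parallel, hence equal, and one end would have a single dart instead of six.\<close>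

lemma few_non_triangular:
  "int (card {x \<in> K. ((\<tau> \<circ> \<alpha>) ^^ 3) x \<noteq> x}) \<le> 4 * (6 * int (card (h ` K)) - 3 * int (norb (\<tau> \<circ> \<alpha>) K))"
proof -
  have "int (card {x \<in> K. ((\<tau> \<circ> \<alpha>) ^^ 3) x \<noteq> x}) \<le> 4 * (int (card K) - 3 * int (norb (\<tau> \<circ> \<alpha>) K))"
  proof (intro card_non_triangular permutes_compose perm fin)
    fix x assume x: "x \<in> K"
    have ax: "\<alpha> x \<in> K" "\<tau> (\<alpha> x) \<in> K" using x permutes_in_image[OF perm(1)] permutes_in_image[OF perm(2)] by auto
    have 1: "(\<tau> \<circ> \<alpha>) x \<noteq> x" using loopless[OF x] tail[OF ax(1)] by auto
    moreover have "(\<tau> \<circ> \<alpha>) ((\<tau> \<circ> \<alpha>) x) \<noteq> x"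
    proof
      assume *: "(\<tau> \<circ> \<alpha>) ((\<tau> \<circ> \<alpha>) x) = x"
      let ?y = "\<tau> (\<alpha> x)"
      have "h ?y = h (\<alpha> x)" using tail[OF ax(1)] .
      moreover have "h (\<alpha> ?y) = h x" using * tail[of "\<alpha> ?y"] ax permutes_in_image[OF perm(2)] by auto
      ultimately have "(h ?y, h (\<alpha> ?y)) = (h (\<alpha> x), h (\<alpha> (\<alpha> x)))" by (simp add: inv2)
      then have "?y = \<alpha> x" using edges ax unfolding bij_betw_def inj_on_def by blast
      then have "orbit \<tau> (\<alpha> x) = {\<alpha> x}" by (simp add: orbit_eq_singleton_iff)
      then show False using card_orbit[OF ax(1)] by simp
    qed
    ultimately show "(\<tau> \<circ> \<alpha>) x \<noteq> x \<and> (\<tau> \<circ> \<alpha>) ((\<tau> \<circ> \<alpha>) x) \<noteq> x" by simp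
  qed
  moreover have "card K = 6 * card (h ` K)" using sum_over_tails[of "\<lambda>_. 1"] by simp
  ultimately show ?thesis by simp
qed

end

section \<open>Rounding the surface to the grid\<close>

text \<open>\<open>cubes1\<close> lists the unit intervals \<open>[i, i + 1]\<close> containing a real number, \<open>verts1\<close> the integers nearest to
  it on either side; both have one or two elements.\<close>

definition cubes1 :: "real \<Rightarrow> int set" where "cubes1 X = {\<lceil>X\<rceil> - 1, \<lfloor>X\<rfloor>}"

definition verts1 :: "real \<Rightarrow> int set" where "verts1 X = {\<lfloor>X\<rfloor>, \<lceil>X\<rceil>}"

lemma cubes1_ex: "a < b \<Longrightarrow> (\<exists>i\<in>cubes1 X. a \<le> i \<and> i < b) \<longleftrightarrow> real_of_int a \<le> X \<and> X \<le> real_of_int b"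
  unfolding cubes1_def by (auto simp: le_floor_iff floor_less_iff) linarith+

lemma cubes1_all: "(\<forall>i\<in>cubes1 X. a \<le> i \<and> i < b) \<longleftrightarrow> real_of_int a < X \<and> X < real_of_int b"
  unfolding cubes1_def by auto linarith+

text \<open>Moving slightly off a point can only lead to a larger cell, which has more vertices and
  fewer cubes around it.\<close>

lemma near_real:
  "\<exists>e>0. \<forall>Y::real. \<bar>Y - X\<bar> < e \<longrightarrow> verts1 X \<subseteq> verts1 Y \<and> cubes1 Y \<subseteq> cubes1 X"
proof (cases "X = of_int \<lfloor>X\<rfloor>")
  case True
  define n where "n = \<lfloor>X\<rfloor>"
  have X: "X = of_int n" using True n_def by simp
  have "verts1 X \<subseteq> verts1 Y \<and> cubes1 Y \<subseteq> cubes1 X" if "\<bar>Y - X\<bar> < 1" for Y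
  proof -
    consider "Y = X" | "X < Y" | "Y < X" by linarith
    then show ?thesis
    proof cases
      case 2
      then have "\<lfloor>Y\<rfloor> = n" "\<lceil>Y\<rceil> = n + 1" using that X by (auto simp: floor_eq_iff ceiling_eq_iff)
      then show ?thesis by (auto simp: verts1_def cubes1_def X)
    next
      case 3
      then have "\<lfloor>Y\<rfloor> = n - 1" "\<lceil>Y\<rceil> = n" using that X by (auto simp: floor_eq_iff ceiling_eq_iff)
      then show ?thesis by (auto simp: verts1_def cubes1_def X)
    qed simp
  qed
  then show ?thesis by (intro exI[of _ 1]) auto
next
  case False
  define e where "e = min (X - of_int \<lfloor>X\<rfloor>) (of_int \<lfloor>X\<rfloor> + 1 - X)"
  have "e > 0" using False of_int_floor_le[of X] real_of_int_floor_add_one_gt[of X] unfolding e_def by linarith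
  moreover have "verts1 X \<subseteq> verts1 Y \<and> cubes1 Y \<subseteq> cubes1 X" if "\<bar>Y - X\<bar> < e" for Y
  proof -
    have "\<lfloor>Y\<rfloor> = \<lfloor>X\<rfloor>" "\<lceil>Y\<rceil> = \<lfloor>X\<rfloor> + 1" "\<lceil>X\<rceil> = \<lfloor>X\<rfloor> + 1"
      using that \<open>e > 0\<close> unfolding e_def by (auto simp: floor_eq_iff ceiling_eq_iff min_def split: if_splits)
    then show ?thesis by (auto simp: verts1_def cubes1_def)
  qed
  ultimately show ?thesis by auto
qed

definition cubes3 :: "nat \<Rightarrow> real \<times> real \<times> real \<Rightarrow> (int \<times> int \<times> int) set" where
  "cubes3 N = (\<lambda>(x, y, z). cubes1 (real N * x) \<times> cubes1 (real N * y) \<times> cubes1 (real N * z))"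

text \<open>The vertices of the smallest grid cell containing the point.\<close>

definition hits :: "nat \<Rightarrow> real \<times> real \<times> real \<Rightarrow> (int \<times> int \<times> int) set" where
  "hits N = (\<lambda>(x, y, z). verts1 (real N * x) \<times> verts1 (real N * y) \<times> verts1 (real N * z))"

definition full_cube :: "nat \<Rightarrow> nat \<Rightarrow> int \<times> int \<times> int \<Rightarrow> bool" where
  "full_cube g N = (\<lambda>(i, j, k). plate g N i j \<and> slab N k)"

lemma dist_triple:
  fixes x y z :: real
  shows "\<bar>x - x'\<bar> \<le> dist (x, y, z) (x', y', z')" "\<bar>y - y'\<bar> \<le> dist (x, y, z) (x', y', z')"
    "\<bar>z - z'\<bar> \<le> dist (x, y, z) (x', y', z')"
    "dist (x, y, z) (x', y', z') \<le> \<bar>x - x'\<bar> + \<bar>y - y'\<bar> + \<bar>z - z'\<bar>"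
proof -
  have a: "dist x x' \<le> dist (x, y, z) (x', y', z')" "dist (y, z) (y', z') \<le> dist (x, y, z) (x', y', z')"
    using dist_fst_le[of "(x, y, z)" "(x', y', z')"] dist_snd_le[of "(x, y, z)" "(x', y', z')"] by auto
  have b: "dist y y' \<le> dist (y, z) (y', z')" "dist z z' \<le> dist (y, z) (y', z')"
    using dist_fst_le[of "(y, z)" "(y', z')"] dist_snd_le[of "(y, z)" "(y', z')"] by auto
  show "\<bar>x - x'\<bar> \<le> dist (x, y, z) (x', y', z')" "\<bar>y - y'\<bar> \<le> dist (x, y, z) (x', y', z')"
    "\<bar>z - z'\<bar> \<le> dist (x, y, z) (x', y', z')" using a b by (auto simp: dist_real_def)
  have "dist (x, y, z) (x', y', z') \<le> dist x x' + dist (y, z) (y', z')"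
    unfolding dist_Pair_Pair[of x "(y, z)"] using sqrt_sum_squares_le_sum[of "dist x x'" "dist (y, z) (y', z')"] by simp
  moreover have "dist (y, z) (y', z') \<le> dist y y' + dist z z'"
    unfolding dist_Pair_Pair[of y z] using sqrt_sum_squares_le_sum[of "dist y y'" "dist z z'"] by simp
  ultimately show "dist (x, y, z) (x', y', z') \<le> \<bar>x - x'\<bar> + \<bar>y - y'\<bar> + \<bar>z - z'\<bar>" by (simp add: dist_real_def)
qed

lemma near_point:
  assumes "N \<ge> 1"
  shows "\<exists>e>0. \<forall>q. dist q p < e \<longrightarrow> hits N p \<subseteq> hits N q \<and> cubes3 N q \<subseteq> cubes3 N p"
proof -
  obtain x y z where p: "p = (x, y, z)" by (metis prod_cases3)
  let ?n = "real N"
  obtain a b c where abc: "a > 0" "b > 0" "c > 0"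
    and h: "\<And>Y. \<bar>Y - ?n * x\<bar> < a \<Longrightarrow> verts1 (?n * x) \<subseteq> verts1 Y \<and> cubes1 Y \<subseteq> cubes1 (?n * x)"
      "\<And>Y. \<bar>Y - ?n * y\<bar> < b \<Longrightarrow> verts1 (?n * y) \<subseteq> verts1 Y \<and> cubes1 Y \<subseteq> cubes1 (?n * y)"
      "\<And>Y. \<bar>Y - ?n * z\<bar> < c \<Longrightarrow> verts1 (?n * z) \<subseteq> verts1 Y \<and> cubes1 Y \<subseteq> cubes1 (?n * z)"
    using near_real[of "?n * x"] near_real[of "?n * y"] near_real[of "?n * z"] by metis
  have n: "?n > 0" using assms by simp
  define e where "e = min a (min b c) / ?n"
  have sc: "\<bar>?n * u - ?n * v\<bar> < d" if "\<bar>u - v\<bar> < e" "e * ?n \<le> d" for u v d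
  proof -
    have "\<bar>?n * u - ?n * v\<bar> = ?n * \<bar>u - v\<bar>" using n by (simp add: abs_mult right_diff_distrib[symmetric])
    also have "\<dots> < ?n * e" using that n by simp
    finally show ?thesis using that by (simp add: mult.commute)
  qed
  have en: "e * ?n \<le> a" "e * ?n \<le> b" "e * ?n \<le> c" using n by (auto simp: e_def)
  have "hits N p \<subseteq> hits N q \<and> cubes3 N q \<subseteq> cubes3 N p" if "dist q p < e" for q
  proof -
    obtain x' y' z' where q: "q = (x', y', z')" by (metis prod_cases3)
    have d: "\<bar>x' - x\<bar> < e" "\<bar>y' - y\<bar> < e" "\<bar>z' - z\<bar> < e"
      using that dist_triple(1)[of x' x y' z' y z] dist_triple(2)[of y' y x' z' x z] dist_triple(3)[of z' z x' y' x y]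
      unfolding p q by linarith+
    show ?thesis using h(1)[OF sc[OF d(1) en(1)]] h(2)[OF sc[OF d(2) en(2)]] h(3)[OF sc[OF d(3) en(3)]]
      unfolding p q hits_def cubes3_def prod.case by blast
  qed
  moreover have "e > 0" using abc n by (simp add: e_def)
  ultimately show ?thesis by auto
qed

text \<open>An exact equivalence, because all walls have integer coordinates and so are made of grid
  squares.\<close>

lemma handlebody_iff:
  assumes "N \<ge> 1"
  shows "p \<in> handlebody g \<longleftrightarrow> (\<exists>c\<in>cubes3 N p. full_cube g N c)"
proof -
  obtain x y z where p: "p = (x, y, z)" by (metis prod_cases3)
  let ?n = "real N" and ?W = "(2 * int g + 1) * int N"
  have n: "?n > 0" using assms by simp
  have sc: "?n * u \<le> ?n * v \<longleftrightarrow> u \<le> v" "?n * u < ?n * v \<longleftrightarrow> u < v" for u v using n by auto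
  have W: "?W > 0" using assms by simp
  have W': "real_of_int ?W = ?n * (2 * real g + 1)" by (simp add: algebra_simps)
  have z: "(\<exists>k\<in>cubes1 (?n * z). slab N k) \<longleftrightarrow> 0 \<le> z \<and> z \<le> 1"
    using cubes1_ex[of 0 "int N" "?n * z"] assms sc(1)[of 0 z] sc(1)[of z 1] unfolding slab_def by simp
  have x: "(\<exists>i\<in>cubes1 (?n * x). 0 \<le> i \<and> i < ?W) \<longleftrightarrow> 0 \<le> x \<and> x \<le> 2 * real g + 1"
    using cubes1_ex[OF W, of "?n * x"] sc(1)[of 0 x] sc(1)[of x "2 * real g + 1"] unfolding W' by simp
  have hx: "(\<forall>i\<in>cubes1 (?n * x). (2 * int m + 1) * int N \<le> i \<and> i < (2 * int m + 2) * int N) \<longleftrightarrow>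
      2 * real m + 1 < x \<and> x < 2 * real m + 2" for m
    using cubes1_all[of "?n * x" "(2 * int m + 1) * int N" "(2 * int m + 2) * int N"]
      sc(2)[of "2 * real m + 1" x] sc(2)[of x "2 * real m + 2"] by (simp add: mult.commute)
  have hy: "(\<forall>j\<in>cubes1 (?n * y). hole_y N j) \<longleftrightarrow> 1 < y \<and> y < 2"
    using cubes1_all[of "?n * y" "int N" "2 * int N"] sc(2)[of 1 y] sc(2)[of y 2] unfolding hole_y_def by (simp add: mult.commute)
  have yr: "(\<exists>j\<in>cubes1 (?n * y). a * int N \<le> j \<and> j < b * int N) \<longleftrightarrow> of_int a \<le> y \<and> y \<le> of_int b" if "a < b" for a b
    using cubes1_ex[of "a * int N" "b * int N" "?n * y"] assms that sc(1)[of "of_int a" y] sc(1)[of y "of_int b"] by (simp add: mult.commute)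
  have xr: "(\<exists>j\<in>cubes1 (?n * x). a * int N \<le> j \<and> j < b * int N) \<longleftrightarrow> of_int a \<le> x \<and> x \<le> of_int b" if "a < b" for a b
    using cubes1_ex[of "a * int N" "b * int N" "?n * x"] assms that sc(1)[of "of_int a" x] sc(1)[of x "of_int b"] by (simp add: mult.commute)
  have xy: "(\<exists>i\<in>cubes1 (?n * x). \<exists>j\<in>cubes1 (?n * y). plate g N i j) \<longleftrightarrow>
     0 \<le> x \<and> x \<le> 2 * real g + 1 \<and> 0 \<le> y \<and> y \<le> 3 \<and> \<not> (\<exists>m<g. 2 * real m + 1 < x \<and> x < 2 * real m + 2 \<and> 1 < y \<and> y < 2)"
    (is "?L \<longleftrightarrow> ?R")
  proof
    assume ?L
    then obtain i j where ij: "i \<in> cubes1 (?n * x)" "j \<in> cubes1 (?n * y)" "plate g N i j" by auto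
    then have "0 \<le> x \<and> x \<le> 2 * real g + 1" using x unfolding plate_def in_block_def by blast
    moreover have "0 \<le> y \<and> y \<le> 3" using yr[of 0 3] ij unfolding plate_def in_block_def by auto
    moreover have False if m: "m < g" "2 * real m + 1 < x" "x < 2 * real m + 2" "1 < y" "y < 2" for m
    proof -
      have "hole_x g N i" using hx[of m] m ij(1) unfolding hole_x_def by blast
      moreover have "hole_y N j" using hy m ij(2) by blast
      ultimately show False using ij(3) by (simp add: plate_def)
    qed
    ultimately show ?R by blast
  next
    assume R: ?R
    consider "y \<le> 1" | "y \<ge> 2" | "1 < y" "y < 2" by linarith
    then show ?L
    proof cases
      case 1
      then obtain j where "j \<in> cubes1 (?n * y)" "0 * int N \<le> j" "j < 1 * int N" using yr[of 0 1] R by auto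
      moreover obtain i where "i \<in> cubes1 (?n * x)" "0 \<le> i" "i < ?W" using x R by auto
      ultimately show ?L unfolding plate_def in_block_def hole_y_def by (intro bexI[of _ i] bexI[of _ j]) auto
    next
      case 2
      then obtain j where "j \<in> cubes1 (?n * y)" "2 * int N \<le> j" "j < 3 * int N" using yr[of 2 3] R by auto
      moreover obtain i where "i \<in> cubes1 (?n * x)" "0 \<le> i" "i < ?W" using x R by auto
      ultimately show ?L unfolding plate_def in_block_def hole_y_def by (intro bexI[of _ i] bexI[of _ j]) auto
    next
      case 3
      obtain j where j: "j \<in> cubes1 (?n * y)" "0 * int N \<le> j" "j < 3 * int N" using yr[of 0 3] R by auto
      \<comment> \<open>At the height of the tunnels, \<open>x\<close> must lie in a solid strip
        [2 m, 2 m + 1] between two of them or at an end.\<close>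
      define m where "m = nat \<lfloor>x / 2\<rfloor>"
      have mx: "2 * real m \<le> x" "x < 2 * real m + 2" using R unfolding m_def by (auto simp: of_nat_nat) linarith+
      have "x \<le> 2 * real m + 1"
      proof (rule ccontr)
        assume "\<not> ?thesis"
        moreover from this have "m < g" using R by linarith
        ultimately show False using R 3 mx by auto
      qed
      then obtain i where i: "i \<in> cubes1 (?n * x)" "(2 * int m) * int N \<le> i" "i < (2 * int m + 1) * int N"
        using xr[of "2 * int m" "2 * int m + 1"] mx by auto
      have "m \<le> g" using mx R by linarith
      then have "(2 * int m + 1) * int N \<le> ?W" by (intro mult_right_mono) auto
      then have "0 \<le> i" "i < ?W" using i mult_nonneg_nonneg[of "2 * int m" "int N"] by linarith+
      moreover have "\<not> hole_x g N i"
      proof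
        assume "hole_x g N i"
        then obtain l where l: "(2 * int l + 1) * int N \<le> i" "i < (2 * int l + 2) * int N" by (auto simp: hole_x_def)
        have "(2 * int l + 1) * int N < (2 * int m + 1) * int N" "(2 * int m) * int N < (2 * int l + 2) * int N" using l i by linarith+
        then have "2 * int l + 1 < 2 * int m + 1" "2 * int m < 2 * int l + 2"
          using mult_less_cancel_right_pos[of "int N"] assms by simp_all
        then show False by presburger
      qed
      ultimately show ?L using i(1) j unfolding plate_def in_block_def by (intro bexI[of _ i] bexI[of _ j]) auto
    qed
  qed
  have "(\<exists>c\<in>cubes3 N p. full_cube g N c) \<longleftrightarrow> (\<exists>i\<in>cubes1 (?n * x). \<exists>j\<in>cubes1 (?n * y). plate g N i j) \<and> (\<exists>k\<in>cubes1 (?n * z). slab N k)"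
    unfolding p cubes3_def full_cube_def by auto
  then show ?thesis unfolding xy z unfolding p handlebody_def by auto
qed

text \<open>The cubes around nearby points are among those around \<open>p\<close>; were these all
  full or all empty, a whole ball would lie inside or outside the handlebody.\<close>

lemma frontier_imp_mixed:
  assumes N: "N \<ge> 1" and p: "p \<in> genus_surface g"
  shows "\<exists>c\<in>cubes3 N p. full_cube g N c" "\<exists>c\<in>cubes3 N p. \<not> full_cube g N c"
proof -
  obtain e where e: "e > 0" "\<And>q. dist q p < e \<Longrightarrow> cubes3 N q \<subseteq> cubes3 N p" using near_point[OF N] by meson
  have ne: "\<exists>c. c \<in> cubes3 N q" for q by (cases q) (auto simp: cubes3_def cubes1_def)
  show "\<exists>c\<in>cubes3 N p. full_cube g N c"
  proof (rule ccontr)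
    assume "\<not> ?thesis"
    then have "q \<notin> handlebody g" if "dist q p < e" for q using e(2)[OF that] handlebody_iff[OF N] by blast
    moreover have "p \<in> closure (handlebody g)" using p by (auto simp: genus_surface_def frontier_def)
    ultimately show False using e(1) unfolding closure_approachable by blast
  qed
  show "\<exists>c\<in>cubes3 N p. \<not> full_cube g N c"
  proof (rule ccontr)
    assume "\<not> ?thesis"
    then have "ball p e \<subseteq> handlebody g"
      using e(2) handlebody_iff[OF N] ne by (fastforce simp: dist_commute)
    then have "p \<in> interior (handlebody g)" using e(1) by (meson centre_in_ball interior_maximal open_ball subsetD)
    then show False using p by (simp add: genus_surface_def frontier_def)
  qed
qed

lemma frontier_handlebodyI:
  assumes "p \<in> handlebody g" "\<And>e. e > 0 \<Longrightarrow> \<exists>q. q \<notin> handlebody g \<and> dist q p < e"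
  shows "p \<in> genus_surface g"
proof -
  have "p \<notin> interior (handlebody g)"
  proof
    assume "p \<in> interior (handlebody g)"
    then obtain e where "e > 0" "ball p e \<subseteq> handlebody g" by (meson mem_interior)
    then show False using assms(2)[of e] by (auto simp: dist_commute)
  qed
  moreover have "p \<in> closure (handlebody g)" using assms(1) closure_subset by blast
  ultimately show ?thesis by (simp add: genus_surface_def frontier_def)
qed

lemma mixed_imp_frontier:
  assumes N: "N \<ge> 1" and c: "c \<in> cubes3 N p" "full_cube g N c" and d: "d \<in> cubes3 N p" "\<not> full_cube g N d"
  shows "p \<in> genus_surface g"
proof (rule frontier_handlebodyI)
  show "p \<in> handlebody g" using handlebody_iff[OF N] c by blast
  fix e :: real assume "e > 0"
  obtain x y z where p: "p = (x, y, z)" by (metis prod_cases3)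
  obtain i j k where d': "d = (i, j, k)" by (metis prod_cases3)
  let ?n = "real N"
  have n: "?n > 0" using N by simp
  define t where "t = min (1/2) (e / 6)"
  have t: "0 < t" "t < 1" "t * 3 < e" using \<open>e > 0\<close> by (auto simp: t_def min_def)
  \<comment> \<open>Moving each coordinate by the fraction \<open>t\<close> towards the centre of
    the empty cube lands in its interior.\<close>
  define f where "f X i = (X + t * ((of_int i + 1/2) - X * ?n) / ?n)" for X i
  have f: "cubes1 (?n * f X i) = {i} \<and> \<bar>f X i - X\<bar> \<le> t" if "i \<in> cubes1 (?n * X)" for X i
  proof -
    have i: "of_int i \<le> ?n * X" "?n * X \<le> of_int i + 1" using that unfolding cubes1_def by auto
    have nf: "?n * f X i = (1 - t) * (?n * X) + t * (of_int i + 1/2)" using n by (simp add: f_def field_simps)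
    have "(1 - t) * (?n * X) \<ge> (1 - t) * of_int i" "(1 - t) * (?n * X) \<le> (1 - t) * (of_int i + 1)" using i t by (intro mult_left_mono; simp)+
    then have "of_int i < ?n * f X i" "?n * f X i < of_int i + 1" unfolding nf using t by (auto simp: algebra_simps)
    then have "\<lfloor>?n * f X i\<rfloor> = i" "\<lceil>?n * f X i\<rceil> = i + 1" by (auto simp: floor_eq_iff ceiling_eq_iff)
    moreover have "\<bar>f X i - X\<bar> \<le> t"
    proof -
      have "\<bar>(of_int i + 1/2) - X * ?n\<bar> \<le> 1" using i by (auto simp: mult.commute abs_le_iff)
      moreover have "1 \<le> ?n" using N by simp
      ultimately have "\<bar>((of_int i + 1/2) - X * ?n) / ?n\<bar> \<le> 1" using n by (simp add: abs_divide)
      then have "t * \<bar>((of_int i + 1/2) - X * ?n) / ?n\<bar> \<le> t * 1" using t by (intro mult_left_mono) auto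
      then show ?thesis using t by (simp add: f_def abs_mult)
    qed
    ultimately show ?thesis by (simp add: cubes1_def)
  qed
  have dd: "i \<in> cubes1 (?n * x)" "j \<in> cubes1 (?n * y)" "k \<in> cubes1 (?n * z)" using d(1) unfolding p d' cubes3_def by auto
  have "cubes3 N (f x i, f y j, f z k) = {d}" using f[OF dd(1)] f[OF dd(2)] f[OF dd(3)] by (simp add: cubes3_def d')
  then have "(f x i, f y j, f z k) \<notin> handlebody g" using handlebody_iff[OF N] d(2) by auto
  moreover have "dist (f x i, f y j, f z k) p < e"
    unfolding p using dist_triple(4)[of "f x i" "f y j" "f z k" x y z] f[OF dd(1)] f[OF dd(2)] f[OF dd(3)] t by linarith
  ultimately show "\<exists>q. q \<notin> handlebody g \<and> dist q p < e" by blast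
qed

section \<open>Connected sets of grid vertices\<close>

definition conn_in :: "('w \<times> 'w) set \<Rightarrow> 'w set \<Rightarrow> bool" where
  "conn_in R A \<longleftrightarrow> (\<forall>v\<in>A. \<forall>w\<in>A. (v, w) \<in> (R \<inter> A \<times> A)\<^sup>*)"

lemma rtrancl_exit:
  assumes "(u, w) \<in> S\<^sup>*" "u \<in> C" "w \<notin> C"
  shows "\<exists>x y. (x, y) \<in> S \<and> x \<in> C \<and> y \<notin> C"
  using assms by (induction rule: rtrancl_induct) blast+

lemma rtrancl_in_mono: "(v, w) \<in> (R \<inter> A \<times> A)\<^sup>* \<Longrightarrow> A \<subseteq> B \<Longrightarrow> (v, w) \<in> (R \<inter> B \<times> B)\<^sup>*"
  by (erule rtrancl_mono[THEN subsetD, rotated]) auto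

lemma rtrancl_in_sym:
  assumes "sym R" "(v, w) \<in> (R \<inter> A \<times> A)\<^sup>*" shows "(w, v) \<in> (R \<inter> A \<times> A)\<^sup>*"
proof -
  have "sym (R \<inter> A \<times> A)" using assms(1) by (auto simp: sym_def)
  then show ?thesis using assms(2) by (meson sym_rtrancl symD)
qed

lemma conn_inI:
  assumes "sym R" "\<And>w. w \<in> A \<Longrightarrow> (m, w) \<in> (R \<inter> A \<times> A)\<^sup>*" shows "conn_in R A"
  unfolding conn_in_def using rtrancl_in_sym[OF assms(1) assms(2)] assms(2) by (meson rtrancl_trans)

lemma conn_in_edge:
  assumes "sym R" "(a, b) \<in> R" shows "conn_in R {a, b}"
  by (rule conn_inI[OF assms(1), of _ a]) (use assms in auto)

lemma conn_in_square:
  assumes "sym R" "(a, b) \<in> R" "(b, c) \<in> R" "(c, d) \<in> R" shows "conn_in R {a, b, c, d}"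
proof (rule conn_inI[OF assms(1), of _ a])
  let ?S = "R \<inter> {a, b, c, d} \<times> {a, b, c, d}"
  have 1: "(a, b) \<in> ?S\<^sup>*" using assms by auto
  then have 2: "(a, c) \<in> ?S\<^sup>*" by (rule rtrancl_into_rtrancl) (use assms in auto)
  then have "(a, d) \<in> ?S\<^sup>*" by (rule rtrancl_into_rtrancl) (use assms in auto)
  then show "(a, w) \<in> ?S\<^sup>*" if "w \<in> {a, b, c, d}" for w using 1 2 that by auto
qed

definition adj :: "nat \<Rightarrow> nat \<Rightarrow> ((int \<times> int \<times> int) \<times> (int \<times> int \<times> int)) set" where
  "adj g N = {(fst x, fst (galpha g N x)) | x. x \<in> darts g N}"

lemma sym_adj: "sym (adj g N)"
proof (rule symI)
  fix v w assume "(v, w) \<in> adj g N"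
  then obtain x where "x \<in> darts g N" "v = fst x" "w = fst (galpha g N x)" by (auto simp: adj_def)
  then show "(w, v) \<in> adj g N" using galpha_dart(1,2)[of x g N] unfolding adj_def mem_Collect_eq
    by (intro exI[of _ "galpha g N x"]) simp
qed

lemma dart_step:
  assumes "(v, u, n) \<in> darts g N"
  shows "(v, move u v) \<in> adj g N" "(move u v, crs n u, n) \<in> darts g N"
    "v \<in> fst ` darts g N" "move u v \<in> fst ` darts g N"
proof -
  show "(v, move u v) \<in> adj g N" using galpha_dart(5)[OF assms] assms unfolding adj_def by force
  have "(move u v, crs n u, n) = gsigma g N (galpha g N (v, u, n))" using galpha_dart(4)[OF assms] by simp
  then show D: "(move u v, crs n u, n) \<in> darts g N" using gsigma_dart(1)[OF galpha_dart(1)[OF assms]] by simp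
  show "v \<in> fst ` darts g N" "move u v \<in> fst ` darts g N" using assms D by force+
qed

lemma dart_square:
  assumes "(v, u, n) \<in> darts g N"
  defines "A \<equiv> {v, move u v, move (crs n u) (move u v), move (crs n u) v}"
  shows "A \<subseteq> fst ` darts g N" "conn_in (adj g N) A"
proof -
  let ?l = "crs n u"
  have p: "perp u n" using assms(1) unfolding darts_def is_frame_def by auto
  have e: "crs n ?l = neg u" using p by (cases u; cases n; simp add: perp_def crs_def)
  note 1 = dart_step[OF assms(1)]
  note 2 = dart_step[OF 1(2)]
  note 3 = dart_step[OF 2(2), unfolded e]
  have m: "move (neg u) (move ?l (move u v)) = move ?l v"
    using p by (cases v; cases u; cases n; simp add: move_def perp_def crs_def)
  show "A \<subseteq> fst ` darts g N" using 1 2 3 unfolding m A_def by simp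
  show "conn_in (adj g N) A" unfolding A_def using 1 2 3 unfolding m by (intro conn_in_square sym_adj)
qed

lemma bool_square:
  assumes "F False False \<Longrightarrow> F True False" "F True False \<Longrightarrow> F True True" "F True True \<Longrightarrow> F False True" "F False True \<Longrightarrow> F False False"
  shows "F b c = F b' c'"
proof -
  have "F True False = F True True" "F False True = F True True" "F False False = F True True" using assms by blast+
  then have all: "F x y = F True True" for x y by (cases x; cases y; simp)
  show ?thesis unfolding all[of b c] all[of b' c'] ..
qed

text \<open>Absence of frames on an edge means that, going around it, a filled cube is followed by a
  filled one; in a cycle of four cubes this makes all agree. Used contrapositively: differing cubes
  yield a dart on the edge.\<close>

lemma edge_frame:
  "\<forall>n. \<not> is_frame p z (Xp, n) \<Longrightarrow> (p True b \<and> z c) = (p True b' \<and> z c')"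
  "\<forall>n. \<not> is_frame p z (Yp, n) \<Longrightarrow> (p a True \<and> z c) = (p a' True \<and> z c')"
  "\<forall>n. \<not> is_frame p z (Zp, n) \<Longrightarrow> (p a b \<and> z True) = (p a' b' \<and> z True)"
proof -
  note d = is_frame_def perp_def cfg_def crs_def
  assume "\<forall>n. \<not> is_frame p z (Xp, n)"
  from this[rule_format, of Yp] this[rule_format, of Ym] this[rule_format, of Zp] this[rule_format, of Zm]
  show "(p True b \<and> z c) = (p True b' \<and> z c')"
    by (intro bool_square[of "\<lambda>b c. p True b \<and> z c"]) (simp_all add: d)
next
  note d = is_frame_def perp_def cfg_def crs_def
  assume "\<forall>n. \<not> is_frame p z (Yp, n)"
  from this[rule_format, of Xp] this[rule_format, of Xm] this[rule_format, of Zm] this[rule_format, of Zp]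
  have "(z c \<and> p a True) = (z c' \<and> p a' True)"
    by (intro bool_square[of "\<lambda>c a. z c \<and> p a True"]) (simp_all add: d)
  then show "(p a True \<and> z c) = (p a' True \<and> z c')" by blast
next
  note d = is_frame_def perp_def cfg_def crs_def
  assume "\<forall>n. \<not> is_frame p z (Zp, n)"
  from this[rule_format, of Xp] this[rule_format, of Xm] this[rule_format, of Yp] this[rule_format, of Ym]
  show "(p a b \<and> z True) = (p a' b' \<and> z True)"
    by (intro bool_square[of "\<lambda>a b. p a b \<and> z True"]) (simp_all add: d)
qed

text \<open>If the cubes on the two sides of a square differ, the square is on the boundary; which
  of the two frames applies depends on the side that is filled.\<close>

lemma face_frame:
  "p True True \<Longrightarrow> z True \<noteq> z False \<Longrightarrow> is_frame p z (Xp, Zp) \<or> is_frame p z (Yp, Zm)"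
  "z True \<Longrightarrow> p True True \<noteq> p True False \<Longrightarrow> is_frame p z (Zp, Yp) \<or> is_frame p z (Xp, Ym)"
  "z True \<Longrightarrow> p True True \<noteq> p False True \<Longrightarrow> is_frame p z (Yp, Xp) \<or> is_frame p z (Zp, Xm)"
  by (auto simp: is_frame_def perp_def cfg_def crs_def)

lemma cubes1_shift: "cubes1 X = {\<lfloor>X\<rfloor> - shift b | b. b \<or> X \<in> \<int>}"
  by (cases "X \<in> \<int>") (auto simp: cubes1_def shift_def ceiling_altdef Ints_def intro: exI[of _ True] exI[of _ False])

lemma verts1_alt: "verts1 X = (if X \<in> \<int> then {\<lfloor>X\<rfloor>} else {\<lfloor>X\<rfloor>, \<lfloor>X\<rfloor> + 1})"
  by (auto simp: verts1_def ceiling_altdef Ints_def)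

text \<open>The smallest cell of a surface point touches a full and an empty cube, so it is a
  vertex, an edge or a square of the grid map and never a whole cube. The eight cases record which
  scaled coordinates are integers.\<close>

lemma hits_surface:
  assumes N: "N \<ge> 1" and S: "p \<in> genus_surface g"
  shows "hits N p \<subseteq> fst ` darts g N" "conn_in (adj g N) (hits N p)"
proof -
  obtain x y z where p: "p = (x, y, z)" by (metis prod_cases3)
  define X Y Z where "X = real N * x" and "Y = real N * y" and "Z = real N * z"
  define v where "v = (\<lfloor>X\<rfloor>, \<lfloor>Y\<rfloor>, \<lfloor>Z\<rfloor>)"
  let ?p = "pc g N v" and ?z = "zc N v"
  have cub: "cubes3 N p = {(\<lfloor>X\<rfloor> - shift a, \<lfloor>Y\<rfloor> - shift b, \<lfloor>Z\<rfloor> - shift c) | a b c. (a \<or> X \<in> \<int>) \<and> (b \<or> Y \<in> \<int>) \<and> (c \<or> Z \<in> \<int>)}"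
    unfolding p cubes3_def prod.case X_def[symmetric] Y_def[symmetric] Z_def[symmetric] cubes1_shift by blast
  have full: "full_cube g N (\<lfloor>X\<rfloor> - shift a, \<lfloor>Y\<rfloor> - shift b, \<lfloor>Z\<rfloor> - shift c) \<longleftrightarrow> ?p a b \<and> ?z c" for a b c
    by (simp add: full_cube_def pc_def zc_def v_def)
  obtain q1 where q1: "q1 \<in> cubes3 N p" "full_cube g N q1" using frontier_imp_mixed(1)[OF N S] by blast
  from q1(1)[unfolded cub mem_Collect_eq] obtain a b c where i1: "q1 = (\<lfloor>X\<rfloor> - shift a, \<lfloor>Y\<rfloor> - shift b, \<lfloor>Z\<rfloor> - shift c)"
    "a \<or> X \<in> \<int>" "b \<or> Y \<in> \<int>" "c \<or> Z \<in> \<int>" by (elim exE conjE)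
  note 1 = i1(2-4) q1(2)[unfolded i1(1) full]
  obtain q2 where q2: "q2 \<in> cubes3 N p" "\<not> full_cube g N q2" using frontier_imp_mixed(2)[OF N S] by blast
  from q2(1)[unfolded cub mem_Collect_eq] obtain a' b' c' where i2: "q2 = (\<lfloor>X\<rfloor> - shift a', \<lfloor>Y\<rfloor> - shift b', \<lfloor>Z\<rfloor> - shift c')"
    "a' \<or> X \<in> \<int>" "b' \<or> Y \<in> \<int>" "c' \<or> Z \<in> \<int>" by (elim exE conjE)
  note 2 = i2(2-4) q2(2)[unfolded i2(1) full]
  have h: "hits N p = verts1 X \<times> verts1 Y \<times> verts1 Z" unfolding p hits_def X_def Y_def Z_def by simp
  have fr: "(v, u, n) \<in> darts g N" if "is_frame ?p ?z (u, n)" for u n using that by (simp add: darts_def)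
  have edge: "{v, move u v} \<subseteq> fst ` darts g N \<and> conn_in (adj g N) {v, move u v}" if "is_frame ?p ?z (u, n)" for u n
    using dart_step[OF fr[OF that]] conn_in_edge[OF sym_adj] by blast
  note sq = dart_square[OF fr]
  have "hits N p \<subseteq> fst ` darts g N \<and> conn_in (adj g N) (hits N p)"
  proof (cases "X \<in> \<int>"; cases "Y \<in> \<int>"; cases "Z \<in> \<int>")
    assume c: "X \<in> \<int>" "Y \<in> \<int>" "Z \<in> \<int>"
    have "frames ?p ?z \<noteq> []" by (rule frame_local(5)[OF 1(4) 2(4)])
    then obtain x where "x \<in> set (frames ?p ?z)" by (cases "frames ?p ?z") auto
    then have "(v, x) \<in> darts g N" by (simp add: set_frames darts_def)
    then have "v \<in> fst ` darts g N" by (metis fst_conv image_eqI)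
    moreover have "hits N p = {v}" using c by (simp add: h verts1_alt v_def)
    ultimately show ?thesis by (simp add: conn_in_def)
  next
    assume c: "X \<in> \<int>" "Y \<in> \<int>" "Z \<notin> \<int>"
    then have "c" "c'" using 1 2 by auto
    then obtain n where "is_frame ?p ?z (Zp, n)" using edge_frame(3)[of ?p ?z a b a' b'] 1(4) 2(4) by auto
    moreover have "hits N p = {v, move Zp v}" using c by (auto simp: h verts1_alt v_def move_def)
    ultimately show ?thesis using edge by simp
  next
    assume c: "X \<in> \<int>" "Y \<notin> \<int>" "Z \<in> \<int>"
    then have "b" "b'" using 1 2 by auto
    then obtain n where "is_frame ?p ?z (Yp, n)" using edge_frame(2)[of ?p ?z a c a' c'] 1(4) 2(4) by auto
    moreover have "hits N p = {v, move Yp v}" using c by (auto simp: h verts1_alt v_def move_def)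
    ultimately show ?thesis using edge by simp
  next
    assume c: "X \<notin> \<int>" "Y \<in> \<int>" "Z \<in> \<int>"
    then have "a" "a'" using 1 2 by auto
    then obtain n where "is_frame ?p ?z (Xp, n)" using edge_frame(1)[of ?p ?z b c b' c'] 1(4) 2(4) by auto
    moreover have "hits N p = {v, move Xp v}" using c by (auto simp: h verts1_alt v_def move_def)
    ultimately show ?thesis using edge by simp
  next
    assume c: "X \<notin> \<int>" "Y \<notin> \<int>" "Z \<in> \<int>"
    then have "a" "a'" "b" "b'" using 1 2 by auto
    then have "?p True True" "?z True \<noteq> ?z False" using 1(4) 2(4) by (cases c; cases c'; auto)+
    note f = face_frame(1)[of ?p ?z, OF this]
    have hh: "hits N p = {v, move Xp v, move Yp (move Xp v), move Yp v}"
      "hits N p = {v, move Yp v, move Xp (move Yp v), move Xp v}"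
      using c by (auto simp: h verts1_alt v_def move_def)
    show ?thesis using f sq[of Xp Zp] sq[of Yp Zm] unfolding crs_def dir.case hh(1)[symmetric] hh(2)[symmetric] by blast
  next
    assume c: "X \<notin> \<int>" "Y \<in> \<int>" "Z \<notin> \<int>"
    then have "a" "a'" "c" "c'" using 1 2 by auto
    then have "?z True" "?p True True \<noteq> ?p True False" using 1(4) 2(4) by (cases b; cases b'; auto)+
    note f = face_frame(2)[of ?z ?p, OF this]
    have hh: "hits N p = {v, move Zp v, move Xp (move Zp v), move Xp v}"
      "hits N p = {v, move Xp v, move Zp (move Xp v), move Zp v}"
      using c by (auto simp: h verts1_alt v_def move_def)
    show ?thesis using f sq[of Zp Yp] sq[of Xp Ym] unfolding crs_def dir.case hh(1)[symmetric] hh(2)[symmetric] by blast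
  next
    assume c: "X \<in> \<int>" "Y \<notin> \<int>" "Z \<notin> \<int>"
    then have "b" "b'" "c" "c'" using 1 2 by auto
    then have "?z True" "?p True True \<noteq> ?p False True" using 1(4) 2(4) by (cases a; cases a'; auto)+
    note f = face_frame(3)[of ?z ?p, OF this]
    have hh: "hits N p = {v, move Yp v, move Zp (move Yp v), move Zp v}"
      "hits N p = {v, move Zp v, move Yp (move Zp v), move Yp v}"
      using c by (auto simp: h verts1_alt v_def move_def)
    show ?thesis using f sq[of Yp Xp] sq[of Zp Xm] unfolding crs_def dir.case hh(1)[symmetric] hh(2)[symmetric] by blast
  next
    assume c: "X \<notin> \<int>" "Y \<notin> \<int>" "Z \<notin> \<int>"
    then show ?thesis using 1 2 by auto
  qed
  then show "hits N p \<subseteq> fst ` darts g N" "conn_in (adj g N) (hits N p)" by auto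
qed

lemma hits_nonempty: "hits N p \<noteq> {}"
  by (cases p) (auto simp: hits_def verts1_def)

text \<open>Nearby points have nested sets of rounded vertices, each of them connected, so
  reachability from \<open>v\<close> is locally constant along \<open>X\<close>.\<close>

lemma hits_connected:
  assumes N: "N \<ge> 1" and X: "X \<subseteq> genus_surface g" "connected X"
  shows "conn_in (adj g N) (\<Union> (hits N ` X))"
  unfolding conn_in_def
proof (intro ballI)
  let ?A = "\<Union> (hits N ` X)"
  let ?S = "adj g N \<inter> ?A \<times> ?A"
  fix v w assume "v \<in> ?A" "w \<in> ?A"
  then obtain p q where pq: "p \<in> X" "v \<in> hits N p" "q \<in> X" "w \<in> hits N q" by auto
  define C where "C = {w. (v, w) \<in> ?S\<^sup>*}"
  have sub: "b \<in> C" if "r \<in> X" "a \<in> hits N r" "b \<in> hits N r" "a \<in> C" for r a b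
  proof -
    have "(a, b) \<in> (adj g N \<inter> hits N r \<times> hits N r)\<^sup>*"
      using hits_surface(2)[OF N, of r g] that X(1) unfolding conn_in_def by blast
    then have "(a, b) \<in> ?S\<^sup>*" by (rule rtrancl_in_mono) (use that in auto)
    then show ?thesis using that(4) unfolding C_def by auto
  qed
  have "(hits N p \<subseteq> C) = (hits N q \<subseteq> C)"
  proof (rule connected_local_const[OF X(2) pq(1,3)], rule ballI)
    fix r assume r: "r \<in> X"
    obtain e where e: "e > 0" "\<And>q. dist q r < e \<Longrightarrow> hits N r \<subseteq> hits N q" using near_point[OF N, of r] by blast
    obtain a where a: "a \<in> hits N r" using hits_nonempty by blast
    show "\<forall>\<^sub>F s in at r within X. (hits N r \<subseteq> C) = (hits N s \<subseteq> C)"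
      unfolding eventually_at
    proof (intro exI[of _ e] conjI ballI impI e(1))
      fix s assume s: "s \<in> X" "s \<noteq> r \<and> dist s r < e"
      then have rs: "hits N r \<subseteq> hits N s" using e(2) by blast
      show "(hits N r \<subseteq> C) = (hits N s \<subseteq> C)"
        using sub[OF s(1)] sub[OF r] a rs by blast
    qed
  qed
  moreover have "v \<in> C" by (simp add: C_def)
  then have "hits N p \<subseteq> C" using sub[OF pq(1,2)] by blast
  ultimately show "(v, w) \<in> ?S\<^sup>*" using pq unfolding C_def by blast
qed

text \<open>Every grid vertex is the rounding of a surface point, which lets connectedness of the
  surface pass to the grid map.\<close>

lemma tail_point:
  assumes N: "N \<ge> 1" and v: "(i, j, k) \<in> fst ` darts g N"
  defines "p \<equiv> (of_int i / real N, of_int j / real N, of_int k / real N)"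
  shows "p \<in> genus_surface g" "hits N p = {(i, j, k)}"
proof -
  have n: "real N * (of_int a / real N) = of_int a" for a using N by simp
  show "hits N p = {(i, j, k)}" unfolding p_def hits_def prod.case n by (simp add: verts1_def)
  obtain u m where "is_frame (pc g N (i, j, k)) (zc N (i, j, k)) (u, m)" using v unfolding darts_def by auto
  then have f: "cfg (pc g N (i, j, k)) (zc N (i, j, k)) u (crs m u) (neg m)" "\<not> cfg (pc g N (i, j, k)) (zc N (i, j, k)) u (crs m u) m"
    by (auto simp: is_frame_def)
  have cub: "(i - shift a, j - shift b, k - shift c) \<in> cubes3 N p" for a b c
    unfolding p_def cubes3_def prod.case n cubes1_def shift_def by auto
  obtain a b c a' b' c' where "full_cube g N (i - shift a, j - shift b, k - shift c)" "\<not> full_cube g N (i - shift a', j - shift b', k - shift c')"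
    using f unfolding cfg_def pc_def zc_def full_cube_def prod.case by blast
  then show "p \<in> genus_surface g" using mixed_imp_frontier[OF N cub _ cub] by blast
qed

section \<open>Connectedness of the surface\<close>

lemma plate_surface:
  assumes "(x, y, z) \<in> handlebody g" "c = 0 \<or> c = 1"
  shows "(x, y, c) \<in> genus_surface g"
proof (rule frontier_handlebodyI)
  show "(x, y, c) \<in> handlebody g" using assms by (auto simp: handlebody_def)
  fix e :: real assume "e > 0"
  show "\<exists>q. q \<notin> handlebody g \<and> dist q (x, y, c) < e"
  proof (intro exI conjI)
    show "(x, y, if c = 0 then - e / 2 else 1 + e / 2) \<notin> handlebody g" using \<open>e > 0\<close> by (auto simp: handlebody_def)
    show "dist (x, y, if c = 0 then - e / 2 else 1 + e / 2) (x, y, c) < e"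
      using dist_triple(4)[of x y "if c = 0 then - e / 2 else 1 + e / 2" x y c] \<open>e > 0\<close> assms(2) by auto
  qed
qed

text \<open>The handlebody is a product in the third coordinate, so a missing point near (x, y, z)
  gives one near (x, y, t).\<close>

lemma wall_surface:
  assumes S: "(x, y, z) \<in> genus_surface g" "0 < z" "z < 1" and t: "0 \<le> t" "t \<le> 1" and H: "(x, y, z) \<in> handlebody g"
  shows "(x, y, t) \<in> genus_surface g"
proof (rule frontier_handlebodyI)
  show "(x, y, t) \<in> handlebody g" using H t by (auto simp: handlebody_def)
  fix e :: real assume "e > 0"
  define d where "d = min (e / 2) (min z (1 - z))"
  have d: "d > 0" "d \<le> e / 2" "d \<le> z" "d \<le> 1 - z" using \<open>e > 0\<close> S(2,3) unfolding d_def by linarith+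
  have "(x, y, z) \<notin> interior (handlebody g)" using S(1) by (simp add: genus_surface_def frontier_def)
  then have "\<not> ball (x, y, z) d \<subseteq> handlebody g"
    using d(1) by (meson centre_in_ball interior_maximal open_ball subsetD)
  then obtain q where q: "dist (x, y, z) q < d" "q \<notin> handlebody g" by (meson mem_ball subsetI)
  obtain x' y' z' where q': "q = (x', y', z')" by (metis prod_cases3)
  have l: "\<bar>x - x'\<bar> < d" "\<bar>y - y'\<bar> < d" "\<bar>z - z'\<bar> < d"
    using q(1) dist_triple(1)[of x x' y z y' z'] dist_triple(2)[of y y' x z x' z'] dist_triple(3)[of z z' x y x' y'] unfolding q' by linarith+
  have "0 \<le> z'" "z' \<le> 1" using l d by linarith+
  then have "(x', y', t) \<notin> handlebody g" using q(2) t unfolding q' handlebody_def by auto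
  moreover have "dist (x', y', t) (x, y, t) < e" using dist_triple(4)[of x' y' t x y t] l d by linarith
  ultimately show "\<exists>q. q \<notin> handlebody g \<and> dist q (x, y, t) < e" by blast
qed

lemma connected_component_curve:
  fixes f :: "real \<Rightarrow> 'b::topological_space"
  assumes "continuous_on {min a b..max a b} f" "\<And>t. t \<in> {min a b..max a b} \<Longrightarrow> f t \<in> S"
  shows "connected_component S (f a) (f b)"
  unfolding connected_component_def
  using assms by (intro exI[of _ "f ` {min a b..max a b}"] conjI connected_continuous_image) auto

text \<open>A point on a wall slides up to the top. Within the top or bottom it moves away from the
  tunnels to a long side y = 0 or y = 3, then along that side to x = 0.\<close>

lemma connected_genus_surface: "connected (genus_surface g)"
proof -
  let ?S = "genus_surface g" and ?H = "handlebody g"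
  have top: "connected_component ?S (x, y, c) (0, 0, c)" if H: "(x, y, z) \<in> ?H" and c: "c = 0 \<or> c = 1" for x y z c
  proof -
    have r: "0 \<le> x" "x \<le> 2 * real g + 1" "0 \<le> y" "y \<le> 3" using H by (auto simp: handlebody_def)
    have row: "connected_component ?S (x, b, c) (0, b, c)" if "b = 0 \<or> b = 3" for b
      using that r by (intro connected_component_curve[where f = "\<lambda>t. (t, b, c)"] plate_surface[of _ _ 0, OF _ c] continuous_intros)
        (auto simp: handlebody_def)
    show ?thesis
    proof (cases "y \<ge> 2")
      case True
      have 1: "connected_component ?S (x, y, c) (x, 3, c)"
        using True r by (intro connected_component_curve[where f = "\<lambda>t. (x, t, c)"] plate_surface[of _ _ 0, OF _ c] continuous_intros)
          (auto simp: handlebody_def)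
      have 2: "connected_component ?S (0, 3, c) (0, 0, c)"
        by (intro connected_component_curve[where f = "\<lambda>t. (0, t, c)"] plate_surface[of _ _ 0, OF _ c] continuous_intros)
          (auto simp: handlebody_def)
      show ?thesis using connected_component_trans[OF connected_component_trans[OF 1 row] 2] by simp
    next
      case False
      have "connected_component ?S (x, y, c) (x, 0, c)"
        using False r H by (intro connected_component_curve[where f = "\<lambda>t. (x, t, c)"] plate_surface[of _ _ 0, OF _ c] continuous_intros)
          (auto simp: handlebody_def)
      then show ?thesis using connected_component_trans row by blast
    qed
  qed
  have corner: "(0, 0, t) \<in> ?S" if "0 \<le> t" "t \<le> 1" for t
  proof (rule frontier_handlebodyI)
    show "(0, 0, t) \<in> ?H" using that by (auto simp: handlebody_def)
    fix e :: real assume "e > 0"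
    moreover have "(- e / 2, 0, t) \<notin> ?H" using \<open>e > 0\<close> by (auto simp: handlebody_def)
    moreover have "dist (- e / 2, 0::real, t) (0, 0, t) < e" using dist_triple(4)[of "- e / 2" 0 t 0 0 t] \<open>e > 0\<close> by simp
    ultimately show "\<exists>q. q \<notin> ?H \<and> dist q (0, 0, t) < e" by blast
  qed
  have vert: "connected_component ?S (0, 0, 1) (0, 0, 0)"
    by (intro connected_component_curve[where f = "\<lambda>t. (0, 0, t)"] continuous_intros corner) auto
  have all: "connected_component ?S p (0, 0, 0)" if p: "p \<in> ?S" for p
  proof -
    obtain x y z where xyz: "p = (x, y, z)" by (metis prod_cases3)
    \<comment> \<open>On the unit grid, points near \<open>q\<close> touch only cubes that
      \<open>q\<close> touches, so the complement is open.\<close>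
    have "closed ?H"
      unfolding closed_def open_dist
    proof (intro ballI)
      fix q assume q: "q \<in> - ?H"
      obtain e where e: "e > 0" "\<And>r. dist r q < e \<Longrightarrow> cubes3 1 r \<subseteq> cubes3 1 q" using near_point[of 1 q] by auto
      have "r \<in> - ?H" if "dist r q < e" for r using e(2)[OF that] q handlebody_iff[of 1] by auto
      then show "\<exists>e>0. \<forall>r. dist r q < e \<longrightarrow> r \<in> - ?H" using e(1) by blast
    qed
    then have H: "(x, y, z) \<in> ?H" using p unfolding xyz genus_surface_def by (metis frontier_subset_closed subsetD)
    then have z: "0 \<le> z" "z \<le> 1" by (auto simp: handlebody_def)
    consider "z = 0" | "z = 1" | "0 < z" "z < 1" using z by linarith
    then show ?thesis
    proof cases
      case 1 then show ?thesis using top[OF H, of 0] xyz by simp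
    next
      case 2 then show ?thesis using connected_component_trans[OF top[OF H, of 1] vert] xyz by simp
    next
      case 3
      have "connected_component ?S (x, y, z) (x, y, 1)"
        using 3 by (intro connected_component_curve[where f = "\<lambda>t. (x, y, t)"] continuous_intros wall_surface[OF p[unfolded xyz] 3 _ _ H]) auto
      then show ?thesis using connected_component_trans[OF connected_component_trans[OF _ top[OF H, of 1]] vert] xyz by simp
    qed
  qed
  then show ?thesis unfolding connected_iff_connected_component
    by (meson connected_component_sym connected_component_trans)
qed

lemma conn_in_tails:
  assumes N: "N \<ge> 1" shows "conn_in (adj g N) (fst ` darts g N)"
proof -
  have "fst ` darts g N = \<Union> (hits N ` genus_surface g)"
  proof
    show "fst ` darts g N \<subseteq> \<Union> (hits N ` genus_surface g)"
    proof
      fix v assume v: "v \<in> fst ` darts g N"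
      obtain i j k where ijk: "v = (i, j, k)" by (metis prod_cases3)
      note t = tail_point[OF N v[unfolded ijk]]
      show "v \<in> \<Union> (hits N ` genus_surface g)" by (rule UN_I[OF t(1)]) (simp add: t(2) ijk)
    qed
    show "\<Union> (hits N ` genus_surface g) \<subseteq> fst ` darts g N" using hits_surface(1)[OF N] by blast
  qed
  then show ?thesis using hits_connected[OF N order_refl connected_genus_surface] by simp
qed

lemma conn_in_insert:
  assumes "sym R" "conn_in R A" "(a, b) \<in> R" "a \<in> A" shows "conn_in R (insert b A)"
proof (rule conn_inI[OF assms(1), of _ a])
  fix w assume w: "w \<in> insert b A"
  show "(a, w) \<in> (R \<inter> insert b A \<times> insert b A)\<^sup>*"
  proof (cases "w \<in> A")
    case True
    then have "(a, w) \<in> (R \<inter> A \<times> A)\<^sup>*" using assms(2,4) by (simp add: conn_in_def)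
    then show ?thesis by (rule rtrancl_in_mono) auto
  next
    case False
    then show ?thesis using w assms by auto
  qed
qed

text \<open>The disjoint connected seeds grow by one adjacent uncovered element at a time;
  connectedness of \<open>W\<close> provides such an element until everything is covered.\<close>

lemma extend_labels:
  assumes "finite W" "sym R" "conn_in R W" "V \<noteq> {}"
    and "\<And>v. v \<in> V \<Longrightarrow> M v \<subseteq> W \<and> M v \<noteq> {} \<and> conn_in R (M v)"
    and "\<And>u v. u \<in> V \<Longrightarrow> v \<in> V \<Longrightarrow> u \<noteq> v \<Longrightarrow> M u \<inter> M v = {}"
  shows "\<exists>l. (\<forall>w\<in>W. l w \<in> V) \<and> (\<forall>v\<in>V. M v \<subseteq> {w \<in> W. l w = v} \<and> conn_in R {w \<in> W. l w = v})"
  using assms(5,6)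
proof (induction "card (W - \<Union> (M ` V))" arbitrary: M rule: less_induct)
  case less
  note M = less.prems(1) and disj = less.prems(2)
  show ?case
  proof (cases "W \<subseteq> \<Union> (M ` V)")
    case True
    define l where "l w = (SOME v. v \<in> V \<and> w \<in> M v)" for w
    have l: "l w \<in> V \<and> w \<in> M (l w)" if "w \<in> W" for w
      unfolding l_def by (rule someI_ex) (use True that in blast)
    have "{w \<in> W. l w = v} = M v" if "v \<in> V" for v
      using l M[OF that] disj[OF _ that] that by blast
    then show ?thesis using l M by (intro exI[of _ l]) auto
  next
    case False
    then obtain b where b: "b \<in> W" "b \<notin> \<Union> (M ` V)" by auto
    obtain v a where "v \<in> V" "a \<in> M v" using assms(4) M by blast
    then have aW: "a \<in> W" "a \<in> \<Union> (M ` V)" using M by auto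
    have "(a, b) \<in> (R \<inter> W \<times> W)\<^sup>*" using assms(3) b aW by (simp add: conn_in_def)
    from rtrancl_exit[OF this aW(2) b(2)]
    obtain x y where xy: "(x, y) \<in> R \<inter> W \<times> W" "x \<in> \<Union> (M ` V)" "y \<notin> \<Union> (M ` V)" by (elim exE conjE)
    then obtain u where u: "u \<in> V" "x \<in> M u" by auto
    define M' where "M' = M(u := insert y (M u))"
    have un: "\<Union> (M' ` V) = insert y (\<Union> (M ` V))" using u unfolding M'_def by (auto split: if_splits)
    have "card (W - \<Union> (M' ` V)) < card (W - \<Union> (M ` V))"
      unfolding un using xy assms(1) by (intro psubset_card_mono) auto
    moreover have "M' v \<subseteq> W \<and> M' v \<noteq> {} \<and> conn_in R (M' v)" if "v \<in> V" for v
      using M[OF that] xy u conn_in_insert[OF assms(2), of "M u" x y] unfolding M'_def by auto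
    moreover have "M' v \<inter> M' v' = {}" if "v \<in> V" "v' \<in> V" "v \<noteq> v'" for v v'
      using disj[OF that] xy(3) that unfolding M'_def by auto
    ultimately obtain l where l: "\<forall>w\<in>W. l w \<in> V" "\<And>v. v \<in> V \<Longrightarrow> M' v \<subseteq> {w \<in> W. l w = v} \<and> conn_in R {w \<in> W. l w = v}"
      using less.hyps[of M'] by blast
    moreover have "M v \<subseteq> M' v" for v unfolding M'_def by auto
    ultimately show ?thesis by (intro exI[of _ l]) blast
  qed
qed

text \<open>The part of \<open>Z e\<close> reachable from \<open>M (a e)\<close> without entering
  \<open>M (b e)\<close> is added to the branch set of \<open>a e\<close>. A path through
  \<open>Z e\<close> leaves this part by an edge into \<open>M (b e)\<close>, which is the edge
  sought.\<close>

lemma assign_edges: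
  assumes R: "sym R"
    and M: "\<And>v. v \<in> V \<Longrightarrow> M v \<subseteq> W \<and> M v \<noteq> {} \<and> conn_in R (M v)"
    and Mdisj: "\<And>u v. u \<in> V \<Longrightarrow> v \<in> V \<Longrightarrow> u \<noteq> v \<Longrightarrow> M u \<inter> M v = {}"
    and e: "\<And>e. e \<in> E \<Longrightarrow> a e \<in> V \<and> b e \<in> V \<and> a e \<noteq> b e"
    and Z: "\<And>e. e \<in> E \<Longrightarrow> Z e \<subseteq> W \<and> conn_in R (Z e) \<and> Z e \<inter> M (a e) \<noteq> {} \<and> Z e \<inter> M (b e) \<noteq> {}"
    and ZM: "\<And>e v. e \<in> E \<Longrightarrow> v \<in> V \<Longrightarrow> v \<noteq> a e \<Longrightarrow> v \<noteq> b e \<Longrightarrow> Z e \<inter> M v = {}"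
    and ZZ: "\<And>e f. e \<in> E \<Longrightarrow> f \<in> E \<Longrightarrow> e \<noteq> f \<Longrightarrow> Z e \<inter> Z f = {}"
  shows "\<exists>M'. (\<forall>v\<in>V. M' v \<subseteq> W \<and> M' v \<noteq> {} \<and> conn_in R (M' v)) \<and>
    (\<forall>u\<in>V. \<forall>v\<in>V. u \<noteq> v \<longrightarrow> M' u \<inter> M' v = {}) \<and>
    (\<forall>e\<in>E. \<exists>x y. (x, y) \<in> R \<and> x \<in> M' (a e) \<and> y \<in> M' (b e))"
proof -
  define S where "S e = R \<inter> (Z e - M (b e)) \<times> (Z e - M (b e))" for e
  define P where "P e = {w \<in> Z e - M (b e). \<exists>m\<in>M (a e) \<inter> Z e. (m, w) \<in> (S e)\<^sup>*}" for e
  define M' where "M' v = M v \<union> \<Union> (P ` {e \<in> E. a e = v})" for v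
  have PZ: "P e \<subseteq> Z e - M (b e)" for e by (auto simp: P_def)
  have startP: "m \<in> P e" if "e \<in> E" "m \<in> M (a e)" "m \<in> Z e" for m e
    using that Mdisj[of "a e" "b e"] e[of e] unfolding P_def by blast
  have nextP: "y \<in> P e" if "x \<in> P e" "(x, y) \<in> S e" for x y e
    using that unfolding P_def S_def by (auto intro: rtrancl_into_rtrancl)
  have reach: "\<exists>m\<in>M (a e) \<inter> Z e. (m, w) \<in> (R \<inter> P e \<times> P e)\<^sup>*" if eE: "e \<in> E" and w: "w \<in> P e" for e w
  proof -
    obtain m where m: "m \<in> M (a e) \<inter> Z e" "(m, w) \<in> (S e)\<^sup>*" using w by (auto simp: P_def)
    from m(2) have "(m, w) \<in> (R \<inter> P e \<times> P e)\<^sup>* \<and> w \<in> P e"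
    proof (induction rule: rtrancl_induct)
      case base then show ?case using startP[OF eE] m by auto
    next
      case (step y z)
      then show ?case using nextP[of y e z]
        by (auto simp: S_def intro: rtrancl_into_rtrancl)
    qed
    then show ?thesis using m by auto
  qed
  have c1: "M' v \<subseteq> W \<and> M' v \<noteq> {} \<and> conn_in R (M' v)" if v: "v \<in> V" for v
  proof (intro conjI)
    show "M' v \<subseteq> W" using M[OF v] Z PZ unfolding M'_def by blast
    show "M' v \<noteq> {}" using M[OF v] unfolding M'_def by blast
    obtain m0 where m0: "m0 \<in> M v" using M[OF v] by blast
    have in0: "(m0, m) \<in> (R \<inter> M' v \<times> M' v)\<^sup>*" if "m \<in> M v" for m
    proof -
      have "(m0, m) \<in> (R \<inter> M v \<times> M v)\<^sup>*" using M[OF v] m0 that by (simp add: conn_in_def)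
      then show ?thesis by (rule rtrancl_in_mono) (auto simp: M'_def)
    qed
    show "conn_in R (M' v)"
    proof (rule conn_inI[OF R, of _ m0])
      fix w assume "w \<in> M' v"
      then consider "w \<in> M v" | e where "e \<in> E" "a e = v" "w \<in> P e" unfolding M'_def by auto
      then show "(m0, w) \<in> (R \<inter> M' v \<times> M' v)\<^sup>*"
      proof cases
        case 1 then show ?thesis by (rule in0)
      next
        case 2
        then obtain m where m: "m \<in> M v" "(m, w) \<in> (R \<inter> P e \<times> P e)\<^sup>*" using reach by blast
        have "(m, w) \<in> (R \<inter> M' v \<times> M' v)\<^sup>*" using m(2) by (rule rtrancl_in_mono) (use 2 in \<open>auto simp: M'_def\<close>)
        then show ?thesis using in0[OF m(1)] by auto
      qed
    qed
  qed
  have c2: "M' u \<inter> M' v = {}" if uv: "u \<in> V" "v \<in> V" "u \<noteq> v" for u v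
  proof -
    have PM: "P e \<inter> M x = {}" if "e \<in> E" "x \<in> V" "x \<noteq> a e" for e x
      using PZ[of e] ZM[OF that(1,2,3)] by (cases "x = b e") auto
    have PP: "P e \<inter> P f = {}" if "e \<in> E" "f \<in> E" "a e \<noteq> a f" for e f
      using PZ[of e] PZ[of f] ZZ[of e f] that by blast
    show ?thesis using Mdisj[OF uv] PM PP uv unfolding M'_def by blast
  qed
  have c3: "\<exists>x y. (x, y) \<in> R \<and> x \<in> M' (a e) \<and> y \<in> M' (b e)" if eE: "e \<in> E" for e
  proof -
    obtain m m' where m: "m \<in> Z e" "m \<in> M (a e)" and m': "m' \<in> Z e" "m' \<in> M (b e)" using Z[OF eE] by blast
    have pth: "(m, m') \<in> (R \<inter> Z e \<times> Z e)\<^sup>*" using Z[OF eE] m m' by (simp add: conn_in_def)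
    have mP: "m \<in> P e" using startP[OF eE] m by simp
    have "m' \<notin> P e" using PZ m' by blast
    from rtrancl_exit[OF pth mP this]
    obtain x y where xy: "(x, y) \<in> R \<inter> Z e \<times> Z e" "x \<in> P e" "y \<notin> P e" by (elim exE conjE)
    have "y \<in> M (b e)"
    proof (rule ccontr)
      assume "y \<notin> M (b e)"
      then have "(x, y) \<in> S e" using xy PZ[of e] unfolding S_def by blast
      then show False using nextP xy by blast
    qed
    then show ?thesis using xy eE unfolding M'_def by blast
  qed
  show ?thesis
  proof (intro exI[of _ M'] conjI ballI impI)
    show "M' v \<subseteq> W" "M' v \<noteq> {}" "conn_in R (M' v)" if "v \<in> V" for v using c1[OF that] by auto
  qed (use c2 c3 in auto)
qed

text \<open>The enlarged branch sets, extended to all grid vertices, become the labels of the grid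
  map. \<open>K\<close> consists of one dart per edge of the graph and its reversal; contracting and
  deleting the rest leaves a rotation system of the graph.\<close>

lemma grid_minor:
  assumes N: "N \<ge> 1" and V: "V \<noteq> {}"
    and M: "\<And>v. v \<in> V \<Longrightarrow> M v \<subseteq> fst ` darts g N \<and> M v \<noteq> {} \<and> conn_in (adj g N) (M v)"
    and Mdisj: "\<And>u v. u \<in> V \<Longrightarrow> v \<in> V \<Longrightarrow> u \<noteq> v \<Longrightarrow> M u \<inter> M v = {}"
    and e: "\<And>e. e \<in> E \<Longrightarrow> e = {a e, b e} \<and> a e \<in> V \<and> b e \<in> V \<and> a e \<noteq> b e"
    and Z: "\<And>e. e \<in> E \<Longrightarrow> Z e \<subseteq> fst ` darts g N \<and> conn_in (adj g N) (Z e) \<and> Z e \<inter> M (a e) \<noteq> {} \<and> Z e \<inter> M (b e) \<noteq> {}"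
    and ZM: "\<And>e v. e \<in> E \<Longrightarrow> v \<in> V \<Longrightarrow> v \<noteq> a e \<Longrightarrow> v \<noteq> b e \<Longrightarrow> Z e \<inter> M v = {}"
    and ZZ: "\<And>e f. e \<in> E \<Longrightarrow> f \<in> E \<Longrightarrow> e \<noteq> f \<Longrightarrow> Z e \<inter> Z f = {}"
    and cover: "\<And>v. v \<in> V \<Longrightarrow> \<exists>e\<in>E. v \<in> e"
  shows "\<exists>(K :: dart set) \<tau> \<alpha> h. labelled_map K \<tau> \<alpha> h \<and> h ` K = V \<and>
     (\<forall>x\<in>K. \<forall>y\<in>K. h x = h y \<longrightarrow> y \<in> orbit \<tau> x) \<and>
     bij_betw (\<lambda>x. (h x, h (\<alpha> x))) K {(u, v). {u, v} \<in> E} \<and> 4 - 4 * int g \<le> euler2 K \<tau> \<alpha>"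
proof -
  let ?D = "darts g N" and ?W = "fst ` darts g N" and ?R = "adj g N" and ?\<alpha> = "galpha g N"
  have e': "a e \<in> V \<and> b e \<in> V \<and> a e \<noteq> b e" if "e \<in> E" for e using e[OF that] by blast
  have "\<exists>M'. (\<forall>v\<in>V. M' v \<subseteq> ?W \<and> M' v \<noteq> {} \<and> conn_in ?R (M' v)) \<and>
    (\<forall>u\<in>V. \<forall>v\<in>V. u \<noteq> v \<longrightarrow> M' u \<inter> M' v = {}) \<and>
    (\<forall>e\<in>E. \<exists>x y. (x, y) \<in> ?R \<and> x \<in> M' (a e) \<and> y \<in> M' (b e))"
    by (rule assign_edges[OF sym_adj]) (fact M Mdisj e' Z ZM ZZ)+
  then obtain M' where MM: "(\<forall>v\<in>V. M' v \<subseteq> ?W \<and> M' v \<noteq> {} \<and> conn_in ?R (M' v)) \<and>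
    (\<forall>u\<in>V. \<forall>v\<in>V. u \<noteq> v \<longrightarrow> M' u \<inter> M' v = {}) \<and>
    (\<forall>e\<in>E. \<exists>x y. (x, y) \<in> ?R \<and> x \<in> M' (a e) \<and> y \<in> M' (b e))" by (elim exE)
  have M': "\<And>v. v \<in> V \<Longrightarrow> M' v \<subseteq> ?W \<and> M' v \<noteq> {} \<and> conn_in ?R (M' v)"
    "\<And>u v. u \<in> V \<Longrightarrow> v \<in> V \<Longrightarrow> u \<noteq> v \<Longrightarrow> M' u \<inter> M' v = {}"
    "\<And>e. e \<in> E \<Longrightarrow> \<exists>x y. (x, y) \<in> ?R \<and> x \<in> M' (a e) \<and> y \<in> M' (b e)"
    using MM by simp_all
  have "finite ?W" using finite_darts by simp
  then have "\<exists>l. (\<forall>w\<in>?W. l w \<in> V) \<and> (\<forall>v\<in>V. M' v \<subseteq> {w \<in> ?W. l w = v} \<and> conn_in ?R {w \<in> ?W. l w = v})"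
    by (rule extend_labels[OF _ sym_adj conn_in_tails[OF N] V]) (fact M'(1,2))+
  then obtain l where ll: "(\<forall>w\<in>?W. l w \<in> V) \<and> (\<forall>v\<in>V. M' v \<subseteq> {w \<in> ?W. l w = v} \<and> conn_in ?R {w \<in> ?W. l w = v})"
    by (elim exE)
  then have l: "\<forall>w\<in>?W. l w \<in> V" "\<And>v. v \<in> V \<Longrightarrow> M' v \<subseteq> {w \<in> ?W. l w = v} \<and> conn_in ?R {w \<in> ?W. l w = v}"
    by simp_all
  define h where "h x = l (fst x)" for x :: dart
  have fc: "fibre_connected ?D (gsigma g N) ?\<alpha> h"
    unfolding fibre_connected_def
  proof (intro allI impI ballI)
    fix P x y
    assume P1: "\<forall>x\<in>?D. P x \<longrightarrow> P (gsigma g N x)" and P2: "\<forall>x\<in>?D. h x = h (?\<alpha> x) \<longrightarrow> P x \<longrightarrow> P (?\<alpha> x)"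
      and xy: "x \<in> ?D" "y \<in> ?D" "h x = h y" "P x"
    have same: "P z'" if "z \<in> ?D" "z' \<in> ?D" "fst z = fst z'" "P z" for z z'
    proof -
      have "orbit (gsigma g N) z \<subseteq> {z \<in> ?D. P z}"
        using P1 that gsigma_dart by (intro orbit_least) auto
      then show ?thesis using gsigma_orbit[OF that(1)] that by auto
    qed
    let ?A = "{w \<in> ?W. l w = h x}"
    have "h x \<in> V" using l(1) xy(1) by (auto simp: h_def)
    then have "conn_in ?R ?A" using l(2) by blast
    moreover have "fst x \<in> ?A" "fst y \<in> ?A" using xy by (auto simp: h_def)
    ultimately have "(fst x, fst y) \<in> (?R \<inter> ?A \<times> ?A)\<^sup>*" unfolding conn_in_def by blast
    then have "\<forall>z\<in>?D. fst z = fst y \<longrightarrow> P z"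
    proof (induction rule: rtrancl_induct)
      case base then show ?case using same xy by metis
    next
      case (step u w)
      then obtain d where d: "d \<in> ?D" "u = fst d" "w = fst (?\<alpha> d)" by (auto simp: adj_def)
      have "h d = h (?\<alpha> d)" using step(2) d by (simp add: h_def)
      then have "P (?\<alpha> d)" using step(3) d P2 by blast
      then show ?case using same[OF galpha_dart(1)[OF d(1)]] d by auto
    qed
    then show "P y" using xy by blast
  qed
  have lm: "labelled_map ?D (gsigma g N) ?\<alpha> h"
    unfolding labelled_map_def
    using finite_darts gsigma_permutes galpha_permutes galpha_dart fc gsigma_dart(2) by (auto simp: h_def)
  have "\<exists>d\<in>?D. h d = a e \<and> h (?\<alpha> d) = b e" if eE: "e \<in> E" for e
  proof -
    obtain x y where xy: "(x, y) \<in> ?R" "x \<in> M' (a e)" "y \<in> M' (b e)" using M'(3)[OF eE] by auto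
    then obtain d where "d \<in> ?D" "x = fst d" "y = fst (?\<alpha> d)" by (auto simp: adj_def)
    then show ?thesis using xy l(2)[of "a e"] l(2)[of "b e"] e[OF eE] unfolding h_def by auto
  qed
  then obtain d where d: "\<And>e. e \<in> E \<Longrightarrow> d e \<in> ?D \<and> h (d e) = a e \<and> h (?\<alpha> (d e)) = b e" by metis
  define K where "K = d ` E \<union> (\<lambda>e. ?\<alpha> (d e)) ` E"
  have dd: "d e \<in> ?D" "h (d e) = a e" "h (?\<alpha> (d e)) = b e" "?\<alpha> (d e) \<in> ?D" "?\<alpha> (?\<alpha> (d e)) = d e"
    if "e \<in> E" for e
    using d[OF that] galpha_dart(1,2)[of "d e" g N] by blast+
  have Kcase: "\<exists>e\<in>E. x = d e \<or> x = ?\<alpha> (d e)" if "x \<in> K" for x using that unfolding K_def by blast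
  have Kin: "d e \<in> K" "?\<alpha> (d e) \<in> K" if "e \<in> E" for e using that unfolding K_def by blast+
  have KD: "K \<subseteq> ?D" using dd Kcase by blast
  have Kh: "\<exists>e\<in>E. (x = d e \<and> h x = a e \<and> h (?\<alpha> x) = b e) \<or> (x = ?\<alpha> (d e) \<and> h x = b e \<and> h (?\<alpha> x) = a e)" if x: "x \<in> K" for x
  proof -
    obtain e where e: "e \<in> E" "x = d e \<or> x = ?\<alpha> (d e)" using Kcase[OF x] by blast
    then show ?thesis using dd[OF e(1)] by (intro bexI[of _ e]) auto
  qed
  have Ka: "?\<alpha> x \<in> K" if x: "x \<in> K" for x
  proof -
    obtain e where e: "e \<in> E" "x = d e \<or> x = ?\<alpha> (d e)" using Kcase[OF x] by blast
    then show ?thesis using dd(5)[OF e(1)] Kin[OF e(1)] by auto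
  qed
  have Kne: "h (?\<alpha> x) \<noteq> h x" if xK: "x \<in> K" for x 
  proof -
    obtain p where "p \<in> E" "(h x = a p \<and> h (?\<alpha> x) = b p) \<or> (h x = b p \<and> h (?\<alpha> x) = a p)" using Kh[OF xK] by blast
    then show ?thesis using e'[of p] by auto
  qed
  have KV: "V \<subseteq> h ` K"
  proof
    fix v assume "v \<in> V"
    then obtain e' where e': "e' \<in> E" "v \<in> e'" using cover by auto
    then have "v = a e' \<or> v = b e'" using e[OF e'(1)] by auto
    then show "v \<in> h ` K" using d[OF e'(1)] e'(1) unfolding K_def by force
  qed
  have DV: "h ` ?D \<subseteq> V" using l(1) by (auto simp: h_def)
  have hK: "h ` K = h ` ?D" "h ` K = V" using KV DV KD by auto
  have "\<exists>\<tau> \<alpha>. labelled_map K \<tau> \<alpha> h \<and> (\<forall>x\<in>K. \<alpha> x = ?\<alpha> x) \<and>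
     (\<forall>x\<in>K. \<forall>y\<in>K. h x = h y \<longrightarrow> y \<in> orbit \<tau> x) \<and> euler2 ?D (gsigma g N) ?\<alpha> \<le> euler2 K \<tau> \<alpha>"
    by (rule map_minor[OF lm KD _ _ hK(1)]) (fact Ka Kne)+
  then obtain \<tau> \<alpha> where stt: "labelled_map K \<tau> \<alpha> h \<and> (\<forall>x\<in>K. \<alpha> x = ?\<alpha> x) \<and>
     (\<forall>x\<in>K. \<forall>y\<in>K. h x = h y \<longrightarrow> y \<in> orbit \<tau> x) \<and> euler2 ?D (gsigma g N) ?\<alpha> \<le> euler2 K \<tau> \<alpha>" by (elim exE)
  then have st: "labelled_map K \<tau> \<alpha> h" "\<And>x. x \<in> K \<Longrightarrow> \<alpha> x = ?\<alpha> x"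
    "\<forall>x\<in>K. \<forall>y\<in>K. h x = h y \<longrightarrow> y \<in> orbit \<tau> x" "euler2 ?D (gsigma g N) ?\<alpha> \<le> euler2 K \<tau> \<alpha>"
    by simp_all
  have "bij_betw (\<lambda>x. (h x, h (\<alpha> x))) K {(u, v). {u, v} \<in> E}"
    unfolding bij_betw_def
  proof
    show "inj_on (\<lambda>x. (h x, h (\<alpha> x))) K"
    proof (rule inj_onI)
      fix x y assume x: "x \<in> K" and y: "y \<in> K" and eq: "(h x, h (\<alpha> x)) = (h y, h (\<alpha> y))"
      obtain p where p: "p \<in> E" "(x = d p \<and> h x = a p \<and> h (?\<alpha> x) = b p) \<or> (x = ?\<alpha> (d p) \<and> h x = b p \<and> h (?\<alpha> x) = a p)"
        using Kh[OF x] by auto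
      obtain q where q: "q \<in> E" "(y = d q \<and> h y = a q \<and> h (?\<alpha> y) = b q) \<or> (y = ?\<alpha> (d q) \<and> h y = b q \<and> h (?\<alpha> y) = a q)"
        using Kh[OF y] by auto
      have hh: "h x = h y" "h (?\<alpha> x) = h (?\<alpha> y)" using eq st(2) x y by auto
      have "{a p, b p} = {a q, b q}" using p(2) q(2) hh by auto
      then have pq: "p = q" using conjunct1[OF e[OF p(1)]] conjunct1[OF e[OF q(1)]] by simp
      have "a p \<noteq> b p" using e[OF p(1)] by simp
      then show "x = y" using p(2) q(2) hh unfolding pq by auto
    qed
    show "(\<lambda>x. (h x, h (\<alpha> x))) ` K = {(u, v). {u, v} \<in> E}"
    proof
      show "(\<lambda>x. (h x, h (\<alpha> x))) ` K \<subseteq> {(u, v). {u, v} \<in> E}"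
      proof clarify
        fix x assume x: "x \<in> K"
        obtain p where p: "p \<in> E" "(x = d p \<and> h x = a p \<and> h (?\<alpha> x) = b p) \<or> (x = ?\<alpha> (d p) \<and> h x = b p \<and> h (?\<alpha> x) = a p)"
          using Kh[OF x] by auto
        then have "{h x, h (\<alpha> x)} = p" using e[OF p(1)] st(2)[OF x] by (auto simp: insert_commute)
        then show "{h x, h (\<alpha> x)} \<in> E" using p by simp
      qed
      show "{(u, v). {u, v} \<in> E} \<subseteq> (\<lambda>x. (h x, h (\<alpha> x))) ` K"
      proof clarify
        fix u v assume uv: "{u, v} \<in> E"
        let ?d = "d {u, v}"
        have dk: "?d \<in> K" "?\<alpha> ?d \<in> K" using uv unfolding K_def by auto
        have aa: "?\<alpha> (?\<alpha> ?d) = ?d" using d[OF uv] galpha_dart(2) by blast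
        have "{a {u, v}, b {u, v}} = {u, v}" using e[OF uv] by simp
        then consider "u = a {u, v}" "v = b {u, v}" | "u = b {u, v}" "v = a {u, v}" by (auto simp: doubleton_eq_iff)
        then show "(u, v) \<in> (\<lambda>x. (h x, h (\<alpha> x))) ` K"
        proof cases
          case 1
          then have "(u, v) = (h ?d, h (\<alpha> ?d))" using d[OF uv] st(2)[OF dk(1)] by simp
          then show ?thesis using dk by blast
        next
          case 2
          then have "(u, v) = (h (?\<alpha> ?d), h (\<alpha> (?\<alpha> ?d)))" using d[OF uv] st(2)[OF dk(2)] aa by simp
          then show ?thesis using dk by blast
        qed
      qed
    qed
  qed
  then show ?thesis using st hK(2) order_trans[OF euler_grid[OF N] st(4)] by blast
qed

section \<open>The rotation system of an embedded graph\<close>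

lemma finite_separation:
  fixes \<C> :: "'a::heine_borel set set"
  assumes "finite \<C>" "\<And>A. A \<in> \<C> \<Longrightarrow> compact A"
  shows "\<exists>d>0. \<forall>A\<in>\<C>. \<forall>B\<in>\<C>. A \<inter> B = {} \<longrightarrow> (\<forall>x\<in>A. \<forall>y\<in>B. d \<le> dist x y)"
proof -
  have "\<exists>d>0. A \<inter> B = {} \<longrightarrow> (\<forall>x\<in>A. \<forall>y\<in>B. d \<le> dist x y)" if "A \<in> \<C>" "B \<in> \<C>" for A B
  proof (cases "A \<inter> B = {}")
    case True
    then show ?thesis using separate_compact_closed[of A B] assms(2)[OF that(1)] compact_imp_closed[OF assms(2)[OF that(2)]] by blast
  qed (auto intro: exI[of _ 1])
  then obtain d where d: "\<And>A B. A \<in> \<C> \<Longrightarrow> B \<in> \<C> \<Longrightarrow> d A B > 0 \<and> (A \<inter> B = {} \<longrightarrow> (\<forall>x\<in>A. \<forall>y\<in>B. d A B \<le> dist x y))"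
    by metis
  define \<D> where "\<D> = insert 1 ((\<lambda>(A, B). d A B) ` (\<C> \<times> \<C>))"
  have fin: "finite \<D>" using assms(1) by (simp add: \<D>_def)
  have "Min \<D> > 0" using fin d by (subst Min_gr_iff) (auto simp: \<D>_def)
  moreover have "Min \<D> \<le> d A B" if "A \<in> \<C>" "B \<in> \<C>" for A B
    using fin that by (intro Min_le) (auto simp: \<D>_def)
  ultimately show ?thesis using d by (intro exI[of _ "Min \<D>"]) (meson order_trans)
qed

text \<open>In every coordinate a common vertex is within 1 / N of both points; three coordinates
  give 6 / N.\<close>

lemma hits_close:
  assumes N: "N \<ge> 1" and w: "w \<in> hits N p" "w \<in> hits N q"
  shows "dist p q \<le> 6 / real N"
proof -
  obtain x y z where p: "p = (x, y, z)" by (metis prod_cases3)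
  obtain x' y' z' where q: "q = (x', y', z')" by (metis prod_cases3)
  obtain i j k where ijk: "w = (i, j, k)" by (metis prod_cases3)
  have 1: "\<bar>of_int i - real N * x\<bar> \<le> 1" if "i \<in> verts1 (real N * x)" for i x
    using that by (auto simp: verts1_def abs_le_iff) linarith+
  have c: "\<bar>x - x'\<bar> \<le> 2 / real N" if "i \<in> verts1 (real N * x)" "i \<in> verts1 (real N * x')" for i x x'
  proof -
    have "\<bar>real N * x - real N * x'\<bar> \<le> 2" using 1[OF that(1)] 1[OF that(2)] by linarith
    moreover have "\<bar>real N * x - real N * x'\<bar> = real N * \<bar>x - x'\<bar>" by (simp add: abs_mult right_diff_distrib[symmetric])
    ultimately show ?thesis using N by (simp add: field_simps)
  qed
  have "\<bar>x - x'\<bar> \<le> 2 / real N" "\<bar>y - y'\<bar> \<le> 2 / real N" "\<bar>z - z'\<bar> \<le> 2 / real N"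
    using w unfolding p q ijk hits_def by (auto intro: c)
  then have "dist p q \<le> 2 / real N + 2 / real N + 2 / real N"
    unfolding p q using dist_triple(4)[of x y z x' y' z'] by linarith
  then show ?thesis by simp
qed

text \<open>A vertex together with the adjacent thirds of its arcs forms one connected set, and the
  middle thirds link these sets. By compactness, disjoint sets among them have a positive distance
  \<open>d\<close>; on a grid with 6 / N < d their roundings stay disjoint, while connectedness and
  intersections are inherited.\<close>

theorem rotation_system:
  fixes V :: "'v set"
  assumes G: "simple_graph V E" and emb: "embeddable V E (genus_surface g)"
    and V: "V \<noteq> {}" and cover: "\<And>v. v \<in> V \<Longrightarrow> \<exists>e\<in>E. v \<in> e"
  shows "\<exists>(K :: dart set) \<tau> \<alpha> h. labelled_map K \<tau> \<alpha> h \<and> h ` K = V \<and>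
     (\<forall>x\<in>K. \<forall>y\<in>K. h x = h y \<longrightarrow> y \<in> orbit \<tau> x) \<and>
     bij_betw (\<lambda>x. (h x, h (\<alpha> x))) K {(u, v). {u, v} \<in> E} \<and> 4 - 4 * int g \<le> euler2 K \<tau> \<alpha>"
proof -
  let ?S = "genus_surface g"
  from emb obtain p \<gamma> where emb': "inj_on p V \<and> p ` V \<subseteq> ?S \<and>
        (\<forall>e\<in>E. arc (\<gamma> e) \<and> path_image (\<gamma> e) \<subseteq> ?S \<and>
           {pathstart (\<gamma> e), pathfinish (\<gamma> e)} = p ` e \<and> path_image (\<gamma> e) \<inter> p ` V = p ` e) \<and>
        (\<forall>e\<in>E. \<forall>f\<in>E. e \<noteq> f \<longrightarrow> path_image (\<gamma> e) \<inter> path_image (\<gamma> f) \<subseteq> p ` (e \<inter> f))"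
    unfolding embeddable_def by (elim exE)
  have p: "inj_on p V" "p ` V \<subseteq> ?S"
    and arc: "\<And>e. e \<in> E \<Longrightarrow> arc (\<gamma> e)" and img: "\<And>e. e \<in> E \<Longrightarrow> path_image (\<gamma> e) \<subseteq> ?S"
    and ends: "\<And>e. e \<in> E \<Longrightarrow> {pathstart (\<gamma> e), pathfinish (\<gamma> e)} = p ` e"
    and thru: "\<And>e. e \<in> E \<Longrightarrow> path_image (\<gamma> e) \<inter> p ` V = p ` e"
    and cross: "\<And>e f. e \<in> E \<Longrightarrow> f \<in> E \<Longrightarrow> e \<noteq> f \<Longrightarrow> path_image (\<gamma> e) \<inter> path_image (\<gamma> f) \<subseteq> p ` (e \<inter> f)"
    using emb' by blast+
  have finV: "finite V" and Esub: "\<And>e. e \<in> E \<Longrightarrow> e \<subseteq> V \<and> card e = 2" using G by (auto simp: simple_graph_def)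
  have "E \<subseteq> Pow V" using Esub by auto
  then have finE: "finite E" using finV by (meson finite_Pow_iff finite_subset)
  have inj: "\<gamma> e s = \<gamma> e t \<longleftrightarrow> s = t" if "e \<in> E" "s \<in> {0..1}" "t \<in> {0..1}" for e s t
    using arc[OF that(1)] that(2,3) by (auto simp: arc_def dest: inj_onD)
  have inim: "\<gamma> e t \<in> path_image (\<gamma> e)" if "t \<in> {0..1}" for e t using that by (auto simp: path_image_def)
  have "\<exists>a b. e = {a, b} \<and> a \<noteq> b \<and> p a = \<gamma> e 0 \<and> p b = \<gamma> e 1" if e: "e \<in> E" for e
  proof -
    obtain u v where uv: "e = {u, v}" "u \<noteq> v" using Esub[OF e] by (meson card_2_iff)
    have "{\<gamma> e 0, \<gamma> e 1} = {p u, p v}" using ends[OF e] uv by (simp add: pathstart_def pathfinish_def)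
    then consider "p u = \<gamma> e 0" "p v = \<gamma> e 1" | "p v = \<gamma> e 0" "p u = \<gamma> e 1" by (metis doubleton_eq_iff)
    then show ?thesis by cases (use uv in blast)+
  qed
  then obtain a b where ab: "\<And>e. e \<in> E \<Longrightarrow> e = {a e, b e} \<and> a e \<noteq> b e \<and> p (a e) = \<gamma> e 0 \<and> p (b e) = \<gamma> e 1" by metis
  have abV: "a e \<in> V" "b e \<in> V" if "e \<in> E" for e using ab[OF that] Esub[OF that] by auto
  have atV: "(t = 0 \<and> v = a e) \<or> (t = 1 \<and> v = b e)" if e: "e \<in> E" and t: "t \<in> {0..1}" and v: "v \<in> V" "\<gamma> e t = p v" for e t v
  proof -
    have "p v \<in> p ` e" using thru[OF e] inim[OF t, of e] v by auto
    then have "p v = p (a e) \<or> p v = p (b e)" using ab[OF e] by (metis (no_types, lifting) image_iff insertE singletonD)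
    then have "v = a e \<or> v = b e" using p(1) abV[OF e] v(1) by (auto dest: inj_onD)
    then show ?thesis using ab[OF e] inj[OF e t, of 0] inj[OF e t, of 1] v by auto
  qed
  define pieces where "pieces v = insert {p v} ((\<lambda>e. \<gamma> e ` {0..1/3}) ` {e \<in> E. a e = v} \<union> (\<lambda>e. \<gamma> e ` {2/3..1}) ` {e \<in> E. b e = v})" for v
  define X where "X v = \<Union> (pieces v)" for v
  define Y where "Y e = \<gamma> e ` {1/3..2/3}" for e
  have cont: "continuous_on {0..1} (\<gamma> e)" if "e \<in> E" for e using arc[OF that] by (simp add: arc_def path_def)
  have seg: "compact (\<gamma> e ` {s..t}) \<and> connected (\<gamma> e ` {s..t})" if "e \<in> E" "0 \<le> s" "t \<le> 1" for e s t
    using continuous_on_subset[OF cont[OF that(1)], of "{s..t}"] that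
    by (intro conjI compact_continuous_image connected_continuous_image) auto
  have pv: "p v \<in> A \<and> compact A \<and> connected A \<and> A \<subseteq> ?S" if v: "v \<in> V" and A: "A \<in> pieces v" for v A
  proof -
    consider "A = {p v}" | e where "e \<in> E" "a e = v" "A = \<gamma> e ` {0..1/3}" | e where "e \<in> E" "b e = v" "A = \<gamma> e ` {2/3..1}"
      using A unfolding pieces_def by auto
    then show ?thesis
    proof cases
      case 1 then show ?thesis using p v by auto
    next
      case 2
      then show ?thesis using seg[OF 2(1), of 0 "1/3"] ab[OF 2(1)] img[OF 2(1)] by (auto simp: path_image_def)
    next
      case 3
      then show ?thesis using seg[OF 3(1), of "2/3" 1] ab[OF 3(1)] img[OF 3(1)] by (auto simp: path_image_def)
    qed
  qed
  have Xc: "compact (X v)" "connected (X v)" "X v \<subseteq> ?S" "p v \<in> X v" if v: "v \<in> V" for v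
  proof -
    have "finite (pieces v)" using finE unfolding pieces_def by simp
    then show "compact (X v)" unfolding X_def using pv[OF v] by (intro compact_Union) auto
    have ne: "\<Inter> (pieces v) \<noteq> {}" using pv[OF v] by blast
    show "connected (X v)" unfolding X_def using pv[OF v] ne by (intro connected_Union) auto
    show "X v \<subseteq> ?S" unfolding X_def using pv[OF v] by blast
    show "p v \<in> X v" unfolding X_def pieces_def by auto
  qed
  have Yc: "compact (Y e)" "connected (Y e)" "Y e \<subseteq> ?S" if "e \<in> E" for e
    using seg[OF that, of "1/3" "2/3"] img[OF that] unfolding Y_def by (auto simp: path_image_def)
  have Xcases: "x = p v \<or> (\<exists>e t. e \<in> E \<and> x = \<gamma> e t \<and> ((a e = v \<and> t \<in> {0..1/3}) \<or> (b e = v \<and> t \<in> {2/3..1})))"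
    if "x \<in> X v" for x v using that unfolding X_def pieces_def by auto
  have share: "\<exists>w\<in>e \<inter> f. \<gamma> e s = p w" if "e \<in> E" "f \<in> E" "e \<noteq> f" "s \<in> {0..1}" "t \<in> {0..1}" "\<gamma> e s = \<gamma> f t" for e f s t
    using cross[OF that(1-3)] inim[OF that(4), of e] inim[OF that(5), of f] that(6) by auto
  have XV: "w = v" if w: "w \<in> V" and v: "v \<in> V" and x: "p w \<in> X v" for v w
  proof (cases "p w = p v")
    case True then show ?thesis using p(1) v w by (auto dest: inj_onD)
  next
    case False
    then obtain e t where et: "e \<in> E" "p w = \<gamma> e t" "(a e = v \<and> t \<in> {0..1/3}) \<or> (b e = v \<and> t \<in> {2/3..1})"
      using Xcases[OF x] by blast
    then have "(t = 0 \<and> w = a e) \<or> (t = 1 \<and> w = b e)" using atV[OF et(1) _ w, of t] by auto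
    then show ?thesis using et(3) by auto
  qed
  have XX: "X u \<inter> X v = {}" if u: "u \<in> V" and v: "v \<in> V" and uv: "u \<noteq> v" for u v
  proof (rule ccontr)
    assume "X u \<inter> X v \<noteq> {}"
    then obtain x where x: "x \<in> X u" "x \<in> X v" by auto
    have "x \<noteq> p w" if "w \<in> V" for w using XV[OF that u] XV[OF that v] x uv by auto
    note np = this
    obtain e s where es: "e \<in> E" "x = \<gamma> e s" "(a e = u \<and> s \<in> {0..1/3}) \<or> (b e = u \<and> s \<in> {2/3..1})"
      using Xcases[OF x(1)] np[OF u] by blast
    obtain f t where ft: "f \<in> E" "x = \<gamma> f t" "(a f = v \<and> t \<in> {0..1/3}) \<or> (b f = v \<and> t \<in> {2/3..1})"
      using Xcases[OF x(2)] np[OF v] by blast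
    have st: "s \<in> {0..1}" "t \<in> {0..1}" using es(3) ft(3) by auto
    show False
    proof (cases "e = f")
      case True
      then have "s = t" using inj[OF es(1) st] es(2) ft(2) by simp
      then show False using es(3) ft(3) True uv by auto
    next
      case False
      then obtain w where "w \<in> e \<inter> f" "\<gamma> e s = p w" using share[OF es(1) ft(1) False st] es(2) ft(2) by auto
      then show False using np[of w] es(2) Esub[OF es(1)] by auto
    qed
  qed
  have Ynp: "y \<noteq> p w" if yw: "e \<in> E" "y \<in> Y e" "w \<in> V" for e y w
  proof
    assume "y = p w"
    obtain t where "t \<in> {1/3..2/3}" "y = \<gamma> e t" using yw(2) unfolding Y_def by auto
    then show False using atV[OF yw(1) _ yw(3), of t] \<open>y = p w\<close> by auto
  qed
  have YX: "Y e \<inter> X v = {}" if e: "e \<in> E" and v: "v \<in> V" and ne: "v \<noteq> a e" "v \<noteq> b e" for e v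
  proof (rule ccontr)
    assume "Y e \<inter> X v \<noteq> {}"
    then obtain x where x: "x \<in> Y e" "x \<in> X v" by auto
    obtain s where s: "s \<in> {1/3..2/3}" "x = \<gamma> e s" using x(1) unfolding Y_def by auto
    obtain f t where ft: "f \<in> E" "x = \<gamma> f t" "(a f = v \<and> t \<in> {0..1/3}) \<or> (b f = v \<and> t \<in> {2/3..1})"
      using Xcases[OF x(2)] Ynp[OF e x(1) v] by blast
    have st: "s \<in> {0..1}" "t \<in> {0..1}" using s ft(3) by auto
    have "e \<noteq> f" using ft(3) ne by auto
    then obtain w where "w \<in> e \<inter> f" "\<gamma> e s = p w" using share[OF e ft(1) _ st] s(2) ft(2) by auto
    then show False using Ynp[OF e x(1), of w] s(2) Esub[OF e] by auto
  qed
  have YY: "Y e \<inter> Y f = {}" if e: "e \<in> E" "f \<in> E" "e \<noteq> f" for e f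
  proof (rule ccontr)
    assume "Y e \<inter> Y f \<noteq> {}"
    then obtain x where x: "x \<in> Y e" "x \<in> Y f" by auto
    obtain s where s: "s \<in> {1/3..2/3}" "x = \<gamma> e s" using x(1) unfolding Y_def by auto
    obtain t where t: "t \<in> {1/3..2/3}" "x = \<gamma> f t" using x(2) unfolding Y_def by auto
    have st: "s \<in> {0..1}" "t \<in> {0..1}" using s t by auto
    obtain w where "w \<in> e \<inter> f" "\<gamma> e s = p w" using share[OF e st] s(2) t(2) by auto
    then show False using Ynp[OF e(1) x(1), of w] s(2) Esub[OF e(1)] by auto
  qed
  have meet: "\<gamma> e (1/3) \<in> Y e" "\<gamma> e (1/3) \<in> X (a e)" "\<gamma> e (2/3) \<in> Y e" "\<gamma> e (2/3) \<in> X (b e)" if "e \<in> E" for e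
  proof -
    show "\<gamma> e (1/3) \<in> Y e" "\<gamma> e (2/3) \<in> Y e" unfolding Y_def by auto
    have "\<gamma> e ` {0..1/3} \<in> pieces (a e)" "\<gamma> e ` {2/3..1} \<in> pieces (b e)" using that unfolding pieces_def by auto
    moreover have "\<gamma> e (1/3) \<in> \<gamma> e ` {0..1/3}" "\<gamma> e (2/3) \<in> \<gamma> e ` {2/3..1}" by auto
    ultimately show "\<gamma> e (1/3) \<in> X (a e)" "\<gamma> e (2/3) \<in> X (b e)" unfolding X_def by blast+
  qed
  have fXY: "finite (X ` V \<union> Y ` E)" using finV finE by simp
  have cXY: "compact A" if "A \<in> X ` V \<union> Y ` E" for A using that Xc(1) Yc(1) by auto
  have "\<exists>d>0. \<forall>A\<in>X ` V \<union> Y ` E. \<forall>B\<in>X ` V \<union> Y ` E. A \<inter> B = {} \<longrightarrow> (\<forall>x\<in>A. \<forall>y\<in>B. d \<le> dist x y)"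
    by (rule finite_separation[OF fXY]) (rule cXY)
  then obtain d where dd: "d > 0" "\<forall>A\<in>X ` V \<union> Y ` E. \<forall>B\<in>X ` V \<union> Y ` E. A \<inter> B = {} \<longrightarrow> (\<forall>x\<in>A. \<forall>y\<in>B. d \<le> dist x y)"
    by (elim exE conjE)
  have d: "d > 0" "d \<le> dist x y" if "A \<in> X ` V \<union> Y ` E" "B \<in> X ` V \<union> Y ` E" "A \<inter> B = {}" "x \<in> A" "y \<in> B" for A B x y
    using dd(1) bspec[OF bspec[OF dd(2) that(1)] that(2)] that(3-5) by blast+
  note d = dd(1) d(2)
  obtain N :: nat where N: "6 / d < real N" using reals_Archimedean2 by blast
  have "0 < 6 / d" using d(1) by simp
  then have N1: "N \<ge> 1" using N by (cases N) auto
  have Nd: "6 / real N < d" using N d(1) N1 by (simp add: field_simps)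
  define H where "H A = \<Union> (hits N ` A)" for A
  have Hdisj: "H A \<inter> H B = {}" if "A \<in> X ` V \<union> Y ` E" "B \<in> X ` V \<union> Y ` E" "A \<inter> B = {}" for A B
  proof (rule ccontr)
    assume "H A \<inter> H B \<noteq> {}"
    then obtain w x y where "x \<in> A" "y \<in> B" "w \<in> hits N x" "w \<in> hits N y" unfolding H_def by auto
    then show False using hits_close[OF N1, of w x y] d(2)[OF that, of x y] Nd by linarith
  qed
  have Hsub: "H A \<subseteq> fst ` darts g N \<and> conn_in (adj g N) (H A)" if "A \<subseteq> ?S" "connected A" for A
    using hits_surface(1)[OF N1] hits_connected[OF N1 that] that unfolding H_def by blast
  have Hmeet: "H A \<inter> H B \<noteq> {}" if "x \<in> A" "x \<in> B" for A B x
    using that hits_nonempty[of N x] unfolding H_def by blast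
  show ?thesis
  proof (rule grid_minor[where M = "\<lambda>v. H (X v)" and Z = "\<lambda>e. H (Y e)" and a = a and b = b, OF N1 V])
    show "H (X v) \<subseteq> fst ` darts g N \<and> H (X v) \<noteq> {} \<and> conn_in (adj g N) (H (X v))" if "v \<in> V" for v
      using Hsub[OF Xc(3,2)[OF that]] Hmeet[OF Xc(4)[OF that] Xc(4)[OF that]] by auto
    show "H (X u) \<inter> H (X v) = {}" if "u \<in> V" "v \<in> V" "u \<noteq> v" for u v
      using Hdisj[OF _ _ XX[OF that]] that by auto
    show "e = {a e, b e} \<and> a e \<in> V \<and> b e \<in> V \<and> a e \<noteq> b e" if "e \<in> E" for e
      using ab[OF that] abV[OF that] by auto
    show "H (Y e) \<subseteq> fst ` darts g N \<and> conn_in (adj g N) (H (Y e)) \<and> H (Y e) \<inter> H (X (a e)) \<noteq> {} \<and> H (Y e) \<inter> H (X (b e)) \<noteq> {}" if "e \<in> E" for e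
      using Hsub[OF Yc(3,2)[OF that]] Hmeet[OF meet(1,2)[OF that]] Hmeet[OF meet(3,4)[OF that]] by auto
    show "H (Y e) \<inter> H (X v) = {}" if "e \<in> E" "v \<in> V" "v \<noteq> a e" "v \<noteq> b e" for e v
      using Hdisj[OF _ _ YX[OF that]] that by auto
    show "H (Y e) \<inter> H (Y f) = {}" if "e \<in> E" "f \<in> E" "e \<noteq> f" for e f
      using Hdisj[OF _ _ YY[OF that]] that by auto
    show "\<exists>e\<in>E. v \<in> e" if "v \<in> V" for v using cover[OF that] .
  qed
qed

section \<open>Spanning trees and rooted forests\<close>

definition adjacency :: "'v set set \<Rightarrow> ('v \<times> 'v) set" where "adjacency E = {(x, y). {x, y} \<in> E}"

lemma sym_adjacency: "sym (adjacency E)" by (auto simp: sym_def adjacency_def insert_commute)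

lemma adjacency_rtrancl_sym: "(u, v) \<in> (adjacency E)\<^sup>* \<Longrightarrow> (v, u) \<in> (adjacency E)\<^sup>*"
  by (meson sym_adjacency sym_rtrancl symD)

lemma connected_graph_alt: "connected_graph V E \<longleftrightarrow> V \<noteq> {} \<and> (\<forall>u\<in>V. \<forall>v\<in>V. (u, v) \<in> (adjacency E)\<^sup>*)"
  by (simp add: connected_graph_def adjacency_def)

lemma simple_path:
  assumes "(u, v) \<in> R\<^sup>*"
  shows "\<exists>vs. vs \<noteq> [] \<and> distinct vs \<and> hd vs = u \<and> last vs = v \<and> (\<forall>i. Suc i < length vs \<longrightarrow> (vs ! i, vs ! Suc i) \<in> R)"
  using assms
proof (induction rule: converse_rtrancl_induct)
  case base
  show ?case by (intro exI[of _ "[v]"]) auto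
next
  case (step y z)
  then obtain vs where vs: "vs \<noteq> []" "distinct vs" "hd vs = z" "last vs = v"
    "\<And>i. Suc i < length vs \<Longrightarrow> (vs ! i, vs ! Suc i) \<in> R" by auto
  show ?case
  proof (cases "y \<in> set vs")
    case True
    then obtain k where k: "k < length vs" "vs ! k = y" by (auto simp: in_set_conv_nth)
    show ?thesis
    proof (intro exI[of _ "drop k vs"] conjI allI impI)
      show "(drop k vs ! i, drop k vs ! Suc i) \<in> R" if "Suc i < length (drop k vs)" for i
        using vs(5)[of "k + i"] that by simp
    qed (use vs k in \<open>auto simp: hd_drop_conv_nth\<close>)
  next
    case False
    show ?thesis
    proof (intro exI[of _ "y # vs"] conjI allI impI)
      show "((y # vs) ! i, (y # vs) ! Suc i) \<in> R" if "Suc i < length (y # vs)" for i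
        using vs(1,3,5) step(1) that by (cases i) (auto simp: hd_conv_nth)
    qed (use vs False in auto)
  qed
qed

text \<open>A simple path in \<open>F\<close> between the ends has at least two edges because
  \<open>{u, v}\<close> is not in \<open>F\<close>, so the extra edge closes it to a genuine
  cycle.\<close>

lemma path_edge_cycle:
  assumes "(u, v) \<in> (adjacency F)\<^sup>*" "u \<noteq> v" "{u, v} \<notin> F" "{u, v} \<in> T" "F \<subseteq> T"
  shows "\<exists>vs. is_cycle T vs"
proof -
  obtain vs where vs: "vs \<noteq> []" "distinct vs" "hd vs = u" "last vs = v"
    "\<And>i. Suc i < length vs \<Longrightarrow> {vs ! i, vs ! Suc i} \<in> F"
    using simple_path[OF assms(1)] by (auto simp: adjacency_def)
  have h: "vs ! 0 = u" "vs ! (length vs - 1) = v" using vs by (auto simp: hd_conv_nth last_conv_nth)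
  have "length vs \<noteq> 1" using h assms(2) by auto
  moreover have "length vs \<noteq> 2" using vs(5)[of 0] h assms(3) by auto
  ultimately have len: "length vs \<ge> 3" using vs(1) by (cases "length vs") auto
  have "{vs ! i, vs ! (Suc i mod length vs)} \<in> T" if i: "i < length vs" for i
  proof (cases "Suc i < length vs")
    case True then show ?thesis using vs(5)[OF True] assms(5) by auto
  next
    case False
    then have "Suc i = length vs" using i by simp
    then have "i = length vs - 1" "Suc i mod length vs = 0" by auto
    then show ?thesis using h assms(4) by (simp add: insert_commute)
  qed
  then show ?thesis using len vs(2) unfolding is_cycle_def by blast
qed

lemma is_cycle_rotate:
  assumes "is_cycle T vs" shows "is_cycle T (rotate m vs)"
  unfolding is_cycle_def
proof (intro conjI allI impI)
  have len: "length vs \<ge> 3" using assms by (simp add: is_cycle_def)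
  show "3 \<le> length (rotate m vs)" "distinct (rotate m vs)" using assms by (auto simp: is_cycle_def)
  fix i assume i: "i < length (rotate m vs)"
  let ?l = "length vs" and ?k = "(m + i) mod length vs"
  have l0: "?l > 0" using len by linarith
  then have "?k < ?l" by (rule mod_less_divisor)
  then have "{vs ! ?k, vs ! (Suc ?k mod ?l)} \<in> T" using assms unfolding is_cycle_def by blast
  moreover have "rotate m vs ! i = vs ! ?k" using i by (simp add: nth_rotate)
  moreover have "Suc i mod ?l < ?l" using l0 by (rule mod_less_divisor)
  then have "rotate m vs ! (Suc i mod ?l) = vs ! ((m + Suc i mod ?l) mod ?l)" by (rule nth_rotate)
  moreover have "(m + Suc i mod ?l) mod ?l = Suc ?k mod ?l" by (simp add: mod_simps)
  ultimately show "{rotate m vs ! i, rotate m vs ! (Suc i mod length (rotate m vs))} \<in> T" by simp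
qed

text \<open>The cycle is rotated until the chosen edge is the one that closes it; what remains is a
  path avoiding that edge.\<close>

lemma cycle_edge_redundant:
  assumes cyc: "is_cycle T vs" and i: "i < length vs"
  defines "x \<equiv> vs ! i" and "y \<equiv> vs ! (Suc i mod length vs)"
  shows "(x, y) \<in> (adjacency (T - {{x, y}}))\<^sup>*"
proof -
  let ?l = "length vs"
  define ws where "ws = rotate (Suc i) vs"
  have ws: "is_cycle T ws" "length ws = ?l" unfolding ws_def by (rule is_cycle_rotate[OF cyc], simp)
  have len: "?l \<ge> 3" using cyc by (simp add: is_cycle_def)
  have w0: "ws ! 0 = y" unfolding ws_def y_def using len by (subst nth_rotate) auto
  have "Suc i + (?l - 1) = i + ?l" using len by linarith
  then have "(Suc i + (?l - 1)) mod ?l = i" using i by simp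
  then have wl: "ws ! (?l - 1) = x" unfolding ws_def x_def using len by (subst nth_rotate) auto
  have dist: "distinct ws" using ws(1) by (simp add: is_cycle_def)
  have "(y, ws ! k) \<in> (adjacency (T - {{x, y}}))\<^sup>*" if "k < ?l" for k
    using that
  proof (induction k)
    case 0 then show ?case using w0 by simp
  next
    case (Suc k)
    have "k < length ws" using Suc.prems ws(2) by simp
    then have "{ws ! k, ws ! (Suc k mod length ws)} \<in> T" using ws(1) unfolding is_cycle_def by blast
    moreover have "Suc k mod length ws = Suc k" using Suc.prems ws(2) by simp
    ultimately have T: "{ws ! k, ws ! Suc k} \<in> T" by (simp only:)
    have "{ws ! k, ws ! Suc k} \<noteq> {x, y}"
    proof
      assume "{ws ! k, ws ! Suc k} = {x, y}"
      then have "ws ! k = ws ! (?l - 1) \<or> ws ! k = ws ! 0 \<and> ws ! Suc k = ws ! (?l - 1)"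
        unfolding w0 wl by (auto simp: doubleton_eq_iff)
      moreover have "k < length ws" "Suc k < length ws" "?l - 1 < length ws" "0 < length ws"
        using Suc.prems len ws(2) by linarith+
      ultimately have "k = ?l - 1 \<or> k = 0 \<and> Suc k = ?l - 1"
        using nth_eq_iff_index_eq[OF dist] by blast
      then show False using Suc.prems len by linarith
    qed
    then have "(ws ! k, ws ! Suc k) \<in> adjacency (T - {{x, y}})" using T by (simp add: adjacency_def)
    then show ?case using Suc by (auto intro: rtrancl_into_rtrancl)
  qed
  from this[of "?l - 1"] have "(y, x) \<in> (adjacency (T - {{x, y}}))\<^sup>*" using wl len by simp
  then show ?thesis by (rule adjacency_rtrancl_sym)
qed

text \<open>A connected edge set between \<open>F\<close> and \<open>E\<close> with fewest edges is
  a tree: a cycle would contain an edge outside the acyclic set \<open>F\<close>, and that edge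
  could be dropped.\<close>

lemma spanning_tree_above:
  assumes "finite E" "connected_graph V E" "F \<subseteq> E" "\<nexists>vs. is_cycle F vs"
  shows "\<exists>T\<in>spanning_trees V E. F \<subseteq> T"
proof -
  let ?P = "\<lambda>T. F \<subseteq> T \<and> T \<subseteq> E \<and> connected_graph V T"
  have "?P E" using assms by simp
  then obtain T where T: "?P T" and min: "\<And>T'. ?P T' \<Longrightarrow> card T \<le> card T'"
    using ex_has_least_nat[of ?P E card] by blast
  have "\<nexists>vs. is_cycle T vs"
  proof
    assume "\<exists>vs. is_cycle T vs"
    then obtain vs where cyc: "is_cycle T vs" by auto
    have "\<not> is_cycle F vs" using assms(4) by blast
    then obtain i where i: "i < length vs" "{vs ! i, vs ! (Suc i mod length vs)} \<notin> F"
      using cyc unfolding is_cycle_def by blast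
    let ?x = "vs ! i" and ?y = "vs ! (Suc i mod length vs)"
    let ?T = "T - {{?x, ?y}}"
    have xyT: "{?x, ?y} \<in> T" using cyc i unfolding is_cycle_def by blast
    have red: "(?x, ?y) \<in> (adjacency ?T)\<^sup>*" by (rule cycle_edge_redundant[OF cyc i(1)])
    have "adjacency T \<subseteq> (adjacency ?T)\<^sup>*"
    proof clarify
      fix u v assume uv: "(u, v) \<in> adjacency T"
      show "(u, v) \<in> (adjacency ?T)\<^sup>*"
      proof (cases "{u, v} = {?x, ?y}")
        case True
        then have "(u = ?x \<and> v = ?y) \<or> (u = ?y \<and> v = ?x)" by (auto simp: doubleton_eq_iff)
        then show ?thesis using red adjacency_rtrancl_sym[OF red] by auto
      next
        case False
        then have "(u, v) \<in> adjacency ?T" using uv by (simp add: adjacency_def)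
        then show ?thesis by auto
      qed
    qed
    then have "(adjacency T)\<^sup>* \<subseteq> (adjacency ?T)\<^sup>*" by (rule rtrancl_subset_rtrancl)
    then have "connected_graph V ?T" using T unfolding connected_graph_alt by blast
    then have "card T \<le> card ?T" using T i by (intro min) auto
    moreover have "finite T" using T assms(1) finite_subset by auto
    ultimately show False using xyT card_Diff1_less[of T "{?x, ?y}"] by simp
  qed
  then show ?thesis using T unfolding spanning_trees_def by blast
qed

text \<open>A rooted forest on \<open>{..<n}\<close> is encoded by a parent function, with \<open>n\<close> as the parent of the roots.\<close>

definition arrows :: "nat \<Rightarrow> (nat \<Rightarrow> nat) \<Rightarrow> (nat \<times> nat) set" where "arrows n f = {(i, f i) | i. i < n}"

definition rooted :: "nat \<Rightarrow> (nat \<Rightarrow> nat) \<Rightarrow> bool" where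
  "rooted n f \<longleftrightarrow> (\<forall>i<n. (i, n) \<in> (arrows n f)\<^sup>*)"

lemma arrows_iff: "(i, j) \<in> arrows n f \<longleftrightarrow> i < n \<and> j = f i" by (auto simp: arrows_def)

lemma rooted_no_closed_set:
  assumes "rooted n f" "\<And>i. i \<in> B \<Longrightarrow> i < n \<and> f i \<in> B" shows "B = {}"
proof (rule ccontr)
  assume "B \<noteq> {}"
  then obtain i where i: "i \<in> B" by auto
  then have "(i, n) \<in> (arrows n f)\<^sup>*" using assms by (auto simp: rooted_def)
  then have "n \<in> B" by (induction rule: rtrancl_induct) (use i assms(2) in \<open>auto simp: arrows_iff\<close>)
  then show False using assms(2) by blast
qed

text \<open>For \<open>j = n\<close> the second summand vanishes in every column
  \<open>k < n\<close>, so the row of a root is a plain unit vector.\<close>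

definition unit_row :: "nat \<Rightarrow> nat \<Rightarrow> nat \<Rightarrow> real" where
  "unit_row i j k = (if k = i then 1 else 0) - (if k = j then 1 else 0)"

text \<open>In a permutation with nonzero product every moved point goes to its parent, so the moved
  points form a set closed under \<open>f\<close>; if \<open>f\<close> is rooted, only the identity
  remains. Otherwise the indicator of the points that never reach \<open>n\<close> lies in the
  kernel.\<close>

lemma det_rooted:
  assumes f: "\<And>i. i < n \<Longrightarrow> f i \<le> n"
  shows "Determinant.det (Matrix.mat n n (\<lambda>(i, k). unit_row i (f i) k)) = (if rooted n f then 1 else 0)"
    (is "Determinant.det ?M = _")
proof -
  have M: "?M \<in> carrier_mat n n" by simp
  show ?thesis
  proof (cases "rooted n f")
    case True
    have nofix: "f i \<noteq> i" if "i < n" for i using rooted_no_closed_set[OF True, of "{i}"] that by auto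
    have zero: "(\<Prod>i = 0..<n. ?M $$ (i, p i)) = 0" if p: "p permutes {0..<n}" "p \<noteq> id" for p
    proof (rule ccontr)
      assume "(\<Prod>i = 0..<n. ?M $$ (i, p i)) \<noteq> 0"
      then have nz: "\<And>i. i < n \<Longrightarrow> ?M $$ (i, p i) \<noteq> 0" by auto
      have pl: "i < n \<Longrightarrow> p i < n" for i using permutes_in_image[OF p(1), of i] by simp
      have ur: "p i = i \<or> p i = f i" if "i < n" for i
        using nz[OF that] pl[OF that] that by (auto simp: unit_row_def split: if_splits)
      define B where "B = {i. i < n \<and> p i \<noteq> i}"
      have "i < n \<and> f i \<in> B" if "i \<in> B" for i
      proof -
        have i: "i < n" "p i \<noteq> i" "p i = f i" using that ur unfolding B_def by auto
        have "p (p i) \<noteq> p i" using i(2) permutes_inj[OF p(1)] by (auto dest: injD)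
        then show ?thesis using i pl[OF i(1)] unfolding B_def by auto
      qed
      then have "B = {}" using rooted_no_closed_set[OF True, of B] by blast
      then have "p i = i" for i using permutes_not_in[OF p(1), of i] unfolding B_def by (cases "i < n") auto
      then show False using p(2) by auto
    qed
    have "Determinant.det ?M = (\<Sum>p\<in>{p. p permutes {0..<n}}. signof p * (\<Prod>i = 0..<n. ?M $$ (i, p i)))"
      by (rule det_def'[OF M])
    also have "\<dots> = (\<Sum>p\<in>{id}. signof p * (\<Prod>i = 0..<n. ?M $$ (i, p i)))"
      by (rule sum.mono_neutral_right) (use zero in \<open>auto simp: finite_permutations permutes_id\<close>)
    also have "\<dots> = (\<Prod>i = 0..<n. unit_row i (f i) i)" by simp
    also have "\<dots> = 1"
    proof (intro prod.neutral ballI)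
      fix i assume "i \<in> {0..<n}"
      then have "i \<noteq> f i" using nofix[of i] by auto
      then show "unit_row i (f i) i = 1" by (simp add: unit_row_def)
    qed
    finally show ?thesis using True by simp
  next
    case False
    define y where "y = Matrix.vec n (\<lambda>k. if (k, n) \<in> (arrows n f)\<^sup>* then 0 else (1::real))"
    have yc: "y \<in> carrier_vec n" by (simp add: y_def)
    have reach: "(i, n) \<in> (arrows n f)\<^sup>* \<longleftrightarrow> (f i, n) \<in> (arrows n f)\<^sup>*" if i: "i < n" for i
    proof
      assume "(i, n) \<in> (arrows n f)\<^sup>*"
      then show "(f i, n) \<in> (arrows n f)\<^sup>*" using i by (cases rule: converse_rtranclE) (auto simp: arrows_iff)
    next
      assume "(f i, n) \<in> (arrows n f)\<^sup>*"
      moreover have "(i, f i) \<in> arrows n f" using i by (simp add: arrows_iff)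
      ultimately show "(i, n) \<in> (arrows n f)\<^sup>*" by (rule converse_rtrancl_into_rtrancl[rotated])
    qed
    have "?M *\<^sub>v y = 0\<^sub>v n"
    proof (rule eq_vecI)
      fix i assume "i < dim_vec (0\<^sub>v n :: real Matrix.vec)"
      then have i: "i < n" by simp
      have "(?M *\<^sub>v y) $ i = (\<Sum>k = 0..<n. unit_row i (f i) k * y $ k)"
        using i yc by (simp add: scalar_prod_def y_def)
      also have "\<dots> = (\<Sum>k = 0..<n. (if k = i then y $ k else 0)) - (\<Sum>k = 0..<n. (if k = f i then y $ k else 0))"
        unfolding sum_subtractf[symmetric] by (intro sum.cong) (auto simp: unit_row_def)
      also have "\<dots> = y $ i - (if f i < n then y $ (f i) else 0)" using i by (simp add: sum.delta)
      also have "\<dots> = 0" using reach[OF i] f[OF i] i by (cases "f i < n") (auto simp: y_def)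
      finally show "(?M *\<^sub>v y) $ i = 0\<^sub>v n $ i" using i by simp
    qed simp
    moreover have "y \<noteq> 0\<^sub>v n"
    proof -
      obtain i where "i < n" "(i, n) \<notin> (arrows n f)\<^sup>*" using False by (auto simp: rooted_def)
      then have "y $ i \<noteq> 0\<^sub>v n $ i" by (simp add: y_def)
      then show ?thesis by auto
    qed
    ultimately have "Determinant.det ?M = 0" using det_0_iff_vec_prod_zero[OF M] yc by blast
    then show ?thesis using False by simp
  qed
qed

text \<open>Row \<open>i\<close> of the matrix is a weighted sum of rows \<open>unit_row i j\<close>, so the determinant expands over all
  parent functions, of which only the acyclic ones contribute.\<close>

lemma det_forest_expansion:
  fixes \<epsilon> :: real and A :: "nat \<Rightarrow> nat set"
  assumes A: "\<And>i. i < n \<Longrightarrow> A i \<subseteq> {..<n}"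
  shows "Determinant.det (Matrix.mat n n (\<lambda>(i, k). (if k = i then real (card (A i)) + \<epsilon> else 0) - (if k \<in> A i then 1 else 0))) =
    (\<Sum>f\<in>{f \<in> PiE {0..<n} (\<lambda>i. insert n (A i)). rooted n f}. \<epsilon> ^ card {i. i < n \<and> f i = n})"
    (is "Determinant.det ?M = _")
proof -
  let ?B = "\<lambda>i. insert n (A i)" and ?w = "\<lambda>j. if j = n then \<epsilon> else 1"
  let ?P = "PiE {0..<n} ?B"
  have finA: "finite (A i)" "n \<notin> A i" if "i < n" for i using A[OF that] finite_subset by auto
  have finP: "finite ?P" using finA by (intro finite_PiE) auto
  have M: "?M \<in> carrier_mat n n" by simp
  have entry: "?M $$ (i, k) = (\<Sum>j\<in>?B i. ?w j * unit_row i j k)" if "i < n" "k < n" for i k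
  proof -
    have "(\<Sum>j\<in>A i. ?w j * unit_row i j k) = (\<Sum>j\<in>A i. (if k = i then 1 else 0) - (if k = j then 1 else 0))"
      using finA[OF that(1)] by (intro sum.cong) (auto simp: unit_row_def)
    also have "\<dots> = (if k = i then real (card (A i)) else 0) - (if k \<in> A i then 1 else 0)"
      using finA[OF that(1)] by (simp add: sum_subtractf sum.delta')
    finally show ?thesis using finA[OF that(1)] that by (simp add: unit_row_def)
  qed
  have fl: "f i \<le> n" if "f \<in> ?P" "i < n" for f i using that A[OF that(2)] by (auto simp: PiE_def Pi_def)
  have "Determinant.det ?M = (\<Sum>p\<in>{p. p permutes {0..<n}}. signof p * (\<Prod>i = 0..<n. ?M $$ (i, p i)))"
    by (rule det_def'[OF M])
  also have "\<dots> = (\<Sum>p\<in>{p. p permutes {0..<n}}. signof p * (\<Sum>f\<in>?P. \<Prod>i = 0..<n. ?w (f i) * unit_row i (f i) (p i)))"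
  proof (intro sum.cong refl arg_cong2[where f = "(*)"])
    fix p assume "p \<in> {p. p permutes {0..<n}}"
    then have pl: "i < n \<Longrightarrow> p i < n" for i using permutes_in_image[of p "{0..<n}" i] by simp
    have "(\<Prod>i = 0..<n. ?M $$ (i, p i)) = (\<Prod>i = 0..<n. \<Sum>j\<in>?B i. ?w j * unit_row i j (p i))"
      using entry pl by (intro prod.cong) auto
    also have "\<dots> = (\<Sum>f\<in>?P. \<Prod>i = 0..<n. ?w (f i) * unit_row i (f i) (p i))"
      using finA by (intro prod_sum_PiE) auto
    finally show "(\<Prod>i = 0..<n. ?M $$ (i, p i)) = (\<Sum>f\<in>?P. \<Prod>i = 0..<n. ?w (f i) * unit_row i (f i) (p i))" .
  qed
  also have "\<dots> = (\<Sum>f\<in>?P. (\<Prod>i = 0..<n. ?w (f i)) * (\<Sum>p\<in>{p. p permutes {0..<n}}. signof p * (\<Prod>i = 0..<n. unit_row i (f i) (p i))))"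
    unfolding sum_distrib_left prod.distrib by (subst sum.swap) (simp add: mult_ac)
  also have "\<dots> = (\<Sum>f\<in>?P. (\<Prod>i = 0..<n. ?w (f i)) * (if rooted n f then 1 else 0))"
  proof (intro sum.cong refl arg_cong2[where f = "(*)"])
    fix f assume f: "f \<in> ?P"
    let ?N = "Matrix.mat n n (\<lambda>(i, k). unit_row i (f i) k)"
    have "(\<Sum>p\<in>{p. p permutes {0..<n}}. signof p * (\<Prod>i = 0..<n. unit_row i (f i) (p i))) =
       (\<Sum>p\<in>{p. p permutes {0..<n}}. signof p * (\<Prod>i = 0..<n. ?N $$ (i, p i)))"
      by (intro sum.cong refl arg_cong2[where f = "(*)"] prod.cong) (auto simp: permutes_in_image)
    also have "\<dots> = Determinant.det ?N" by (rule det_def'[symmetric]) simp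
    also have "\<dots> = (if rooted n f then 1 else 0)" using fl[OF f] by (rule det_rooted)
    finally show "(\<Sum>p\<in>{p. p permutes {0..<n}}. signof p * (\<Prod>i = 0..<n. unit_row i (f i) (p i))) = (if rooted n f then 1 else 0)" .
  qed
  also have "\<dots> = (\<Sum>f\<in>{f \<in> ?P. rooted n f}. \<Prod>i = 0..<n. ?w (f i))"
    using finP by (simp add: sum.inter_filter[symmetric] if_distrib cong: if_cong)
  also have "\<dots> = (\<Sum>f\<in>{f \<in> ?P. rooted n f}. \<epsilon> ^ card {i. i < n \<and> f i = n})"
  proof (intro sum.cong refl)
    fix f
    have "(\<Prod>i = 0..<n. ?w (f i)) = (\<Prod>i\<in>{i \<in> {0..<n}. f i = n}. \<epsilon>)"
      by (rule prod.inter_filter[symmetric]) simp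
    also have "{i \<in> {0..<n}. f i = n} = {i. i < n \<and> f i = n}" by auto
    finally show "(\<Prod>i = 0..<n. ?w (f i)) = \<epsilon> ^ card {i. i < n \<and> f i = n}" by simp
  qed
  finally show ?thesis .
qed

definition depth :: "nat \<Rightarrow> (nat \<Rightarrow> nat) \<Rightarrow> nat \<Rightarrow> nat" where
  "depth n f i = (LEAST k. (i, n) \<in> arrows n f ^^ k)"

lemma depth_Suc:
  assumes "rooted n f" "i < n" shows "depth n f i = Suc (depth n f (f i))"
proof -
  have "(i, n) \<in> (arrows n f)\<^sup>*" using assms by (simp add: rooted_def)
  then obtain k where "(i, n) \<in> arrows n f ^^ k" by (auto dest: rtrancl_imp_relpow)
  moreover have "(i, n) \<notin> arrows n f ^^ 0" using assms(2) by simp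
  ultimately have "depth n f i = Suc (LEAST m. (i, n) \<in> arrows n f ^^ Suc m)"
    unfolding depth_def by (rule Least_Suc)
  moreover have "(i, n) \<in> arrows n f ^^ Suc m \<longleftrightarrow> (f i, n) \<in> arrows n f ^^ m" for m
    using assms(2) by (metis arrows_iff relpow_Suc_D2 relpow_Suc_I2)
  ultimately show ?thesis unfolding depth_def by simp
qed

lemma sum_power_card_Pow:
  fixes x :: real
  assumes "finite A" shows "(\<Sum>S\<in>Pow A. x ^ card S) = (1 + x) ^ card A"
  using assms
proof (induction A rule: finite_induct)
  case (insert a A)
  have fin: "finite S" "a \<notin> S" if "S \<in> Pow A" for S using that insert finite_subset by auto
  have "(\<Sum>S\<in>Pow (insert a A). x ^ card S) = (\<Sum>S\<in>Pow A. x ^ card S) + (\<Sum>S\<in>insert a ` Pow A. x ^ card S)"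
    unfolding Pow_insert using insert by (intro sum.union_disjoint) auto
  also have "(\<Sum>S\<in>insert a ` Pow A. x ^ card S) = (\<Sum>S\<in>Pow A. x ^ card (insert a S))"
  proof (subst sum.reindex)
    show "inj_on (insert a) (Pow A)" using insert(2) by (intro inj_onI) (metis Diff_insert_absorb PowD subsetD)
  qed simp
  also have "\<dots> = x * (\<Sum>S\<in>Pow A. x ^ card S)"
    unfolding sum_distrib_left using fin by (intro sum.cong) auto
  finally show ?case using insert by (simp add: algebra_simps)
qed simp

section \<open>Rooted forests of a numbered graph\<close>

locale indexed_graph =
  fixes b :: "nat \<Rightarrow> 'v" and n :: nat and V :: "'v set" and E :: "'v set set"
  assumes bij: "bij_betw b {..<n} V" and edges: "\<And>e. e \<in> E \<Longrightarrow> e \<subseteq> V \<and> card e = 2"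
    and n0: "n > 0" and conn: "connected_graph V E"
begin

definition ni :: "nat \<Rightarrow> nat set" where "ni i = {j. j < n \<and> {b i, b j} \<in> E}"

definition forests :: "(nat \<Rightarrow> nat) set" where
  "forests = {f \<in> PiE {0..<n} (\<lambda>i. insert n (ni i)). rooted n f}"

definition ed :: "(nat \<Rightarrow> nat) \<Rightarrow> 'v set set" where "ed f = {{b i, b (f i)} | i. i < n \<and> f i < n}"

definition roots :: "(nat \<Rightarrow> nat) \<Rightarrow> nat set" where "roots f = {i. i < n \<and> f i = n}"

lemma b_eq: "i < n \<Longrightarrow> j < n \<Longrightarrow> b i = b j \<longleftrightarrow> i = j"
  using bij by (auto simp: bij_betw_def inj_on_def)

lemma b_pair: "i < n \<Longrightarrow> j < n \<Longrightarrow> k < n \<Longrightarrow> l < n \<Longrightarrow> {b i, b j} = {b k, b l} \<longleftrightarrow> (i = k \<and> j = l) \<or> (i = l \<and> j = k)"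
  by (auto simp: doubleton_eq_iff b_eq)

lemma V_b: "v \<in> V \<Longrightarrow> \<exists>i<n. v = b i"
  using bij by (auto simp: bij_betw_def)

lemma bV: "i < n \<Longrightarrow> b i \<in> V" using bij by (auto simp: bij_betw_def)

lemma finite_E: "finite E"
proof -
  have "finite V" using bij bij_betw_finite by blast
  then have "finite (Pow V)" by simp
  moreover have "E \<subseteq> Pow V" using edges by auto
  ultimately show ?thesis by (rule rev_finite_subset)
qed

lemma forestD:
  assumes "f \<in> forests" "i < n"
  shows "f i = n \<or> f i < n \<and> {b i, b (f i)} \<in> E" "f i \<noteq> i" "f i < n \<Longrightarrow> f (f i) \<noteq> i"
proof -
  have r: "rooted n f" and f: "f \<in> PiE {0..<n} (\<lambda>i. insert n (ni i))" using assms by (auto simp: forests_def)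
  have "f i \<in> insert n (ni i)" using f assms(2) by (auto simp: PiE_def Pi_def)
  then show "f i = n \<or> f i < n \<and> {b i, b (f i)} \<in> E" by (auto simp: ni_def)
  show "f i \<noteq> i" using depth_Suc[OF r assms(2)] by auto
  show "f (f i) \<noteq> i" if "f i < n" using depth_Suc[OF r assms(2)] depth_Suc[OF r that] by auto
qed

lemma ed_sub: "f \<in> forests \<Longrightarrow> ed f \<subseteq> E"
  using forestD(1) unfolding ed_def by fastforce

lemma ed_pair:
  assumes "i < n" "j < n" "{b i, b j} \<in> ed f" shows "f i = j \<or> f j = i"
  using assms b_pair unfolding ed_def by auto

text \<open>At a vertex of greatest depth on a cycle, both neighbours on the cycle would have to be
  its parent.\<close>

lemma ed_acyclic:
  assumes f: "f \<in> forests" shows "\<nexists>vs. is_cycle (ed f) vs"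
proof
  assume "\<exists>vs. is_cycle (ed f) vs"
  then obtain vs where vs: "is_cycle (ed f) vs" by auto
  have r: "rooted n f" using f by (simp add: forests_def)
  have len: "length vs \<ge> 3" using vs by (simp add: is_cycle_def)
  have inV: "\<exists>j<n. w = b j" if w: "w \<in> set vs" for w
  proof -
    obtain i where "i < length vs" "w = vs ! i" using w by (auto simp: in_set_conv_nth)
    then have "{w, vs ! (Suc i mod length vs)} \<in> E" using vs ed_sub[OF f] unfolding is_cycle_def by blast
    then show ?thesis using edges V_b by blast
  qed
  define idx where "idx w = (SOME j. j < n \<and> w = b j)" for w
  have idx: "idx w < n \<and> w = b (idx w)" if "w \<in> set vs" for w
    unfolding idx_def by (rule someI_ex) (use inV[OF that] in blast)
  have "finite (set vs)" "set vs \<noteq> {}" using len by auto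
  then have "Max ((\<lambda>w. depth n f (idx w)) ` set vs) \<in> (\<lambda>w. depth n f (idx w)) ` set vs" by (intro Max_in) auto
  then obtain w where w: "w \<in> set vs" "depth n f (idx w) = Max ((\<lambda>w. depth n f (idx w)) ` set vs)" by auto
  have max: "depth n f (idx w') \<le> depth n f (idx w)" if "w' \<in> set vs" for w'
    unfolding w(2) using that by (intro Max_ge) auto
  note w = w(1)
  obtain i where i: "i < length vs" "w = vs ! i" using w by (auto simp: in_set_conv_nth)
  \<comment> \<open>The rotation brings the deepest vertex to position 1, with its neighbours at
    positions 0 and 2.\<close>
  define ws where "ws = rotate (i + (length vs - 1)) vs"
  have ws: "is_cycle (ed f) ws" "length ws = length vs" "set ws = set vs"
    unfolding ws_def by (rule is_cycle_rotate[OF vs], simp_all)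
  have "i + (length vs - 1) + 1 = i + length vs" using len by linarith
  then have "(i + (length vs - 1) + 1) mod length vs = i" using i by simp
  then have w1: "ws ! 1 = w" unfolding ws_def i(2) using len by (subst nth_rotate) auto
  have l012: "0 < length ws" "1 < length ws" "2 < length ws" using len ws(2) by linarith+
  have ine: "ws ! 0 \<in> set vs" "ws ! 2 \<in> set vs" using nth_mem[OF l012(1)] nth_mem[OF l012(3)] ws(3) by auto
  have up: "f (idx w) = idx w'" if w': "w' \<in> set vs" and e: "{w, w'} \<in> ed f" for w'
  proof -
    have "f (idx w) = idx w' \<or> f (idx w') = idx w" using ed_pair[of "idx w" "idx w'" f] idx[OF w] idx[OF w'] e by auto
    moreover have "f (idx w') \<noteq> idx w" using depth_Suc[OF r, of "idx w'"] idx[OF w'] max[OF w'] by auto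
    ultimately show ?thesis by blast
  qed
  have all: "{ws ! k, ws ! (Suc k mod length ws)} \<in> ed f" if "k < length ws" for k
    using ws(1) that unfolding is_cycle_def by blast
  have "Suc 0 mod length ws = 1" "Suc 1 mod length ws = 2" using l012 by simp_all
  then have e: "{ws ! 0, ws ! 1} \<in> ed f" "{ws ! 1, ws ! 2} \<in> ed f" using all[OF l012(1)] all[OF l012(2)] by (simp_all only:)
  have "f (idx w) = idx (ws ! 0)" using up[OF ine(1)] e(1) w1 by (simp add: insert_commute)
  moreover have "f (idx w) = idx (ws ! 2)" using up[OF ine(2)] e(2) w1 by simp
  ultimately have "ws ! 0 = ws ! 2" using idx[OF ine(1)] idx[OF ine(2)] by metis
  moreover have "distinct ws" using ws(1) unfolding is_cycle_def by blast
  ultimately show False using nth_eq_iff_index_eq[OF _ l012(1) l012(3)] by simp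
qed

text \<open>Where \<open>f\<close> and \<open>f'\<close> differ at \<open>i\<close>, the edge from
  \<open>i\<close> to \<open>f i\<close> is traversed by \<open>f'\<close> in the other direction,
  so they also differ at \<open>f i\<close>. The set of disagreements is closed under parents, hence
  empty.\<close>

lemma forest_unique:
  assumes f: "f \<in> forests" "f' \<in> forests" and eq: "ed f = ed f'" "roots f = roots f'"
  shows "f = f'"
proof -
  define B where "B = {i. i < n \<and> f i \<noteq> f' i}"
  have "i < n \<and> f i \<in> B" if "i \<in> B" for i
  proof -
    have i: "i < n" "f i \<noteq> f' i" using that by (auto simp: B_def)
    have "f i \<noteq> n"
    proof
      assume "f i = n"
      then have "i \<in> roots f" using i(1) by (simp add: roots_def)
      then have "i \<in> roots f'" unfolding eq(2) .
      then show False using i \<open>f i = n\<close> by (simp add: roots_def)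
    qed
    then have j: "f i < n" using forestD(1)[OF f(1) i(1)] by auto
    have "{b i, b (f i)} \<in> ed f'" using i j eq(1) unfolding ed_def by blast
    then have "f' i = f i \<or> f' (f i) = i" by (rule ed_pair[OF i(1) j])
    then have "f' (f i) = i" using i(2) by simp
    then show ?thesis using forestD(3)[OF f(1) i(1) j] i j by (auto simp: B_def)
  qed
  then have "B = {}" using f(1) rooted_no_closed_set[of n f B] by (auto simp: forests_def)
  then show ?thesis using f by (intro PiE_ext[of f "{0..<n}" _ f']) (auto simp: forests_def B_def)
qed

lemma card_ed: "f \<in> forests \<Longrightarrow> card (ed f) + card (roots f) = n"
proof -
  assume f: "f \<in> forests"
  let ?A = "{i. i < n \<and> f i < n}"
  have "ed f = (\<lambda>i. {b i, b (f i)}) ` ?A" by (auto simp: ed_def)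
  moreover have "inj_on (\<lambda>i. {b i, b (f i)}) ?A"
  proof (rule inj_onI)
    fix i j assume ij: "i \<in> ?A" "j \<in> ?A" "{b i, b (f i)} = {b j, b (f j)}"
    then have "i = j \<or> (i = f j \<and> f i = j)" using b_pair[of i "f i" j "f j"] by auto
    then show "i = j" using forestD(3)[OF f, of j] ij by auto
  qed
  ultimately have "card (ed f) = card ?A" by (simp add: card_image)
  moreover have "?A \<union> roots f = {..<n}" using forestD(1)[OF f] by (auto simp: roots_def)
  moreover have "card (?A \<union> roots f) = card ?A + card (roots f)" by (rule card_Un_disjoint) (auto simp: roots_def)
  ultimately show ?thesis by simp
qed

lemma tree_forest:
  assumes T: "T \<in> spanning_trees V E"
  shows "\<exists>f\<in>forests. roots f = {0} \<and> ed f = T"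
proof -
  have TE: "T \<subseteq> E" and Tc: "\<And>u v. u \<in> V \<Longrightarrow> v \<in> V \<Longrightarrow> (u, v) \<in> (adjacency T)\<^sup>*" and acyc: "\<nexists>vs. is_cycle T vs"
    using T by (auto simp: spanning_trees_def connected_graph_alt)
  define d where "d i = (LEAST k. (b i, b 0) \<in> adjacency T ^^ k)" for i
  have "\<exists>j. j < n \<and> {b i, b j} \<in> T \<and> d j < d i" if i: "i < n" "i \<noteq> 0" for i
  proof -
    have "(b i, b 0) \<in> (adjacency T)\<^sup>*" using Tc bV i n0 by auto
    then obtain k where k: "(b i, b 0) \<in> adjacency T ^^ k" by (auto dest: rtrancl_imp_relpow)
    then have di: "(b i, b 0) \<in> adjacency T ^^ d i" unfolding d_def by (rule LeastI)
    have "d i \<noteq> 0"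
    proof
      assume "d i = 0"
      then have "b i = b 0" using di by simp
      then show False using b_eq[of i 0] i n0 by simp
    qed
    then obtain m where m: "d i = Suc m" by (cases "d i") auto
    then obtain z where z: "(b i, z) \<in> adjacency T" "(z, b 0) \<in> adjacency T ^^ m"
      using di relpow_Suc_D2[of "b i" "b 0" m "adjacency T"] by auto
    have "{b i, z} \<in> T" using z(1) by (simp add: adjacency_def)
    then have "z \<in> V" using TE edges by auto
    then obtain j where j: "j < n" "z = b j" using V_b by auto
    have "d j \<le> m" unfolding d_def using z(2) j by (intro Least_le) simp
    then show ?thesis using j m \<open>{b i, z} \<in> T\<close> by auto
  qed
  then obtain p where p: "\<And>i. i < n \<Longrightarrow> i \<noteq> 0 \<Longrightarrow> p i < n \<and> {b i, b (p i)} \<in> T \<and> d (p i) < d i" by metis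
  define f where "f i = (if i < n then if i = 0 then n else p i else undefined)" for i
  have f0: "f 0 = n" and fi: "\<And>i. i < n \<Longrightarrow> i \<noteq> 0 \<Longrightarrow> f i = p i" using n0 by (auto simp: f_def)
  have "(i, n) \<in> (arrows n f)\<^sup>*" if "i < n" for i
    using that
  proof (induction "d i" arbitrary: i rule: less_induct)
    case less
    have 1: "(i, f i) \<in> arrows n f" using less.prems by (simp add: arrows_iff)
    show ?case
    proof (cases "i = 0")
      case True then show ?thesis using 1 f0 by auto
    next
      case False
      then have "(p i, n) \<in> (arrows n f)\<^sup>*" using less p by blast
      then show ?thesis using 1 fi[OF less.prems False] by (auto intro: converse_rtrancl_into_rtrancl)
    qed
  qed
  then have r: "rooted n f" by (simp add: rooted_def)
  have "f \<in> PiE {0..<n} (\<lambda>i. insert n (ni i))"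
    using p TE by (auto simp: f_def ni_def PiE_def Pi_def extensional_def)
  then have ff: "f \<in> forests" using r by (simp add: forests_def)
  have roots: "roots f = {0}" using p n0 by (force simp: roots_def f_def split: if_splits)
  have edT: "ed f \<subseteq> T" using p by (auto simp: ed_def f_def split: if_splits)
  have reach: "(b i, b 0) \<in> (adjacency (ed f))\<^sup>*" if "i < n" for i
    using that
  proof (induction "d i" arbitrary: i rule: less_induct)
    case less
    show ?case
    proof (cases "i = 0")
      case False
      have q: "p i < n" "d (p i) < d i" using p[OF less.prems False] by auto
      have "{b i, b (f i)} \<in> ed f" using q fi[OF less.prems False] less.prems unfolding ed_def by auto
      then have "(b i, b (p i)) \<in> adjacency (ed f)" using fi[OF less.prems False] by (simp add: adjacency_def)
      then show ?thesis using less.hyps[OF q(2,1)] by (rule converse_rtrancl_into_rtrancl)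
    qed simp
  qed
  have "T \<subseteq> ed f"
  proof
    fix e assume e: "e \<in> T"
    show "e \<in> ed f"
    proof (rule ccontr)
      assume ne: "e \<notin> ed f"
      obtain u v where uv: "e = {u, v}" "u \<noteq> v" using edges[of e] e TE by (meson card_2_iff subsetD)
      have "e \<subseteq> V" using e TE edges by blast
      then obtain i j where ij: "i < n" "u = b i" "j < n" "v = b j" using uv V_b[of u] V_b[of v] by auto
      have "(u, v) \<in> (adjacency (ed f))\<^sup>*"
        using reach[OF ij(1)] adjacency_rtrancl_sym[OF reach[OF ij(3)]] ij by auto
      then show False using path_edge_cycle[of u v "ed f" T] uv ne e edT acyc by blast
    qed
  qed
  then show ?thesis using ff roots edT by blast
qed

lemma finite_forests: "finite forests"
proof -
  have "finite (PiE {0..<n} (\<lambda>i. insert n (ni i)))"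
    by (intro finite_PiE) (auto simp: ni_def)
  then show ?thesis unfolding forests_def by simp
qed

lemma finite_trees: "finite (spanning_trees V E)"
proof -
  have "spanning_trees V E \<subseteq> Pow E" by (auto simp: spanning_trees_def)
  then show ?thesis using finite_E by (meson finite_Pow_iff finite_subset)
qed

text \<open>Each spanning tree, rooted at vertex 0, is a forest of weight \<epsilon>.\<close>

lemma trees_le_forests:
  assumes "\<epsilon> \<ge> 0"
  shows "\<epsilon> * real (num_spanning_trees V E) \<le> (\<Sum>f\<in>forests. \<epsilon> ^ card (roots f))"
proof -
  obtain F where F: "\<And>T. T \<in> spanning_trees V E \<Longrightarrow> F T \<in> forests \<and> roots (F T) = {0} \<and> ed (F T) = T"
    using tree_forest by metis
  have "inj_on F (spanning_trees V E)" using F by (metis inj_onI)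
  then have c: "card (F ` spanning_trees V E) = num_spanning_trees V E"
    unfolding num_spanning_trees_def by (rule card_image)
  have "\<epsilon> * real (num_spanning_trees V E) = (\<Sum>f\<in>F ` spanning_trees V E. \<epsilon> ^ card (roots f))"
  proof -
    have "(\<Sum>f\<in>F ` spanning_trees V E. \<epsilon> ^ card (roots f)) = (\<Sum>f\<in>F ` spanning_trees V E. \<epsilon>)"
      using F by (intro sum.cong) auto
    then show ?thesis by (simp add: c mult.commute)
  qed
  also have "\<dots> \<le> (\<Sum>f\<in>forests. \<epsilon> ^ card (roots f))"
    using F assms finite_forests by (intro sum_mono2) auto
  finally show ?thesis .
qed

text \<open>A rooted forest is recovered from a spanning tree containing it, the set of tree edges it omits
  and its set of roots; the last two have \<open>c - 1\<close> and \<open>c\<close> elements for a forest with \<open>c\<close> components.\<close>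

lemma forests_le_trees:
  assumes "\<epsilon> \<ge> 0"
  shows "(\<Sum>f\<in>forests. \<epsilon> ^ card (roots f)) \<le> real (num_spanning_trees V E) * (1 + sqrt \<epsilon>) ^ (2 * n)"
proof -
  define s where "s = sqrt \<epsilon>"
  have s: "s \<ge> 0" "s * s = \<epsilon>" using assms by (auto simp: s_def)
  have "\<exists>T\<in>spanning_trees V E. ed f \<subseteq> T" if "f \<in> forests" for f
    by (rule spanning_tree_above[OF finite_E conn ed_sub[OF that] ed_acyclic[OF that]])
  then obtain T where T: "\<And>f. f \<in> forests \<Longrightarrow> T f \<in> spanning_trees V E \<and> ed f \<subseteq> T f" by metis
  have cT: "card t = n - 1" "finite t" if "t \<in> spanning_trees V E" for t
  proof -
    obtain f where "f \<in> forests" "roots f = {0}" "ed f = t" using tree_forest[OF \<open>t \<in> _\<close>] by auto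
    then show "card t = n - 1" using card_ed[of f] by simp
    show "finite t" using \<open>t \<in> _\<close> finite_E finite_subset by (auto simp: spanning_trees_def)
  qed
  define \<Phi> where "\<Phi> f = (T f, (T f - ed f, roots f))" for f
  define \<Omega> where "\<Omega> = (SIGMA t:spanning_trees V E. Pow t \<times> Pow {..<n})"
  define wt where "wt = (\<lambda>(t :: 'v set set, (S :: 'v set set, R :: nat set)). s * (s ^ card S * s ^ card R))"
  have inj: "inj_on \<Phi> forests"
  proof (rule inj_onI)
    fix f f' assume f: "f \<in> forests" "f' \<in> forests" "\<Phi> f = \<Phi> f'"
    then have "T f = T f'" "T f - ed f = T f' - ed f'" "roots f = roots f'" by (auto simp: \<Phi>_def)
    moreover have "ed f = T f - (T f - ed f)" "ed f' = T f' - (T f' - ed f')" using T f by blast+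
    ultimately show "f = f'" using forest_unique f by metis
  qed
  have sub: "\<Phi> ` forests \<subseteq> \<Omega>" using T unfolding \<Phi>_def \<Omega>_def roots_def by auto
  have fin\<Omega>: "finite \<Omega>" unfolding \<Omega>_def using finite_trees cT(2) by (intro finite_SigmaI finite_cartesian_product) auto
  \<comment> \<open>With s the square root of \<epsilon> and c roots, the weight \<epsilon>^c equals
    s times s^(c - 1) for the omitted edges times s^c for the roots.\<close>
  have w: "\<epsilon> ^ card (roots f) = wt (\<Phi> f)" if f: "f \<in> forests" for f
  proof -
    let ?c = "card (roots f)"
    have ft: "finite (T f)" "card (T f) = n - 1" using cT T[OF f] by auto
    have fe: "finite (ed f)" using ed_sub[OF f] finite_E finite_subset by auto
    have "card (T f - ed f) = n - 1 - card (ed f)" using T[OF f] ft fe by (simp add: card_Diff_subset)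
    moreover have "card (ed f) \<le> n - 1" using card_mono[OF ft(1), of "ed f"] T[OF f] ft(2) by simp
    ultimately have "?c = Suc (card (T f - ed f))" using card_ed[OF f] n0 by linarith
    then have "s ^ ?c = s * s ^ card (T f - ed f)" by simp
    moreover have "\<epsilon> ^ ?c = s ^ ?c * s ^ ?c" unfolding s(2)[symmetric] by (rule power_mult_distrib)
    ultimately show ?thesis by (simp add: wt_def \<Phi>_def)
  qed
  have "(\<Sum>f\<in>forests. \<epsilon> ^ card (roots f)) = (\<Sum>x\<in>\<Phi> ` forests. wt x)"
    using w by (simp add: sum.reindex[OF inj])
  also have "\<dots> \<le> (\<Sum>x\<in>\<Omega>. wt x)"
    using sub fin\<Omega> s(1) by (intro sum_mono2) (auto simp: wt_def)
  also have "\<dots> = (\<Sum>t\<in>spanning_trees V E. \<Sum>y\<in>Pow t \<times> Pow {..<n}. wt (t, y))"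
    unfolding \<Omega>_def using finite_trees cT(2) by (subst sum.Sigma) (auto simp: case_prod_beta)
  also have "\<dots> = (\<Sum>t\<in>spanning_trees V E. s * ((1 + s) ^ (n - 1) * (1 + s) ^ n))"
  proof (intro sum.cong refl)
    fix t assume t: "t \<in> spanning_trees V E"
    have "(\<Sum>y\<in>Pow t \<times> Pow {..<n}. wt (t, y)) = (\<Sum>S\<in>Pow t. \<Sum>R\<in>Pow {..<n}. s * (s ^ card S * s ^ card R))"
      by (simp add: sum.cartesian_product wt_def case_prod_beta)
    also have "\<dots> = s * ((\<Sum>S\<in>Pow t. s ^ card S) * (\<Sum>R\<in>Pow {..<n}. s ^ card R))"
      by (subst sum_product) (simp add: sum_distrib_left)
    also have "\<dots> = s * ((1 + s) ^ (n - 1) * (1 + s) ^ n)"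
      using cT[OF t] by (simp add: sum_power_card_Pow)
    finally show "(\<Sum>y\<in>Pow t \<times> Pow {..<n}. wt (t, y)) = s * ((1 + s) ^ (n - 1) * (1 + s) ^ n)" .
  qed
  also have "\<dots> \<le> (\<Sum>t\<in>spanning_trees V E. (1 + s) ^ (2 * n))"
  proof (rule sum_mono)
    have "s * (1 + s) ^ (n - 1) \<le> (1 + s) * (1 + s) ^ (n - 1)" using s by (intro mult_right_mono) auto
    also have "\<dots> = (1 + s) ^ n" using n0 by (cases n) auto
    finally have "s * (1 + s) ^ (n - 1) * (1 + s) ^ n \<le> (1 + s) ^ n * (1 + s) ^ n" using s by (intro mult_right_mono) auto
    then show "s * ((1 + s) ^ (n - 1) * (1 + s) ^ n) \<le> (1 + s) ^ (2 * n)"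
      by (simp add: mult.assoc mult_2 power_add)
  qed
  finally show ?thesis by (simp add: num_spanning_trees_def s_def)
qed

end

section \<open>Logarithm of the characteristic polynomial\<close>

definition mtrace :: "nat \<Rightarrow> 'a::comm_ring_1 mat \<Rightarrow> 'a" where "mtrace n M = (\<Sum>i<n. M $$ (i, i))"

lemma index_mult_square:
  fixes X Y :: "'a::comm_ring_1 mat"
  assumes "X \<in> carrier_mat n n" "Y \<in> carrier_mat n n" "i < n" "j < n"
  shows "(X * Y) $$ (i, j) = (\<Sum>k<n. X $$ (i, k) * Y $$ (k, j))"
  using assms by (simp add: scalar_prod_def lessThan_atLeast0)

lemma mtrace_comm:
  fixes X Y :: "'a::comm_ring_1 mat"
  assumes "X \<in> carrier_mat n n" "Y \<in> carrier_mat n n"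
  shows "mtrace n (X * Y) = mtrace n (Y * X)"
proof -
  have "mtrace n (X * Y) = (\<Sum>i<n. \<Sum>k<n. X $$ (i, k) * Y $$ (k, i))"
    unfolding mtrace_def using index_mult_square[OF assms] by (intro sum.cong) auto
  also have "\<dots> = (\<Sum>k<n. \<Sum>i<n. Y $$ (k, i) * X $$ (i, k))" by (subst sum.swap) (simp add: mult.commute)
  also have "\<dots> = mtrace n (Y * X)"
    unfolding mtrace_def using index_mult_square[OF assms(2,1)] by (intro sum.cong) auto
  finally show ?thesis .
qed

lemma upper_triangular_mult_diag:
  fixes X Y :: "'a::comm_ring_1 mat"
  assumes c: "X \<in> carrier_mat n n" "Y \<in> carrier_mat n n" and ut: "upper_triangular X" "upper_triangular Y"
  shows "upper_triangular (X * Y)" "i < n \<Longrightarrow> (X * Y) $$ (i, i) = X $$ (i, i) * Y $$ (i, i)"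
proof -
  have z: "X $$ (i, k) * Y $$ (k, j) = 0" if "i < n" "k < n" "k < i \<or> j < k" for i j k
    using that ut c by (auto dest: upper_triangularD)
  show "upper_triangular (X * Y)"
  proof (rule upper_triangularI)
    fix i j assume ij: "j < i" "i < dim_row (X * Y)"
    then have "i < n" "j < n" using c by auto
    then have "(X * Y) $$ (i, j) = (\<Sum>k<n. X $$ (i, k) * Y $$ (k, j))" using index_mult_square[OF c] by simp
    also have "\<dots> = 0" using z[OF \<open>i < n\<close>] ij(1) by (intro sum.neutral) (metis lessThan_iff linorder_neqE_nat order.strict_trans)
    finally show "(X * Y) $$ (i, j) = 0" .
  qed
  assume i: "i < n"
  have "(X * Y) $$ (i, i) = (\<Sum>k<n. X $$ (i, k) * Y $$ (k, i))" using index_mult_square[OF c] i by simp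
  also have "\<dots> = (\<Sum>k\<in>{i}. X $$ (i, k) * Y $$ (k, i))"
    using i z[OF i, of _ i] by (intro sum.mono_neutral_right ballI) (auto elim!: linorder_neqE_nat)
  finally show "(X * Y) $$ (i, i) = X $$ (i, i) * Y $$ (i, i)" by simp
qed

lemma upper_triangular_pow_diag:
  fixes B :: "'a::comm_ring_1 mat"
  assumes c: "B \<in> carrier_mat n n" and ut: "upper_triangular B"
  shows "upper_triangular (B ^\<^sub>m k) \<and> (\<forall>i<n. (B ^\<^sub>m k) $$ (i, i) = (B $$ (i, i)) ^ k)"
proof (induction k)
  case 0 then show ?case using c by auto
next
  case (Suc k)
  have ck: "B ^\<^sub>m k \<in> carrier_mat n n" using c by (rule pow_carrier_mat)
  show ?case
    using upper_triangular_mult_diag[OF ck c _ ut] Suc by (auto simp: mult.commute)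
qed

text \<open>A Schur triangularisation puts the same diagonal entries, with multiplicity, into the
  characteristic polynomial and all power traces.\<close>

lemma trace_pow_eigenvalues:
  fixes A :: "complex mat"
  assumes A: "A \<in> carrier_mat n n"
  obtains a where "\<And>z. Determinant.det (z \<cdot>\<^sub>m 1\<^sub>m n - A) = (\<Prod>i<n. z - a i)"
    "\<And>k. mtrace n (A ^\<^sub>m k) = (\<Sum>i<n. a i ^ k)" "\<And>i. i < n \<Longrightarrow> eigenvalue A (a i)"
proof -
  obtain es where es: "char_poly A = (\<Prod>e\<leftarrow>es. [:- e, 1:])" "length es = n" using char_poly_factorized[OF A] by auto
  obtain B P Q where S: "schur_decomposition A es = (B, P, Q)" by (metis prod_cases3)
  have B: "similar_mat_wit A B P Q" "upper_triangular B" "diag_mat B = es"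
    using schur_decomposition[OF A es(1) S] by auto
  note w = similar_mat_witD2[OF A B(1)]
  have Bi: "B $$ (i, i) = es ! i" if "i < n" for i
    using B(3) that w(5) by (auto simp: diag_mat_def)
  show ?thesis
  proof (rule that)
    fix z
    have "Determinant.det (z \<cdot>\<^sub>m 1\<^sub>m n - A) = Determinant.det (- (char_matrix A z))"
      using A by (intro arg_cong[where f = Determinant.det] eq_matI) (auto simp: char_matrix_def)
    also have "\<dots> = poly (char_poly A) z" using char_poly_matrix[OF A] by simp
    also have "\<dots> = (\<Prod>e\<leftarrow>es. z - e)" unfolding es(1) by (simp add: poly_prod_list o_def)
    also have "\<dots> = (\<Prod>i<n. z - es ! i)" using es(2) by (simp add: prod.list_conv_set_nth lessThan_atLeast0)
    finally show "Determinant.det (z \<cdot>\<^sub>m 1\<^sub>m n - A) = (\<Prod>i<n. z - es ! i)" .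
  next
    fix k
    have ck: "B ^\<^sub>m k \<in> carrier_mat n n" using w(5) by (rule pow_carrier_mat)
    have "mtrace n (A ^\<^sub>m k) = mtrace n (P * (B ^\<^sub>m k * Q))"
      using similar_mat_wit_pow_id[OF B(1), of k] w ck by (simp add: assoc_mult_mat[of _ n n _ n _ n])
    also have "\<dots> = mtrace n (B ^\<^sub>m k * Q * P)" using w ck by (intro mtrace_comm) auto
    also have "B ^\<^sub>m k * Q * P = B ^\<^sub>m k" using w ck by (simp add: assoc_mult_mat[of _ n n _ n _ n])
    also have "mtrace n (B ^\<^sub>m k) = (\<Sum>i<n. (es ! i) ^ k)"
      unfolding mtrace_def using upper_triangular_pow_diag[OF w(5) B(2)] Bi by (intro sum.cong) auto
    finally show "mtrace n (A ^\<^sub>m k) = (\<Sum>i<n. (es ! i) ^ k)" .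
  next
    fix i assume i: "i < n"
    have "poly (char_poly A) (es ! i) = (\<Prod>e\<leftarrow>es. es ! i - e)" unfolding es(1) by (simp add: poly_prod_list o_def)
    also have "\<dots> = 0" using i es(2) by (auto simp: prod_list_zero_iff in_set_conv_nth image_iff)
    finally show "eigenvalue A (es ! i)" using eigenvalue_root_char_poly[OF A] by simp
  qed
qed

text \<open>The eigenvector equation is compared at a coordinate of largest modulus.\<close>

lemma eigenvalue_bound:
  fixes A :: "complex mat"
  assumes A: "A \<in> carrier_mat n n" and rows: "\<And>i. i < n \<Longrightarrow> (\<Sum>k<n. cmod (A $$ (i, k))) \<le> c" and ev: "eigenvalue A e"
  shows "cmod e \<le> c"
proof -
  obtain v where v: "v \<in> carrier_vec n" "v \<noteq> 0\<^sub>v n" "A *\<^sub>v v = e \<cdot>\<^sub>v v"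
    using ev A by (auto simp: eigenvalue_def eigenvector_def)
  have "\<exists>i<n. v $ i \<noteq> 0"
  proof (rule ccontr)
    assume "\<not> ?thesis"
    then have "v = 0\<^sub>v n" using v(1) by (intro eq_vecI) auto
    then show False using v(2) by simp
  qed
  then obtain i0 where i0: "i0 < n" "v $ i0 \<noteq> 0" by auto
  let ?m = "Max ((\<lambda>i. cmod (v $ i)) ` {..<n})"
  have "?m \<in> (\<lambda>i. cmod (v $ i)) ` {..<n}" using i0 by (intro Max_in) auto
  then obtain i where i: "i < n" "cmod (v $ i) = ?m" by auto
  have max: "cmod (v $ k) \<le> cmod (v $ i)" if "k < n" for k unfolding i(2) using that by (intro Max_ge) auto
  have pos: "cmod (v $ i) > 0" using max[OF i0(1)] i0(2) by (meson less_le_trans zero_less_norm_iff)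
  have "e * (v $ i) = (A *\<^sub>v v) $ i" using v i by simp
  also have "\<dots> = (\<Sum>k<n. A $$ (i, k) * v $ k)" using A v(1) i(1) by (simp add: scalar_prod_def lessThan_atLeast0)
  finally have "cmod e * cmod (v $ i) = cmod (\<Sum>k<n. A $$ (i, k) * v $ k)" by (metis norm_mult)
  also have "\<dots> \<le> (\<Sum>k<n. cmod (A $$ (i, k)) * cmod (v $ i))"
    using max by (intro order_trans[OF norm_sum] sum_mono) (auto simp: norm_mult intro!: mult_left_mono)
  also have "\<dots> = (\<Sum>k<n. cmod (A $$ (i, k))) * cmod (v $ i)" by (simp add: sum_distrib_right)
  also have "\<dots> \<le> c * cmod (v $ i)" using rows[OF i(1)] by (intro mult_right_mono) auto
  finally show ?thesis using pos by simp
qed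

section \<open>Closed walks as power traces of the adjacency matrix\<close>

context indexed_graph
begin

lemma nb_ni: "i < n \<Longrightarrow> bij_betw b (ni i) (nb E (b i))"
  unfolding bij_betw_def
proof
  assume i: "i < n"
  show "inj_on b (ni i)" using b_eq by (auto simp: inj_on_def ni_def)
  show "b ` ni i = nb E (b i)"
  proof
    show "nb E (b i) \<subseteq> b ` ni i"
    proof
      fix v assume v: "v \<in> nb E (b i)"
      then have "{b i, v} \<in> E" by (simp add: nb_def)
      then have "v \<in> V" using edges by blast
      then obtain j where "j < n" "v = b j" using V_b by auto
      then show "v \<in> b ` ni i" using v by (auto simp: nb_def ni_def)
    qed
  qed (auto simp: nb_def ni_def)
qed

definition adjmat :: "complex mat" where
  "adjmat = Matrix.mat n n (\<lambda>(i, k). if k \<in> ni i then 1 else 0)"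

lemma adjmat_carrier: "adjmat \<in> carrier_mat n n" by (simp add: adjmat_def)

lemma ni_sub: "ni i \<subseteq> {..<n}" by (auto simp: ni_def)

lemma adjmat_pow:
  "i < n \<Longrightarrow> j < n \<Longrightarrow> (adjmat ^\<^sub>m k) $$ (i, j) = of_nat (walks E k (b i) (b j))"
proof (induction k arbitrary: i)
  case 0 then show ?case using adjmat_carrier by (simp add: b_eq)
next
  case (Suc k)
  note c = adjmat_carrier
  have ck: "adjmat ^\<^sub>m k \<in> carrier_mat n n" for k using c by (rule pow_carrier_mat)
  have comm: "adjmat ^\<^sub>m k * adjmat = adjmat * adjmat ^\<^sub>m k" for k
  proof (induction k)
    case 0 then show ?case using c by simp
  next
    case (Suc k)
    then show ?case using c ck[of k] by (simp add: assoc_mult_mat[of _ n n _ n _ n])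
  qed
  have "(adjmat ^\<^sub>m Suc k) $$ (i, j) = (adjmat * adjmat ^\<^sub>m k) $$ (i, j)" by (simp add: comm)
  also have "\<dots> = (\<Sum>l<n. adjmat $$ (i, l) * (adjmat ^\<^sub>m k) $$ (l, j))"
    using index_mult_square[OF c ck Suc.prems] .
  also have "\<dots> = (\<Sum>l<n. if l \<in> ni i then of_nat (walks E k (b l) (b j)) else 0)"
    using Suc by (intro sum.cong) (auto simp: adjmat_def)
  also have "\<dots> = (\<Sum>l\<in>ni i. of_nat (walks E k (b l) (b j)))"
    using ni_sub[of i] by (subst sum.inter_restrict[symmetric]) (auto simp: Int_absorb1)
  also have "\<dots> = of_nat (\<Sum>u\<in>nb E (b i). walks E k u (b j))"
    using sum.reindex_bij_betw[OF nb_ni[OF Suc.prems(1)], of "\<lambda>u. of_nat (walks E k u (b j)) :: complex"] by simp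
  finally show ?case by simp
qed

lemma trace_walks: "mtrace n (adjmat ^\<^sub>m k) = of_nat (\<Sum>v\<in>V. walks E k v v)"
proof -
  have "mtrace n (adjmat ^\<^sub>m k) = of_nat (\<Sum>i<n. walks E k (b i) (b i))"
    unfolding mtrace_def by (simp add: adjmat_pow)
  also have "(\<Sum>i<n. walks E k (b i) (b i)) = (\<Sum>v\<in>V. walks E k v v)" by (rule sum.reindex_bij_betw[OF bij])
  finally show ?thesis .
qed

definition charval :: "real \<Rightarrow> real" where
  "charval x = Determinant.det (Matrix.mat n n (\<lambda>(i, k). (if k = i then x else 0) - (if k \<in> ni i then 1 else 0)))"

text \<open>Eigenvalues have modulus at most 6 < x, so each factor 1 - a / x has a convergent
  logarithmic series, and the sum over all of them has the power traces as coefficients. The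
  logarithms are complex, but the partial sums are real, and exponentiating recovers the
  determinant. The term for k = 0 is a division by 0 and vanishes.\<close>

lemma log_charval:
  assumes deg: "\<And>i. i < n \<Longrightarrow> card (ni i) = 6" and x: "x > 6"
  shows "charval x > 0"
    "(\<lambda>k. real (\<Sum>v\<in>V. walks E k v v) / (real k * x ^ k)) sums (real n * ln x - ln (charval x))"
proof -
  obtain a where a: "\<And>z. Determinant.det (z \<cdot>\<^sub>m 1\<^sub>m n - adjmat) = (\<Prod>i<n. z - a i)"
    "\<And>k. mtrace n (adjmat ^\<^sub>m k) = (\<Sum>i<n. a i ^ k)" "\<And>i. i < n \<Longrightarrow> eigenvalue adjmat (a i)"
    using trace_pow_eigenvalues[OF adjmat_carrier] by blast
  let ?X = "complex_of_real x"
  have rows: "(\<Sum>k<n. cmod (adjmat $$ (i, k))) \<le> 6" if "i < n" for i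
  proof -
    have "(\<Sum>k<n. cmod (adjmat $$ (i, k))) = (\<Sum>k<n. if k \<in> ni i then 1 else 0)"
      using that by (intro sum.cong) (auto simp: adjmat_def)
    also have "\<dots> = real (card (ni i))" using ni_sub[of i] by (simp add: sum.If_cases Int_absorb1)
    finally show ?thesis using deg[OF that] by simp
  qed
  have ai: "cmod (a i) \<le> 6" if "i < n" for i
    by (rule eigenvalue_bound[OF adjmat_carrier rows a(3)[OF that]])
  have lt: "cmod (- (a i / ?X)) < 1" if "i < n" for i using ai[OF that] x by (simp add: norm_divide)
  have "of_real (charval x) = Determinant.det (map_mat complex_of_real (Matrix.mat n n (\<lambda>(i, k). (if k = i then x else 0) - (if k \<in> ni i then 1 else 0))))"
    unfolding charval_def by (rule of_real_hom.hom_det[symmetric])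
  also have "\<dots> = Determinant.det (?X \<cdot>\<^sub>m 1\<^sub>m n - adjmat)"
    by (intro arg_cong[where f = Determinant.det] eq_matI) (auto simp: adjmat_def)
  finally have D: "of_real (charval x) = (\<Prod>i<n. ?X - a i)" using a(1) by simp
  have "(\<lambda>k. - ((a i / ?X) ^ k / of_nat k)) sums Ln (1 - a i / ?X)" if "i < n" for i
    using Ln_series'[OF lt[OF that]] by simp
  then have "(\<lambda>k. \<Sum>i<n. - ((a i / ?X) ^ k / of_nat k)) sums (\<Sum>i<n. Ln (1 - a i / ?X))"
    by (intro sums_sum) auto
  moreover have "(\<Sum>i<n. - ((a i / ?X) ^ k / of_nat k)) = of_real (- (real (\<Sum>v\<in>V. walks E k v v) / (real k * x ^ k)))" for k
  proof -
    have "(\<Sum>i<n. - ((a i / ?X) ^ k / of_nat k)) = - ((\<Sum>i<n. a i ^ k) / (of_nat k * ?X ^ k))"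
      by (simp add: sum_negf sum_divide_distrib power_divide mult.commute)
    also have "(\<Sum>i<n. a i ^ k) = of_nat (\<Sum>v\<in>V. walks E k v v)" using a(2)[of k] trace_walks[of k] by simp
    finally show ?thesis by simp
  qed
  ultimately have cs: "(\<lambda>k. complex_of_real (- (real (\<Sum>v\<in>V. walks E k v v) / (real k * x ^ k)))) sums (\<Sum>i<n. Ln (1 - a i / ?X))"
    by simp
  define L where "L = Re (\<Sum>i<n. Ln (1 - a i / ?X))"
  have rs: "(\<lambda>k. - (real (\<Sum>v\<in>V. walks E k v v) / (real k * x ^ k))) sums L"
    using sums_Re[OF cs] unfolding L_def by simp
  have "complex_of_real L = (\<Sum>i<n. Ln (1 - a i / ?X))"
    using sums_unique2[OF sums_of_real[OF rs, where 'a = complex] cs] .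
  then have "of_real (exp L) = (\<Prod>i<n. exp (Ln (1 - a i / ?X)))" by (simp add: exp_of_real[symmetric] exp_sum)
  also have "\<dots> = (\<Prod>i<n. (?X - a i) / ?X)"
  proof (intro prod.cong refl)
    fix i assume "i \<in> {..<n}"
    then have "cmod (a i) < cmod ?X" using ai[of i] x by simp
    then have "a i \<noteq> ?X" by auto
    then have "1 - a i / ?X \<noteq> 0" using x by (auto simp: field_simps)
    then show "exp (Ln (1 - a i / ?X)) = (?X - a i) / ?X" using x by (simp add: exp_Ln diff_divide_distrib)
  qed
  also have "\<dots> = of_real (charval x / x ^ n)" unfolding prod_dividef D[symmetric] by simp
  finally have "exp L = charval x / x ^ n" using of_real_eq_iff by blast
  then have cv: "charval x = x ^ n * exp L" using x by (simp add: field_simps)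
  then show "charval x > 0" using x by simp
  have "ln (charval x) = real n * ln x + L" unfolding cv using x by (simp add: ln_mult ln_realpow)
  then show "(\<lambda>k. real (\<Sum>v\<in>V. walks E k v v) / (real k * x ^ k)) sums (real n * ln x - ln (charval x))"
    using sums_minus[OF rs] by simp
qed

lemma charval_forests:
  assumes deg: "\<And>i. i < n \<Longrightarrow> card (ni i) = 6"
  shows "charval (6 + \<epsilon>) = (\<Sum>f\<in>forests. \<epsilon> ^ card (roots f))"
proof -
  have "charval (6 + \<epsilon>) = Determinant.det (Matrix.mat n n (\<lambda>(i, k). (if k = i then real (card (ni i)) + \<epsilon> else 0) - (if k \<in> ni i then 1 else 0)))"
    unfolding charval_def using deg by (intro arg_cong[where f = Determinant.det] eq_matI) auto
  also have "\<dots> = (\<Sum>f\<in>{f \<in> PiE {0..<n} (\<lambda>i. insert n (ni i)). rooted n f}. \<epsilon> ^ card {i. i < n \<and> f i = n})"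
    by (rule det_forest_expansion[OF ni_sub])
  finally show ?thesis by (simp add: forests_def roots_def)
qed

end

section \<open>Triangulated tori\<close>

definition cyc :: "nat \<Rightarrow> nat \<Rightarrow> int \<Rightarrow> nat" where "cyc n v d = nat ((int v + d) mod int n)"

lemma int_cyc: "n > 0 \<Longrightarrow> int (cyc n v d) = (int v + d) mod int n" by (simp add: cyc_def)

lemma cyc_less: "n > 0 \<Longrightarrow> cyc n v d < n"
  using int_cyc[of n v d] pos_mod_bound[of "int n" "int v + d"] by linarith

lemma cyc_cyc: "n > 0 \<Longrightarrow> cyc n (cyc n v d) e = cyc n v (d + e)"
  unfolding cyc_def[of n "cyc n v d"] int_cyc by (simp add: cyc_def mod_add_left_eq add.assoc)

lemma cyc_0: "v < n \<Longrightarrow> cyc n v 0 = v" by (simp add: cyc_def flip: zmod_int)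

lemma cyc_eq_iff: "n > 0 \<Longrightarrow> cyc n v d = cyc n v e \<longleftrightarrow> int n dvd d - e"
proof -
  assume n: "n > 0"
  have "cyc n v d = cyc n v e \<longleftrightarrow> (int v + d) mod int n = (int v + e) mod int n"
    using n int_cyc by (metis of_nat_eq_iff)
  also have "\<dots> \<longleftrightarrow> int n dvd d - e" by (simp add: mod_eq_dvd_iff)
  finally show ?thesis .
qed

text \<open>A circulant graph: the triangular lattice modulo the kernel of (a, b) \<mapsto> a + s b
  modulo n.\<close>

definition torus_edges :: "nat \<Rightarrow> nat \<Rightarrow> nat set set" where
  "torus_edges n s = {{v, cyc n v d} | v d. v < n \<and> d \<in> {1, int s, int s + 1}}"

definition disp :: "nat \<Rightarrow> nat \<Rightarrow> int" where "disp s j = fst (hexstep j) + int s * snd (hexstep j)"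

lemma disp_simps: "disp s 0 = 1" "disp s 1 = 1 + int s" "disp s 2 = int s" "disp s 3 = -1" "disp s 4 = -1 - int s" "disp s 5 = - int s"
  by (simp_all add: disp_def hexstep_def)

lemma lessThan_6: "{..<6::nat} = {0, 1, 2, 3, 4, 5}" by auto

lemma disp_image: "disp s ` {..<6} = {1, int s, int s + 1} \<union> uminus ` {1, int s, int s + 1}"
  unfolding lessThan_6 by (auto simp: disp_simps algebra_simps simp del: One_nat_def)

lemma torus_edge_iff:
  assumes "v < n" "u < n"
  shows "{v, u} \<in> torus_edges n s \<longleftrightarrow> (\<exists>j<6. u = cyc n v (disp s j))"
proof -
  have n: "n > 0" using assms by simp
  let ?D = "{1, int s, int s + 1}"
  have flip: "v = cyc n u d \<longleftrightarrow> u = cyc n v (- d)" for d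
    using cyc_cyc[OF n, of u d "- d"] cyc_cyc[OF n, of v "- d" d] cyc_0[OF assms(1)] cyc_0[OF assms(2)] by auto
  have "{v, u} \<in> torus_edges n s \<longleftrightarrow> (\<exists>d\<in>?D. u = cyc n v d) \<or> (\<exists>d\<in>?D. v = cyc n u d)"
  proof
    assume "{v, u} \<in> torus_edges n s"
    then obtain w d where "w < n" "d \<in> ?D" "{v, u} = {w, cyc n w d}" unfolding torus_edges_def by blast
    then show "(\<exists>d\<in>?D. u = cyc n v d) \<or> (\<exists>d\<in>?D. v = cyc n u d)" unfolding doubleton_eq_iff by blast
  next
    assume "(\<exists>d\<in>?D. u = cyc n v d) \<or> (\<exists>d\<in>?D. v = cyc n u d)"
    then show "{v, u} \<in> torus_edges n s" unfolding torus_edges_def using assms insert_commute by blast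
  qed
  also have "\<dots> \<longleftrightarrow> (\<exists>d\<in>disp s ` {..<6}. u = cyc n v d)" unfolding disp_image flip by blast
  also have "\<dots> \<longleftrightarrow> (\<exists>j<6. u = cyc n v (disp s j))" by blast
  finally show ?thesis .
qed

text \<open>Two of the six displacements differ by at most 2 s + 2 < n, so they remain distinct
  modulo n.\<close>

lemma disp_diff:
  assumes "s \<ge> 2" "2 * s + 2 < n" "i < 6" "j < 6" "int n dvd disp s i - disp s j"
  shows "i = j"
proof -
  have ij: "i \<in> {0, 1, 2, 3, 4, 5}" "j \<in> {0, 1, 2, 3, 4, 5}" using assms(3,4) unfolding lessThan_6[symmetric] by auto
  have "\<bar>disp s i - disp s j\<bar> < int n" using ij assms(1,2) by (auto simp: disp_simps simp del: One_nat_def)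
  then have "disp s i - disp s j = 0" using assms(5) zdvd_not_zless[of "\<bar>disp s i - disp s j\<bar>" "int n"] by auto
  then show ?thesis using ij assms(1) by (auto simp: disp_simps simp del: One_nat_def)
qed

lemma disp_nz:
  assumes "s \<ge> 2" "2 * s + 2 < n" "j < 6" "v < n"
  shows "cyc n v (disp s j) \<noteq> v"
proof
  assume "cyc n v (disp s j) = v"
  then have d: "int n dvd disp s j" using cyc_eq_iff[of n v "disp s j" 0] cyc_0[OF assms(4)] assms by simp
  have "j \<in> {0, 1, 2, 3, 4, 5}" using assms(3) unfolding lessThan_6[symmetric] by auto
  then have "\<bar>disp s j\<bar> < int n" "disp s j \<noteq> 0" using assms(1,2) by (auto simp: disp_simps simp del: One_nat_def)
  then show False using d zdvd_not_zless[of "\<bar>disp s j\<bar>" "int n"] by auto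
qed

lemma torus_simple:
  assumes "s \<ge> 2" "2 * s + 2 < n"
  shows "simple_graph {..<n} (torus_edges n s)"
  unfolding simple_graph_def
proof (intro conjI ballI)
  fix e assume "e \<in> torus_edges n s"
  then obtain v d where e: "v < n" "d \<in> {1, int s, int s + 1}" "e = {v, cyc n v d}" unfolding torus_edges_def by blast
  have "d \<in> disp s ` {..<6}" using e(2) unfolding disp_image by auto
  then have "cyc n v d \<noteq> v" using disp_nz[OF assms _ e(1)] by auto
  then show "e \<subseteq> {..<n}" "card e = 2" using e cyc_less[of n v d] by auto
qed auto

lemma torus_nb:
  assumes "s \<ge> 2" "2 * s + 2 < n" "v < n"
  shows "bij_betw (\<lambda>j. cyc n v (disp s j)) {..<6} (nb (torus_edges n s) v)"
proof -
  have n: "n > 0" using assms by simp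
  have "inj_on (\<lambda>j. cyc n v (disp s j)) {..<6}"
    using disp_diff[OF assms(1,2)] cyc_eq_iff[OF n] by (auto intro!: inj_onI)
  moreover have "nb (torus_edges n s) v = (\<lambda>j. cyc n v (disp s j)) ` {..<6}"
  proof (rule Set.set_eqI)
    fix u
    show "u \<in> nb (torus_edges n s) v \<longleftrightarrow> u \<in> (\<lambda>j. cyc n v (disp s j)) ` {..<6}"
    proof (cases "u < n")
      case True
      then show ?thesis using torus_edge_iff[OF assms(3) True] by (auto simp: nb_def)
    next
      case False
      have "\<not> {v, u} \<subseteq> {..<n}" using False by simp
      then have "{v, u} \<notin> torus_edges n s"
        using torus_simple[OF assms(1,2)] unfolding simple_graph_def by metis
      moreover have "u \<noteq> cyc n v d" for d using False cyc_less[OF n, of v d] by metis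
      ultimately show ?thesis by (auto simp: nb_def)
    qed
  qed
  ultimately show ?thesis by (simp add: bij_betw_def)
qed

lemma degree_card_nb:
  assumes "simple_graph V E"
  shows "card {e \<in> E. v \<in> e} = card (nb E v)"
proof -
  have "inj_on (\<lambda>u. {v, u}) (nb E v)" by (auto simp: inj_on_def doubleton_eq_iff)
  moreover have "(\<lambda>u. {v, u}) ` nb E v = {e \<in> E. v \<in> e}"
  proof
    show "{e \<in> E. v \<in> e} \<subseteq> (\<lambda>u. {v, u}) ` nb E v"
    proof
      fix e assume e: "e \<in> {e \<in> E. v \<in> e}"
      then have "card e = 2" using assms by (auto simp: simple_graph_def)
      then obtain a c where ac: "e = {a, c}" by (auto simp: card_2_iff)
      then have "e = {v, if v = a then c else a}" using e by auto
      then show "e \<in> (\<lambda>u. {v, u}) ` nb E v" using e unfolding nb_def by blast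
    qed
  qed (auto simp: nb_def)
  ultimately show ?thesis by (metis card_image)
qed

lemma torus_regular:
  assumes "s \<ge> 2" "2 * s + 2 < n"
  shows "regular_graph 6 {..<n} (torus_edges n s)"
  unfolding regular_graph_def degree_card_nb[OF torus_simple[OF assms]]
  using bij_betw_same_card[OF torus_nb[OF assms]] by auto

lemma torus_connected:
  assumes "n > 0"
  shows "connected_graph {..<n} (torus_edges n s)"
proof -
  let ?R = "adjacency (torus_edges n s)"
  have r: "(0, v) \<in> ?R\<^sup>*" if "v < n" for v
    using that
  proof (induction v)
    case (Suc v)
    have "cyc n v 1 = Suc v" using Suc.prems by (simp add: cyc_def nat_eq_iff)
    then have "{v, Suc v} \<in> torus_edges n s" unfolding torus_edges_def using Suc.prems by force
    then have "(v, Suc v) \<in> ?R" by (simp add: adjacency_def)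
    then show ?case using Suc by (auto intro: rtrancl_into_rtrancl)
  qed simp
  have "(u, v) \<in> ?R\<^sup>*" if "u < n" "v < n" for u v
    using adjacency_rtrancl_sym[OF r[OF that(1)]] r[OF that(2)] by (rule rtrancl_trans)
  then show ?thesis using assms unfolding connected_graph_alt by auto
qed

lemma torus_walks:
  assumes "s \<ge> 2" "2 * s + 2 < n" "v < n"
  shows "walks (torus_edges n s) k v w = card {u \<in> hexwords k. cyc n v (\<Sum>j\<leftarrow>u. disp s j) = w}"
  using assms(3)
proof (induction k arbitrary: v)
  case 0
  have "{u \<in> hexwords 0. cyc n v (\<Sum>j\<leftarrow>u. disp s j) = w} = (if v = w then {[]} else {})"
    using cyc_0[OF 0] by (auto simp: hexwords_def)
  then show ?case by simp
next
  case (Suc k)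
  have n: "n > 0" using assms by simp
  have "walks (torus_edges n s) (Suc k) v w = (\<Sum>j<6. walks (torus_edges n s) k (cyc n v (disp s j)) w)"
    using sum.reindex_bij_betw[OF torus_nb[OF assms(1,2) Suc.prems], of "\<lambda>u. walks (torus_edges n s) k u w"] by simp
  also have "\<dots> = (\<Sum>j<6. card {u \<in> hexwords k. cyc n v (\<Sum>i\<leftarrow>j # u. disp s i) = w})"
    using Suc.IH[OF cyc_less[OF n]] by (simp add: cyc_cyc[OF n])
  finally show ?case unfolding card_hexwords_Suc .
qed

lemma sum_disp: "(\<Sum>j\<leftarrow>u. disp s j) = fst (endpoint u) + int s * snd (endpoint u)"
  by (induction u) (auto simp: endpoint_def disp_def algebra_simps)

lemma endpoint_bound:
  assumes "u \<in> hexwords k"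
  shows "\<bar>fst (endpoint u)\<bar> \<le> int k" "\<bar>snd (endpoint u)\<bar> \<le> int k"
proof -
  have "\<bar>fst (hexstep j)\<bar> \<le> 1 \<and> \<bar>snd (hexstep j)\<bar> \<le> 1" if "j < 6" for j
  proof -
    have "j \<in> {0, 1, 2, 3, 4, 5}" using that unfolding lessThan_6[symmetric] by auto
    then show ?thesis by (auto simp: hexstep_def)
  qed
  then have "set u \<subseteq> {..<6} \<Longrightarrow> \<bar>fst (endpoint u)\<bar> \<le> int (length u) \<and> \<bar>snd (endpoint u)\<bar> \<le> int (length u)"
  proof (induction u)
    case (Cons a u)
    then have "\<bar>fst (hexstep a)\<bar> \<le> 1 \<and> \<bar>snd (hexstep a)\<bar> \<le> 1" "\<bar>fst (endpoint u)\<bar> \<le> int (length u) \<and> \<bar>snd (endpoint u)\<bar> \<le> int (length u)"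
      by auto
    then show ?case by (auto simp: endpoint_def)
  qed (simp add: endpoint_def)
  then show "\<bar>fst (endpoint u)\<bar> \<le> int k" "\<bar>snd (endpoint u)\<bar> \<le> int k" using assms by (auto simp: hexwords_def)
qed

text \<open>A word with lattice endpoint (a, b) satisfies |a + s b| \<le> k (s + 1) < n, so it
  closes modulo n only if a + s b = 0. Then s divides a, and |a| \<le> k < s leaves a = b =
  0.\<close>

lemma torus_closed_walks:
  assumes s: "s \<ge> 2" "2 * s + 2 < n" and v: "v < n" and k: "k < s" "k * (s + 1) < n"
  shows "walks (torus_edges n s) k v v = card (closed_words k)"
proof -
  have "cyc n v (\<Sum>j\<leftarrow>u. disp s j) = v \<longleftrightarrow> endpoint u = (0, 0)" if u: "u \<in> hexwords k" for u
  proof -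
    let ?a = "fst (endpoint u)" and ?b = "snd (endpoint u)"
    note ab = endpoint_bound[OF u]
    have "\<bar>?a + int s * ?b\<bar> \<le> \<bar>?a\<bar> + int s * \<bar>?b\<bar>" by (metis abs_mult abs_of_nat abs_triangle_ineq)
    also have "\<dots> \<le> int k + int s * int k" using ab by (intro add_mono mult_left_mono) auto
    also have "\<dots> = int (k * (s + 1))" by (simp add: algebra_simps)
    finally have lt: "\<bar>?a + int s * ?b\<bar> < int n" using k(2) by linarith
    have "cyc n v (\<Sum>j\<leftarrow>u. disp s j) = v \<longleftrightarrow> int n dvd ?a + int s * ?b"
      using cyc_eq_iff[of n v "\<Sum>j\<leftarrow>u. disp s j" 0] cyc_0[OF v] v by (simp add: sum_disp)
    also have "\<dots> \<longleftrightarrow> ?a + int s * ?b = 0"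
      using lt zdvd_not_zless[of "\<bar>?a + int s * ?b\<bar>" "int n"] by auto
    also have "\<dots> \<longleftrightarrow> ?a = 0 \<and> ?b = 0"
    proof
      assume z: "?a + int s * ?b = 0"
      then have "int s dvd ?a" by (metis dvd_add_left_iff dvd_0_right dvd_triv_left)
      then have "?a = 0" using ab(1) k(1) zdvd_not_zless[of "\<bar>?a\<bar>" "int s"] by auto
      then show "?a = 0 \<and> ?b = 0" using z s(1) by simp
    qed simp
    finally show ?thesis by (simp add: prod_eq_iff)
  qed
  then have "{u \<in> hexwords k. cyc n v (\<Sum>j\<leftarrow>u. disp s j) = v} = closed_words k" by (auto simp: closed_words_def)
  then show ?thesis using torus_walks[OF s v] by simp
qed

text \<open>A square frame is parametrised by rescaling the unit circle to the maximum norm; a frame swept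
  around a frame is the boundary of the first block of the handlebody, tunnel included. Of this torus
  only an open part of the outer face \<open>x = 3\<close> need not lie on the surface.\<close>

definition mnorm :: "real \<Rightarrow> real" where "mnorm t = max \<bar>cos (2 * pi * t)\<bar> \<bar>sin (2 * pi * t)\<bar>"
definition sqx :: "real \<Rightarrow> real" where "sqx t = cos (2 * pi * t) / mnorm t"
definition sqy :: "real \<Rightarrow> real" where "sqy t = sin (2 * pi * t) / mnorm t"

lemma mnorm_pos: "mnorm t > 0"
proof -
  have "cos (2 * pi * t) \<noteq> 0 \<or> sin (2 * pi * t) \<noteq> 0"
  proof (rule ccontr)
    assume "\<not> ?thesis"
    then have c: "cos (2 * pi * t) = 0" "sin (2 * pi * t) = 0" by auto
    show False using sin_cos_squared_add[of "2 * pi * t"] unfolding c by simp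
  qed
  then show ?thesis unfolding mnorm_def by (auto simp: less_max_iff_disj)
qed

lemma continuous_on_sq: "continuous_on A sqx" "continuous_on A sqy"
proof -
  have "continuous_on A mnorm" unfolding mnorm_def by (intro continuous_intros)
  moreover have "\<forall>t\<in>A. mnorm t \<noteq> 0" using mnorm_pos by (metis less_irrefl)
  ultimately show "continuous_on A sqx" "continuous_on A sqy"
    unfolding sqx_def sqy_def by (auto intro!: continuous_intros)
qed

lemma max_sq: "max \<bar>sqx t\<bar> \<bar>sqy t\<bar> = 1"
proof -
  have "max \<bar>sqx t\<bar> \<bar>sqy t\<bar> = max \<bar>cos (2 * pi * t)\<bar> \<bar>sin (2 * pi * t)\<bar> / mnorm t"
    using mnorm_pos[of t] by (simp add: sqx_def sqy_def abs_divide max_def divide_le_cancel)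
  then show ?thesis using mnorm_pos[of t] by (simp flip: mnorm_def)
qed

lemma sq_le: "\<bar>sqx t\<bar> \<le> 1" "\<bar>sqy t\<bar> \<le> 1" and sq_cases: "\<bar>sqx t\<bar> = 1 \<or> \<bar>sqy t\<bar> = 1"
  using max_sq[of t] by (auto simp: max_def split: if_splits)

lemma sq_periodic: "sqx (t + of_int m) = sqx t" "sqy (t + of_int m) = sqy t"
proof -
  have "2 * pi * (t + of_int m) = 2 * pi * t + 2 * pi * of_int m" by (simp add: algebra_simps)
  then have "sin (2 * pi * (t + of_int m)) = sin (2 * pi * t) \<and> cos (2 * pi * (t + of_int m)) = cos (2 * pi * t)"
    unfolding sin_cos_eq_iff by blast
  then show "sqx (t + of_int m) = sqx t" "sqy (t + of_int m) = sqy t"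
    by (simp_all add: sqx_def sqy_def mnorm_def)
qed

text \<open>The Euclidean length of the point determines \<open>mnorm\<close>, hence the point of
  the unit circle, hence the parameter modulo 1.\<close>

lemma sq_eq:
  assumes "sqx t = sqx t'" "sqy t = sqy t'"
  shows "\<exists>m. t = t' + of_int m"
proof -
  have q: "(sqx u)\<^sup>2 + (sqy u)\<^sup>2 = 1 / (mnorm u)\<^sup>2" for u
    by (simp add: sqx_def sqy_def power_divide add_divide_distrib[symmetric])
  have "(mnorm t)\<^sup>2 = (mnorm t')\<^sup>2" using q[of t] q[of t'] assms by simp
  then have m: "mnorm t = mnorm t'" using mnorm_pos[of t] mnorm_pos[of t'] by (simp add: power2_eq_iff)
  have "sin (2 * pi * t) = sin (2 * pi * t') \<and> cos (2 * pi * t) = cos (2 * pi * t')"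
    using assms m mnorm_pos[of t'] by (simp add: sqx_def sqy_def)
  then obtain k :: int where "2 * pi * t = 2 * pi * t' + 2 * pi * of_int k" unfolding sin_cos_eq_iff by blast
  then have "2 * pi * t = 2 * pi * (t' + of_int k)" by (simp add: algebra_simps)
  then show ?thesis by (intro exI[of _ k]) simp
qed

text \<open>\<open>\<phi>\<close> runs around the boundary of the cross-section, whose radius ranges
  over [1/2, 3/2] and whose height over [0, 1]; \<open>\<theta>\<close> runs around the tunnel axis
  above (3/2, 3/2).\<close>

definition torus_point :: "real \<Rightarrow> real \<Rightarrow> real \<times> real \<times> real" where
  "torus_point \<phi> \<theta> = (3/2 + (1 + sqx \<phi> / 2) * sqx \<theta>, 3/2 + (1 + sqx \<phi> / 2) * sqy \<theta>, 1/2 + sqy \<phi> / 2)"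

lemma torus_point_periodic: "torus_point (\<phi> + of_int a) (\<theta> + of_int c) = torus_point \<phi> \<theta>"
  by (simp add: torus_point_def sq_periodic)

text \<open>The maximum norm of the horizontal offset from the axis is the radius, which recovers
  \<open>sqx \<phi>\<close>; then both frame points are known.\<close>

lemma torus_point_eq:
  assumes "torus_point \<phi> \<theta> = torus_point \<phi>' \<theta>'"
  shows "(\<exists>a. \<phi> = \<phi>' + of_int a) \<and> (\<exists>c. \<theta> = \<theta>' + of_int c)"
proof -
  let ?r = "1 + sqx \<phi> / 2" and ?r' = "1 + sqx \<phi>' / 2"
  have r: "?r > 0" "?r' > 0" using sq_le(1)[of \<phi>] sq_le(1)[of \<phi>'] by linarith+
  have eq: "?r * sqx \<theta> = ?r' * sqx \<theta>'" "?r * sqy \<theta> = ?r' * sqy \<theta>'" "sqy \<phi> = sqy \<phi>'"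
    using assms by (simp_all add: torus_point_def)
  have m: "max \<bar>c * sqx u\<bar> \<bar>c * sqy u\<bar> = c" if "c > 0" for c u
  proof -
    have "max \<bar>c * sqx u\<bar> \<bar>c * sqy u\<bar> = c * max \<bar>sqx u\<bar> \<bar>sqy u\<bar>" using that by (simp add: abs_mult max_mult_distrib_left)
    then show ?thesis using max_sq[of u] by simp
  qed
  have rr: "?r = ?r'" using m[OF r(1), of \<theta>] m[OF r(2), of \<theta>'] unfolding eq(1,2) by linarith
  then have "sqx \<phi> = sqx \<phi>'" by simp
  moreover have "sqx \<theta> = sqx \<theta>'" "sqy \<theta> = sqy \<theta>'" using eq(1,2) r(2) unfolding rr by simp_all
  ultimately show ?thesis using sq_eq[of \<phi> \<phi>'] sq_eq[of \<theta> \<theta>'] eq(3) by blast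
qed

lemma continuous_on_torus_point:
  assumes "continuous_on A f" "continuous_on A h"
  shows "continuous_on A (\<lambda>y. torus_point (f y) (h y))"
proof -
  have c: "continuous_on A (\<lambda>y. sqx (f y))" "continuous_on A (\<lambda>y. sqy (f y))"
    "continuous_on A (\<lambda>y. sqx (h y))" "continuous_on A (\<lambda>y. sqy (h y))"
    using assms continuous_on_sq[of UNIV] by (auto intro: continuous_on_compose2)
  show ?thesis unfolding torus_point_def by (intro continuous_intros c) auto
qed

text \<open>For g \<ge> 2 the block continues beyond x = 3. On that face \<open>sqx \<phi>\<close>
  and \<open>sqx \<theta>\<close> are both 1, so both cosines are positive. The hypothesis excludes
  this and leaves the top, the bottom, the tunnel walls and the other three outer faces.\<close>

lemma torus_point_surface:
  assumes g: "g \<ge> 1" and out: "cos (2 * pi * \<phi>) \<le> 0 \<or> cos (2 * pi * \<theta>) \<le> 0"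
  shows "torus_point \<phi> \<theta> \<in> genus_surface g"
proof -
  have out': "sqx \<phi> \<le> 0 \<or> sqx \<theta> \<le> 0"
    using out mnorm_pos[of \<phi>] mnorm_pos[of \<theta>] by (auto simp: sqx_def divide_le_0_iff)
  define r x y z where d: "r = 1 + sqx \<phi> / 2" "x = 3/2 + r * sqx \<theta>" "y = 3/2 + r * sqy \<theta>" "z = 1/2 + sqy \<phi> / 2"
  have p: "torus_point \<phi> \<theta> = (x, y, z)" by (simp add: torus_point_def d)
  have r: "1/2 \<le> r" "r \<le> 3/2" and z: "0 \<le> z" "z \<le> 1" using sq_le[of \<phi>] unfolding d by linarith+
  have bound: "\<bar>c * sqx \<theta>\<bar> \<le> c" "\<bar>c * sqy \<theta>\<bar> \<le> c" if "c \<ge> 0" for c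
    using sq_le[of \<theta>] that by (auto simp: abs_mult intro: mult_left_le)
  have xy: "0 \<le> x" "x \<le> 3" "0 \<le> y" "y \<le> 3" using bound[of r] r unfolding d(2,3) by linarith+
  have far: "\<bar>x - 3/2\<bar> = r \<or> \<bar>y - 3/2\<bar> = r" using sq_cases[of \<theta>] r by (auto simp: d(2,3) abs_mult)
  have H: "(x, y, z) \<in> handlebody g"
  proof -
    have "\<not> (2 * real i + 1 < x \<and> x < 2 * real i + 2 \<and> 1 < y \<and> y < 2)" for i
    proof (cases "i = 0")
      case True
      then show ?thesis using far r by (auto simp: abs_if split: if_splits)
    next
      case False
      then have "real i \<ge> 1" by simp
      then show ?thesis using xy by auto
    qed
    then show ?thesis using xy z g by (auto simp: handlebody_def)
  qed
  have hole: "(x', y', z') \<notin> handlebody g" if "1 < x'" "x' < 2" "1 < y'" "y' < 2" for x' y' z'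
  proof -
    have "\<exists>i<g. 2 * real i + 1 < x' \<and> x' < 2 * real i + 2 \<and> 1 < y' \<and> y' < 2"
      using that g by (intro exI[of _ 0]) auto
    then show ?thesis unfolding handlebody_def mem_Collect_eq prod.case by blast
  qed
  consider "z = 0 \<or> z = 1" | "r = 1/2" | "r = 3/2" "x = 0" | "r = 3/2" "y = 0 \<or> y = 3"
    using sq_cases[of \<phi>] sq_cases[of \<theta>] out' unfolding d by (auto simp: abs_if split: if_splits)
  then have "(x, y, z) \<in> genus_surface g"
  proof cases
    case 1
    then show ?thesis using plate_surface[OF H] plate_surface[OF H, of 0] by auto
  next
    case 2
    show ?thesis
    proof (rule frontier_handlebodyI[OF H])
      fix e :: real assume e: "e > 0"
      \<comment> \<open>Shrinking the radius from 1/2 to 1/2 - c moves the point into the open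
        tunnel.\<close>
      define c where "c = min (e / 4) (1 / 4)"
      have c: "0 < c" "c \<le> e / 4" "c \<le> 1 / 4" using e by (auto simp: c_def)
      let ?x = "3/2 + (1/2 - c) * sqx \<theta>" and ?y = "3/2 + (1/2 - c) * sqy \<theta>"
      have "\<bar>?x - 3/2\<bar> < 1/2" "\<bar>?y - 3/2\<bar> < 1/2" using bound[of "1/2 - c"] c by auto
      then have "1 < ?x \<and> ?x < 2 \<and> 1 < ?y \<and> ?y < 2" by (simp only: abs_less_iff) linarith
      then have "(?x, ?y, z) \<notin> handlebody g" by (intro hole) auto
      moreover have "\<bar>?x - x\<bar> \<le> c" "\<bar>?y - y\<bar> \<le> c" using bound[of c] c unfolding d(2,3) 2 by (auto simp: algebra_simps)
      then have "dist (?x, ?y, z) (x, y, z) < e" using dist_triple(4)[of ?x ?y z x y z] c by simp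
      ultimately show "\<exists>q. q \<notin> handlebody g \<and> dist q (x, y, z) < e" by blast
    qed
  next
    case 3
    show ?thesis
    proof (rule frontier_handlebodyI[OF H])
      fix e :: real assume e: "e > 0"
      then have "(- e / 2, y, z) \<notin> handlebody g" "dist (- e / 2, y, z) (x, y, z) < e"
        using dist_triple(4)[of "- e / 2" y z x y z] 3 by (auto simp: handlebody_def)
      then show "\<exists>q. q \<notin> handlebody g \<and> dist q (x, y, z) < e" by blast
    qed
  next
    case 4
    show ?thesis
    proof (rule frontier_handlebodyI[OF H])
      fix e :: real assume e: "e > 0"
      let ?y = "if y = 0 then - e / 2 else 3 + e / 2"
      have "(x, ?y, z) \<notin> handlebody g" "dist (x, ?y, z) (x, y, z) < e"
        using dist_triple(4)[of x ?y z x y z] 4 e by (auto simp: handlebody_def)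
      then show "\<exists>q. q \<notin> handlebody g \<and> dist q (x, y, z) < e" by blast
    qed
  qed
  then show ?thesis using p by simp
qed

section \<open>Drawing the edges on the torus\<close>

lemma embeddableI:
  assumes p: "inj_on p V" "p ` V \<subseteq> S"
    and ends: "\<And>e. e \<in> E \<Longrightarrow> \<exists>u\<in>V. \<exists>v\<in>V. u \<noteq> v \<and> e = {u, v} \<and> \<gamma> e 0 = p u \<and> \<gamma> e 1 = p v"
    and curve: "\<And>e. e \<in> E \<Longrightarrow> path (\<gamma> e)" "\<And>e. e \<in> E \<Longrightarrow> path_image (\<gamma> e) \<subseteq> S"
    and vert: "\<And>e y v. e \<in> E \<Longrightarrow> 0 < y \<Longrightarrow> y < 1 \<Longrightarrow> v \<in> V \<Longrightarrow> \<gamma> e y \<noteq> p v"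
    and cross: "\<And>e f y y'. e \<in> E \<Longrightarrow> f \<in> E \<Longrightarrow> 0 < y \<Longrightarrow> y < 1 \<Longrightarrow> 0 < y' \<Longrightarrow> y' < 1 \<Longrightarrow> \<gamma> e y = \<gamma> f y' \<Longrightarrow> e = f \<and> y = y'"
  shows "embeddable V E S"
proof -
  have im: "path_image (\<gamma> e) = p ` e \<union> \<gamma> e ` {0<..<1}" "e \<subseteq> V" if e: "e \<in> E" for e
  proof -
    obtain u v where uv: "u \<in> V" "v \<in> V" "e = {u, v}" "\<gamma> e 0 = p u" "\<gamma> e 1 = p v" using ends[OF e] by blast
    have "{0..1::real} = {0, 1} \<union> {0<..<1}" by auto
    then show "path_image (\<gamma> e) = p ` e \<union> \<gamma> e ` {0<..<1}" using uv unfolding path_image_def by auto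
    show "e \<subseteq> V" using uv by auto
  qed
  have arc: "arc (\<gamma> e)" if e: "e \<in> E" for e
    unfolding arc_def
  proof (intro conjI curve(1)[OF e] inj_onI)
    fix y y' :: real assume y: "y \<in> {0..1}" "y' \<in> {0..1}" "\<gamma> e y = \<gamma> e y'"
    obtain u v where uv: "u \<in> V" "v \<in> V" "u \<noteq> v" "\<gamma> e 0 = p u" "\<gamma> e 1 = p v" using ends[OF e] by blast
    have puv: "p u \<noteq> p v" using p(1) uv by (auto simp: inj_on_def)
    consider "y = 0" | "y = 1" | "0 < y" "y < 1" using y(1) by fastforce
    moreover consider "y' = 0" | "y' = 1" | "0 < y'" "y' < 1" using y(2) by fastforce
    ultimately show "y = y'"
      using y(3) cross[OF e e, of y y'] vert[OF e, of y] vert[OF e, of y'] uv puv by metis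
  qed
  show ?thesis
    unfolding embeddable_def
  proof (intro exI[of _ p] exI[of _ \<gamma>] conjI ballI impI)
    fix e assume e: "e \<in> E"
    show "arc (\<gamma> e)" by (rule arc[OF e])
    show "path_image (\<gamma> e) \<subseteq> S" by (rule curve(2)[OF e])
    show "{pathstart (\<gamma> e), pathfinish (\<gamma> e)} = p ` e"
      using ends[OF e] unfolding pathstart_def pathfinish_def by auto
    show "path_image (\<gamma> e) \<inter> p ` V = p ` e"
    proof -
      have "\<gamma> e ` {0<..<1} \<inter> p ` V = {}" using vert[OF e] by fastforce
      moreover have "p ` e \<subseteq> p ` V" using im(2)[OF e] by (rule image_mono)
      ultimately show ?thesis unfolding im(1)[OF e] by blast
    qed
  next
    fix e f assume ef: "e \<in> E" "f \<in> E" "e \<noteq> f"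
    have "p ` e \<inter> p ` f = p ` (e \<inter> f)" using inj_on_image_Int[OF p(1) im(2)[OF ef(1)] im(2)[OF ef(2)]] by simp
    moreover have "\<gamma> e y \<noteq> \<gamma> f y'" if "0 < y" "y < 1" "0 < y'" "y' < 1" for y y'
      using cross[OF ef(1,2) that] ef(3) by blast
    then have "\<gamma> e ` {0<..<1} \<inter> \<gamma> f ` {0<..<1} = {}" by auto
    moreover have "\<gamma> e y \<noteq> p v" if "0 < y" "y < 1" "v \<in> f" for y v
      using vert[OF ef(1) that(1,2)] im(2)[OF ef(2)] that(3) by blast
    then have "\<gamma> e ` {0<..<1} \<inter> p ` f = {}" by auto
    moreover have "\<gamma> f y \<noteq> p v" if "0 < y" "y < 1" "v \<in> e" for y v
      using vert[OF ef(2) that(1,2)] im(2)[OF ef(1)] that(3) by blast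
    then have "\<gamma> f ` {0<..<1} \<inter> p ` e = {}" by auto
    ultimately show "path_image (\<gamma> e) \<inter> path_image (\<gamma> f) \<subseteq> p ` (e \<inter> f)"
      unfolding im(1)[OF ef(1)] im(1)[OF ef(2)] by (simp add: Int_Un_distrib Int_Un_distrib2 Int_commute)
  qed (use p in auto)
qed

text \<open>The strands, indexed by all integers in the universal cover, run from left to right in
  increasing order and never cross. In the middle they are pushed to where the torus point lies on
  the surface whatever the other coordinate is.\<close>

definition smid :: "nat \<Rightarrow> int \<Rightarrow> real" where
  "smid n k = of_int (k div (2 * int n)) + 1/4 + of_int (k mod (2 * int n)) / (4 * real n)"

definition strand :: "nat \<Rightarrow> nat \<Rightarrow> int \<Rightarrow> real \<Rightarrow> real" where
  "strand n s k y = max 0 (1 - 4 * y) * (of_int (k div 2) / real n)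
     + (1 - max 0 (1 - 4 * y) - max 0 (4 * y - 3)) * smid n k
     + max 0 (4 * y - 3) * (of_int ((k + 1) div 2 + int s) / real n)"

text \<open>All 2 n strands of a period are squeezed into the half [1/4, 3/4) of the circle, where
  the cosine is not positive.\<close>

lemma smid_bounds:
  assumes "n > 0" shows "of_int (k div (2 * int n)) + 1/4 \<le> smid n k" "smid n k < of_int (k div (2 * int n)) + 3/4"
proof -
  let ?r = "k mod (2 * int n)"
  have "0 \<le> ?r" "?r < 2 * int n" using assms by simp_all
  then have "real_of_int ?r \<ge> 0" "real_of_int ?r < 2 * real n" by linarith+
  then have "real_of_int ?r / (4 * real n) \<ge> 0" "real_of_int ?r / (4 * real n) < 1/2" using assms by (simp_all add: field_simps)
  then show "of_int (k div (2 * int n)) + 1/4 \<le> smid n k" "smid n k < of_int (k div (2 * int n)) + 3/4"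
    unfolding smid_def by linarith+
qed

lemma smid_strict_mono:
  assumes n: "n > 0" and kl: "k < l" shows "smid n k < smid n l"
proof -
  have "k div (2 * int n) \<le> l div (2 * int n)" using kl n by (intro zdiv_mono1) auto
  then consider "k div (2 * int n) + 1 \<le> l div (2 * int n)" | "k div (2 * int n) = l div (2 * int n)" by linarith
  then show ?thesis
  proof cases
    case 1
    then have "real_of_int (k div (2 * int n)) + 1 \<le> real_of_int (l div (2 * int n))" by linarith
    then show ?thesis using smid_bounds[OF n, of k] smid_bounds[OF n, of l] by linarith
  next
    case 2
    then have "k mod (2 * int n) < l mod (2 * int n)"
      using kl div_mult_mod_eq[of k "2 * int n"] div_mult_mod_eq[of l "2 * int n"] by auto
    then show ?thesis unfolding smid_def 2 using n by (simp add: divide_strict_right_mono)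
  qed
qed

text \<open>A convex combination of three terms that do not decrease in the index; the middle one
  increases strictly and has positive weight for 0 < y < 1.\<close>

lemma strand_strict_mono:
  assumes n: "n > 0" and kl: "k < l" and y: "0 < y" "y < 1" shows "strand n s k y < strand n s l y"
proof -
  define a c where "a = max 0 (1 - 4 * y)" "c = max 0 (4 * y - 3)"
  have ac: "a \<ge> 0" "c \<ge> 0" "1 - a - c > 0" using y by (auto simp: a_c_def max_def)
  have "a * (of_int (k div 2) / real n) \<le> a * (of_int (l div 2) / real n)"
    using kl ac(1) by (intro mult_left_mono divide_right_mono) (auto intro: zdiv_mono1)
  moreover have "c * (of_int ((k + 1) div 2 + int s) / real n) \<le> c * (of_int ((l + 1) div 2 + int s) / real n)"
    using kl ac(2) zdiv_mono1[of "k + 1" "l + 1" 2] by (intro mult_left_mono divide_right_mono) auto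
  moreover have "(1 - a - c) * smid n k < (1 - a - c) * smid n l"
    using smid_strict_mono[OF n kl] ac(3) by simp
  ultimately show ?thesis unfolding strand_def a_c_def by linarith
qed

text \<open>A period of 2 n strands makes one full turn in \<open>\<phi>\<close>.\<close>

lemma strand_shift:
  assumes n: "n > 0" shows "strand n s (k + 2 * int n * m) y = strand n s k y + of_int m"
proof -
  have e: "(a + 2 * c) div 2 = a div 2 + c" for a c :: int by simp
  have 1: "(k + 2 * int n * m) div 2 = k div 2 + int n * m" "(k + 2 * int n * m + 1) div 2 = (k + 1) div 2 + int n * m"
    using e[of k "int n * m"] e[of "k + 1" "int n * m"] by (simp_all add: algebra_simps)
  have 2: "smid n (k + 2 * int n * m) = smid n k + of_int m" using n by (simp add: smid_def)
  have 3: "of_int (i + int n * m) / real n = of_int i / real n + of_int m" for i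
    using n by (simp add: add_divide_distrib)
  have 4: "(k + 1) div 2 + int n * m + int s = (k + 1) div 2 + int s + int n * m" by simp
  show ?thesis unfolding strand_def 1 2 3 4 by (simp add: algebra_simps)
qed

text \<open>Strand 2 i joins i to i + s, strand 2 i + 1 joins i to i + s + 1. Rounding k / 2 down at
  one end and up at the other thus lists these two kinds of edges from left to right.\<close>

lemma strand_ends: "strand n s k 0 = of_int (k div 2) / real n" "strand n s k 1 = of_int ((k + 1) div 2 + int s) / real n"
  by (simp_all add: strand_def)

lemma cos_le_0:
  assumes "of_int m + 1/4 \<le> t" "t \<le> of_int m + 3/4" shows "cos (2 * pi * t) \<le> 0"
proof -
  define u where "u = t - of_int m - 1/2"
  have u: "\<bar>u\<bar> \<le> 1/4" using assms unfolding u_def by linarith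
  have "\<bar>2 * pi * u\<bar> \<le> pi / 2" using u by (simp add: abs_mult)
  then have "cos (2 * pi * u) \<ge> 0" by (intro cos_ge_zero) linarith+
  moreover have "cos (2 * pi * t) = cos (2 * pi * u + pi + 2 * pi * of_int m)" unfolding u_def by (simp add: algebra_simps)
  then have "cos (2 * pi * t) = cos (2 * pi * u + pi)" using sin_cos_eq_iff by metis
  ultimately show ?thesis by simp
qed

text \<open>In the first and last quarter of y the angle \<open>\<theta>\<close> = 1/2 + y has
  nonpositive cosine; in the middle half the strand stays at \<open>smid\<close>, and
  \<open>\<phi>\<close> has it.\<close>

lemma strand_surface:
  assumes g: "g \<ge> 1" and n: "n > 0" and y: "0 \<le> y" "y \<le> 1"
  shows "torus_point (strand n s k y) (1/2 + y) \<in> genus_surface g"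
proof (cases "1/4 \<le> y \<and> y \<le> 3/4")
  case True
  then have "strand n s k y = smid n k" by (simp add: strand_def)
  moreover have "cos (2 * pi * smid n k) \<le> 0"
    using smid_bounds[OF n, of k] by (intro cos_le_0[of "k div (2 * int n)"]) auto
  ultimately show ?thesis by (intro torus_point_surface[OF g]) auto
next
  case False
  then have "cos (2 * pi * (1/2 + y)) \<le> 0"
    using y cos_le_0[of 0 "1/2 + y"] cos_le_0[of 1 "1/2 + y"] by auto
  then show ?thesis by (intro torus_point_surface[OF g]) auto
qed

text \<open>Edges of step 1 run along the circle \<open>\<theta>\<close> = 1/2 through the vertices.
  The codes t = 1 and t = 2 stand for the steps s and s + 1, drawn along strands once around the
  tunnel.\<close>

definition tcurve :: "nat \<Rightarrow> nat \<Rightarrow> nat \<times> nat \<Rightarrow> real \<Rightarrow> real \<times> real \<times> real" where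
  "tcurve n s = (\<lambda>(i, t) y. if t = 0 then torus_point ((real i + y) / real n) (1/2)
     else torus_point (strand n s (2 * int i + int t - 1) y) (1/2 + y))"

lemma torus_point_vertex:
  assumes "n > 0" shows "torus_point (of_int (int i + d) / real n) (1/2) = torus_point (real (cyc n i d) / real n) (1/2)"
proof -
  have "int i + d = int (cyc n i d) + int n * ((int i + d) div int n)"
    using assms by (simp add: int_cyc)
  then have "real_of_int (int i + d) = real (cyc n i d) + real n * of_int ((int i + d) div int n)"
    by (metis of_int_add of_int_mult of_int_of_nat_eq)
  then have "of_int (int i + d) / real n = real (cyc n i d) / real n + of_int ((int i + d) div int n)"
    using assms by (simp add: add_divide_distrib)
  then show ?thesis using torus_point_periodic[of _ _ "1/2" 0] by simp
qed

lemma frac_eq: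
  assumes "(real i + y) / real n = (real j + y') / real n + of_int m" "i < n" "j < n" "0 \<le> y" "y < 1" "0 \<le> y'" "y' < 1"
  shows "i = j \<and> y = y'"
proof -
  have "real i + y = real j + y' + of_int m * real n" using assms(1,2) by (simp add: field_simps)
  then have eq: "real_of_int (int i) + y = real_of_int (int j + m * int n) + y'" by simp
  have "int i = int j + m * int n" using eq assms(4-7) by linarith
  moreover from this have "y = y'" using eq by simp
  moreover have "m = 0"
  proof (rule ccontr)
    assume "m \<noteq> 0"
    then have "int n * 1 \<le> int n * \<bar>m\<bar>" by (intro mult_left_mono) auto
    moreover have "int n * \<bar>m\<bar> = \<bar>int i - int j\<bar>" using \<open>int i = _\<close> by (simp add: abs_mult mult.commute)
    ultimately show False using assms(2,3) by linarith
  qed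
  ultimately show ?thesis by simp
qed

lemma tcurve_inj:
  assumes ij: "i < n" "j < n" "t < 3" "u < 3" and y: "0 < y" "y < 1" "0 < y'" "y' < 1"
    and eq: "tcurve n s (i, t) y = tcurve n s (j, u) y'"
  shows "i = j \<and> t = u \<and> y = y'"
proof -
  have n: "n > 0" using ij by simp
  have "\<not> (0 < real_of_int c \<and> real_of_int c < 1)" for c by auto
  then have noint: "y \<noteq> of_int c" "y' \<noteq> of_int c" for c using y by metis+
  consider "t = 0" "u = 0" | "t = 0" "u \<noteq> 0" | "t \<noteq> 0" "u = 0" | "t \<noteq> 0" "u \<noteq> 0" by blast
  then show ?thesis
  proof cases
    case 1
    then have "torus_point ((real i + y) / real n) (1/2) = torus_point ((real j + y') / real n) (1/2)"
      using eq by (simp add: tcurve_def)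
    from torus_point_eq[OF this] obtain m where "(real i + y) / real n = (real j + y') / real n + of_int m" by blast
    then show ?thesis using frac_eq[of i y n j y' m] ij y 1 by simp
  next
    case 2
    then have "torus_point ((real i + y) / real n) (1/2) = torus_point (strand n s (2 * int j + int u - 1) y') (1/2 + y')"
      using eq by (simp add: tcurve_def)
    from torus_point_eq[OF this] obtain c where "1/2 = 1/2 + y' + of_int c" by blast
    then show ?thesis using noint(2)[of "- c"] by simp
  next
    case 3
    then have "torus_point (strand n s (2 * int i + int t - 1) y) (1/2 + y) = torus_point ((real j + y') / real n) (1/2)"
      using eq by (simp add: tcurve_def)
    from torus_point_eq[OF this] obtain c where "1/2 + y = 1/2 + of_int c" by blast
    then show ?thesis using noint(1)[of c] by simp
  next
    case 4
    let ?k = "2 * int i + int t - 1" and ?l = "2 * int j + int u - 1"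
    have "torus_point (strand n s ?k y) (1/2 + y) = torus_point (strand n s ?l y') (1/2 + y')"
      using eq 4 by (simp add: tcurve_def)
    then obtain m c where mc: "strand n s ?k y = strand n s ?l y' + of_int m" "1/2 + y = 1/2 + y' + of_int c"
      using torus_point_eq[of "strand n s ?k y" "1/2 + y" "strand n s ?l y'" "1/2 + y'"] by blast
    have "c = 0" using mc(2) y by linarith
    then have yy: "y = y'" using mc(2) by simp
    then have "strand n s ?k y = strand n s (?l + 2 * int n * m) y" using mc(1) by (simp add: strand_shift[OF n])
    \<comment> \<open>Strands in the universal cover never cross, so strands that agree at one inner
      y are equal up to full turns.\<close>
    then have kl: "?k = ?l + 2 * int n * m"
      using strand_strict_mono[OF n _ y(1,2), of ?k "?l + 2 * int n * m" s] strand_strict_mono[OF n _ y(1,2), of "?l + 2 * int n * m" ?k s]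
      by (metis less_irrefl linorder_neqE_linordered_idom)
    have "m = 0"
    proof (rule ccontr)
      assume "m \<noteq> 0"
      then have "2 * int n * 1 \<le> 2 * int n * \<bar>m\<bar>" by (intro mult_left_mono) auto
      moreover have "2 * int n * \<bar>m\<bar> = \<bar>?k - ?l\<bar>" using kl by (simp add: abs_mult)
      ultimately show False using ij 4 by linarith
    qed
    then have "?k = ?l" using kl by simp
    then show ?thesis using ij(3,4) 4 yy by presburger
  qed
qed

lemma tcurve_vertex:
  assumes ij: "i < n" "v < n" and y: "0 < y" "y < 1"
  shows "tcurve n s (i, t) y \<noteq> torus_point (real v / real n) (1/2)"
proof
  assume eq: "tcurve n s (i, t) y = torus_point (real v / real n) (1/2)"
  show False
  proof (cases "t = 0")
    case True
    then have "torus_point ((real i + y) / real n) (1/2) = torus_point ((real v + 0) / real n) (1/2)"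
      using eq by (simp add: tcurve_def)
    from torus_point_eq[OF this] obtain m where "(real i + y) / real n = (real v + 0) / real n + of_int m" by blast
    then show False using frac_eq[of i y n v 0 m] ij y by simp
  next
    case False
    then have "torus_point (strand n s (2 * int i + int t - 1) y) (1/2 + y) = torus_point (real v / real n) (1/2)"
      using eq by (simp add: tcurve_def)
    from torus_point_eq[OF this] obtain c where "1/2 + y = 1/2 + of_int c" by blast
    then have "y = of_int c" by simp
    then show False using y by auto
  qed
qed

lemma torus_embeddable:
  assumes g: "g \<ge> 1" and s: "s \<ge> 2" "2 * s + 2 < n"
  shows "embeddable {..<n} (torus_edges n s) (genus_surface g)"
proof -
  define dd where "dd t = (if t = 0 then 1 else int s + int t - 1)" for t :: nat
  define p where "p v = torus_point (real v / real n) (1/2)" for v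
  have n: "n > 0" using s by simp
  have code: "\<exists>it. fst it < n \<and> snd it < 3 \<and> e = {fst it, cyc n (fst it) (dd (snd it))}" if e: "e \<in> torus_edges n s" for e
  proof -
    obtain v d where v: "v < n" "d \<in> {1, int s, int s + 1}" "e = {v, cyc n v d}" using e unfolding torus_edges_def by blast
    have "dd 0 = 1" "dd 1 = int s" "dd 2 = int s + 1" by (simp_all add: dd_def)
    then have "\<exists>t\<in>{0, 1, 2}. d = dd t" using v(2) by auto
    then obtain t where t: "t \<in> {0, 1, 2}" "d = dd t" by (elim bexE)
    then have "t < 3" by auto
    then show ?thesis using v t(2) by (intro exI[of _ "(v, t)"]) simp
  qed
  define cd where "cd e = (SOME it. fst it < n \<and> snd it < 3 \<and> e = {fst it, cyc n (fst it) (dd (snd it))})" for e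
  have cd: "fst (cd e) < n" "snd (cd e) < 3" "e = {fst (cd e), cyc n (fst (cd e)) (dd (snd (cd e)))}"
    if "e \<in> torus_edges n s" for e
    using someI_ex[OF code[OF that]] unfolding cd_def by blast+
  have c0: "tcurve n s (i, t) 0 = p i" if "t < 3" for i t
  proof (cases "t = 0")
    case True
    then show ?thesis by (simp add: tcurve_def p_def)
  next
    case False
    then have "(2 * int i + int t - 1) div 2 = int i" using that by presburger
    then show ?thesis using False by (simp add: tcurve_def p_def strand_ends)
  qed
  have c1: "tcurve n s (i, t) 1 = p (cyc n i (dd t))" if "t < 3" for i t
  proof (cases "t = 0")
    case True
    then show ?thesis using torus_point_vertex[OF n, of i 1] by (simp add: tcurve_def p_def dd_def)
  next
    case False
    then have k: "(2 * int i + int t - 1 + 1) div 2 + int s = int i + dd t" using that unfolding dd_def by simp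
    have "torus_point (of_int (int i + dd t) / real n) (1/2 + 1) = torus_point (of_int (int i + dd t) / real n) (1/2)"
      using torus_point_periodic[of _ 0 "1/2" 1] by simp
    then show ?thesis using False torus_point_vertex[OF n, of i "dd t"] unfolding tcurve_def p_def by (simp only: prod.case if_False strand_ends k)
  qed
  have surf: "tcurve n s (i, t) y \<in> genus_surface g" if "0 \<le> y" "y \<le> 1" for i t y
    using strand_surface[OF g n that] torus_point_surface[OF g, of "(real i + y) / real n" "1/2"] by (simp add: tcurve_def)
  have path: "path (tcurve n s (i, t))" for i t
  proof (cases "t = 0")
    case True
    then have eq: "tcurve n s (i, t) = (\<lambda>y. torus_point ((real i + y) * (1 / real n)) (1/2))"
      by (simp add: tcurve_def fun_eq_iff)
    have c: "continuous_on {0..1} (\<lambda>y. (real i + y) * (1 / real n))" by (intro continuous_intros)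
    show ?thesis unfolding path_def eq by (rule continuous_on_torus_point[OF c continuous_on_const])
  next
    case False
    let ?k = "2 * int i + int t - 1"
    have eq: "tcurve n s (i, t) = (\<lambda>y. torus_point (strand n s ?k y) (1/2 + y))"
      using False by (simp add: tcurve_def fun_eq_iff)
    have "continuous_on {0..1} (\<lambda>y. max 0 (1 - 4 * y) * a + (1 - max 0 (1 - 4 * y) - max 0 (4 * y - 3)) * c
      + max 0 (4 * y - 3) * d)" for a c d :: real by (intro continuous_intros)
    then have c: "continuous_on {0..1} (\<lambda>y. strand n s ?k y)" unfolding strand_def .
    have d: "continuous_on {0..1} (\<lambda>y::real. 1/2 + y)" by (intro continuous_intros)
    show ?thesis unfolding path_def eq by (rule continuous_on_torus_point[OF c d])
  qed
  show ?thesis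
  proof (rule embeddableI[where p = p and \<gamma> = "\<lambda>e. tcurve n s (cd e)"])
    show "inj_on p {..<n}"
    proof (rule inj_onI)
      fix v w assume vw: "v \<in> {..<n}" "w \<in> {..<n}" "p v = p w"
      then obtain m where "real v / real n = real w / real n + of_int m" using torus_point_eq unfolding p_def by blast
      then show "v = w" using frac_eq[of v 0 n w 0 m] vw by simp
    qed
    show "p ` {..<n} \<subseteq> genus_surface g" using surf[of 0 _ 0] c0[of 0] by auto
  next
    fix e assume e: "e \<in> torus_edges n s"
    obtain i t where it: "cd e = (i, t)" by (cases "cd e")
    have ce: "i < n" "t < 3" "e = {i, cyc n i (dd t)}" using cd[OF e] unfolding it fst_conv snd_conv .
    have "card e = 2" using torus_simple[OF s] e by (auto simp: simple_graph_def)
    then have "i \<noteq> cyc n i (dd t)" unfolding ce(3) by auto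
    then have "i \<noteq> cyc n i (dd t) \<and> e = {i, cyc n i (dd t)} \<and> tcurve n s (cd e) 0 = p i \<and> tcurve n s (cd e) 1 = p (cyc n i (dd t))"
      unfolding it using ce(3) c0[OF ce(2)] c1[OF ce(2)] by (intro conjI)
    then show "\<exists>u\<in>{..<n}. \<exists>v\<in>{..<n}. u \<noteq> v \<and> e = {u, v} \<and> tcurve n s (cd e) 0 = p u \<and> tcurve n s (cd e) 1 = p v"
      using ce(1) cyc_less[OF n, of i "dd t"] unfolding lessThan_iff Bex_def by blast
    show "path (tcurve n s (cd e))" using path it by simp
    show "path_image (tcurve n s (cd e)) \<subseteq> genus_surface g" using surf it by (auto simp: path_image_def)
    fix y v assume "0 < y" "y < (1::real)" "v \<in> {..<n}"
    then show "tcurve n s (cd e) y \<noteq> p v" using tcurve_vertex[of i n v y s t] ce(1) unfolding it p_def by simp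
  next
    fix e f y y' assume ef: "e \<in> torus_edges n s" "f \<in> torus_edges n s"
      and y: "0 < y" "y < (1::real)" "0 < y'" "y' < (1::real)" and eq: "tcurve n s (cd e) y = tcurve n s (cd f) y'"
    obtain i t where it: "cd e = (i, t)" by (cases "cd e")
    obtain j u where ju: "cd f = (j, u)" by (cases "cd f")
    have e: "i < n" "t < 3" "e = {i, cyc n i (dd t)}" using cd[OF ef(1)] unfolding it fst_conv snd_conv .
    have f: "j < n" "u < 3" "f = {j, cyc n j (dd u)}" using cd[OF ef(2)] unfolding ju fst_conv snd_conv .
    have "i = j \<and> t = u \<and> y = y'" by (rule tcurve_inj[OF e(1) f(1) e(2) f(2) y eq[unfolded it ju]])
    then show "e = f \<and> y = y'" unfolding e(3) f(3) by simp
  qed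
qed

section \<open>The limit\<close>

text \<open>With n vertices, 3 n edges and f faces, Euler's inequality gives f \<ge> 2 n + 2 - 2 g,
  so at most 24 g - 24 darts lie on faces that are not triangles; as this number is not negative, g
  \<ge> 1. The factor 8 g is twice the weaker bound 24 g, divided by six darts per vertex.\<close>

lemma closed_walks_surface:
  assumes X: "(V, E) \<in> regular_graphs_on_surface n 6 g"
  shows "g \<ge> 1"
    "card (closed_words k) * n \<le> (\<Sum>v\<in>V. walks E k v v) + card (closed_words k) * (k * (k + 3) * (8 * g))"
proof -
  have G: "simple_graph V E" "card V = n" "connected_graph V E" "regular_graph 6 V E" "embeddable V E (genus_surface g)"
    using X by (auto simp: regular_graphs_on_surface_def)
  have V: "V \<noteq> {}" using G(3) by (simp add: connected_graph_def)
  have deg: "card (nb E v) = 6" if "v \<in> V" for v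
    using G(4) that by (simp add: regular_graph_def degree_card_nb[OF G(1)])
  have cover: "\<exists>e\<in>E. v \<in> e" if "v \<in> V" for v
  proof -
    have "nb E v \<noteq> {}" using deg[OF that] by auto
    then show ?thesis by (auto simp: nb_def)
  qed
  have "\<exists>(K :: dart set) \<tau> \<alpha> h. labelled_map K \<tau> \<alpha> h \<and> h ` K = V \<and>
     (\<forall>x\<in>K. \<forall>y\<in>K. h x = h y \<longrightarrow> y \<in> orbit \<tau> x) \<and>
     bij_betw (\<lambda>x. (h x, h (\<alpha> x))) K {(u, v). {u, v} \<in> E} \<and> 4 - 4 * int g \<le> euler2 K \<tau> \<alpha>"
    by (rule rotation_system[OF G(1,5) V]) (rule cover)
  then obtain K :: "dart set" and \<tau> \<alpha> h where
    m: "labelled_map K \<tau> \<alpha> h" and hK: "h ` K = V" and fib: "\<forall>x\<in>K. \<forall>y\<in>K. h x = h y \<longrightarrow> y \<in> orbit \<tau> x"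
    and bij: "bij_betw (\<lambda>x. (h x, h (\<alpha> x))) K {(u, v). {u, v} \<in> E}" and eu: "4 - 4 * int g \<le> euler2 K \<tau> \<alpha>"
    by (elim exE conjE)
  interpret hex_map K \<tau> \<alpha> h E
  proof unfold_locales
    fix x assume x: "x \<in> K"
    have "(h x, h (\<alpha> x)) \<in> {(u, v). {u, v} \<in> E}" using bij x by (auto simp: bij_betw_def)
    then have "card {h x, h (\<alpha> x)} = 2" using G(1) by (auto simp: simple_graph_def)
    then show "h (\<alpha> x) \<noteq> h x" by auto
  qed (use m fib bij deg hK in \<open>auto simp: labelled_map_def\<close>)
  have "orbit \<tau> ` K = (\<lambda>v. {y \<in> K. h y = v}) ` (h ` K)" using orbit_fibre by (auto simp: image_image intro!: image_cong)
  moreover have "inj_on (\<lambda>v. {y \<in> K. h y = v}) (h ` K)" by (auto simp: inj_on_def)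
  ultimately have nv: "norb \<tau> K = n" unfolding norb_def using hK G(2) by (simp add: card_image)
  have cK: "card K = 6 * n" using sum_over_tails[of "\<lambda>_. 1"] hK G(2) by simp
  have arith: "bad \<le> 24 * gg - 24" if "4 - 4 * gg \<le> 2 * nn + 2 * ff - 6 * nn" "bad \<le> 4 * (6 * nn - 3 * ff)"
    for bad gg nn ff :: int using that by (simp add: algebra_simps)
  have "4 - 4 * int g \<le> 2 * int n + 2 * int (norb (\<tau> \<circ> \<alpha>) K) - 6 * int n"
    using eu unfolding euler2_def nv cK by simp
  then have bad: "int (card {x \<in> K. ((\<tau> \<circ> \<alpha>) ^^ 3) x \<noteq> x}) \<le> 24 * int g - 24"
    using few_non_triangular unfolding hK G(2) by (rule arith)
  then show "g \<ge> 1" by linarith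
  have "card {x \<in> K. ((\<tau> \<circ> \<alpha>) ^^ 3) x \<noteq> x} \<le> 24 * g" using bad by linarith
  from closed_walks_ge[OF this, of k] have "card (closed_words k) * (6 * n) \<le>
      6 * (\<Sum>v\<in>V. walks E k v v) + card (closed_words k) * (k * (k + 3) * (2 * (24 * g)))" unfolding hK G(2) .
  moreover have "card (closed_words k) * (k * (k + 3) * (2 * (24 * g))) = 6 * (card (closed_words k) * (k * (k + 3) * (8 * g)))" by simp
  ultimately show "card (closed_words k) * n \<le> (\<Sum>v\<in>V. walks E k v v) + card (closed_words k) * (k * (k + 3) * (8 * g))"
    by linarith
qed

text \<open>Partial sums of the expansion of \<open>log det (x I - A)\<close> per vertex, for the adjacency operator \<open>A\<close>
  of the triangular lattice; the summand for \<open>k = 0\<close> vanishes.\<close>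

definition hex_entropy :: "nat \<Rightarrow> real \<Rightarrow> real" where
  "hex_entropy K x = ln x - (\<Sum>k\<le>K. real (card (closed_words k)) / (real k * x ^ k))"

lemma degree_index:
  assumes "indexed_graph b n V E" "simple_graph V E" "regular_graph 6 V E" "i < n"
  shows "card (indexed_graph.ni b n E i) = 6"
proof -
  interpret indexed_graph b n V E by fact
  have "card (ni i) = card (nb E (b i))" by (rule bij_betw_same_card[OF nb_ni[OF assms(4)]])
  also have "\<dots> = 6" using assms(3) bV[OF assms(4)] by (simp add: regular_graph_def degree_card_nb[OF assms(2)])
  finally show ?thesis .
qed

lemma powr_inverse: "t > 0 \<Longrightarrow> t powr (1 / real n) = exp (ln t / real n)"
  by (simp add: powr_def)

text \<open>The series has nonnegative terms, so cutting it at \<open>K\<close> bounds the logarithm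
  of the determinant from above. \<open>D\<close> collects the errors of the walk counts and the
  weight \<epsilon> of one root; it does not depend on n.\<close>

lemma spanning_trees_upper:
  fixes K :: nat
  assumes X: "(V, E) \<in> regular_graphs_on_surface n 6 g" and \<epsilon>: "\<epsilon> > 0"
  defines "D \<equiv> (\<Sum>k\<le>K. real (card (closed_words k) * (k * (k + 3) * (8 * g))) / (real k * (6 + \<epsilon>) ^ k)) - ln \<epsilon>"
  shows "real (num_spanning_trees V E) powr (1 / real n) \<le> exp (hex_entropy K (6 + \<epsilon>) + D / real n)"
proof (cases "num_spanning_trees V E = 0")
  case False
  have G: "simple_graph V E" "card V = n" "connected_graph V E" "regular_graph 6 V E"
    using X by (auto simp: regular_graphs_on_surface_def)
  have finV: "finite V" using G(1) by (simp add: simple_graph_def)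
  then have n: "n > 0" using G(2,3) by (auto simp: connected_graph_def)
  obtain b where "bij_betw b {0..<card V} V" using ex_bij_betw_nat_finite[OF finV] by auto
  then have bij: "bij_betw b {..<n} V" by (simp add: G(2) lessThan_atLeast0)
  have ig: "indexed_graph b n V E"
    by unfold_locales (use bij G n in \<open>auto simp: simple_graph_def\<close>)
  interpret indexed_graph b n V E by (rule ig)
  let ?x = "6 + \<epsilon>" and ?t = "\<lambda>k. \<Sum>v\<in>V. walks E k v v"
  let ?w = "\<lambda>k. card (closed_words k)" and ?c = "\<lambda>k. card (closed_words k) * (k * (k + 3) * (8 * g))"
  have deg: "card (ni i) = 6" if "i < n" for i by (rule degree_index[OF ig G(1,4) that])
  have x: "?x > 6" using \<epsilon> by simp
  have cv: "charval ?x > 0" using log_charval(1)[OF deg x] by simp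
  have S: "(\<lambda>k. real (?t k) / (real k * ?x ^ k)) sums (real n * ln ?x - ln (charval ?x))"
    using log_charval(2)[OF deg x] by simp
  have "(\<Sum>k\<le>K. real (?t k) / (real k * ?x ^ k)) \<le> (\<Sum>k. real (?t k) / (real k * ?x ^ k))"
    using x by (intro sum_le_suminf sums_summable[OF S]) (auto intro!: divide_nonneg_nonneg sum_nonneg)
  then have 1: "(\<Sum>k\<le>K. real (?t k) / (real k * ?x ^ k)) \<le> real n * ln ?x - ln (charval ?x)"
    using sums_unique[OF S] by simp
  have "real n * (real (?w k) / (real k * ?x ^ k)) - real (?c k) / (real k * ?x ^ k) \<le> real (?t k) / (real k * ?x ^ k)" for k
  proof -
    have "real (?w k * n) \<le> real (?t k + ?c k)" using closed_walks_surface(2)[OF X, of k] by (simp only: of_nat_le_iff)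
    then have "real n * real (?w k) - real (?c k) \<le> real (?t k)" by (simp add: mult.commute del: of_nat_sum)
    then have "(real n * real (?w k) - real (?c k)) / (real k * ?x ^ k) \<le> real (?t k) / (real k * ?x ^ k)"
      using x by (intro divide_right_mono) auto
    then show ?thesis by (simp add: diff_divide_distrib)
  qed
  then have "(\<Sum>k\<le>K. real n * (real (?w k) / (real k * ?x ^ k)) - real (?c k) / (real k * ?x ^ k)) \<le> (\<Sum>k\<le>K. real (?t k) / (real k * ?x ^ k))"
    by (rule sum_mono)
  then have 2: "real n * (\<Sum>k\<le>K. real (?w k) / (real k * ?x ^ k)) - (\<Sum>k\<le>K. real (?c k) / (real k * ?x ^ k)) \<le> (\<Sum>k\<le>K. real (?t k) / (real k * ?x ^ k))"
    by (simp add: sum_subtractf sum_distrib_left)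
  have \<tau>: "real (num_spanning_trees V E) > 0" using False by simp
  have "\<epsilon> * real (num_spanning_trees V E) \<le> charval ?x"
    using trees_le_forests[of \<epsilon>] charval_forests[OF deg, of \<epsilon>] \<epsilon> by simp
  then have "ln (\<epsilon> * real (num_spanning_trees V E)) \<le> ln (charval ?x)" using \<epsilon> \<tau> by (intro ln_mono) auto
  then have "ln \<epsilon> + ln (real (num_spanning_trees V E)) \<le> ln (charval ?x)" using \<epsilon> \<tau> by (simp add: ln_mult)
  then have "ln (real (num_spanning_trees V E)) \<le> real n * hex_entropy K ?x + D"
    using 1 2 unfolding hex_entropy_def D_def right_diff_distrib by linarith
  then have "ln (real (num_spanning_trees V E)) / real n \<le> (real n * hex_entropy K ?x + D) / real n"
    by (rule divide_right_mono) simp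
  also have "\<dots> = hex_entropy K ?x + D / real n" using n by (simp add: add_divide_distrib)
  finally show ?thesis using \<tau> by (simp add: powr_inverse)
qed simp

lemma torus_spanning_trees:
  assumes g: "g \<ge> 1" and n: "n > (K + 3) * (K + 4)" and \<epsilon>: "\<epsilon> > 0"
  shows "\<exists>V E. (V, E) \<in> regular_graphs_on_surface n 6 g \<and>
    exp (hex_entropy K (6 + \<epsilon>) - (6 / (6 + \<epsilon>)) ^ Suc K / (1 - 6 / (6 + \<epsilon>)) - 2 * ln (1 + sqrt \<epsilon>))
      \<le> real (num_spanning_trees V E) powr (1 / real n)"
proof -
  \<comment> \<open>With s = K + 3 and n > s (s + 1), words of length at most \<open>K\<close> close
    in the torus only if they close in the lattice.\<close>
  define s where "s = K + 3"
  have "(K + 3) * 4 \<le> (K + 3) * (K + 4)" by (intro mult_le_mono) auto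
  then have s: "s \<ge> 2" "2 * s + 2 < n" "K < s" using n by (auto simp: s_def)
  have n0: "n > 0" using n by simp
  have Ks: "k < s" "k * (s + 1) < n" if "k \<le> K" for k
  proof -
    have "k * (s + 1) \<le> (K + 3) * (K + 4)" unfolding s_def using that by (intro mult_le_mono) auto
    then show "k < s" "k * (s + 1) < n" using n s(3) that by auto
  qed
  let ?V = "{..<n}" and ?E = "torus_edges n s"
  have G: "simple_graph ?V ?E" "connected_graph ?V ?E" "regular_graph 6 ?V ?E"
    using torus_simple[OF s(1,2)] torus_connected[OF n0] torus_regular[OF s(1,2)] by auto
  have X: "(?V, ?E) \<in> regular_graphs_on_surface n 6 g"
    using G torus_embeddable[OF g s(1,2)] by (simp add: regular_graphs_on_surface_def)
  have ig: "indexed_graph (\<lambda>i. i) n ?V ?E"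
    by unfold_locales (use G n0 in \<open>auto simp: simple_graph_def bij_betw_def\<close>)
  interpret indexed_graph "\<lambda>i. i" n ?V ?E by (rule ig)
  let ?x = "6 + \<epsilon>" and ?t = "\<lambda>k. \<Sum>v\<in>?V. walks ?E k v v"
  define q where "q = 6 / ?x"
  have q: "0 < q" "q < 1" using \<epsilon> by (auto simp: q_def)
  have deg: "card (ni i) = 6" if "i < n" for i by (rule degree_index[OF ig G(1,3) that])
  have x: "?x > 6" using \<epsilon> by simp
  have cv: "charval ?x > 0" using log_charval(1)[OF deg x] by simp
  have S: "(\<lambda>k. real (?t k) / (real k * ?x ^ k)) sums (real n * ln ?x - ln (charval ?x))"
    using log_charval(2)[OF deg x] by simp
  have t_eq: "?t k = n * card (closed_words k)" if "k \<le> K" for k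
    using torus_closed_walks[OF s(1,2) _ Ks[OF that]] by simp
  have t_le: "?t k \<le> n * 6 ^ k" for k
  proof -
    have "walks ?E k v v \<le> 6 ^ k" if "v \<in> ?V" for v
    proof -
      have "walks ?E k v v \<le> card (hexwords k)"
        using torus_walks[OF s(1,2), of v k v] that by (auto intro!: card_mono finite_hexwords)
      also have "\<dots> = 6 ^ k" using card_lists_length_eq[of "{..<6::nat}" k] by (simp add: hexwords_def conj_commute)
      finally show ?thesis .
    qed
    then have "?t k \<le> (\<Sum>v\<in>?V. 6 ^ k)" by (rule sum_mono)
    then show ?thesis by simp
  qed
  have A: "(\<lambda>i. real (?t (i + Suc K)) / (real (i + Suc K) * ?x ^ (i + Suc K))) sums
      (real n * ln ?x - ln (charval ?x) - (\<Sum>k<Suc K. real (?t k) / (real k * ?x ^ k)))"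
    by (rule sums_split_initial_segment[OF S])
  have B: "(\<lambda>i. real n * q ^ Suc K * q ^ i) sums (real n * q ^ Suc K * (1 / (1 - q)))"
    using q by (intro sums_mult geometric_sums) simp
  \<comment> \<open>There are at most 6^k closed walks of length k at a vertex, and the denominator
    k is at least 1, so the tail is dominated by a geometric series.\<close>
  have C: "real (?t (i + Suc K)) / (real (i + Suc K) * ?x ^ (i + Suc K)) \<le> real n * q ^ Suc K * q ^ i" for i
  proof -
    let ?k = "i + Suc K"
    have "real (?t ?k) \<le> real (n * 6 ^ ?k)" using t_le[of ?k] by (simp only: of_nat_le_iff)
    then have "real (?t ?k) / (real ?k * ?x ^ ?k) \<le> real n * 6 ^ ?k / (1 * ?x ^ ?k)"
      using x by (intro frac_le mult_right_mono mult_pos_pos) (auto simp del: of_nat_sum)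
    also have "\<dots> = real n * q ^ ?k" by (simp add: q_def power_divide)
    also have "\<dots> = real n * q ^ Suc K * q ^ i" by (simp add: power_add mult.commute mult.left_commute)
    finally show ?thesis .
  qed
  have "real n * ln ?x - ln (charval ?x) - (\<Sum>k<Suc K. real (?t k) / (real k * ?x ^ k)) \<le> real n * q ^ Suc K * (1 / (1 - q))"
    by (rule sums_le[OF C A B])
  moreover have "(\<Sum>k<Suc K. real (?t k) / (real k * ?x ^ k)) = real n * (\<Sum>k\<le>K. real (card (closed_words k)) / (real k * ?x ^ k))"
    unfolding lessThan_Suc_atMost sum_distrib_left using t_eq by (intro sum.cong) (auto simp del: of_nat_sum)
  ultimately have 1: "real n * (hex_entropy K ?x - q ^ Suc K / (1 - q)) \<le> ln (charval ?x)"
    unfolding hex_entropy_def right_diff_distrib by simp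
  let ?\<tau> = "real (num_spanning_trees ?V ?E)"
  have 2: "charval ?x \<le> ?\<tau> * (1 + sqrt \<epsilon>) ^ (2 * n)"
    using forests_le_trees[of \<epsilon>] charval_forests[OF deg, of \<epsilon>] \<epsilon> by simp
  have \<tau>: "?\<tau> > 0"
  proof (rule ccontr)
    assume "\<not> ?thesis"
    then have z: "?\<tau> = 0" by simp
    show False using 2 cv unfolding z by simp
  qed
  have r: "1 + sqrt \<epsilon> > 0" using \<epsilon> by (simp add: add_pos_pos)
  have "ln (charval ?x) \<le> ln (?\<tau> * (1 + sqrt \<epsilon>) ^ (2 * n))" using 2 cv by (intro ln_mono) auto
  also have "\<dots> = ln ?\<tau> + real (2 * n) * ln (1 + sqrt \<epsilon>)"
    using \<tau> r by (simp add: ln_mult ln_realpow)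
  finally have "real n * (hex_entropy K ?x - q ^ Suc K / (1 - q) - 2 * ln (1 + sqrt \<epsilon>)) \<le> ln ?\<tau>"
    using 1 by (simp add: right_diff_distrib)
  then have "hex_entropy K ?x - q ^ Suc K / (1 - q) - 2 * ln (1 + sqrt \<epsilon>) \<le> ln ?\<tau> / real n"
    using n0 by (simp add: pos_le_divide_eq mult.commute)
  then have "exp (hex_entropy K ?x - q ^ Suc K / (1 - q) - 2 * ln (1 + sqrt \<epsilon>)) \<le> ?\<tau> powr (1 / real n)"
    using \<tau> by (simp add: powr_inverse)
  then show ?thesis using X unfolding q_def by blast
qed

text \<open>Since the limsup is at most exp F, multiplying it by exp (- t - r) brings it below the
  liminf; K tending to infinity and then \<epsilon> to 0 closes the gap. The limit exists without
  that of F being identified.\<close>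

lemma limit_of_two_sided_bounds:
  fixes u :: "nat \<Rightarrow> ereal" and F t :: "nat \<Rightarrow> real \<Rightarrow> real" and r :: "real \<Rightarrow> real"
  assumes up: "\<And>K \<epsilon>. \<epsilon> > 0 \<Longrightarrow> limsup u \<le> ereal (exp (F K \<epsilon>))"
    and low: "\<And>K \<epsilon>. \<epsilon> > 0 \<Longrightarrow> ereal (exp (F K \<epsilon> - t K \<epsilon> - r \<epsilon>)) \<le> liminf u"
    and t: "\<And>\<epsilon>. \<epsilon> > 0 \<Longrightarrow> (\<lambda>K. t K \<epsilon>) \<longlonglongrightarrow> (0::real)" and r: "(r \<longlongrightarrow> (0::real)) (at_right 0)"
  shows "u \<longlonglongrightarrow> limsup u"
proof -
  have le: "liminf u \<le> limsup u" by (simp add: Liminf_le_Limsup)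
  have one: "(0::real) < 1" by simp
  obtain m where m: "limsup u = ereal m"
    using up[OF one, of 0] low[OF one, of 0] le by (cases "limsup u") auto
  obtain l where l: "liminf u = ereal l"
    using up[OF one, of 0] low[OF one, of 0] le by (cases "liminf u") auto
  have 1: "m * exp (- t K \<epsilon> - r \<epsilon>) \<le> l" if "\<epsilon> > 0" for K \<epsilon>
  proof -
    have "m * exp (- t K \<epsilon> - r \<epsilon>) \<le> exp (F K \<epsilon>) * exp (- t K \<epsilon> - r \<epsilon>)"
      using up[OF that, of K] unfolding m by (intro mult_right_mono) auto
    also have "\<dots> = exp (F K \<epsilon> - t K \<epsilon> - r \<epsilon>)" by (simp add: exp_add[symmetric])
    also have "\<dots> \<le> l" using low[OF that, of K] unfolding l by simp
    finally show ?thesis .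
  qed
  have 2: "m * exp (- 0 - r \<epsilon>) \<le> l" if "\<epsilon> > 0" for \<epsilon>
  proof (rule tendsto_upperbound)
    show "(\<lambda>K. m * exp (- t K \<epsilon> - r \<epsilon>)) \<longlonglongrightarrow> m * exp (- 0 - r \<epsilon>)"
      by (intro tendsto_intros t[OF that])
    show "\<forall>\<^sub>F K in sequentially. m * exp (- t K \<epsilon> - r \<epsilon>) \<le> l" using 1[OF that] by simp
  qed simp
  have "m * exp (- 0 - 0) \<le> l"
  proof (rule tendsto_upperbound)
    show "((\<lambda>\<epsilon>. m * exp (- 0 - r \<epsilon>)) \<longlongrightarrow> m * exp (- 0 - 0)) (at_right 0)"
      by (intro tendsto_intros r)
    show "\<forall>\<^sub>F \<epsilon> in at_right 0. m * exp (- 0 - r \<epsilon>) \<le> l"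
      using eventually_at_right_less[of "0::real"] by (rule eventually_mono) (rule 2)
  qed simp
  then have "liminf u = limsup u" using le unfolding m l by simp
  then show ?thesis by (intro Liminf_eq_Limsup) auto
qed

section \<open>Evaluating the first terms of the expansion\<close>

primrec hexcount :: "nat \<Rightarrow> int \<Rightarrow> int \<Rightarrow> nat" where
  "hexcount 0 a b = (if a = 0 \<and> b = 0 then 1 else 0)"
| "hexcount (Suc k) a b = hexcount k (a - 1) b + hexcount k (a - 1) (b - 1) + hexcount k a (b - 1)
     + hexcount k (a + 1) b + hexcount k (a + 1) (b + 1) + hexcount k a (b + 1)"

lemma card_endpoint: "card {w \<in> hexwords k. endpoint w = (a, b)} = hexcount k a b"
proof (induction k arbitrary: a b)
  case 0
  have "{w \<in> hexwords 0. endpoint w = (a, b)} = (if a = 0 \<and> b = 0 then {[]} else {})"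
    by (auto simp: hexwords_def endpoint_def)
  then show ?case by simp
next
  case (Suc k)
  have "endpoint (j # w) = (a, b) \<longleftrightarrow> endpoint w = (a - fst (hexstep j), b - snd (hexstep j))" for j w
    by (auto simp: endpoint_def)
  then show ?case unfolding card_hexwords_Suc by (simp add: Suc.IH lessThan_6 hexstep_def)
qed

lemma closed_words_count: "card (closed_words 2) = 6" "card (closed_words 3) = 12" "card (closed_words 4) = 90"
  unfolding closed_words_def card_endpoint by (simp_all add: eval_nat_numeral)

text \<open>At x = 6 the terms of length 2, 3 and 4 add up to 3/36 + 4/216 + 22.5/1296, about
  0.1192, and \<epsilon> = 1/1000 still leaves 0.119. The result 6.001 / 1.1260805 is about 5.329,
  just below 16/3; stopping at length 3 would give about 5.42.\<close>

lemma hex_entropy_4: "exp (hex_entropy 4 (6 + 1/1000)) \<le> 16 / 3"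
proof -
  let ?x = "6 + 1/1000 :: real"
  define S where "S = (\<Sum>k\<le>4. real (card (closed_words k)) / (real k * ?x ^ k))"
  have "S \<ge> (\<Sum>k\<in>{2, 3, 4}. real (card (closed_words k)) / (real k * ?x ^ k))"
    unfolding S_def by (intro sum_mono2) auto
  also have "(\<Sum>k\<in>{2, 3, 4}. real (card (closed_words k)) / (real k * ?x ^ k)) = 6 / (2 * ?x ^ 2) + (12 / (3 * ?x ^ 3) + 90 / (4 * ?x ^ 4))"
    by (simp add: closed_words_count)
  also have "\<dots> \<ge> 119 / 1000" by (simp add: power_divide field_simps eval_nat_numeral)
  finally have S: "S \<ge> 119 / 1000" .
  have "1 + (119 / 1000) + (119 / 1000)\<^sup>2 / 2 \<le> exp (119 / 1000 :: real)" by (rule exp_lower_Taylor_quadratic) simp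
  also have "\<dots> \<le> exp S" using S by simp
  finally have e: "11260805 / 10000000 \<le> exp S" by (simp add: power2_eq_square)
  have "exp (hex_entropy 4 ?x) = ?x / exp S" by (simp add: hex_entropy_def S_def exp_diff)
  also have "\<dots> \<le> ?x / (11260805 / 10000000)" using e by (intro divide_left_mono) auto
  also have "\<dots> \<le> 16 / 3" by simp
  finally show ?thesis .
qed

lemma sigma_values: "(\<sigma> 3)\<^sup>2 = 16 / 3" "\<sigma> 6 = 3125 / 576"
proof -
  have "\<sigma> 3 = 4 / sqrt 3" by (simp add: \<sigma>_def powr_half_sqrt)
  then show "(\<sigma> 3)\<^sup>2 = 16 / 3" by (simp add: power_divide)
  show "\<sigma> 6 = 3125 / 576" by (simp add: \<sigma>_def powr_numeral)
qed

theorem theorem4p1: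
  fixes g :: nat
  shows "(\<exists>L :: ereal.
            (\<lambda>n. SUP (V, E) \<in> regular_graphs_on_surface n 6 g.
                   ereal (real (num_spanning_trees V E) powr (1 / real n))) \<longlonglongrightarrow> L \<and>
            L \<le> ereal ((\<sigma> 3)\<^sup>2)) \<and>
         (\<sigma> 3)\<^sup>2 < \<sigma> 6"
proof
  let ?X = "\<lambda>n. regular_graphs_on_surface n 6 g"
  define u where "u n = (SUP (V, E) \<in> ?X n. ereal (real (num_spanning_trees V E) powr (1 / real n)))" for n
  have "\<exists>L. u \<longlonglongrightarrow> L \<and> L \<le> ereal ((\<sigma> 3)\<^sup>2)"
  proof (cases "g = 0")
    case True
    have empty: "?X n = {}" for n
    proof (rule ccontr)
      assume "?X n \<noteq> {}"
      then obtain V E where "(V, E) \<in> ?X n" by auto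
      then show False using closed_walks_surface(1) True by auto
    qed
    have "u = (\<lambda>n. - \<infinity>)" unfolding u_def empty by (simp add: bot_ereal_def)
    then show ?thesis by (intro exI[of _ "- \<infinity>"]) simp
  next
    case False
    then have g: "g \<ge> 1" by simp
    let ?F = "\<lambda>K \<epsilon>. hex_entropy K (6 + \<epsilon>)"
    let ?t = "\<lambda>K \<epsilon>. (6 / (6 + \<epsilon>)) ^ Suc K / (1 - 6 / (6 + \<epsilon>))"
    have up: "limsup u \<le> ereal (exp (?F K \<epsilon>))" if \<epsilon>: "\<epsilon> > 0" for K \<epsilon>
    proof -
      let ?D = "(\<Sum>k\<le>K. real (card (closed_words k) * (k * (k + 3) * (8 * g))) / (real k * (6 + \<epsilon>) ^ k)) - ln \<epsilon>"
      have "u n \<le> ereal (exp (?F K \<epsilon> + ?D / real n))" for n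
        unfolding u_def using spanning_trees_upper[OF _ \<epsilon>, where K = K] by (intro SUP_least) auto
      then have "limsup u \<le> limsup (\<lambda>n. ereal (exp (?F K \<epsilon> + ?D / real n)))" by (intro Limsup_mono) simp
      also have "(\<lambda>n. ?F K \<epsilon> + ?D / real n) \<longlonglongrightarrow> ?F K \<epsilon> + 0"
        by (intro tendsto_add tendsto_const tendsto_divide_0[OF tendsto_const] filterlim_at_top_imp_at_infinity filterlim_real_sequentially)
      then have "(\<lambda>n. ereal (exp (?F K \<epsilon> + ?D / real n))) \<longlonglongrightarrow> ereal (exp (?F K \<epsilon>))"
        by (intro tendsto_intros) simp
      then have "limsup (\<lambda>n. ereal (exp (?F K \<epsilon> + ?D / real n))) = ereal (exp (?F K \<epsilon>))"
        by (intro lim_imp_Limsup) auto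
      finally show ?thesis .
    qed
    have low: "ereal (exp (?F K \<epsilon> - ?t K \<epsilon> - 2 * ln (1 + sqrt \<epsilon>))) \<le> liminf u" if \<epsilon>: "\<epsilon> > 0" for K \<epsilon>
    proof (rule Liminf_bounded, rule eventually_mono)
      show "\<forall>\<^sub>F n in sequentially. (K + 3) * (K + 4) < n" by (rule eventually_gt_at_top)
      fix n assume "(K + 3) * (K + 4) < n"
      from torus_spanning_trees[OF g this \<epsilon>] obtain V E where VE: "(V, E) \<in> ?X n"
        "exp (?F K \<epsilon> - ?t K \<epsilon> - 2 * ln (1 + sqrt \<epsilon>)) \<le> real (num_spanning_trees V E) powr (1 / real n)" by blast
      show "ereal (exp (?F K \<epsilon> - ?t K \<epsilon> - 2 * ln (1 + sqrt \<epsilon>))) \<le> u n"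
        unfolding u_def using VE by (intro SUP_upper2[of "(V, E)"]) auto
    qed
    have t: "(\<lambda>K. ?t K \<epsilon>) \<longlonglongrightarrow> 0" if \<epsilon>: "\<epsilon> > 0" for \<epsilon> :: real
    proof -
      have "(\<lambda>K. (6 / (6 + \<epsilon>)) ^ K) \<longlonglongrightarrow> 0" using \<epsilon> by (intro LIMSEQ_power_zero) auto
      then have "(\<lambda>K. (6 / (6 + \<epsilon>)) ^ Suc K) \<longlonglongrightarrow> 0" by (rule LIMSEQ_Suc)
      then show ?thesis by (rule tendsto_divide_zero)
    qed
    have "((\<lambda>\<epsilon>::real. 2 * ln (1 + sqrt \<epsilon>)) \<longlongrightarrow> 2 * ln (1 + sqrt 0)) (at_right 0)"
      by (intro tendsto_intros) auto
    then have r: "((\<lambda>\<epsilon>::real. 2 * ln (1 + sqrt \<epsilon>)) \<longlongrightarrow> 0) (at_right 0)" by simp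
    have "limsup u \<le> ereal (exp (hex_entropy 4 (6 + 1/1000)))" using up[of "1/1000" 4] by simp
    also have "\<dots> \<le> ereal ((\<sigma> 3)\<^sup>2)" using hex_entropy_4 by (simp add: sigma_values)
    finally show ?thesis using limit_of_two_sided_bounds[of u ?F ?t "\<lambda>\<epsilon>. 2 * ln (1 + sqrt \<epsilon>)", OF up low t r] by blast
  qed
  then show "\<exists>L :: ereal.
            (\<lambda>n. SUP (V, E) \<in> regular_graphs_on_surface n 6 g.
                   ereal (real (num_spanning_trees V E) powr (1 / real n))) \<longlonglongrightarrow> L \<and>
            L \<le> ereal ((\<sigma> 3)\<^sup>2)"
    unfolding u_def .
  show "(\<sigma> 3)\<^sup>2 < \<sigma> 6" by (simp add: sigma_values)
qed

end
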